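(* Let $E\subset\mathbb{C}$ be a compact set containing more than one point, with $0\in E$ and $\overline{\mathbb{C}}\setminus E$ simply connected. Let $\mathbf{F}=(F_1,\ldots,F_d)\in\mathcal{H}(E)^d$ and let $\mathbf{m}=(m_1,\ldots,m_d)\in\mathbb{N}^d$ be a fixed multi-index. Let $\|\cdot\|$ denote the coefficient norm in the space of polynomials. Then the following assertions are equivalent: (a) $\mathbf{F}$ has exactly $|\mathbf{m}|$ system poles with respect to $\mathbf{m}$ counting multiplicities. (b) The (monic) polynomials $Q_{n,\mathbf{m}}$ of $\mathbf{F}$ are uniquely determined for all sufficiently large $n$ and there exists a polynomial $Q_{|\mathbf{m}|}$ of degree $|\mathbf{m}|$ such that $$\limsup_{n\to\infty}\|Q_{n,\mathbf{m}}-Q_{|\mathbf{m}|}\|^{1/n}=\theta<1.$$ Consequently, if either (a) or (b) takes place, then $Q_{|\mathbf{m}|}=Q^{\mathbf{F}}_{\mathbf{m}}$, $$\limsup_{n\to\infty}\|Q_{n,\mathbf{m}}-Q_{\mathbf{m}}^{\mathbf{F}}\|^{1/n}=\max\left\{\frac{|\Phi(\xi)|}{\boldsymbol\rho_{\xi}(\mathbf{F},\mathbf{m})}:\xi\in\mathcal{P}(\mathbf{F},\mathbf{m})\right\},$$ and, for any $\alpha=1,\ldots,d$, any $k=0,1,\ldots,m_\alpha-1$, and any compact subset $K$ of $D_\alpha^{*}(\mathbf{F},\mathbf{m})\setminus\mathcal{P}(\mathbf{F},\mathbf{m})$, $$\limsup_{n\to\infty}\left\|\frac{P_{n,\mathbf{m},k,\alpha}}{Q_{n,\mathbf{m}}}-z^kF_\alpha\right\|_K^{1/n}\le\frac{\|\Phi\|_K}{\boldsymbol\rho_\alpha^{*}(\mathbf{F},\mathbf{m})},$$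 where $\|\cdot\|_K$ denotes the sup-norm on $K$ and, if $K\subset E$, $\|\Phi\|_K$ is replaced by $1$.
   Context: Conventions: $\mathbb{N}=\{1,2,\ldots\}$; $|\mathbf{m}|=m_1+\cdots+m_d$; $1/\infty=0$. The index $\rho=\infty$ is allowed, with $D_\infty=\mathbb{C}$. $\Phi$ is the unique conformal map of $\overline{\mathbb{C}}\setminus E$ onto $\overline{\mathbb{C}}\setminus\{|w|\le1\}$ with $\Phi(\infty)=\infty$ and $\Phi'(\infty)=\lim_{z\to\infty}\Phi(z)/z>0$. For $\rho>1$, $\Gamma_\rho=\{z\in\mathbb{C}:|\Phi(z)|=\rho\}$ and the canonical domain of index $\rho$ is $D_\rho=E\cup\{z\in\mathbb{C}\setminus E:|\Phi(z)|<\rho\}$. If $K\not\subset E$, $\|\Phi\|_K$ is the supremum of $|\Phi|$ over $K\setminus E$. $\mathcal{H}(E)$ is the space of functions holomorphic in some neighborhood of $E$, and $\mathcal{H}(E)^d$ is the set of $d$-tuples of such functions. For $G\in\mathcal{H}(E)$ and an integer $t\ge0$, $\rho_t(G)$ is the index of the largest canonical domain to which $G$ extends as a meromorphic function with at most $t$ poles counting multiplicities (so $\rho_0(G)$ refers to holomorphic extension). The $n$-th Faber coefficient of $G$ is $$[G]_n=\frac{1}{2\pi i}\int_{\Gamma_\rho}\frac{G(t)\Phi'(t)}{\Phi^{n+1}(t)}\,dt,\qquad 1<\rho<\rho_0(G).$$ Simultaneous Padé–Faber approximants: for $n\in\mathbb{N}$ there exist polynomials $Q_{n,\mathbf{m}}\not\equiv0$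 and $P_{n,\mathbf{m},k,\alpha}$ with $\deg Q_{n,\mathbf{m}}\le|\mathbf{m}|$, $\deg P_{n,\mathbf{m},k,\alpha}\le n-1$, and $$[Q_{n,\mathbf{m}}z^kF_\alpha-P_{n,\mathbf{m},k,\alpha}]_j=0,\qquad j=0,1,\ldots,n,$$ for all $k=0,\ldots,m_\alpha-1$ and $\alpha=1,\ldots,d$. $Q_{n,\mathbf{m}}$ is normalized to be monic; for each $n$ one solution is chosen. "$Q_{n,\mathbf{m}}$ is uniquely determined" means that there is only one monic polynomial $Q_{n,\mathbf{m}}$ satisfying these conditions (for some polynomials $P_{n,\mathbf{m},k,\alpha}$). System poles: $\xi\in\mathbb{C}$ (necessarily $\xi\notin E$) is a system pole of order $\tau$ of $\mathbf{F}$ with respect to $\mathbf{m}$ if $\tau$ is the largest positive integer such that for each $t=1,\ldots,\tau$ there is at least one polynomial combination $$G=\sum_{\alpha=1}^d v_\alpha F_\alpha,\qquad \deg v_\alpha<m_\alpha,\ \alpha=1,\ldots,d,\qquad( * )$$ which is holomorphic on a neighborhood of $\overline{D}_{|\Phi(\xi)|}$ except for a pole at $z=\xi$ of exact order $t$. System poles are counted with their order. $Q^{\mathbf{F}}_{\mathbf{m}}$ is the monic polynomial whose zeros are the system poles of $\mathbf{F}$ with respect to $\mathbf{m}$, with multiplicity equal to their order; $\mathcal{P}(\mathbf{F},\mathbf{m})$ is the set of its distinct zeros. For a system pole $\xi$ of order $\tau$ and $t=1,\ldots,\tau$, $\rho_{\xi,t}(\mathbf{F},\mathbf{m})$ is the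 largest (it is attained) of the numbers $\rho_t(G)$ over all $G$ of the form $( * )$ that are holomorphic on a neighborhood of $\overline{D}_{|\Phi(\xi)|}$ except for a pole at $\xi$ of order $t$. Then $\boldsymbol\rho_{\xi,t}(\mathbf{F},\mathbf{m})=\min_{k=1,\ldots,t}\rho_{\xi,k}(\mathbf{F},\mathbf{m})$ and $\boldsymbol\rho_\xi(\mathbf{F},\mathbf{m})=\boldsymbol\rho_{\xi,\tau}(\mathbf{F},\mathbf{m})$. For $\alpha\in\{1,\ldots,d\}$, $D_\alpha(\mathbf{F},\mathbf{m})$ is the largest canonical domain in which all the poles of $F_\alpha$ are system poles of $\mathbf{F}$ with respect to $\mathbf{m}$, their order as poles of $F_\alpha$ does not exceed their order as system poles, and $F_\alpha$ has no other singularity; $\boldsymbol\rho_\alpha(\mathbf{F},\mathbf{m})$ is its index. If $\xi_1,\ldots,\xi_N$ are the poles of $F_\alpha$ in $D_\alpha(\mathbf{F},\mathbf{m})$ and $\hat\tau_j$ is the order of $\xi_j$ as a pole of $F_\alpha$, then $$\boldsymbol\rho_\alpha^{*}(\mathbf{F},\mathbf{m})=\min\Big\{\boldsymbol\rho_\alpha(\mathbf{F},\mathbf{m}),\min_{j=1,\ldots,N}\boldsymbol\rho_{\xi_j,\hat\tau_j}(\mathbf{F},\mathbf{m})\Big\},$$ and $D_\alpha^{*}(\mathbf{F},\mathbf{m})$ is the canonical domain with this index. *)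

theory Defs
  imports "HOL-Complex_Analysis.Complex_Analysis"
begin

text \<open>The Riemann sphere is realised as the unit sphere of \<open>complex \<times> real\<close>; the north pole
  \<open>(0, 1)\<close> is the point at infinity.\<close>

definition to_sphere :: "complex \<Rightarrow> complex \<times> real" where
  "to_sphere z = ((2 / ((norm z)\<^sup>2 + 1)) *\<^sub>R z, ((norm z)\<^sup>2 - 1) / ((norm z)\<^sup>2 + 1))"

definition sphere_compl :: "complex set \<Rightarrow> (complex \<times> real) set" where
  "sphere_compl E = insert (0, 1) (to_sphere ` (- E))"

text \<open>Only the finite part of the map is represented; the limit condition says that it extends to
  the sphere by fixing infinity and that its derivative there is positive. The values of \<open>\<Phi>\<close> on
  \<open>E\<close> are irrelevant.\<close>

definition exterior_map :: "complex set \<Rightarrow> (complex \<Rightarrow> complex) \<Rightarrow> bool" where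
  "exterior_map E \<Phi> \<longleftrightarrow>
     \<Phi> holomorphic_on (- E) \<and> bij_betw \<Phi> (- E) {w. norm w > 1} \<and>
     (\<exists>c::real. c > 0 \<and> ((\<lambda>z. \<Phi> z / z) \<longlongrightarrow> of_real c) at_infinity)"

definition canon_dom :: "complex set \<Rightarrow> (complex \<Rightarrow> complex) \<Rightarrow> ereal \<Rightarrow> complex set" where
  "canon_dom E \<Phi> \<rho> = E \<union> {z. z \<notin> E \<and> ereal (norm (\<Phi> z)) < \<rho>}"

text \<open>Positively oriented parametrisation of the level curve \<open>{z. norm (\<Phi> z) = \<rho>}\<close>.\<close>

definition level_path :: "complex set \<Rightarrow> (complex \<Rightarrow> complex) \<Rightarrow> real \<Rightarrow> real \<Rightarrow> complex" where
  "level_path E \<Phi> \<rho> = inv_into (- E) \<Phi> \<circ> circlepath 0 \<rho>"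

text \<open>A function holomorphic near \<open>E\<close> is represented by a total function that is
  \<open>analytic_on E\<close>. Its values away from \<open>E\<close> carry no information, so everything below
  depends only on the germ along \<open>E\<close> and refers to continuations of that germ.\<close>

definition same_germ :: "complex set \<Rightarrow> (complex \<Rightarrow> complex) \<Rightarrow> (complex \<Rightarrow> complex) \<Rightarrow> bool" where
  "same_germ E g G \<longleftrightarrow> (\<exists>V. open V \<and> E \<subseteq> V \<and> (\<forall>z\<in>V. g z = G z))"

definition continues ::
  "complex set \<Rightarrow> (complex \<Rightarrow> complex) \<Rightarrow> ereal \<Rightarrow> (complex \<Rightarrow> complex) \<Rightarrow> (complex \<Rightarrow> complex) \<Rightarrow> bool"
where
  "continues E \<Phi> \<rho> G g \<longleftrightarrow> same_germ E g G \<and> g meromorphic_on canon_dom E \<Phi> \<rho>"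

text \<open>The continuation is unique up to values at isolated points; \<^const>\<open>remove_sings\<close> fixes the
  correct values off the poles.\<close>

definition mero_ext ::
  "complex set \<Rightarrow> (complex \<Rightarrow> complex) \<Rightarrow> ereal \<Rightarrow> (complex \<Rightarrow> complex) \<Rightarrow> complex \<Rightarrow> complex"
where
  "mero_ext E \<Phi> \<rho> G = remove_sings (SOME g. continues E \<Phi> \<rho> G g)"

definition pole_order :: "(complex \<Rightarrow> complex) \<Rightarrow> complex \<Rightarrow> nat" where
  "pole_order g z = nat (- zorder g z)"

definition poles_at_most :: "(complex \<Rightarrow> complex) \<Rightarrow> complex set \<Rightarrow> nat \<Rightarrow> bool" where
  "poles_at_most g D t \<longleftrightarrow>
     finite {z\<in>D. is_pole g z} \<and> (\<Sum>z | z \<in> D \<and> is_pole g z. pole_order g z) \<le> t"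

text \<open>\<open>\<rho>\<^sub>t(G)\<close>; the supremum is attained.\<close>

definition mero_index :: "complex set \<Rightarrow> (complex \<Rightarrow> complex) \<Rightarrow> nat \<Rightarrow> (complex \<Rightarrow> complex) \<Rightarrow> ereal" where
  "mero_index E \<Phi> t G =
     Sup {\<rho>. 1 < \<rho> \<and> (\<exists>g. continues E \<Phi> \<rho> G g \<and> poles_at_most g (canon_dom E \<Phi> \<rho>) t)}"

text \<open>By Cauchy's theorem the integral does not depend on \<open>\<rho>\<close>.\<close>

definition faber_coeff :: "complex set \<Rightarrow> (complex \<Rightarrow> complex) \<Rightarrow> (complex \<Rightarrow> complex) \<Rightarrow> nat \<Rightarrow> complex" where
  "faber_coeff E \<Phi> G n =
     (THE c. \<forall>\<rho>::real. 1 < \<rho> \<and> ereal \<rho> < mero_index E \<Phi> 0 G \<longrightarrow>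
        c = 1 / (2 * of_real pi * \<i>) *
            contour_integral (level_path E \<Phi> \<rho>)
              (\<lambda>t. mero_ext E \<Phi> (mero_index E \<Phi> 0 G) G t * deriv \<Phi> t / \<Phi> t ^ (n + 1)))"

text \<open>A vector of functions is \<open>F 1, \<dots>, F d\<close>, a multi-index is \<open>m 1, \<dots>, m d\<close>.\<close>

definition msize :: "nat \<Rightarrow> (nat \<Rightarrow> nat) \<Rightarrow> nat" where
  "msize d m = (\<Sum>\<alpha>\<in>{1..d}. m \<alpha>)"

text \<open>\<open>p k \<alpha>\<close> is the numerator belonging to the function \<open>z ^ k * F \<alpha> z\<close>.\<close>

definition pade_faber ::
  "complex set \<Rightarrow> (complex \<Rightarrow> complex) \<Rightarrow> nat \<Rightarrow> (nat \<Rightarrow> nat) \<Rightarrow> (nat \<Rightarrow> complex \<Rightarrow> complex) \<Rightarrow> nat \<Rightarrow>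
   complex poly \<Rightarrow> (nat \<Rightarrow> nat \<Rightarrow> complex poly) \<Rightarrow> bool"
where
  "pade_faber E \<Phi> d m F n q p \<longleftrightarrow>
     q \<noteq> 0 \<and> degree q \<le> msize d m \<and>
     (\<forall>\<alpha>\<in>{1..d}. \<forall>k<m \<alpha>.
        degree (p k \<alpha>) \<le> n - 1 \<and>
        (\<forall>j\<le>n. faber_coeff E \<Phi> (\<lambda>z. poly q z * z ^ k * F \<alpha> z - poly (p k \<alpha>) z) j = 0))"

definition coeff_norm :: "complex poly \<Rightarrow> real" where
  "coeff_norm p = (\<Sum>i\<le>degree p. norm (coeff p i))"

definition only_pole ::
  "complex set \<Rightarrow> (complex \<Rightarrow> complex) \<Rightarrow> (complex \<Rightarrow> complex) \<Rightarrow> complex \<Rightarrow> nat \<Rightarrow> bool"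
where
  "only_pole E \<Phi> G \<xi> t \<longleftrightarrow>
     (\<exists>U g. open U \<and> closure (canon_dom E \<Phi> (ereal (norm (\<Phi> \<xi>)))) \<subseteq> U \<and>
        same_germ E g G \<and> g holomorphic_on (U - {\<xi>}) \<and> is_pole g \<xi> \<and> pole_order g \<xi> = t)"

definition poly_combs :: "nat \<Rightarrow> (nat \<Rightarrow> nat) \<Rightarrow> (nat \<Rightarrow> complex \<Rightarrow> complex) \<Rightarrow> (complex \<Rightarrow> complex) set" where
  "poly_combs d m F =
     {(\<lambda>z. \<Sum>\<alpha>\<in>{1..d}. poly (v \<alpha>) z * F \<alpha> z) | v :: nat \<Rightarrow> complex poly.
        \<forall>\<alpha>\<in>{1..d}. degree (v \<alpha>) < m \<alpha>}"

definition system_pole ::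
  "complex set \<Rightarrow> (complex \<Rightarrow> complex) \<Rightarrow> nat \<Rightarrow> (nat \<Rightarrow> nat) \<Rightarrow> (nat \<Rightarrow> complex \<Rightarrow> complex) \<Rightarrow>
   complex \<Rightarrow> nat \<Rightarrow> bool"
where
  "system_pole E \<Phi> d m F \<xi> \<tau> \<longleftrightarrow>
     \<xi> \<notin> E \<and> 1 \<le> \<tau> \<and>
     (\<forall>t\<in>{1..\<tau>}. \<exists>G\<in>poly_combs d m F. only_pole E \<Phi> G \<xi> t) \<and>
     (\<forall>\<sigma>. (\<forall>t\<in>{1..\<sigma>}. \<exists>G\<in>poly_combs d m F. only_pole E \<Phi> G \<xi> t) \<longrightarrow> \<sigma> \<le> \<tau>)"

definition system_poles ::
  "complex set \<Rightarrow> (complex \<Rightarrow> complex) \<Rightarrow> nat \<Rightarrow> (nat \<Rightarrow> nat) \<Rightarrow> (nat \<Rightarrow> complex \<Rightarrow> complex) \<Rightarrow> complex set"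
where
  "system_poles E \<Phi> d m F = {\<xi>. \<exists>\<tau>. system_pole E \<Phi> d m F \<xi> \<tau>}"

definition sys_order ::
  "complex set \<Rightarrow> (complex \<Rightarrow> complex) \<Rightarrow> nat \<Rightarrow> (nat \<Rightarrow> nat) \<Rightarrow> (nat \<Rightarrow> complex \<Rightarrow> complex) \<Rightarrow> complex \<Rightarrow> nat"
where
  "sys_order E \<Phi> d m F \<xi> = (THE \<tau>. system_pole E \<Phi> d m F \<xi> \<tau>)"

definition system_poly ::
  "complex set \<Rightarrow> (complex \<Rightarrow> complex) \<Rightarrow> nat \<Rightarrow> (nat \<Rightarrow> nat) \<Rightarrow> (nat \<Rightarrow> complex \<Rightarrow> complex) \<Rightarrow> complex poly"
where
  "system_poly E \<Phi> d m F = (\<Prod>\<xi>\<in>system_poles E \<Phi> d m F. [:- \<xi>, 1:] ^ sys_order E \<Phi> d m F \<xi>)"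

text \<open>\<open>\<rho>\<^bsub>\<xi>,t\<^esub>\<close> (the supremum is attained), followed by its running minimum in \<open>t\<close>.\<close>

definition rho_raw ::
  "complex set \<Rightarrow> (complex \<Rightarrow> complex) \<Rightarrow> nat \<Rightarrow> (nat \<Rightarrow> nat) \<Rightarrow> (nat \<Rightarrow> complex \<Rightarrow> complex) \<Rightarrow>
   complex \<Rightarrow> nat \<Rightarrow> ereal"
where
  "rho_raw E \<Phi> d m F \<xi> t = Sup {mero_index E \<Phi> t G | G. G \<in> poly_combs d m F \<and> only_pole E \<Phi> G \<xi> t}"

definition rho_bold ::
  "complex set \<Rightarrow> (complex \<Rightarrow> complex) \<Rightarrow> nat \<Rightarrow> (nat \<Rightarrow> nat) \<Rightarrow> (nat \<Rightarrow> complex \<Rightarrow> complex) \<Rightarrow>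
   complex \<Rightarrow> nat \<Rightarrow> ereal"
where
  "rho_bold E \<Phi> d m F \<xi> t = Min (rho_raw E \<Phi> d m F \<xi> ` {1..t})"

definition rho_pole ::
  "complex set \<Rightarrow> (complex \<Rightarrow> complex) \<Rightarrow> nat \<Rightarrow> (nat \<Rightarrow> nat) \<Rightarrow> (nat \<Rightarrow> complex \<Rightarrow> complex) \<Rightarrow> complex \<Rightarrow> ereal"
where
  "rho_pole E \<Phi> d m F \<xi> = rho_bold E \<Phi> d m F \<xi> (sys_order E \<Phi> d m F \<xi>)"

text \<open>The supremum, the index of \<open>D\<^sub>\<alpha>(F, m)\<close>, is attained.\<close>

definition rho_comp ::
  "complex set \<Rightarrow> (complex \<Rightarrow> complex) \<Rightarrow> nat \<Rightarrow> (nat \<Rightarrow> nat) \<Rightarrow> (nat \<Rightarrow> complex \<Rightarrow> complex) \<Rightarrow> nat \<Rightarrow> ereal"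
where
  "rho_comp E \<Phi> d m F \<alpha> =
     Sup {\<rho>. 1 < \<rho> \<and> (\<exists>g. continues E \<Phi> \<rho> (F \<alpha>) g \<and>
            (\<forall>z\<in>canon_dom E \<Phi> \<rho>. is_pole g z \<longrightarrow>
               z \<in> system_poles E \<Phi> d m F \<and> pole_order g z \<le> sys_order E \<Phi> d m F z))}"

definition rho_star ::
  "complex set \<Rightarrow> (complex \<Rightarrow> complex) \<Rightarrow> nat \<Rightarrow> (nat \<Rightarrow> nat) \<Rightarrow> (nat \<Rightarrow> complex \<Rightarrow> complex) \<Rightarrow> nat \<Rightarrow> ereal"
where
  "rho_star E \<Phi> d m F \<alpha> =
     (let \<rho> = rho_comp E \<Phi> d m F \<alpha>; f = mero_ext E \<Phi> \<rho> (F \<alpha>)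
      in Min (insert \<rho> ((\<lambda>\<xi>. rho_bold E \<Phi> d m F \<xi> (pole_order f \<xi>)) `
                          {\<xi> \<in> canon_dom E \<Phi> \<rho>. is_pole f \<xi>})))"

text \<open>The inserted \<open>0\<close> only matters for \<open>K = {}\<close>. The value is meaningful only for \<open>f\<close> bounded
  on \<open>K\<close>.\<close>

definition sup_norm :: "complex set \<Rightarrow> (complex \<Rightarrow> complex) \<Rightarrow> real" where
  "sup_norm K f = Sup (insert 0 ((\<lambda>z. norm (f z)) ` K))"

definition Phi_norm :: "complex set \<Rightarrow> (complex \<Rightarrow> complex) \<Rightarrow> complex set \<Rightarrow> real" where
  "Phi_norm E \<Phi> K = (if K \<subseteq> E then 1 else sup_norm (K - E) \<Phi>)"

end

theory Submission
  imports Defs "HOL-Computational_Algebra.Fundamental_Theorem_Algebra"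
begin

text \<open>In the coordinate \<open>w = \<Phi> z\<close> the Faber coefficients are Laurent coefficients, so
  continuation to \<open>D \<rho>\<close> amounts to decay of the coefficients like \<open>\<rho>\<^sup>-\<^sup>n\<close>, and \<open>Q n\<close> is a polynomial
  of degree at most \<open>|m|\<close> for which the \<open>n\<close>-th Faber coefficient of \<open>Q n * G\<close> vanishes for every
  polynomial combination \<open>G\<close>.

  If \<open>G\<close> has a pole of exact order \<open>s\<close> at \<open>\<xi>\<close> and no other singularity in \<open>D \<rho>\<close>, this relation
  bounds the Taylor coefficient of \<open>Q n\<close> of order \<open>s - 1\<close> at \<open>\<xi>\<close> by those of lower order and a term
  of size \<open>(|\<Phi> \<xi>| / \<rho>)\<^sup>n\<close>. With \<open>|m|\<close> system poles, Hermite interpolation turns these bounds into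
  the convergence of \<open>Q n\<close>, and (a) implies (b).

  Conversely let \<open>Q n\<close> tend to \<open>R\<close> at the rate \<open>\<theta> < 1\<close>. The \<open>n\<close>-th coefficient of \<open>R * G\<close> is that
  of \<open>(R - Q n) * G\<close>, so \<open>R * G\<close> continues to \<open>D (\<rho> / \<theta>)\<close> whenever \<open>G\<close> continues to \<open>D \<rho>\<close>. Removing
  the zeros of \<open>R\<close> one at a time, in the order of \<open>|\<Phi>|\<close>, filters the \<open>|m|\<close>-dimensional space of
  combinations by subspaces, each of codimension at most one in the previous one; the last one
  consists of entire combinations. An entire combination is zero: its Faber coefficients satisfy a
  recursion that makes it a polynomial, and a nonzero polynomial combination would leave \<open>Q n\<close>
  undetermined. Hence \<open>R\<close> has \<open>|m|\<close> zeros off \<open>E\<close> and every step of the filtration is strict, which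
  yields the combinations with prescribed poles.

  The same gain by the factor \<open>1 / \<theta>\<close>, with the unwanted poles cancelled one level curve at a time,
  gives the lower bound for the rate. For the approximants, \<open>Q n\<close> is expanded at the poles of
  \<open>F \<alpha>\<close>: the remainders of the Faber expansions of the polar parts do not decay fast enough, but
  they are multiplied by the small Taylor coefficients of \<open>Q n\<close>.\<close>

section \<open>Laurent coefficients on circles\<close>

text \<open>Nothing is known about the boundary of \<open>E\<close>, so coefficients are estimated
  on circles |w| = r > 1. There a function splits into the power series with the Faber coefficients
  and a remainder holomorphic up to infinity, which never obstructs continuation outwards. In this
  coordinate multiplication by z is a shift only to leading order, because \<open>Psi w\<close>
  behaves like \<open>lead * w\<close>; a top coefficient can be isolated, the others are only
  bounded.

  Poles are multiplied away by polynomials and continuation is stated for the product: a pole is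
  removed by dividing by a linear factor, and its presence is a nonzero value of the product.

  The factor 1/\<theta> is gained only for a combination that is itself holomorphic in the smaller
  domain. Hence the treatment level by level: poles beyond the present level do no harm, those on it
  are dealt with before it is passed. Uniqueness of the \<open>Q n\<close> enters once, to exclude
  entire combinations; otherwise the filtration could end in a nonzero space.\<close>

lemma circle_integral_radius:
  assumes "f holomorphic_on S" "open S" "0 < r1" "r1 \<le> r2"
    and sub: "\<And>w. r1 \<le> norm w \<Longrightarrow> norm w \<le> r2 \<Longrightarrow> w \<in> S"
  shows "contour_integral (circlepath 0 r1) f = contour_integral (circlepath 0 r2) f"
proof (rule Cauchy_theorem_homotopic_loops[OF _ assms(2,1)])
  show "homotopic_loops S (circlepath 0 r1) (circlepath 0 r2)"
  proof (rule homotopic_loops_linear)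
    fix t :: real assume t: "t \<in> {0..1}"
    show "closed_segment (circlepath 0 r1 t) (circlepath 0 r2 t) \<subseteq> S"
    proof
      fix x assume "x \<in> closed_segment (circlepath 0 r1 t) (circlepath 0 r2 t)"
      then obtain u where u: "0 \<le> u" "u \<le> 1"
        and x: "x = (1 - u) *\<^sub>R circlepath 0 r1 t + u *\<^sub>R circlepath 0 r2 t"
        by (auto simp: closed_segment_def)
      have "x = of_real ((1-u)*r1 + u*r2) * exp (2 * of_real pi * \<i> * of_real t)"
        by (simp add: x circlepath scaleR_conv_of_real algebra_simps)
      moreover have "(1-u)*r1 + u*r2 \<ge> 0" using u assms by simp
      ultimately have n: "norm x = (1-u)*r1 + u*r2" by (simp only: norm_mult norm_of_real) simp
      have "(1-u)*r1 + u*r2 = r1 + u*(r2-r1)" by (simp add: algebra_simps)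
      moreover have "u * (r2-r1) \<le> r2-r1" using u assms by (intro mult_left_le_one_le) auto
      moreover have "u * (r2-r1) \<ge> 0" using u assms by simp
      ultimately have "r1 \<le> norm x" "norm x \<le> r2" using n by linarith+
      then show "x \<in> S" by (rule sub)
    qed
  qed auto
qed auto

lemma circle_integral_bound:
  assumes "continuous_on (sphere 0 r) f" "0 < r" "\<And>w. norm w = r \<Longrightarrow> norm (f w) \<le> B"
  shows "norm (contour_integral (circlepath 0 r) f) \<le> B * (2 * pi * r)"
proof (rule has_contour_integral_bound_circlepath)
  show "(f has_contour_integral contour_integral (circlepath 0 r) f) (circlepath 0 r)"
    using assms by (intro has_contour_integral_integral contour_integrable_continuous_circlepath) auto
  have "norm (f (of_real r)) \<le> B" using assms by auto
  then show "0 \<le> B" using norm_ge_zero order_trans by blast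
qed (use assms in auto)

text \<open>This is the residue at infinity: after the circle is pushed out to where
  \<open>w * f w\<close> is within \<open>e'\<close> of \<open>L\<close>, the integrals of
  \<open>f\<close> and of \<open>L / w\<close> differ by at most 2 \<pi> e', whatever the
  radius.\<close>

lemma circle_integral_at_infinity:
  assumes f: "f holomorphic_on {w. a < norm w}" and a: "0 \<le> a" "a < r"
    and lim: "((\<lambda>w. w * f w) \<longlongrightarrow> L) at_infinity"
  shows "contour_integral (circlepath 0 r) f = 2 * of_real pi * \<i> * L"
proof -
  have op: "open {w::complex. a < norm w}" by (intro open_Collect_less continuous_intros)
  have "norm (contour_integral (circlepath 0 r) f - 2 * of_real pi * \<i> * L) \<le> e" if e: "e > 0" for e
  proof -
    define e' where "e' = e / (2 * pi)"
    have "e' > 0" using e by (simp add: e'_def)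
    then have "\<forall>\<^sub>F w in at_infinity. dist (w * f w) L < e'" using lim tendstoD by blast
    then obtain B where B: "\<And>w. norm w \<ge> B \<Longrightarrow> dist (w * f w) L < e'"
      by (auto simp: eventually_at_infinity)
    define R where "R = max B r"
    have R: "R \<ge> r" "R > 0" "R \<ge> B" "R > a" using a by (auto simp: R_def)
    have eq: "contour_integral (circlepath 0 r) f = contour_integral (circlepath 0 R) f"
      using R a by (intro circle_integral_radius[OF f op]) auto
    have cf: "continuous_on (sphere 0 R) f"
      using R by (intro continuous_on_subset[OF holomorphic_on_imp_continuous_on[OF f]]) auto
    have "((\<lambda>w. L / w) has_contour_integral (2 * of_real pi * \<i> * L)) (circlepath 0 R)"
    proof -
      have "((\<lambda>w. L / (w - 0)) has_contour_integral (2 * of_real pi * \<i> * L)) (circlepath 0 R)"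
        using R Cauchy_integral_circlepath_simple[of "\<lambda>_. L" 0 R 0] by auto
      then show ?thesis by simp
    qed
    moreover have "(f has_contour_integral contour_integral (circlepath 0 R) f) (circlepath 0 R)"
      using cf R by (intro has_contour_integral_integral contour_integrable_continuous_circlepath) auto
    ultimately have "((\<lambda>w. f w - L / w) has_contour_integral
        (contour_integral (circlepath 0 R) f - 2 * of_real pi * \<i> * L)) (circlepath 0 R)"
      by (rule has_contour_integral_diff[rotated])
    then have "norm (contour_integral (circlepath 0 R) f - 2 * of_real pi * \<i> * L) \<le> (e' / R) * (2 * pi * R)"
    proof (rule has_contour_integral_bound_circlepath)
      fix w :: complex assume "norm (w - 0) = R"
      then have w: "norm w = R" by simp
      then have "w \<noteq> 0" using R by auto
      have "norm (f w - L / w) = norm (w * f w - L) / R"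
        using \<open>w \<noteq> 0\<close> by (simp add: w[symmetric] norm_divide[symmetric] diff_divide_distrib)
      also have "\<dots> \<le> e' / R" using B[of w] w R by (intro divide_right_mono) (auto simp: dist_norm)
      finally show "norm (f w - L / w) \<le> e' / R" .
    qed (use \<open>e' > 0\<close> R in auto)
    also have "\<dots> = e" using R by (simp add: e'_def)
    finally show ?thesis using eq by simp
  qed
  then have "norm (contour_integral (circlepath 0 r) f - 2 * of_real pi * \<i> * L) \<le> 0"
    by (rule field_le_epsilon[of _ 0, simplified])
  then show ?thesis by simp
qed

text \<open>Only coefficients of nonnegative index are named; the negative ones stay together in one
  function, the \<open>h\<close> of \<open>laurent_decomposition\<close>.\<close>

definition laurent_coeff :: "(complex \<Rightarrow> complex) \<Rightarrow> real \<Rightarrow> nat \<Rightarrow> complex" where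
  "laurent_coeff f r n = contour_integral (circlepath 0 r) (\<lambda>w. f w / w ^ (n + 1)) / (2 * of_real pi * \<i>)"

lemma laurent_coeff_integrable:
  assumes "continuous_on (sphere 0 r) f" "0 < r"
  shows "(\<lambda>w. f w / w ^ k) contour_integrable_on (circlepath 0 r)"
  using assms by (intro contour_integrable_continuous_circlepath continuous_intros) auto

lemma laurent_coeff_cong: "(\<And>w. norm w = r \<Longrightarrow> f w = g w) \<Longrightarrow> 0 \<le> r \<Longrightarrow> laurent_coeff f r n = laurent_coeff g r n"
  unfolding laurent_coeff_def by (intro arg_cong2[where f = "(/)"] contour_integral_cong) auto

lemma laurent_coeff_radius:
  assumes "f holomorphic_on S" "open S" "0 < r1" "r1 \<le> r2"
    and sub: "\<And>w. r1 \<le> norm w \<Longrightarrow> norm w \<le> r2 \<Longrightarrow> w \<in> S"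
  shows "laurent_coeff f r1 n = laurent_coeff f r2 n"
proof -
  have "contour_integral (circlepath 0 r1) (\<lambda>w. f w / w ^ (n+1)) = contour_integral (circlepath 0 r2) (\<lambda>w. f w / w ^ (n+1))"
  proof (rule circle_integral_radius[of _ "S - {0}"])
    show "(\<lambda>w. f w / w ^ (n+1)) holomorphic_on S - {0}"
      by (intro holomorphic_intros holomorphic_on_subset[OF assms(1)]) auto
    show "open (S - {0})" using assms(2) by auto
    show "w \<in> S - {0}" if "r1 \<le> norm w" "norm w \<le> r2" for w using sub that \<open>0 < r1\<close> by auto
  qed (use assms in auto)
  then show ?thesis by (simp add: laurent_coeff_def)
qed

lemma laurent_coeff_add:
  assumes "continuous_on (sphere 0 r) f" "continuous_on (sphere 0 r) g" "0 < r"
  shows "laurent_coeff (\<lambda>w. f w + g w) r n = laurent_coeff f r n + laurent_coeff g r n"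
  unfolding laurent_coeff_def
  by (simp add: add_divide_distrib contour_integral_add laurent_coeff_integrable[OF assms(1,3), of "n+1", simplified]
      laurent_coeff_integrable[OF assms(2,3), of "n+1", simplified])

lemma laurent_coeff_cmult:
  assumes "continuous_on (sphere 0 r) f" "0 < r"
  shows "laurent_coeff (\<lambda>w. c * f w) r n = c * laurent_coeff f r n"
  unfolding laurent_coeff_def using contour_integral_lmul[OF laurent_coeff_integrable[OF assms, of "n+1"], of c] by simp

lemma laurent_coeff_bound:
  assumes "continuous_on (sphere 0 r) f" "0 < r" "\<And>w. norm w = r \<Longrightarrow> norm (f w) \<le> B"
  shows "norm (laurent_coeff f r n) \<le> B / r ^ n"
proof -
  have "norm (contour_integral (circlepath 0 r) (\<lambda>w. f w / w ^ (n+1))) \<le> (B / r ^ (n+1)) * (2 * pi * r)"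
  proof (rule circle_integral_bound)
    show "continuous_on (sphere 0 r) (\<lambda>w. f w / w ^ (n+1))"
      using assms(1,2) by (intro continuous_intros) auto
    show "norm (f w / w ^ (n+1)) \<le> B / r ^ (n+1)" if "norm w = r" for w
      using assms that by (simp add: norm_divide norm_power norm_mult divide_right_mono)
  qed fact
  then show ?thesis using assms(2) by (simp add: laurent_coeff_def norm_divide norm_mult field_simps)
qed

text \<open>The Cauchy kernel is expanded in a geometric series. Continuity on the circle is enough,
  since the sum is identified with the Cauchy integral and not yet with \<open>f\<close>.\<close>

lemma cauchy_circle_sums:
  assumes f: "continuous_on (sphere 0 r) f" and w: "norm w < r"
  shows "(\<lambda>n. laurent_coeff f r n * w ^ n) sums
    (contour_integral (circlepath 0 r) (\<lambda>s. f s / (s - w)) / (2 * of_real pi * \<i>))"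
proof -
  have r: "r > 0" using w norm_ge_zero[of w] by linarith
  let ?I = "\<lambda>g. contour_integral (circlepath 0 r) g"
  obtain B where B: "\<And>s. norm s = r \<Longrightarrow> norm (f s) \<le> B"
  proof -
    have "compact (f ` sphere 0 r)" using f by (intro compact_continuous_image) auto
    then obtain B where "\<forall>x\<in>f ` sphere 0 r. norm x \<le> B" using compact_imp_bounded bounded_iff by metis
    then show ?thesis using that[of B] by simp
  qed
  have B0: "B \<ge> 0" using B[of "of_real r"] r by (metis abs_of_pos norm_ge_zero norm_of_real order_trans)
  have nz: "s - w \<noteq> 0" "s \<noteq> 0" if "norm s = r" for s using that w r by auto
  \<comment> \<open>The remainder after \<open>k\<close> terms is an exact integral, bounded by a
    multiple of (|w|/r)^k; sum and integral are never interchanged.\<close>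
  have part: "?I (\<lambda>s. f s / (s - w)) - (\<Sum>n<k. laurent_coeff f r n * w ^ n) * (2 * of_real pi * \<i>)
     = ?I (\<lambda>s. f s * (w / s) ^ k / (s - w))" for k
  proof (induction k)
    case 0 then show ?case by simp
  next
    case (Suc k)
    have c1: "(\<lambda>s. f s * (w / s) ^ k / (s - w)) contour_integrable_on circlepath 0 r"
      using r by (intro contour_integrable_continuous_circlepath continuous_intros) (use nz f in auto)
    have "?I (\<lambda>s. f s * (w / s) ^ Suc k / (s - w)) = ?I (\<lambda>s. f s * (w / s) ^ k / (s - w) - w ^ k * (f s / s ^ (k+1)))"
    proof (rule contour_integral_cong)
      fix s assume "s \<in> path_image (circlepath 0 r)"
      then have s: "s - w \<noteq> 0" "s \<noteq> 0" using nz r by auto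
      have "w / (s * (s - w)) = 1 / (s - w) - 1 / s" using s by (simp add: field_simps)
      then have "f s * (w / s) ^ k * (w / (s * (s - w))) = f s * (w / s) ^ k * (1 / (s - w) - 1 / s)" by simp
      moreover have "f s * (w / s) ^ k * (w / (s * (s - w))) = f s * (w / s) ^ Suc k / (s - w)" by (simp add: ac_simps)
      moreover have "f s * (w / s) ^ k * (1 / (s - w) - 1 / s) = f s * (w / s) ^ k / (s - w) - w ^ k * (f s / s ^ (k+1))"
        by (simp add: power_divide right_diff_distrib diff_divide_distrib ac_simps)
      ultimately show "f s * (w / s) ^ Suc k / (s - w) = f s * (w / s) ^ k / (s - w) - w ^ k * (f s / s ^ (k+1))" by simp
    qed simp
    also have "\<dots> = ?I (\<lambda>s. f s * (w / s) ^ k / (s - w)) - ?I (\<lambda>s. w ^ k * (f s / s ^ (k+1)))"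
      by (intro contour_integral_diff c1 contour_integrable_lmul laurent_coeff_integrable[OF f r])
    also have "?I (\<lambda>s. w ^ k * (f s / s ^ (k+1))) = w ^ k * ?I (\<lambda>s. f s / s ^ (k+1))"
      by (intro contour_integral_lmul laurent_coeff_integrable[OF f r])
    finally have "?I (\<lambda>s. f s * (w / s) ^ Suc k / (s - w)) = ?I (\<lambda>s. f s * (w / s) ^ k / (s - w)) - w ^ k * ?I (\<lambda>s. f s / s ^ (k+1))" .
    also have "\<dots> = ?I (\<lambda>s. f s / (s - w)) - (\<Sum>n<Suc k. laurent_coeff f r n * w ^ n) * (2 * of_real pi * \<i>)"
      by (subst Suc.IH[symmetric]) (simp add: laurent_coeff_def field_simps)
    finally show ?case by simp
  qed
  define q where "q = norm w / r"
  have q: "0 \<le> q" "q < 1" using w r by (auto simp: q_def)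
  have bd: "norm (?I (\<lambda>s. f s / (s - w)) - (\<Sum>n<k. laurent_coeff f r n * w ^ n) * (2 * of_real pi * \<i>))
      \<le> (B / (r - norm w)) * (2 * pi * r) * q ^ k" for k
  proof -
    have "norm (?I (\<lambda>s. f s * (w / s) ^ k / (s - w))) \<le> (B * q ^ k / (r - norm w)) * (2 * pi * r)"
    proof (rule circle_integral_bound)
      show "continuous_on (sphere 0 r) (\<lambda>s. f s * (w / s) ^ k / (s - w))"
        by (intro continuous_intros f) (use nz in auto)
      show "norm (f s * (w / s) ^ k / (s - w)) \<le> B * q ^ k / (r - norm w)" if s: "norm s = r" for s
      proof -
        have "norm (s - w) \<ge> r - norm w" using s norm_triangle_ineq2[of s w] by simp
        then show ?thesis using B[OF s] B0 q w s
          by (auto simp: norm_divide norm_mult norm_power q_def intro!: frac_le mult_right_mono mult_nonneg_nonneg)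
      qed
    qed fact
    then show ?thesis by (simp only: part) (simp add: field_simps)
  qed
  have "(\<lambda>k. (B / (r - norm w)) * (2 * pi * r) * q ^ k) \<longlonglongrightarrow> 0"
    using q by (intro tendsto_mult_right_zero LIMSEQ_realpow_zero)
  then have "(\<lambda>k. ?I (\<lambda>s. f s / (s - w)) - (\<Sum>n<k. laurent_coeff f r n * w ^ n) * (2 * of_real pi * \<i>)) \<longlonglongrightarrow> 0"
    by (rule Lim_null_comparison[rotated]) (use bd in auto)
  then have "(\<lambda>k. (?I (\<lambda>s. f s / (s - w)) - (?I (\<lambda>s. f s / (s - w)) - (\<Sum>n<k. laurent_coeff f r n * w ^ n) * (2 * of_real pi * \<i>))) / (2 * of_real pi * \<i>))
     \<longlonglongrightarrow> (?I (\<lambda>s. f s / (s - w)) - 0) / (2 * of_real pi * \<i>)"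
    by (intro tendsto_intros) auto
  then show ?thesis by (simp add: sums_def)
qed

lemma cauchy_circle_exterior:
  assumes f: "continuous_on (sphere 0 r) f" and r: "0 < r"
  defines "h \<equiv> \<lambda>w. contour_integral (circlepath 0 r) (\<lambda>s. f s / (s - w))"
  shows "h holomorphic_on {w. r < norm w}" "(h \<longlongrightarrow> 0) at_infinity"
proof -
  obtain B where B: "\<And>s. norm s = r \<Longrightarrow> norm (f s) \<le> B"
  proof -
    have "compact (f ` sphere 0 r)" using f by (intro compact_continuous_image) auto
    then obtain B where "\<forall>x\<in>f ` sphere 0 r. norm x \<le> B" using compact_imp_bounded bounded_iff by metis
    then show ?thesis using that[of B] by simp
  qed
  have B0: "B \<ge> 0" using B[of "of_real r"] r by (metis abs_of_pos norm_ge_zero norm_of_real order_trans)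
  have op: "open {w::complex. r < norm w}" by (intro open_Collect_less continuous_intros)
  have cg: "continuous_on (sphere 0 r) (\<lambda>s. f s / (s - w))" if "r < norm w" for w
    by (intro continuous_intros f) (use that in auto)
  have der: "(h has_field_derivative (of_nat 1 * contour_integral (circlepath 0 r) (\<lambda>u. f u / (u - w) ^ Suc 1))) (at w)"
    if w: "r < norm w" for w
  proof (rule Cauchy_next_derivative(2)[where \<gamma> = "circlepath 0 r" and f' = f and B = "2 * pi * r" and S = "{w. r < norm w}" and k = 1 and f = h])
    show "continuous_on (path_image (circlepath 0 r)) f" using f r by simp
    show "norm (vector_derivative (circlepath 0 r) (at t)) \<le> 2 * pi * r" if "t \<in> {0..1}" for t
      using r by (simp add: vector_derivative_circlepath norm_mult)
    show "((\<lambda>u. f u / (u - w) ^ 1) has_contour_integral h w) (circlepath 0 r)"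
      if "w \<in> {w. r < norm w} - path_image (circlepath 0 r)" for w
      unfolding h_def using that r
      by (simp, intro has_contour_integral_integral contour_integrable_continuous_circlepath) (auto intro: cg)
  qed (use w r op in auto)
  show "h holomorphic_on {w. r < norm w}"
    using der by (subst holomorphic_on_open[OF op]) blast
  have bd: "norm (h w) \<le> (B * (2 * pi * r)) * inverse (norm w - r)" if w: "r < norm w" for w
  proof -
    have "norm (h w) \<le> (B / (norm w - r)) * (2 * pi * r)"
      unfolding h_def
    proof (rule circle_integral_bound[OF cg[OF w] r])
      fix s :: complex assume s: "norm s = r"
      have "norm (s - w) \<ge> norm w - r" using s norm_triangle_ineq2[of w s] by (simp add: norm_minus_commute)
      then show "norm (f s / (s - w)) \<le> B / (norm w - r)" using B[OF s] B0 w
        by (auto simp: norm_divide intro!: frac_le)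
    qed
    then show ?thesis by (simp add: field_simps)
  qed
  have "filterlim (\<lambda>w::complex. - r + norm w) at_top at_infinity"
    by (rule filterlim_tendsto_add_at_top[OF tendsto_const filterlim_norm_at_top])
  then have "((\<lambda>w::complex. inverse (- r + norm w)) \<longlongrightarrow> 0) at_infinity"
    by (rule tendsto_inverse_0_at_top)
  then have l: "((\<lambda>w::complex. (B * (2 * pi * r)) * inverse (norm w - r)) \<longlongrightarrow> 0) at_infinity"
    by (intro tendsto_mult_right_zero) (simp add: algebra_simps)
  show "(h \<longlongrightarrow> 0) at_infinity"
  proof (rule Lim_null_comparison[OF _ l])
    show "\<forall>\<^sub>F w in at_infinity. norm (h w) \<le> B * (2 * pi * r) * inverse (norm w - r)"
      unfolding eventually_at_infinity by (rule exI[of _ "r + 1"]) (auto intro!: bd)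
  qed
qed

lemma open_annulus: "open {w::complex. a < norm w \<and> ereal (norm w) < b}"
  by (intro open_Collect_conj open_Collect_less continuous_intros continuous_on_ereal)

text \<open>By Cauchy's formula on the annulus, the integral over a circle beyond \<open>w\<close>
  gives the power series and the one over the circle of radius \<open>r\<close> gives
  \<open>- h\<close>. Since \<open>h\<close> depends on that circle alone, it lives on all of |w| >
  r even if \<open>f\<close> stops at \<open>b\<close>; this is what makes continuation past
  \<open>b\<close> possible.\<close>

theorem laurent_decomposition:
  fixes b :: ereal
  assumes f: "f holomorphic_on {w. a < norm w \<and> ereal (norm w) < b}" and a: "0 \<le> a" "a < r" "ereal r < b"
  obtains h where "h holomorphic_on {w. r < norm w}" "(h \<longlongrightarrow> 0) at_infinity"
    "\<And>w. r < norm w \<Longrightarrow> ereal (norm w) < b \<Longrightarrow> (\<lambda>n. laurent_coeff f r n * w ^ n) sums (f w - h w)"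
proof -
  let ?A = "{w::complex. a < norm w \<and> ereal (norm w) < b}"
  define h where "h w = - (contour_integral (circlepath 0 r) (\<lambda>s. f s / (s - w)) / (2 * of_real pi * \<i>))" for w
  have r: "r > 0" using a by simp
  have cf: "continuous_on (sphere 0 \<rho>) f" if "a < \<rho>" "ereal \<rho> < b" for \<rho>
    using that by (intro continuous_on_subset[OF holomorphic_on_imp_continuous_on[OF f]]) auto
  note ext = cauchy_circle_exterior[OF cf[OF a(2,3)] r]
  show ?thesis
  proof (rule that[of h])
    show "h holomorphic_on {w. r < norm w}" unfolding h_def by (intro holomorphic_intros ext) auto
    have "((\<lambda>w. - (contour_integral (circlepath 0 r) (\<lambda>s. f s / (s - w)) / (2 * of_real pi * \<i>))) \<longlongrightarrow> - (0 / (2 * of_real pi * \<i>))) at_infinity"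
      by (intro tendsto_intros ext) auto
    then show "(h \<longlongrightarrow> 0) at_infinity" by (simp add: h_def[abs_def])
    fix w :: complex assume w: "r < norm w" "ereal (norm w) < b"
    obtain R where R: "norm w < R" "ereal R < b"
      using ereal_dense2[OF w(2)] by (auto simp: less_ereal.simps)
    have R0: "R > 0" "R > a" "R > r" using R w r a by auto
    have sub: "w \<in> ?A" if "r \<le> norm w" "norm w \<le> R" for w
    proof -
      have "ereal (norm w) \<le> ereal R" using that by simp
      then have "ereal (norm w) < b" using R(2) by (rule le_less_trans)
      then show ?thesis using that a by auto
    qed
    \<comment> \<open>The difference quotient has a removable singularity at \<open>w\<close>, so
      its integral is the same over both circles; Cauchy's formula for the annulus follows by
      splitting it.\<close>
    define g where "g s = (if s = w then deriv f w else (f s - f w) / (s - w))" for s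
    have g: "g holomorphic_on ?A" unfolding g_def by (rule pole_lemma_open[OF f open_annulus])
    have eq: "contour_integral (circlepath 0 r) g = contour_integral (circlepath 0 R) g"
      using R0 r by (intro circle_integral_radius[OF g open_annulus] sub) auto
    have split: "contour_integral (circlepath 0 \<rho>) g = contour_integral (circlepath 0 \<rho>) (\<lambda>s. f s / (s - w))
       - f w * contour_integral (circlepath 0 \<rho>) (\<lambda>s. 1 / (s - w))" if \<rho>: "a < \<rho>" "ereal \<rho> < b" "\<rho> \<noteq> norm w" for \<rho>
    proof -
      have \<rho>0: "\<rho> > 0" using \<rho> a by simp
      have nz: "s \<noteq> w" if "norm s = \<rho>" for s using that \<rho> by auto
      have "contour_integral (circlepath 0 \<rho>) g = contour_integral (circlepath 0 \<rho>) (\<lambda>s. f s / (s - w) - f w * (1 / (s - w)))"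
        using \<rho>0 nz by (intro contour_integral_cong) (auto simp: g_def diff_divide_distrib)
      also have "\<dots> = contour_integral (circlepath 0 \<rho>) (\<lambda>s. f s / (s - w)) - contour_integral (circlepath 0 \<rho>) (\<lambda>s. f w * (1 / (s - w)))"
        using \<rho>0 nz by (intro contour_integral_diff contour_integrable_continuous_circlepath continuous_intros)
          (auto intro!: cf[OF \<rho>(1,2)] continuous_intros)
      also have "contour_integral (circlepath 0 \<rho>) (\<lambda>s. f w * (1 / (s - w))) = f w * contour_integral (circlepath 0 \<rho>) (\<lambda>s. 1 / (s - w))"
        using \<rho>0 nz by (intro contour_integral_lmul contour_integrable_continuous_circlepath continuous_intros) auto
      finally show ?thesis .
    qed
    have iR: "contour_integral (circlepath 0 R) (\<lambda>s. 1 / (s - w)) = 2 * of_real pi * \<i>"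
      using Cauchy_integral_circlepath_simple[of "\<lambda>_. 1" 0 R w] R by (auto intro!: contour_integral_unique)
    have ir: "contour_integral (circlepath 0 r) (\<lambda>s. 1 / (s - w)) = 0"
    proof (rule contour_integral_unique, rule Cauchy_theorem_convex_simple[of _ "ball 0 (norm w)"])
      show "(\<lambda>s. 1 / (s - w)) holomorphic_on ball 0 (norm w)" by (intro holomorphic_intros) auto
    qed (use w r in auto)
    have key: "contour_integral (circlepath 0 R) (\<lambda>s. f s / (s - w)) / (2 * of_real pi * \<i>) = f w - h w"
      using split[of r] split[of R] eq iR ir R R0 a w
      by (auto simp: h_def field_simps)
    have "laurent_coeff f r n = laurent_coeff f R n" for n
      using R0 r by (intro laurent_coeff_radius[OF f open_annulus] sub) auto
    then show "(\<lambda>n. laurent_coeff f r n * w ^ n) sums (f w - h w)"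
      using cauchy_circle_sums[OF cf[OF R0(2) R(2)] R(1)] key by simp
  qed
qed

section \<open>The exterior map and canonical domains\<close>

locale exterior =
  fixes E :: "complex set" and \<Phi> :: "complex \<Rightarrow> complex"
  assumes compact_E: "compact E" and E_ne: "E \<noteq> {}" and ext_map: "exterior_map E \<Phi>"
begin

abbreviation "D \<equiv> canon_dom E \<Phi>"

definition Psi :: "complex \<Rightarrow> complex" where "Psi = inv_into (- E) \<Phi>"

lemma holo_Phi: "\<Phi> holomorphic_on (- E)"
  and bij_Phi: "bij_betw \<Phi> (- E) {w. norm w > 1}"
  using ext_map by (auto simp: exterior_map_def)

lemma open_compl_E: "open (- E)"
  using compact_E compact_imp_closed by blast

lemma norm_Phi: "z \<notin> E \<Longrightarrow> 1 < norm (\<Phi> z)"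
  using bij_betwE[OF bij_Phi] by auto

lemma Psi_Phi [simp]: "z \<notin> E \<Longrightarrow> Psi (\<Phi> z) = z"
  unfolding Psi_def using bij_Phi by (simp add: bij_betw_def)

lemma Phi_Psi [simp]: "1 < norm w \<Longrightarrow> \<Phi> (Psi w) = w"
  unfolding Psi_def by (rule f_inv_into_f) (use bij_Phi in \<open>auto simp: bij_betw_def\<close>)

lemma Psi_notin: "1 < norm w \<Longrightarrow> Psi w \<notin> E"
  unfolding Psi_def using inv_into_into[of w \<Phi> "- E"] bij_Phi by (auto simp: bij_betw_def)

lemma holo_Psi: "Psi holomorphic_on {w. 1 < norm w}"
  and deriv_Psi: "1 < norm w \<Longrightarrow> deriv \<Phi> (Psi w) * deriv Psi w = 1"
proof -
  obtain g where g: "g holomorphic_on (\<Phi> ` (- E))"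
      "\<And>z. z \<in> - E \<Longrightarrow> deriv \<Phi> z * deriv g (\<Phi> z) = 1" "\<And>z. z \<in> - E \<Longrightarrow> g (\<Phi> z) = z"
    using holomorphic_has_inverse[OF holo_Phi open_compl_E] bij_Phi by (auto simp: bij_betw_def)
  have im: "\<Phi> ` (- E) = {w. 1 < norm w}" using bij_Phi by (simp add: bij_betw_def)
  have eq: "g w = Psi w" if "1 < norm w" for w
    using g(3)[of "Psi w"] that Psi_notin[of w] by simp
  have op: "open {w::complex. 1 < norm w}" by (intro open_Collect_less continuous_intros)
  show "Psi holomorphic_on {w. 1 < norm w}"
    using g(1) unfolding im by (rule holomorphic_transform) (use eq in auto)
  assume w: "1 < norm w"
  have "deriv g w = deriv Psi w"
    by (rule deriv_cong_ev) (use eventually_nhds_in_open[OF op, of w] w eq in \<open>auto elim!: eventually_mono\<close>)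
  then show "deriv \<Phi> (Psi w) * deriv Psi w = 1"
    using g(2)[of "Psi w"] w Psi_notin[of w] by simp
qed

lemma open_gt: "open {w::complex. a < norm w}"
  by (intro open_Collect_less continuous_intros)

lemma cont_Phi: "continuous_on (- E) \<Phi>"
  using holo_Phi by (rule holomorphic_on_imp_continuous_on)

lemma cont_Psi: "continuous_on {w. 1 < norm w} Psi"
  using holo_Psi by (rule holomorphic_on_imp_continuous_on)

section \<open>The exterior map and its inverse near infinity\<close>

lemma Phi_asymp: obtains c where "c \<noteq> 0" "((\<lambda>z. \<Phi> z / z) \<longlongrightarrow> c) at_infinity"
proof -
  obtain c :: real where "c > 0" "((\<lambda>z. \<Phi> z / z) \<longlongrightarrow> of_real c) at_infinity"
    using ext_map by (auto simp: exterior_map_def)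
  then show ?thesis using that[of "of_real c"] by auto
qed

text \<open>In the coordinate \<zeta> = 1/z the function \<open>g\<close> is 1/\<Phi>(1/\<zeta>),
  extended by 0 at the origin. It is not constant, so by the open mapping theorem its image contains
  a disc about 0: every large \<open>w\<close> is attained by \<Phi> at a point of large modulus,
  and injectivity makes this point \<open>Psi w\<close>.\<close>

lemma Psi_large: "filterlim Psi at_infinity at_infinity"
proof -
  obtain c where c: "c \<noteq> 0" and lim: "((\<lambda>z. \<Phi> z / z) \<longlongrightarrow> c) at_infinity" by (rule Phi_asymp)
  obtain B0 where B0: "\<And>z. z \<in> E \<Longrightarrow> norm z \<le> B0" using compact_imp_bounded[OF compact_E] bounded_iff by metis
  define B where "B = max B0 1"
  have B: "B > 0" "\<And>z. norm z > B \<Longrightarrow> z \<notin> E" using B0 by (force simp: B_def)+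
  define \<phi> where "\<phi> \<zeta> = (if \<zeta> = 0 then c else \<zeta> * \<Phi> (1 / \<zeta>))" for \<zeta> :: complex
  have inv: "1 / \<zeta> \<notin> E" if "\<zeta> \<noteq> 0" "norm \<zeta> < 1 / B" for \<zeta>
    using that B by (intro B(2)) (simp add: norm_divide field_simps)
  have lim0: "(\<phi> \<longlongrightarrow> c) (at 0)"
  proof -
    have "((\<lambda>z. \<Phi> (inverse z) / inverse z) \<longlongrightarrow> c) (at 0)"
      by (rule filterlim_compose[OF lim filterlim_inverse_at_infinity])
    then show ?thesis
      by (rule Lim_transform_eventually) (auto simp: eventually_at_filter \<phi>_def field_simps)
  qed
  have holo: "\<phi> holomorphic_on ball 0 (1 / B)"
  proof (rule no_isolated_singularity'[where K = "{0}"])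
    show "\<phi> holomorphic_on ball 0 (1 / B) - {0}"
    proof (rule holomorphic_transform)
      show "(\<lambda>\<zeta>. \<zeta> * \<Phi> (1 / \<zeta>)) holomorphic_on ball 0 (1 / B) - {0}"
        by (intro holomorphic_intros holomorphic_on_compose_gen[OF _ holo_Phi, unfolded o_def])
          (use inv in auto)
    qed (auto simp: \<phi>_def)
    show "(\<phi> \<longlongrightarrow> \<phi> z) (at z within ball 0 (1/B))" if "z \<in> {0}" for z
      using tendsto_within_subset[OF lim0] that by (auto simp: \<phi>_def)
  qed auto
  have large: "\<exists>M. \<forall>w. norm w > M \<longrightarrow> norm (Psi w) > A" for A
  proof -
    have "continuous_on (ball 0 (1/B)) \<phi>" using holo by (rule holomorphic_on_imp_continuous_on)
    then have "isCont \<phi> 0" using B by (simp add: continuous_on_eq_continuous_at)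
    moreover have "\<phi> 0 \<noteq> 0" using c by (simp add: \<phi>_def)
    ultimately obtain e where e: "e > 0" "\<And>\<zeta>. norm \<zeta> < e \<Longrightarrow> \<phi> \<zeta> \<noteq> 0"
      using continuous_at_avoid[of 0 \<phi> 0] by (auto simp: dist_norm)
    \<comment> \<open>The three bounds make \<phi> nonzero, keep 1/\<zeta> outside \<open>E\<close>,
      and make |1/\<zeta>| larger than \<open>A\<close>.\<close>
    define \<delta> where "\<delta> = min e (min (1/B) (1 / max A 1))"
    have \<delta>: "\<delta> > 0" "\<delta> \<le> e" "\<delta> \<le> 1 / B" "\<delta> \<le> 1 / max A 1" using e B by (auto simp: \<delta>_def)
    define g where "g \<zeta> = \<zeta> / \<phi> \<zeta>" for \<zeta>
    have gh: "g holomorphic_on ball 0 \<delta>"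
      unfolding g_def by (intro holomorphic_intros holomorphic_on_subset[OF holo]) (use \<delta> e in auto)
    have gn: "g \<zeta> \<noteq> 0" if "\<zeta> \<noteq> 0" "norm \<zeta> < \<delta>" for \<zeta>
      using e(2)[of \<zeta>] that \<delta> by (auto simp: g_def)
    have "\<not> g constant_on ball 0 \<delta>"
    proof
      assume "g constant_on ball 0 \<delta>"
      then obtain k where "\<And>z. z \<in> ball 0 \<delta> \<Longrightarrow> g z = k" by (auto simp: constant_on_def)
      from this[of 0] this[of "of_real (\<delta>/2)"] \<delta> g_def gn[of "of_real (\<delta>/2)"] show False by auto
    qed
    then have "open (g ` ball 0 \<delta>)" using open_mapping_thm[OF gh open_ball connected_ball open_ball] by auto
    moreover have "0 \<in> g ` ball 0 \<delta>" using \<delta> by (auto simp: g_def intro!: image_eqI[of _ _ 0])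
    ultimately obtain r where r: "r > 0" "ball 0 r \<subseteq> g ` ball 0 \<delta>" using openE by blast
    show ?thesis
    proof (intro exI[of _ "1 / r"] allI impI)
      fix w :: complex assume w: "1 / r < norm w"
      have "w \<noteq> 0" using w r by auto
      have "norm (1 / w) < r" using w r \<open>w \<noteq> 0\<close> by (simp add: norm_divide field_simps)
      then obtain \<zeta> where z: "norm \<zeta> < \<delta>" "1 / w = g \<zeta>" using r by (auto simp: subset_iff image_iff)
      have "\<zeta> \<noteq> 0" using z \<open>w \<noteq> 0\<close> by (auto simp: g_def)
      then have "w = \<Phi> (1 / \<zeta>)" using z(2) \<open>w \<noteq> 0\<close> by (auto simp: g_def \<phi>_def field_simps)
      moreover have "1 / \<zeta> \<notin> E" using inv \<open>\<zeta> \<noteq> 0\<close> z \<delta> by auto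
      ultimately have "Psi w = 1 / \<zeta>" by simp
      moreover have "norm (1 / \<zeta>) > max A 1"
      proof -
        have "norm \<zeta> < 1 / max A 1" using z \<delta> by linarith
        then have "norm \<zeta> * max A 1 < 1" by (simp add: less_divide_eq)
          then have "max A 1 < 1 / norm \<zeta>" using \<open>\<zeta> \<noteq> 0\<close> by (subst pos_less_divide_eq) (auto simp: mult.commute)
          then show ?thesis by (simp add: norm_divide)
      qed
      ultimately show "norm (Psi w) > A" by simp
    qed
  qed
  show ?thesis
    unfolding filterlim_at_infinity[OF order_refl] eventually_at_infinity
  proof (intro allI impI)
    fix A :: real
    obtain M where "\<forall>w. norm w > M \<longrightarrow> norm (Psi w) > A" using large by blast
    then show "\<exists>b. \<forall>x. b \<le> norm x \<longrightarrow> A \<le> norm (Psi x)" by (intro exI[of _ "M + 1"]) (auto intro: less_imp_le)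
  qed
qed

lemma Psi_asymp: obtains C where "C \<noteq> 0" "((\<lambda>w. Psi w / w) \<longlongrightarrow> C) at_infinity"
proof -
  obtain c where c: "c \<noteq> 0" and lim: "((\<lambda>z. \<Phi> z / z) \<longlongrightarrow> c) at_infinity" by (rule Phi_asymp)
  have "((\<lambda>w. inverse (\<Phi> (Psi w) / Psi w)) \<longlongrightarrow> inverse c) at_infinity"
    by (intro tendsto_inverse c filterlim_compose[OF lim Psi_large])
  then have "((\<lambda>w. Psi w / w) \<longlongrightarrow> inverse c) at_infinity"
    by (rule Lim_transform_eventually)
      (auto simp: eventually_at_infinity intro!: exI[of _ 2])
  then show ?thesis using that[of "inverse c"] c by auto
qed

text \<open>\<Phi> need not extend continuously to the boundary of \<open>E\<close>, so compactness
  of the disc gives no bound. The bound is \<open>Psi_large\<close> read backwards.\<close>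

lemma Phi_bounded: obtains M where "\<And>z. z \<notin> E \<Longrightarrow> norm z \<le> B \<Longrightarrow> norm (\<Phi> z) \<le> M"
proof -
  have "\<forall>\<^sub>F w in at_infinity. max (B + 1) 1 \<le> norm (Psi w)"
    using Psi_large unfolding filterlim_at_infinity[OF order_refl, of Psi] by (rule allE[of _ "max (B+1) 1"]) simp
  then obtain M where M: "\<And>w. M \<le> norm w \<Longrightarrow> B + 1 \<le> norm (Psi w)" by (auto simp: eventually_at_infinity)
  show ?thesis
  proof (rule that[of M])
    fix z assume "z \<notin> E" "norm z \<le> B"
    then show "norm (\<Phi> z) \<le> M" using M[of "\<Phi> z"] by (cases "M \<le> norm (\<Phi> z)") auto
  qed
qed

lemma Phi_proper: obtains B where "\<And>z. z \<notin> E \<Longrightarrow> norm (\<Phi> z) \<le> M \<Longrightarrow> norm z \<le> B"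
proof -
  obtain c where c: "c \<noteq> 0" and lim: "((\<lambda>z. \<Phi> z / z) \<longlongrightarrow> c) at_infinity" by (rule Phi_asymp)
  have "\<forall>\<^sub>F z in at_infinity. dist (\<Phi> z / z) c < norm c / 2" using c by (intro tendstoD[OF lim]) auto
  then obtain B where B: "\<And>z. B \<le> norm z \<Longrightarrow> dist (\<Phi> z / z) c < norm c / 2" by (auto simp: eventually_at_infinity)
  show ?thesis
  proof (rule that)
    fix z assume z: "z \<notin> E" "norm (\<Phi> z) \<le> M"
    show "norm z \<le> max (max B 1) (2 * M / norm c)"
    proof (rule ccontr)
      assume "\<not> ?thesis"
      then have *: "norm z > B" "norm z > 1" "norm z > 2 * M / norm c" by auto
      have "norm c \<le> norm (\<Phi> z / z) + dist (\<Phi> z / z) c" using norm_triangle_sub[of c "\<Phi> z / z"] by (simp add: dist_norm norm_minus_commute)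
      with B[of z] * have "norm (\<Phi> z / z) > norm c / 2" by simp
      then have "norm (\<Phi> z) > norm c / 2 * norm z" using pos_less_divide_eq[of "norm z" "norm c / 2" "norm (\<Phi> z)"] * less_trans[OF zero_less_one *(2)] by (simp add: norm_divide)
      moreover have "norm c / 2 * norm z > M" using * c by (simp add: field_simps)
      ultimately show False using z by simp
    qed
  qed
qed

section \<open>Topology of the canonical domains\<close>

definition cD :: "real \<Rightarrow> complex set" where "cD r = E \<union> {z. z \<notin> E \<and> norm (\<Phi> z) \<le> r}"

lemma compact_cD: "compact (cD r)"
proof -
  have "closed (cD r)"
  proof -
    have "open ({z \<in> - E. \<Phi> z \<in> {w. r < norm w}})"
      using continuous_open_preimage[OF cont_Phi open_compl_E open_gt[of r]] by (simp add: vimage_def Int_def)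
    moreover have "{z \<in> - E. \<Phi> z \<in> {w. r < norm w}} = - cD r" by (auto simp: cD_def)
    ultimately show ?thesis by (simp add: closed_def)
  qed
  moreover have "bounded (cD r)"
  proof -
    obtain B where "\<And>z. z \<notin> E \<Longrightarrow> norm (\<Phi> z) \<le> r \<Longrightarrow> norm z \<le> B" using Phi_proper[of r] by metis
    then have "bounded {z. z \<notin> E \<and> norm (\<Phi> z) \<le> r}" by (auto simp: bounded_iff)
    then show ?thesis using compact_imp_bounded[OF compact_E] by (simp add: cD_def)
  qed
  ultimately show ?thesis by (simp add: compact_eq_bounded_closed)
qed

lemma E_sub_D: "E \<subseteq> D \<rho>" and D_mono: "\<rho> \<le> \<rho>' \<Longrightarrow> D \<rho> \<subseteq> D \<rho>'"
  and D_cD: "ereal r < \<rho> \<Longrightarrow> cD r \<subseteq> D \<rho>" and D_sub_cD: "D (ereal r) \<subseteq> cD r" and D_infty: "D \<infinity> = UNIV"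
  and in_D: "z \<notin> E \<Longrightarrow> z \<in> D \<rho> \<longleftrightarrow> ereal (norm (\<Phi> z)) < \<rho>"
proof -
  show "cD r \<subseteq> D \<rho>" if "ereal r < \<rho>"
  proof
    fix z assume "z \<in> cD r"
    then have "z \<in> E \<or> z \<notin> E \<and> ereal (norm (\<Phi> z)) \<le> ereal r" by (auto simp: cD_def)
    then show "z \<in> D \<rho>" using le_less_trans[OF _ that] by (auto simp: canon_dom_def simp del: ereal_less_eq)
  qed
qed (auto simp: canon_dom_def cD_def less_imp_le)

text \<open>The issue is openness at points of \<open>E\<close>, near which \<Phi> is not controlled
  directly. A convergent sequence outside the domain is mapped into a closed annulus r \<le> |w|
  \<le> M, and the image of this annulus under \<open>Psi\<close> is compact and disjoint from the
  domain.\<close>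

lemma open_D: "1 < \<rho> \<Longrightarrow> open (D \<rho>)"
proof (cases \<rho>)
  case (real r)
  assume "1 < \<rho>"
  then have r: "1 < r" using real by simp
  have "closed (- D \<rho>)"
    unfolding closed_sequential_limits
  proof (intro allI impI)
    fix x l assume xl: "(\<forall>n. x n \<in> - D \<rho>) \<and> x \<longlonglongrightarrow> l"
    then have xD: "\<And>n. x n \<notin> E" "\<And>n. r \<le> norm (\<Phi> (x n))" by (auto simp: canon_dom_def real not_less)
    have "bounded (range x)" using xl convergent_imp_bounded by blast
    then obtain B where B: "\<And>n. norm (x n) \<le> B" by (auto simp: bounded_iff)
    obtain M where M: "\<And>z. z \<notin> E \<Longrightarrow> norm z \<le> B \<Longrightarrow> norm (\<Phi> z) \<le> M" using Phi_bounded by blast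
    define K where "K = Psi ` (cball 0 M - ball 0 r)"
    have "compact K" unfolding K_def
      by (intro compact_continuous_image continuous_on_subset[OF cont_Psi] compact_diff) (use r in auto)
    then have "closed K" by (rule compact_imp_closed)
    moreover have "x n \<in> K" for n
      unfolding K_def using xD M[OF xD(1)[of n] B] by (intro image_eqI[of _ _ "\<Phi> (x n)"]) (auto simp: not_less)
    ultimately have "l \<in> K" using xl unfolding closed_sequential_limits by blast
    then show "l \<in> - D \<rho>" unfolding K_def using r Psi_notin by (auto simp: canon_dom_def real)
  qed
  then show ?thesis by (simp add: closed_def)
next
  case PInf then show ?thesis by (simp add: D_infty)
next
  case MInf assume "1 < \<rho>" then show ?thesis using MInf by simp
qed

text \<open>The part outside \<open>E\<close> is the image \<open>A\<close> of an annulus and hence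
  connected. The piece of a separation that misses \<open>A\<close> lies in \<open>E\<close> and
  would be a nonempty bounded set, both open and closed in the plane.\<close>

lemma connected_D:
  assumes "1 < \<rho>" shows "connected (D \<rho>)"
proof (rule ccontr)
  assume "\<not> connected (D \<rho>)"
  then obtain U V where UV: "open U" "open V" "U \<inter> D \<rho> \<noteq> {}" "V \<inter> D \<rho> \<noteq> {}"
     "U \<inter> V \<inter> D \<rho> = {}" "D \<rho> \<subseteq> U \<union> V" by (auto simp: connected_def)
  define A where "A = Psi ` {w. 1 < norm w \<and> ereal (norm w) < \<rho>}"
  have con: "connected {w::complex. 1 < norm w \<and> ereal (norm w) < \<rho>}"
  proof -
    have "is_interval {x::real. 1 < x \<and> ereal x < \<rho>}"
      unfolding is_interval_1 by (auto intro: le_less_trans[of "ereal _" "ereal _"])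
    then have "connected ((\<lambda>(x, t). of_real x * cis t) ` ({x::real. 1 < x \<and> ereal x < \<rho>} \<times> UNIV))"
      by (intro connected_continuous_image connected_Times is_interval_connected)
        (auto simp: case_prod_beta intro!: continuous_intros)
    moreover have "(\<lambda>(x, t). of_real x * cis t) ` ({x::real. 1 < x \<and> ereal x < \<rho>} \<times> UNIV)
        = {w. 1 < norm w \<and> ereal (norm w) < \<rho>}"
    proof (intro equalityI subsetI)
      fix w :: complex assume "w \<in> {w. 1 < norm w \<and> ereal (norm w) < \<rho>}"
      then show "w \<in> (\<lambda>(x, t). of_real x * cis t) ` ({x::real. 1 < x \<and> ereal x < \<rho>} \<times> UNIV)"
        by (intro image_eqI[of _ _ "(norm w, Arg w)"]) (auto simp: rcis_cmod_Arg[unfolded rcis_def])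
    qed (auto simp: norm_mult)
    ultimately show ?thesis by simp
  qed
  have conA: "connected A" unfolding A_def
    by (intro connected_continuous_image continuous_on_subset[OF cont_Psi] con) auto
  have DA: "D \<rho> = E \<union> A"
  proof -
    have "z \<in> A" if "z \<notin> E" "ereal (norm (\<Phi> z)) < \<rho>" for z
      unfolding A_def using that norm_Phi[of z] by (intro image_eqI[of _ _ "\<Phi> z"]) auto
    then show ?thesis by (auto simp: canon_dom_def A_def Psi_notin)
  qed
  have main: False if UV: "open U" "open V" "V \<inter> D \<rho> \<noteq> {}" "U \<inter> V \<inter> D \<rho> = {}" "D \<rho> \<subseteq> U \<union> V" "A \<subseteq> U" for U V
  proof -
    define W where "W = V \<inter> D \<rho>"
    have W: "W \<subseteq> E" "W \<noteq> {}" using UV by (auto simp: W_def DA)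
    have "open W" unfolding W_def using UV open_D[OF assms] by auto
    moreover have "closed W"
    proof -
      have "W = E - U" using UV W by (auto simp: W_def DA)
      then show ?thesis using UV compact_imp_closed[OF compact_E] by auto
    qed
    ultimately have "W = UNIV" using W(2) clopen by blast
    then show False using W compact_imp_bounded[OF compact_E] bounded_subset not_bounded_UNIV by metis
  qed
  have "A \<subseteq> U \<or> A \<subseteq> V"
  proof (rule ccontr)
    assume "\<not> ?thesis"
    then have "U \<inter> A \<noteq> {}" "V \<inter> A \<noteq> {}" using UV DA by blast+
    moreover have "U \<inter> V \<inter> A = {}" "A \<subseteq> U \<union> V" using UV DA by blast+
    ultimately show False using connectedD[OF conA UV(1,2)] by blast
  qed
  then show False using main[of U V] main[of V U] UV by (metis inf_commute sup_commute)
qed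

lemma D_neighborhood:
  assumes "open U" "cD r \<subseteq> U" "1 \<le> r"
  obtains r' where "r < r'" "D (ereal r') \<subseteq> U"
proof -
  \<comment> \<open>Cutting at r + 1 makes the part outside \<open>U\<close> compact, so |\<Phi>|
    attains its minimum there; this minimum exceeds \<open>r\<close> and serves as the new
    index.\<close>
  define T where "T = cD (r+1) - U"
  have T: "compact T" "T \<subseteq> - E" using compact_diff[OF compact_cD assms(1)] assms(2) by (auto simp: T_def cD_def)
  show ?thesis
  proof (cases "T = {}")
    case True
    then have "D (ereal (r+1)) \<subseteq> U" using D_sub_cD[of "r+1"] by (auto simp: T_def)
    then show ?thesis using that[of "r+1"] by auto
  next
    case False
    have "continuous_on T (\<lambda>z. norm (\<Phi> z))" by (intro continuous_intros continuous_on_subset[OF cont_Phi] T)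
    then obtain x where x: "x \<in> T" "\<And>y. y \<in> T \<Longrightarrow> norm (\<Phi> x) \<le> norm (\<Phi> y)"
      using continuous_attains_inf[OF T(1) False] by blast
    have "r < norm (\<Phi> x)" using x(1) assms(2) by (force simp: T_def cD_def)
    moreover have "D (ereal (norm (\<Phi> x))) \<subseteq> U"
    proof
      fix z assume z: "z \<in> D (ereal (norm (\<Phi> x)))"
      have "norm (\<Phi> x) \<le> r + 1" using x(1) T by (auto simp: T_def cD_def)
      show "z \<in> U"
      proof (rule ccontr)
        assume "z \<notin> U"
        then have "z \<notin> E" using assms(2) by (auto simp: cD_def)
        then have "norm (\<Phi> z) < norm (\<Phi> x)" using z by (simp add: in_D)
        moreover have "z \<in> T" using \<open>z \<notin> U\<close> \<open>z \<notin> E\<close> calculation \<open>norm (\<Phi> x) \<le> r + 1\<close> by (auto simp: T_def cD_def)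
        ultimately show False using x(2)[of z] by simp
      qed
    qed
    ultimately show ?thesis using that by blast
  qed
qed

lemma E_neighborhood:
  assumes "open U" "E \<subseteq> U"
  obtains r where "1 < r" "D (ereal r) \<subseteq> U"
proof -
  have "cD 1 = E" using norm_Phi by (force simp: cD_def)
  then show ?thesis using D_neighborhood[OF assms(1), of 1] assms that by auto
qed

lemma closure_D: assumes "1 < r" shows "closure (D (ereal r)) = cD r"
proof
  show "closure (D (ereal r)) \<subseteq> cD r"
    by (rule closure_minimal[OF D_sub_cD]) (simp add: compact_imp_closed compact_cD)
  show "cD r \<subseteq> closure (D (ereal r))"
  proof
    fix z assume "z \<in> cD r"
    then consider "z \<in> D (ereal r)" | "z \<notin> E" "norm (\<Phi> z) = r" by (force simp: cD_def canon_dom_def)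
    then show "z \<in> closure (D (ereal r))"
    proof cases
      case 1 then show ?thesis using closure_subset by blast
    next
      case 2
      define w where "w = \<Phi> z"
      \<comment> \<open>The point is approached along its ray in the coordinate w: the factors lie
        between 1/r and 1, so the moduli lie between 1 and \<open>r\<close>.\<close>
      define x where "x n = Psi (of_real (1 - (1 - 1/r) / (real n + 2)) * w)" for n
      have *: "1 < norm (of_real (1 - (1 - 1/r) / (real n + 2)) * w)" "norm (of_real (1 - (1 - 1/r) / (real n + 2)) * w) < r" for n
      proof -
        define t where "t = (1 - 1/r) / (real n + 2)"
        have "0 < t" using assms by (simp add: t_def)
        moreover have "t < 1 - 1/r" unfolding t_def using mult_strict_left_mono[of 1 "real n + 2" "1 - 1/r"] assms by (simp add: divide_less_eq)
        ultimately have t: "0 < t" "1/r < 1 - t" by auto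
        then have "0 < 1 - t" using assms by (smt (verit) divide_pos_pos)
        then have "norm (of_real (1 - t) * w) = (1-t) * r" using 2 unfolding w_def norm_mult norm_of_real by simp
        moreover have "1 < (1-t)*r" "(1-t)*r < r" using t assms by (auto simp: field_simps)
        ultimately show "1 < norm (of_real (1 - (1 - 1/r) / (real n + 2)) * w)" "norm (of_real (1 - (1 - 1/r) / (real n + 2)) * w) < r"
          unfolding t_def[symmetric] by auto
      qed
      have "x n \<in> D (ereal r)" for n
        unfolding x_def using * Psi_notin by (simp add: in_D)
      moreover have "x \<longlonglongrightarrow> z"
      proof -
        have "(\<lambda>n. (1 - 1/r) / (real n + 2)) \<longlonglongrightarrow> 0" by real_asymp
        then have "(\<lambda>n. of_real (1 - (1 - 1/r) / (real n + 2)) * w) \<longlonglongrightarrow> of_real (1 - 0) * w" by (intro tendsto_intros)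
        moreover have "isCont Psi w" using continuous_on_eq_continuous_at[OF open_gt] cont_Psi 2 assms by (auto simp: w_def)
        ultimately have "x \<longlonglongrightarrow> Psi w" unfolding x_def by (intro isCont_tendsto_compose[of w Psi]) auto
        then show ?thesis using 2 by (simp add: w_def)
      qed
      ultimately show ?thesis unfolding closure_sequential by blast
    qed
  qed
qed

end

section \<open>Continuation and Faber coefficients\<close>

lemma holomorphic_on_Un_open:
  "f holomorphic_on S \<Longrightarrow> f holomorphic_on T \<Longrightarrow> open S \<Longrightarrow> open T \<Longrightarrow> f holomorphic_on S \<union> T"
  by (metis analytic_on_Un analytic_on_open open_Un)

lemma power_bounded_imp_summable:
  fixes a :: "nat \<Rightarrow> complex"
  assumes ev: "\<forall>\<^sub>F n in sequentially. norm (a n) \<le> B / y ^ n" and xy: "0 \<le> x" "x < y"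
  shows "summable (\<lambda>n. norm (a n) * x ^ n)"
proof (rule summable_comparison_test_ev)
  show "\<forall>\<^sub>F n in sequentially. norm (norm (a n) * x ^ n) \<le> B * (x / y) ^ n"
    using ev
  proof eventually_elim
    case (elim n)
    have "norm (a n) * x ^ n \<le> B / y ^ n * x ^ n" using elim xy by (intro mult_right_mono) auto
    then show ?case using xy by (simp add: power_divide)
  qed
  show "summable (\<lambda>n. B * (x / y) ^ n)" using xy by (intro summable_mult summable_geometric) auto
qed

lemma laurent_coeff_summable:
  assumes f: "f holomorphic_on {w. a < norm w \<and> ereal (norm w) < b}" and "0 \<le> a" "a < r" "ereal r < b"
    and x: "0 \<le> x" "ereal x < b"
  shows "summable (\<lambda>n. norm (laurent_coeff f r n) * x ^ n)"
proof -
  have "max (ereal r) (ereal x) < b" using assms by (cases "r \<le> x") (auto simp: max_def)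
  then obtain y where y: "max (ereal r) (ereal x) < ereal y" "ereal y < b" using ereal_dense2 by blast
  then have y': "r < y" "x < y" by (auto simp: max_def split: if_splits)
  have cf: "continuous_on (sphere 0 y) f"
    using y y' assms by (intro continuous_on_subset[OF holomorphic_on_imp_continuous_on[OF f]]) auto
  have "laurent_coeff f r n = laurent_coeff f y n" for n
  proof (rule laurent_coeff_radius[OF f open_annulus])
    fix w :: complex assume "r \<le> norm w" "norm w \<le> y"
    then have "ereal (norm w) < b" using y(2) by (auto intro: le_less_trans[of _ "ereal y"])
    then show "w \<in> {w. a < norm w \<and> ereal (norm w) < b}" using \<open>r \<le> norm w\<close> assms by auto
  qed (use assms y' in auto)
  moreover obtain B where "\<And>w. norm w = y \<Longrightarrow> norm (f w) \<le> B"
  proof -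
    have "compact (f ` sphere 0 y)" using cf by (intro compact_continuous_image) auto
    then obtain B where "\<forall>x\<in>f ` sphere 0 y. norm x \<le> B" using compact_imp_bounded bounded_iff by metis
    then show ?thesis using that[of B] by simp
  qed
  ultimately have "norm (laurent_coeff f r n) \<le> B / y ^ n" for n
    using laurent_coeff_bound[OF cf] y' x by auto
  then show ?thesis using x y' by (intro power_bounded_imp_summable[of _ B y]) auto
qed

context exterior
begin

text \<open>The working notion of continuation. It depends on the germ along \<open>E\<close> only,
  and statements about poles are reduced to it by multiplying with a polynomial first.\<close>

definition holo_ext :: "(complex \<Rightarrow> complex) \<Rightarrow> ereal \<Rightarrow> bool" where
  "holo_ext u R \<longleftrightarrow> (\<exists>g. g holomorphic_on D R \<and> same_germ E g u)"

lemma holo_comp_Psi: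
  assumes "g holomorphic_on D R"
  shows "(\<lambda>w. g (Psi w)) holomorphic_on {w. 1 < norm w \<and> ereal (norm w) < R}"
  by (rule holomorphic_on_compose_gen[OF holomorphic_on_subset[OF holo_Psi] assms, unfolded o_def])
    (auto simp: in_D Psi_notin)

lemma same_germ_refl: "same_germ E u u"
  by (auto simp: same_germ_def intro: exI[of _ UNIV])

lemma same_germ_sym: "same_germ E u v \<Longrightarrow> same_germ E v u"
  by (auto simp: same_germ_def)

lemma same_germ_trans: "same_germ E u v \<Longrightarrow> same_germ E v w \<Longrightarrow> same_germ E u w"
  unfolding same_germ_def
proof (elim exE conjE)
  fix V V' assume *: "open V" "E \<subseteq> V" "\<forall>z\<in>V. u z = v z" "open V'" "E \<subseteq> V'" "\<forall>z\<in>V'. v z = w z"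
  show "\<exists>V. open V \<and> E \<subseteq> V \<and> (\<forall>z\<in>V. u z = w z)" by (rule exI[of _ "V \<inter> V'"]) (use * in auto)
qed

lemma same_germ_combine:
  assumes "same_germ E u u'" "same_germ E v v'" "\<And>z. u z = u' z \<Longrightarrow> v z = v' z \<Longrightarrow> w z = w' z"
  shows "same_germ E w w'"
proof -
  obtain V V' where *: "open V" "E \<subseteq> V" "\<forall>z\<in>V. u z = u' z" "open V'" "E \<subseteq> V'" "\<forall>z\<in>V'. v z = v' z"
    using assms(1,2) unfolding same_germ_def by blast
  show ?thesis unfolding same_germ_def by (rule exI[of _ "V \<inter> V'"]) (use * assms(3) in auto)
qed

lemma same_germ_map:
  assumes "same_germ E u u'" "\<And>z. u z = u' z \<Longrightarrow> w z = w' z"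
  shows "same_germ E w w'"
  using same_germ_combine[OF assms(1) assms(1)] assms(2) by blast

lemma D_identity:
  assumes "1 < R" "f holomorphic_on D R" "g holomorphic_on D R" "same_germ E f g" "z \<in> D R"
  shows "f z = g z"
proof -
  obtain V where V: "open V" "E \<subseteq> V" "\<And>z. z \<in> V \<Longrightarrow> f z = g z" using assms(4) by (auto simp: same_germ_def)
  show ?thesis
    by (rule analytic_continuation_open[of "V \<inter> D R" "D R" f g])
      (use V E_ne E_sub_D[of R] assms open_D connected_D in auto)
qed

lemma holo_ext_mono: "holo_ext u R \<Longrightarrow> R' \<le> R \<Longrightarrow> holo_ext u R'"
  unfolding holo_ext_def using holomorphic_on_subset D_mono by blast

lemma analytic_holo_ext:
  assumes "u analytic_on E"
  obtains r where "1 < r" "u holomorphic_on D (ereal r)"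
proof -
  obtain U where "open U" "E \<subseteq> U" "u holomorphic_on U" using assms by (auto simp: analytic_on_holomorphic)
  then show ?thesis using E_neighborhood[of U] that holomorphic_on_subset by metis
qed

text \<open>The converse of Cauchy's estimate. Away from \<open>E\<close> the function is rewritten
  as power series plus principal part, both composed with \<Phi>; the series converges up to
  \<open>R\<close>, and the principal part \<open>h\<close> is holomorphic on the whole exterior of
  the circle.\<close>

theorem extension:
  assumes g: "g holomorphic_on D (ereal \<rho>)" and r: "1 < r" "r < \<rho>" and R: "1 < R"
    and S: "\<And>x. 0 \<le> x \<Longrightarrow> ereal x < R \<Longrightarrow> summable (\<lambda>n. norm (laurent_coeff (\<lambda>w. g (Psi w)) r n) * x ^ n)"
  shows "holo_ext g R"
proof (cases "R \<le> ereal \<rho>")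
  case True
  then show ?thesis using g holo_ext_mono[of g "ereal \<rho>"] same_germ_refl by (auto simp: holo_ext_def)
next
  case False
  then have R\<rho>: "ereal \<rho> < R" by simp
  define a where "a = laurent_coeff (\<lambda>w. g (Psi w)) r"
  obtain h where h: "h holomorphic_on {w. r < norm w}"
    and hs: "\<And>w. r < norm w \<Longrightarrow> ereal (norm w) < ereal \<rho> \<Longrightarrow> (\<lambda>n. a n * w ^ n) sums (g (Psi w) - h w)"
    using laurent_decomposition[OF holo_comp_Psi[OF g], of r] r unfolding a_def by auto
  define A where "A w = (\<Sum>n. a n * w ^ n)" for w
  have sumA: "(\<lambda>n. a n * w ^ n) sums A w" if "ereal (norm w) < R" for w
  proof -
    have "summable (\<lambda>n. norm (a n * w ^ n))" using S[of "norm w"] that by (simp add: norm_mult norm_power a_def)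
    then show ?thesis unfolding A_def by (intro summable_sums) (rule summable_norm_cancel)
  qed
  have openR: "open {w::complex. ereal (norm w) < R}" by (intro open_Collect_less continuous_intros continuous_on_ereal)
  have holA: "A holomorphic_on {w. ereal (norm w) < R}"
    unfolding holomorphic_on_open[OF openR]
  proof (intro ballI)
    fix w :: complex assume "w \<in> {w. ereal (norm w) < R}"
    then obtain y where y: "norm w < y" "ereal y < R" using ereal_dense2[of "ereal (norm w)" R] by auto
    have "A holomorphic_on ball 0 y"
    proof (rule power_series_holomorphic)
      fix v :: complex assume "v \<in> ball 0 y"
      then have "ereal (norm v) < ereal y" by simp
      then have "ereal (norm v) < R" using y by (meson less_trans)
      then show "(\<lambda>n. a n * (v - 0) ^ n) sums A v" using sumA by simp
    qed
    then show "\<exists>f'. (A has_field_derivative f') (at w)" using y by (subst (asm) holomorphic_on_open) auto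
  qed
  \<comment> \<open>The seam is put strictly between \<open>r\<close> and \<rho>, where both
    formulas hold, so that \<open>G\<close> is given by one formula on each of two overlapping open
    sets.\<close>
  define r1 where "r1 = (r + \<rho>) / 2"
  have r1: "r < r1" "r1 < \<rho>" using r by (auto simp: r1_def)
  define G where "G z = (if z \<in> cD r1 then g z else A (\<Phi> z) + h (\<Phi> z))" for z
  have G1: "G z = g z" if "z \<in> D (ereal \<rho>)" for z
  proof (cases "z \<in> cD r1")
    case False
    then have z: "z \<notin> E" "r1 < norm (\<Phi> z)" by (auto simp: cD_def)
    then have n: "norm (\<Phi> z) < \<rho>" using that by (simp add: in_D)
    then have "ereal (norm (\<Phi> z)) < R" using R\<rho> by (auto intro: less_trans[of _ "ereal \<rho>"])
    then have "A (\<Phi> z) = g (Psi (\<Phi> z)) - h (\<Phi> z)"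
      using sums_unique2[OF sumA hs] z r1 n by auto
    then show ?thesis using False z by (simp add: G_def)
  qed (simp add: G_def)
  let ?B = "{z \<in> - E. \<Phi> z \<in> {w. r < norm w \<and> ereal (norm w) < R}}"
  have openB: "open ?B"
    using continuous_open_preimage[OF cont_Phi open_compl_E open_annulus[of r R]] by (simp add: vimage_def Int_def)
  have G2: "G z = A (\<Phi> z) + h (\<Phi> z)" if z: "z \<in> ?B" for z
  proof (cases "z \<in> cD r1")
    case True
    then have n: "norm (\<Phi> z) < \<rho>" using z r1 by (auto simp: cD_def)
    then have "A (\<Phi> z) = g (Psi (\<Phi> z)) - h (\<Phi> z)"
      using sums_unique2[OF sumA hs, of "\<Phi> z"] z n by auto
    then show ?thesis using True z by (simp add: G_def)
  qed (simp add: G_def)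
  have "G holomorphic_on D (ereal \<rho>) \<union> ?B"
  proof (rule holomorphic_on_Un_open)
    show "G holomorphic_on D (ereal \<rho>)" by (rule holomorphic_transform[OF g]) (use G1 in auto)
    have "(\<lambda>z. A (\<Phi> z) + h (\<Phi> z)) holomorphic_on ?B"
      by (intro holomorphic_intros holomorphic_on_compose_gen[OF holomorphic_on_subset[OF holo_Phi] holA, unfolded o_def]
        holomorphic_on_compose_gen[OF holomorphic_on_subset[OF holo_Phi] h, unfolded o_def]) auto
    then show "G holomorphic_on ?B" by (rule holomorphic_transform) (use G2 in auto)
  qed (use openB open_D r in auto)
  moreover have "D R \<subseteq> D (ereal \<rho>) \<union> ?B"
    using r by (auto simp: canon_dom_def)
  ultimately have "G holomorphic_on D R" using holomorphic_on_subset by blast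
  moreover have "same_germ E G g"
    unfolding same_germ_def using G1 E_sub_D open_D[of "ereal \<rho>"] r by (intro exI[of _ "D (ereal \<rho>)"]) auto
  ultimately show ?thesis by (auto simp: holo_ext_def)
qed

section \<open>Meromorphic continuation and the index of holomorphic continuation\<close>

lemma mero_germ_eq:
  assumes R: "1 < R" and g: "g1 meromorphic_on D R" "g2 meromorphic_on D R" and s: "same_germ E g1 g2" and z: "z \<in> D R"
  shows "\<forall>\<^sub>F w in at z. g1 w = g2 w" "remove_sings g1 z = remove_sings g2 z"
proof -
  define f where "f w = g1 w - g2 w" for w
  have fm: "f meromorphic_on D R" unfolding f_def by (intro meromorphic_intros g)
  obtain V where V: "open V" "E \<subseteq> V" "\<And>z. z \<in> V \<Longrightarrow> g1 z = g2 z" using s by (auto simp: same_germ_def)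
  obtain e where e: "e \<in> E" using E_ne by auto
  have ev: "\<forall>\<^sub>F w in at x. f w = 0" if "x \<in> V" for x
    using eventually_at_in_open'[OF V(1) that] by eventually_elim (simp add: f_def V)
  have "\<forall>\<^sub>F x in at e. remove_sings f x = 0"
  proof -
    have "\<forall>\<^sub>F x in at e. x \<in> V" using eventually_at_in_open'[OF V(1)] e V by auto
    then show ?thesis
      by eventually_elim (use ev in \<open>auto intro!: remove_sings_eqI tendsto_eventually\<close>)
  qed
  then have "frequently (\<lambda>x. remove_sings f x = 0) (at e)"
    by (rule eventually_frequently[OF trivial_limit_at])
  then have zero: "remove_sings f w = 0" if "w \<in> D R" for w
    using frequently_eq_meromorphic_imp_constant[OF _ remove_sings_nicely_meromorphic[OF fm] open_D[OF R] connected_D[OF R]] e E_sub_D that by blast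
  have "isolated_singularity_at f z" using fm z meromorphic_on_isolated_singularity meromorphic_on_subset by blast
  then have "\<forall>\<^sub>F w in at z. remove_sings f w = f w" by (rule eventually_remove_sings_eq_at)
  moreover have "\<forall>\<^sub>F w in at z. w \<in> D R" using eventually_at_in_open'[OF open_D[OF R] z] .
  ultimately show ev2: "\<forall>\<^sub>F w in at z. g1 w = g2 w"
    by eventually_elim (use zero in \<open>auto simp: f_def\<close>)
  then show "remove_sings g1 z = remove_sings g2 z" by (rule remove_sings_cong) simp
qed

lemma mero_ext_props:
  assumes R: "1 < R" and g: "g meromorphic_on D R" "same_germ E g u"
  shows "mero_ext E \<Phi> R u meromorphic_on D R"
    "z \<in> D R \<Longrightarrow> \<forall>\<^sub>F w in at z. mero_ext E \<Phi> R u w = g w"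
    "z \<in> D R \<Longrightarrow> mero_ext E \<Phi> R u z = remove_sings g z"
proof -
  define g0 where "g0 = (SOME g. continues E \<Phi> R u g)"
  have "continues E \<Phi> R u g" using g by (simp add: continues_def)
  then have "continues E \<Phi> R u g0" unfolding g0_def by (rule someI[of "continues E \<Phi> R u"])
  then have g0: "g0 meromorphic_on D R" "same_germ E g0 u" by (auto simp: continues_def)
  have m: "mero_ext E \<Phi> R u = remove_sings g0" by (simp add: mero_ext_def g0_def)
  show "mero_ext E \<Phi> R u meromorphic_on D R" unfolding m by (intro remove_sings_meromorphic g0)
  have s: "same_germ E g0 g" using g0 g same_germ_trans same_germ_sym by blast
  assume z: "z \<in> D R"
  show "mero_ext E \<Phi> R u z = remove_sings g z" unfolding m by (rule mero_germ_eq(2)[OF R g0(1) g(1) s z])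
  have "isolated_singularity_at g0 z" using g0 z meromorphic_on_isolated_singularity meromorphic_on_subset by blast
  then have "\<forall>\<^sub>F w in at z. remove_sings g0 w = g0 w" by (rule eventually_remove_sings_eq_at)
  then show "\<forall>\<^sub>F w in at z. mero_ext E \<Phi> R u w = g w"
    using mero_germ_eq(1)[OF R g0(1) g(1) s z] unfolding m by eventually_elim simp
qed

lemma holo_mero: "g holomorphic_on D R \<Longrightarrow> 1 < R \<Longrightarrow> g meromorphic_on D R"
  using analytic_on_imp_meromorphic_on analytic_on_open open_D by blast

lemma mero_ext_holo:
  assumes "1 < R" "g holomorphic_on D R" "same_germ E g u" "z \<in> D R"
  shows "mero_ext E \<Phi> R u z = g z"
proof -
  have "g analytic_on {z}" using assms open_D analytic_at by blast
  then show ?thesis using mero_ext_props(3)[OF assms(1) holo_mero[OF assms(2,1)] assms(3,4)] by simp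
qed

lemma pole_order_pos:
  assumes "g meromorphic_on A" "z \<in> A" "is_pole g z"
  shows "1 \<le> pole_order g z"
proof -
  have "isolated_singularity_at g z" using assms meromorphic_on_isolated_singularity meromorphic_on_subset by blast
  then have "zorder g z < 0" using isolated_pole_imp_neg_zorder assms by blast
  then show ?thesis by (simp add: pole_order_def)
qed

text \<open>This ties \<open>mero_index\<close> with no poles allowed to \<open>holo_ext\<close>:
  removable singularities are filled by \<open>remove_sings\<close>, which changes nothing near
  \<open>E\<close>, where the germ is already analytic.\<close>

lemma holo_ext_iff_mero:
  assumes u: "u analytic_on E" and R: "1 < R"
  shows "holo_ext u R \<longleftrightarrow> (\<exists>g. continues E \<Phi> R u g \<and> poles_at_most g (D R) 0)"
proof
  assume "holo_ext u R"
  then obtain g where g: "g holomorphic_on D R" "same_germ E g u" by (auto simp: holo_ext_def)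
  have e: "{z \<in> D R. is_pole g z} = {}" using not_is_pole_holomorphic[OF open_D[OF R] _ g(1)] by auto
  have "poles_at_most g (D R) 0" unfolding poles_at_most_def e by simp
  then show "\<exists>g. continues E \<Phi> R u g \<and> poles_at_most g (D R) 0"
    using g holo_mero[OF g(1) R] by (intro exI[of _ g]) (simp add: continues_def)
next
  assume "\<exists>g. continues E \<Phi> R u g \<and> poles_at_most g (D R) 0"
  then obtain g where g: "g meromorphic_on D R" "same_germ E g u" "finite {z\<in>D R. is_pole g z}"
     "(\<Sum>z | z \<in> D R \<and> is_pole g z. pole_order g z) = 0" by (auto simp: continues_def poles_at_most_def)
  have np: "\<not> is_pole g z" if "z \<in> D R" for z
    using g(3,4) pole_order_pos[OF g(1) that] that by auto
  have "\<not> is_pole (remove_sings g) z" if z: "z \<in> D R" for z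
  proof -
    have "isolated_singularity_at g z" using g z meromorphic_on_isolated_singularity meromorphic_on_subset by blast
    then have "\<forall>\<^sub>F w in at z. remove_sings g w = g w" by (rule eventually_remove_sings_eq_at)
    then show ?thesis using np[OF z] is_pole_cong by blast
  qed
  then have "remove_sings g analytic_on D R"
    using nicely_meromorphic_without_singularities[OF remove_sings_nicely_meromorphic[OF g(1)]] by blast
  then have "remove_sings g holomorphic_on D R" by (rule analytic_imp_holomorphic)
  moreover have "same_germ E (remove_sings g) u"
  proof -
    obtain r where r: "1 < r" "u holomorphic_on D (ereal r)" using analytic_holo_ext[OF u] .
    obtain V where V: "open V" "E \<subseteq> V" "\<And>z. z \<in> V \<Longrightarrow> g z = u z" using g(2) by (auto simp: same_germ_def)
    define W where "W = V \<inter> D (ereal r)"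
    have W: "open W" "E \<subseteq> W" using V open_D r E_sub_D by (auto simp: W_def)
    have "g holomorphic_on W"
      by (rule holomorphic_transform[OF holomorphic_on_subset[OF r(2)]]) (use V in \<open>auto simp: W_def\<close>)
    then have "remove_sings g z = u z" if "z \<in> W" for z
      using W that V analytic_at[of g z] by (auto simp: W_def)
    then show ?thesis using W by (auto simp: same_germ_def)
  qed
  ultimately show "holo_ext u R" by (auto simp: holo_ext_def)
qed

text \<open>Instead of gluing the extensions to the smaller domains, their coefficients are used:
  each extension gives summability at smaller radii, the coefficients are always those of
  \<open>u\<close>, and a single application of \<open>extension\<close> yields a function on all of
  \<open>D R\<close>.\<close>

lemma holo_ext_sup:
  assumes u: "u analytic_on E" and R: "1 < R" and h: "\<And>\<rho>. 1 < \<rho> \<Longrightarrow> \<rho> < R \<Longrightarrow> holo_ext u \<rho>"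
  shows "holo_ext u R"
proof -
  obtain r0 where r0: "1 < r0" "u holomorphic_on D (ereal r0)" using analytic_holo_ext[OF u] .
  have "1 < min R (ereal r0)" using R r0 by auto
  then obtain r1 where r1: "1 < ereal r1" "ereal r1 < min R (ereal r0)" using ereal_dense2 by blast
  show ?thesis
  proof (rule extension[OF r0(2), of r1])
    fix x assume x: "0 \<le> x" "ereal x < R"
    then have "max (ereal x) (ereal r1) < R" using r1 by (auto simp: max_def)
    then obtain \<rho> where \<rho>: "max (ereal x) (ereal r1) < ereal \<rho>" "ereal \<rho> < R" using ereal_dense2 by blast
    then have \<rho>': "x < \<rho>" "r1 < \<rho>" "1 < \<rho>" using r1 by (auto simp: max_def split: if_splits)
    obtain g where g: "g holomorphic_on D (ereal \<rho>)" "same_germ E g u" using h[of "ereal \<rho>"] \<rho> \<rho>' by (auto simp: holo_ext_def)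
    let ?m = "min \<rho> r0"
    have eq: "g z = u z" if "z \<in> D (ereal ?m)" for z
      by (rule D_identity[OF _ holomorphic_on_subset[OF g(1)] holomorphic_on_subset[OF r0(2)] g(2) that])
        (use D_mono \<rho>' r0 in auto)
    have "laurent_coeff (\<lambda>w. u (Psi w)) r1 n = laurent_coeff (\<lambda>w. g (Psi w)) r1 n" for n
    proof (rule laurent_coeff_cong)
      fix w :: complex assume w: "norm w = r1"
      then have "Psi w \<in> D (ereal ?m)" using r1 \<rho>' by (simp add: in_D Psi_notin)
      then show "u (Psi w) = g (Psi w)" using eq by simp
    qed (use r1 in auto)
    then show "summable (\<lambda>n. norm (laurent_coeff (\<lambda>w. u (Psi w)) r1 n) * x ^ n)"
      using laurent_coeff_summable[OF holo_comp_Psi[OF g(1)], of r1 x] r1 \<rho>' x by auto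
  qed (use r1 R in auto)
qed

lemma mero_index_holo_ext:
  assumes u: "u analytic_on E"
  shows "holo_ext u (mero_index E \<Phi> 0 u)" "1 < mero_index E \<Phi> 0 u" "1 < R \<Longrightarrow> holo_ext u R \<Longrightarrow> R \<le> mero_index E \<Phi> 0 u"
proof -
  have eq: "mero_index E \<Phi> 0 u = Sup {\<rho>. 1 < \<rho> \<and> holo_ext u \<rho>}"
    unfolding mero_index_def by (intro arg_cong[where f = Sup] Collect_cong conj_cong refl) (simp add: holo_ext_iff_mero[OF u])
  show le: "1 < R \<Longrightarrow> holo_ext u R \<Longrightarrow> R \<le> mero_index E \<Phi> 0 u" for R
    unfolding eq by (intro Sup_upper) auto
  obtain r where r: "1 < r" "u holomorphic_on D (ereal r)" using analytic_holo_ext[OF u] .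
  then have "ereal r \<le> mero_index E \<Phi> 0 u" by (intro le) (auto simp: holo_ext_def intro: same_germ_refl)
  then show gt: "1 < mero_index E \<Phi> 0 u" using r by (auto intro: less_le_trans[of _ "ereal r"])
  show "holo_ext u (mero_index E \<Phi> 0 u)"
  proof (rule holo_ext_sup[OF u gt])
    fix \<rho> assume "\<rho> < mero_index E \<Phi> 0 u"
    then obtain \<rho>' where "\<rho> < \<rho>'" "holo_ext u \<rho>'" unfolding eq less_Sup_iff by auto
    then show "holo_ext u \<rho>" using holo_ext_mono[of u \<rho>' \<rho>] by auto
  qed
qed

text \<open>Substituting \<open>Psi w\<close> cancels the factor \<open>deriv \<Phi>\<close> and
  turns the integral over the level curve into a Laurent coefficient. Its independence of the radius
  shows that the definite description denotes something; an admissible radius exists because the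
  index exceeds 1.\<close>

theorem faber_coeff_eq:
  assumes u: "u analytic_on E" and g: "g holomorphic_on D R" "same_germ E g u" and r: "1 < r" "ereal r < R"
  shows "faber_coeff E \<Phi> u n = laurent_coeff (\<lambda>w. g (Psi w)) r n"
proof -
  define R0 where "R0 = mero_index E \<Phi> 0 u"
  have R: "1 < R" using r by (auto intro: less_trans[of _ "ereal r"])
  have R0: "1 < R0" "R \<le> R0" using mero_index_holo_ext(2,3)[OF u] R g by (auto simp: R0_def holo_ext_def)
  obtain G where G: "G holomorphic_on D R0" "same_germ E G u"
    using mero_index_holo_ext(1)[OF u] by (auto simp: holo_ext_def R0_def)
  have Gg: "G z = g z" if "z \<in> D R" for z
  proof (rule D_identity[OF R _ g(1) _ that])
    show "G holomorphic_on D R" using G(1) D_mono[OF R0(2)] holomorphic_on_subset by blast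
    show "same_germ E G g" using G g same_germ_trans same_germ_sym by blast
  qed
  have int: "1 / (2 * of_real pi * \<i>) * contour_integral (level_path E \<Phi> \<rho>)
      (\<lambda>t. mero_ext E \<Phi> R0 u t * deriv \<Phi> t / \<Phi> t ^ (n + 1)) = laurent_coeff (\<lambda>w. G (Psi w)) r n"
    if \<rho>: "1 < \<rho>" "ereal \<rho> < R0" for \<rho> :: real
  proof -
    have "contour_integral (level_path E \<Phi> \<rho>) (\<lambda>t. mero_ext E \<Phi> R0 u t * deriv \<Phi> t / \<Phi> t ^ (n + 1))
      = contour_integral (circlepath 0 \<rho>) (\<lambda>w. deriv Psi w * (mero_ext E \<Phi> R0 u (Psi w) * deriv \<Phi> (Psi w) / \<Phi> (Psi w) ^ (n + 1)))"
      unfolding level_path_def Psi_def[symmetric]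
      by (rule contour_integral_comp_analyticW[of _ "{w. 1 < norm w}"])
        (use holo_Psi \<rho> in \<open>auto simp: analytic_on_open open_gt\<close>)
    also have "\<dots> = contour_integral (circlepath 0 \<rho>) (\<lambda>w. G (Psi w) / w ^ (n + 1))"
    proof (rule contour_integral_cong)
      fix w assume "w \<in> path_image (circlepath 0 \<rho>)"
      then have w: "norm w = \<rho>" using \<rho> by simp
      then have "mero_ext E \<Phi> R0 u (Psi w) = G (Psi w)"
        using \<rho> by (intro mero_ext_holo[OF R0(1) G]) (simp add: in_D Psi_notin)
      moreover have "deriv Psi w * deriv \<Phi> (Psi w) = 1" using deriv_Psi[of w] w \<rho> by (simp add: mult.commute)
      moreover have "\<Phi> (Psi w) = w" using w \<rho> by simp
      moreover have "deriv Psi w * (mero_ext E \<Phi> R0 u (Psi w) * deriv \<Phi> (Psi w) / \<Phi> (Psi w) ^ (n + 1))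
         = (deriv Psi w * deriv \<Phi> (Psi w)) * (mero_ext E \<Phi> R0 u (Psi w) / \<Phi> (Psi w) ^ (n + 1))" by simp
      ultimately show "deriv Psi w * (mero_ext E \<Phi> R0 u (Psi w) * deriv \<Phi> (Psi w) / \<Phi> (Psi w) ^ (n + 1)) = G (Psi w) / w ^ (n + 1)"
        by simp
    qed simp
    finally have "1 / (2 * of_real pi * \<i>) * contour_integral (level_path E \<Phi> \<rho>)
      (\<lambda>t. mero_ext E \<Phi> R0 u t * deriv \<Phi> t / \<Phi> t ^ (n + 1)) = laurent_coeff (\<lambda>w. G (Psi w)) \<rho> n" by (simp add: laurent_coeff_def)
    also have "\<dots> = laurent_coeff (\<lambda>w. G (Psi w)) r n"
    proof -
      have *: "laurent_coeff (\<lambda>w. G (Psi w)) x n = laurent_coeff (\<lambda>w. G (Psi w)) y n" if "1 < x" "x \<le> y" "ereal y < R0" for x y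
      proof (rule laurent_coeff_radius[OF holo_comp_Psi[OF G(1)] open_annulus])
        fix w :: complex assume "x \<le> norm w" "norm w \<le> y"
        then show "w \<in> {w. 1 < norm w \<and> ereal (norm w) < R0}" using that by (auto intro: le_less_trans[of _ "ereal y"])
      qed (use that in auto)
      have rR0: "ereal r < R0" using r(2) R0(2) by (rule less_le_trans)
      show ?thesis
      proof (cases "\<rho> \<le> r")
        case True then show ?thesis by (rule *[OF \<rho>(1) _ rR0])
      next
        case False then show ?thesis by (intro *[OF r(1) _ \<rho>(2), symmetric]) simp
      qed
    qed
    finally show ?thesis .
  qed
  have "faber_coeff E \<Phi> u n = laurent_coeff (\<lambda>w. G (Psi w)) r n"
    unfolding faber_coeff_def R0_def[symmetric]
  proof (rule the_equality)
    show "\<forall>\<rho>. 1 < \<rho> \<and> ereal \<rho> < R0 \<longrightarrow> laurent_coeff (\<lambda>w. G (Psi w)) r n = 1 / (2 * of_real pi * \<i>) * contour_integral (level_path E \<Phi> \<rho>)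
      (\<lambda>t. mero_ext E \<Phi> R0 u t * deriv \<Phi> t / \<Phi> t ^ (n + 1))"
      by (intro allI impI int[symmetric]) (erule conjunct1, erule conjunct2)
    fix c assume "\<forall>\<rho>. 1 < \<rho> \<and> ereal \<rho> < R0 \<longrightarrow> c = 1 / (2 * of_real pi * \<i>) * contour_integral (level_path E \<Phi> \<rho>)
      (\<lambda>t. mero_ext E \<Phi> R0 u t * deriv \<Phi> t / \<Phi> t ^ (n + 1))"
    moreover have "ereal r < R0" using r(2) R0(2) by (rule less_le_trans)
    ultimately show "c = laurent_coeff (\<lambda>w. G (Psi w)) r n" using r(1) int[of r] by simp
  qed
  also have "\<dots> = laurent_coeff (\<lambda>w. g (Psi w)) r n"
    by (rule laurent_coeff_cong) (use Gg r in \<open>auto simp: in_D Psi_notin\<close>)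
  finally show ?thesis .
qed

section \<open>Linearity and decay of the Faber coefficients\<close>

abbreviation "fc \<equiv> faber_coeff E \<Phi>"

lemma fc_eq:
  assumes "u analytic_on E"
  obtains r where "1 < r" "u holomorphic_on D (ereal r)"
    "\<And>x n. 1 < x \<Longrightarrow> x < r \<Longrightarrow> fc u n = laurent_coeff (\<lambda>w. u (Psi w)) x n"
proof -
  obtain r where r: "1 < r" "u holomorphic_on D (ereal r)" using analytic_holo_ext[OF assms] .
  show ?thesis using that[OF r] faber_coeff_eq[OF assms r(2) same_germ_refl] by auto
qed

lemma cont_comp_Psi: "u holomorphic_on D (ereal r) \<Longrightarrow> 1 < x \<Longrightarrow> x < r \<Longrightarrow> continuous_on (sphere 0 x) (\<lambda>w. u (Psi w))"
  by (rule continuous_on_subset[OF holomorphic_on_imp_continuous_on[OF holo_comp_Psi]]) auto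

lemma fc_add:
  assumes "u analytic_on E" "v analytic_on E"
  shows "fc (\<lambda>z. u z + v z) n = fc u n + fc v n"
proof -
  obtain r where r: "1 < r" "u holomorphic_on D (ereal r)"
    "\<And>x n. 1 < x \<Longrightarrow> x < r \<Longrightarrow> fc u n = laurent_coeff (\<lambda>w. u (Psi w)) x n" using fc_eq[OF assms(1)] by blast
  obtain r' where r': "1 < r'" "v holomorphic_on D (ereal r')"
    "\<And>x n. 1 < x \<Longrightarrow> x < r' \<Longrightarrow> fc v n = laurent_coeff (\<lambda>w. v (Psi w)) x n" using fc_eq[OF assms(2)] by blast
  obtain r'' where r'': "1 < r''"
    "\<And>x n. 1 < x \<Longrightarrow> x < r'' \<Longrightarrow> fc (\<lambda>z. u z + v z) n = laurent_coeff (\<lambda>w. u (Psi w) + v (Psi w)) x n"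
    using fc_eq[OF analytic_on_add[OF assms]] by metis
  obtain x where x: "1 < x" "x < min r (min r' r'')" using dense[of 1 "min r (min r' r'')"] r r' r'' by auto
  show ?thesis using x r(3)[of x] r'(3)[of x] r''(2)[of x] laurent_coeff_add[OF cont_comp_Psi[OF r(2)] cont_comp_Psi[OF r'(2)], of x] by auto
qed

lemma fc_cmult:
  assumes "u analytic_on E"
  shows "fc (\<lambda>z. c * u z) n = c * fc u n"
proof -
  obtain r where r: "1 < r" "u holomorphic_on D (ereal r)"
    "\<And>x n. 1 < x \<Longrightarrow> x < r \<Longrightarrow> fc u n = laurent_coeff (\<lambda>w. u (Psi w)) x n" using fc_eq[OF assms(1)] by blast
  obtain r'' where r'': "1 < r''"
    "\<And>x n. 1 < x \<Longrightarrow> x < r'' \<Longrightarrow> fc (\<lambda>z. c * u z) n = laurent_coeff (\<lambda>w. c * u (Psi w)) x n"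
    using fc_eq[OF analytic_on_mult[OF analytic_on_const assms]] by metis
  obtain x where x: "1 < x" "x < min r r''" using dense[of 1 "min r r''"] r r'' by auto
  show ?thesis using x r(3)[of x] r''(2)[of x] laurent_coeff_cmult[OF cont_comp_Psi[OF r(2)], of x] by auto
qed

lemma fc_0: "fc (\<lambda>z. 0) n = 0"
  using fc_cmult[OF analytic_on_const, of 0 0 n] by simp

lemma fc_diff:
  assumes "u analytic_on E" "v analytic_on E"
  shows "fc (\<lambda>z. u z - v z) n = fc u n - fc v n"
  using fc_add[OF assms(1) analytic_on_mult[OF analytic_on_const[of "-1"] assms(2)], of n] fc_cmult[OF assms(2), of "-1" n] by simp

lemma fc_sum:
  assumes "\<And>i. i \<in> I \<Longrightarrow> u i analytic_on E"
  shows "fc (\<lambda>z. \<Sum>i\<in>I. c i * u i z) n = (\<Sum>i\<in>I. c i * fc (u i) n)"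
  using assms
proof (induction I rule: infinite_finite_induct)
  case (insert i I)
  have "fc (\<lambda>z. c i * u i z + (\<Sum>i\<in>I. c i * u i z)) n = fc (\<lambda>z. c i * u i z) n + fc (\<lambda>z. \<Sum>i\<in>I. c i * u i z) n"
    using insert by (intro fc_add analytic_intros) auto
  then show ?case using insert by (simp add: fc_cmult)
qed (auto simp: fc_0)

lemma fc_germ:
  assumes "u analytic_on E" "v analytic_on E" "same_germ E u v"
  shows "fc u n = fc v n"
proof -
  obtain r where r: "1 < r" "u holomorphic_on D (ereal r)" using analytic_holo_ext[OF assms(1)] .
  obtain x where x: "1 < x" "x < r" using dense r by blast
  show ?thesis using faber_coeff_eq[OF assms(1) r(2) same_germ_refl, of x] faber_coeff_eq[OF assms(2) r(2) assms(3), of x] x by simp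
qed

lemma fc_bound:
  assumes u: "u analytic_on E" and h: "holo_ext u R" and r: "1 < r" "ereal r < R"
  obtains B where "B > 0" "\<And>n. norm (fc u n) \<le> B / r ^ n"
proof -
  obtain g where g: "g holomorphic_on D R" "same_germ E g u" using h by (auto simp: holo_ext_def)
  have c: "continuous_on (sphere 0 r) (\<lambda>w. g (Psi w))"
    using r by (intro continuous_on_subset[OF holomorphic_on_imp_continuous_on[OF holo_comp_Psi[OF g(1)]]]) auto
  have "compact ((\<lambda>w. g (Psi w)) ` sphere 0 r)" using c by (intro compact_continuous_image) auto
  then obtain B where B: "\<forall>x\<in>(\<lambda>w. g (Psi w)) ` sphere 0 r. norm x \<le> B" using compact_imp_bounded bounded_iff by metis
  have "norm (fc u n) \<le> max B 1 / r ^ n" for n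
    unfolding faber_coeff_eq[OF u g r] by (rule laurent_coeff_bound[OF c]) (use r B in \<open>auto simp: le_max_iff_disj\<close>)
  then show ?thesis using that[of "max B 1"] by auto
qed

text \<open>The form of Cauchy-Hadamard used below. The constant may depend on \<open>x\<close>, so
  a bound that degenerates at the limiting radius does no harm.\<close>

lemma holo_ext_if_fc_bound:
  assumes u: "u analytic_on E" and R: "1 < R"
    and b: "\<And>x. 1 < x \<Longrightarrow> ereal x < R \<Longrightarrow> \<exists>B. \<forall>\<^sub>F n in sequentially. norm (fc u n) \<le> B / x ^ n"
  shows "holo_ext u R"
proof -
  obtain r where r: "1 < r" "u holomorphic_on D (ereal r)"
    "\<And>x n. 1 < x \<Longrightarrow> x < r \<Longrightarrow> fc u n = laurent_coeff (\<lambda>w. u (Psi w)) x n" using fc_eq[OF u] by blast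
  obtain r1 where r1: "1 < r1" "r1 < r" using dense r by blast
  show ?thesis
  proof (rule extension[OF r(2) r1 R])
    fix x assume x: "0 \<le> x" "ereal x < R"
    then have "max (ereal x) 1 < R" using R by (auto simp: max_def)
    then obtain y where y: "max (ereal x) 1 < ereal y" "ereal y < R" using ereal_dense2 by blast
    then have y': "x < y" "1 < y" by (auto simp: max_def split: if_splits)
    obtain B where "\<forall>\<^sub>F n in sequentially. norm (fc u n) \<le> B / y ^ n" using b[of y] y y' by auto
    then show "summable (\<lambda>n. norm (laurent_coeff (\<lambda>w. u (Psi w)) r1 n) * x ^ n)"
      unfolding r(3)[OF r1, symmetric] using x y' by (intro power_bounded_imp_summable[of _ B y]) auto
  qed
qed

end

section \<open>Faber polynomials\<close>

lemma laurent_coeff_at_infinity: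
  assumes f: "f holomorphic_on {w. a < norm w}" and a: "0 \<le> a" "a < r"
    and lim: "((\<lambda>w. f w / w ^ n) \<longlongrightarrow> L) at_infinity"
  shows "laurent_coeff f r n = L"
proof -
  have "contour_integral (circlepath 0 r) (\<lambda>w. f w / w ^ (n + 1)) = 2 * of_real pi * \<i> * L"
  proof (rule circle_integral_at_infinity)
    show "(\<lambda>w. f w / w ^ (n + 1)) holomorphic_on {w. a < norm w}"
      by (intro holomorphic_intros f) (use a in auto)
    show "((\<lambda>w. w * (f w / w ^ (n + 1))) \<longlongrightarrow> L) at_infinity"
    proof (rule Lim_transform_eventually[OF lim])
      have "f w / w ^ n = w * (f w / w ^ (n + 1))" if "w \<noteq> 0" for w using that by simp
      then show "\<forall>\<^sub>F w in at_infinity. f w / w ^ n = w * (f w / w ^ (n + 1))"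
        unfolding eventually_at_infinity by (intro exI[of _ 1] allI impI) fastforce
    qed
  qed (use a in auto)
  then show ?thesis by (simp add: laurent_coeff_def)
qed

text \<open>From 1/(w (w - w0)) = (1/(w - w0) - 1/w)/w0 comes a recursion in the exponent. It starts
  from 0, because \<open>w0\<close> lies outside the circle, and the integral of 1/w^(k+1) is
  nonzero at k = 0 only.\<close>

lemma laurent_coeff_simple_fraction:
  assumes "0 < r" "r < norm w0"
  shows "laurent_coeff (\<lambda>w. 1 / (w - w0)) r n = - 1 / w0 ^ (n + 1)"
proof -
  define J where "J k = contour_integral (circlepath 0 r) (\<lambda>w. 1 / (w - w0) / w ^ k)" for k
  have w0: "w0 \<noteq> 0" and nz: "\<And>w. norm w = r \<Longrightarrow> w \<noteq> w0 \<and> w \<noteq> 0" using assms by auto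
  have J0: "J 0 = 0"
    unfolding J_def
  proof (rule contour_integral_unique, rule Cauchy_theorem_convex_simple[of _ "ball 0 (norm w0)"])
    show "(\<lambda>w. 1 / (w - w0) / w ^ 0) holomorphic_on ball 0 (norm w0)" by (intro holomorphic_intros) auto
  qed (use assms in auto)
  have I: "contour_integral (circlepath 0 r) (\<lambda>w. 1 / w ^ (k + 1)) = (if k = 0 then 2 * of_real pi * \<i> else 0)" for k
  proof -
    have "((\<lambda>w::complex. 1 / w ^ k) \<longlongrightarrow> (if k = 0 then 1 else 0)) at_infinity"
    proof (cases "k = 0")
      case False
      have "((\<lambda>w::complex. (inverse w) ^ k) \<longlongrightarrow> 0 ^ k) at_infinity"
        by (intro tendsto_power tendsto_inverse_0)
      then show ?thesis using False by (simp add: divide_inverse power_inverse power_0_left)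
    qed auto
    from laurent_coeff_at_infinity[OF _ _ assms(1) this] show ?thesis by (simp add: laurent_coeff_def split: if_splits)
  qed
  have rec: "J (Suc k) = (J k - (if k = 0 then 2 * of_real pi * \<i> else 0)) / w0" for k
  proof -
    have "J (Suc k) = contour_integral (circlepath 0 r) (\<lambda>w. inverse w0 * (1 / (w - w0) / w ^ k - 1 / w ^ (k + 1)))"
      unfolding J_def
    proof (rule contour_integral_cong)
      fix w assume "w \<in> path_image (circlepath 0 r)"
      then have w: "w - w0 \<noteq> 0" "w \<noteq> 0" using nz assms by auto
      have "1 / (w - w0) / w = inverse w0 * (1 / (w - w0) - 1 / w)" using w w0 by (simp add: field_simps)
      then have "1 / (w - w0) / w / w ^ k = inverse w0 * (1 / (w - w0) - 1 / w) / w ^ k" by simp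
      also have "\<dots> = inverse w0 * (1 / (w - w0) / w ^ k - 1 / w / w ^ k)"
        by (simp only: diff_divide_distrib[symmetric] times_divide_eq_right)
      finally show "1 / (w - w0) / w ^ Suc k = inverse w0 * (1 / (w - w0) / w ^ k - 1 / w ^ (k + 1))"
        by (simp add: ac_simps)
    qed simp
    also have "\<dots> = inverse w0 * contour_integral (circlepath 0 r) (\<lambda>w. 1 / (w - w0) / w ^ k - 1 / w ^ (k + 1))"
      using assms nz by (intro contour_integral_lmul contour_integrable_continuous_circlepath continuous_intros) auto
    also have "\<dots> = inverse w0 * (J k - contour_integral (circlepath 0 r) (\<lambda>w. 1 / w ^ (k + 1)))"
      unfolding J_def using assms nz
      by (subst contour_integral_diff) (auto intro!: contour_integrable_continuous_circlepath continuous_intros)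
    finally show ?thesis unfolding I by (simp add: field_simps)
  qed
  have "J (Suc n) = - (2 * of_real pi * \<i>) / w0 ^ Suc n"
    by (induction n) (use w0 in \<open>simp_all add: rec J0 del: power_Suc, simp_all add: field_simps\<close>)
  then show ?thesis by (simp add: laurent_coeff_def J_def)
qed

context exterior
begin

text \<open>The reciprocal of \<Phi>'(\<infinity>), known as the logarithmic capacity of
  \<open>E\<close>.\<close>

definition lead :: complex where "lead = Lim at_infinity (\<lambda>w. Psi w / w)"

lemma lead: "lead \<noteq> 0" "((\<lambda>w. Psi w / w) \<longlongrightarrow> lead) at_infinity"
proof -
  obtain C where C: "C \<noteq> 0" "((\<lambda>w. Psi w / w) \<longlongrightarrow> C) at_infinity" by (rule Psi_asymp)
  then have "lead = C" unfolding lead_def by (intro tendsto_Lim trivial_limit_at_infinity)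
  then show "lead \<noteq> 0" "((\<lambda>w. Psi w / w) \<longlongrightarrow> lead) at_infinity" using C by auto
qed

lemma poly_Psi_asymp:
  assumes "degree q \<le> n"
  shows "((\<lambda>w. poly q (Psi w) / w ^ n) \<longlongrightarrow> coeff q n * lead ^ n) at_infinity"
proof -
  have p: "poly q z = (\<Sum>i\<le>n. coeff q i * z ^ i)" for z
  proof -
    have "poly q z = (\<Sum>i\<le>degree q. coeff q i * z ^ i)" by (rule poly_altdef)
    also have "\<dots> = (\<Sum>i\<le>n. coeff q i * z ^ i)"
      using assms by (intro sum.mono_neutral_left) (auto simp: coeff_eq_0)
    finally show ?thesis .
  qed
  have "((\<lambda>w. \<Sum>i\<le>n. coeff q i * (Psi w / w) ^ i * (inverse w) ^ (n - i)) \<longlongrightarrow>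
      (\<Sum>i\<le>n. coeff q i * lead ^ i * 0 ^ (n - i))) at_infinity"
    by (intro tendsto_intros lead tendsto_inverse_0)
  moreover have "(\<Sum>i\<le>n. coeff q i * lead ^ i * 0 ^ (n - i)) = coeff q n * lead ^ n"
  proof -
    have "(\<Sum>i\<le>n. coeff q i * lead ^ i * 0 ^ (n - i)) = (\<Sum>i\<in>{n}. coeff q i * lead ^ i * 0 ^ (n - i))"
      by (rule sum.mono_neutral_right) auto
    then show ?thesis by simp
  qed
  ultimately have "((\<lambda>w. \<Sum>i\<le>n. coeff q i * (Psi w / w) ^ i * (inverse w) ^ (n - i)) \<longlongrightarrow> coeff q n * lead ^ n) at_infinity" by simp
  then show ?thesis
  proof (rule Lim_transform_eventually)
    have t: "(\<Sum>i\<le>n. coeff q i * (Psi w / w) ^ i * (inverse w) ^ (n - i)) = poly q (Psi w) / w ^ n" if "w \<noteq> 0" for w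
      unfolding p sum_divide_distrib
    proof (rule sum.cong)
      fix i assume "i \<in> {..n}"
      then have "w ^ n = w ^ i * w ^ (n - i)" by (simp add: power_add[symmetric])
      then show "coeff q i * (Psi w / w) ^ i * (inverse w) ^ (n - i) = coeff q i * Psi w ^ i / w ^ n"
        using that by (simp add: power_divide power_inverse divide_inverse power_mult_distrib)
    qed simp
    show "\<forall>\<^sub>F w in at_infinity. (\<Sum>i\<le>n. coeff q i * (Psi w / w) ^ i * (inverse w) ^ (n - i)) = poly q (Psi w) / w ^ n"
      unfolding eventually_at_infinity by (intro exI[of _ 1] allI impI t) auto
  qed
qed

lemma poly_Psi_holo: "(\<lambda>w. poly q (Psi w)) holomorphic_on {w. 1 < norm w}"
  by (intro holomorphic_intros holo_Psi holomorphic_on_compose_gen[OF holo_Psi, of "poly q" UNIV, unfolded o_def]) auto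

lemma poly_analytic: "poly q analytic_on S"
  unfolding analytic_on_holomorphic
  by (rule exI[of _ UNIV]) (auto simp: holomorphic_on_def field_differentiable_def intro: poly_DERIV)

text \<open>By growth at infinity the coefficient of index \<open>n\<close> sees only the term of
  degree \<open>n\<close>. The map from polynomials to Faber coefficients is thus triangular with
  nonzero diagonal \<open>lead ^ n\<close>.\<close>

lemma fc_poly:
  assumes "degree q \<le> n"
  shows "fc (poly q) n = coeff q n * lead ^ n"
proof -
  have "fc (poly q) n = laurent_coeff (\<lambda>w. poly q (Psi w)) 2 n"
    by (rule faber_coeff_eq[where R = \<infinity>]) (auto intro: poly_analytic holomorphic_intros same_germ_refl)
  also have "\<dots> = coeff q n * lead ^ n"
    by (rule laurent_coeff_at_infinity[OF poly_Psi_holo _ _ poly_Psi_asymp[OF assms]]) auto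
  finally show ?thesis .
qed

lemma fc_poly_eq_0: "degree q < n \<Longrightarrow> fc (poly q) n = 0"
  by (simp add: fc_poly coeff_eq_0)

lemma faber_poly_unique:
  assumes "degree p < n" "\<And>j. j < n \<Longrightarrow> fc (poly p) j = 0"
  shows "p = 0"
proof (rule ccontr)
  assume "p \<noteq> 0"
  then show False using assms(2)[of "degree p"] assms(1) lead(1) fc_poly[of p "degree p"] by simp
qed

text \<open>The triangular system is solved from the top index down: adding a monomial of degree
  \<open>i\<close> leaves the coefficients above \<open>i\<close> unchanged and adjusts that of
  index \<open>i\<close>. For coefficients of a function the result is a partial sum of its Faber
  expansion.\<close>

lemma faber_poly_exists:
  assumes "1 \<le> n"
  shows "\<exists>p. degree p \<le> n - 1 \<and> (\<forall>j<n. fc (poly p) j = a j)"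
proof -
  have "\<exists>p. degree p < n \<and> (\<forall>j. n - k \<le> j \<and> j < n \<longrightarrow> fc (poly p) j = a j)" if "k \<le> n" for k
    using that
  proof (induction k)
    case 0 show ?case using assms by (intro exI[of _ 0]) auto
  next
    case (Suc k)
    then obtain p where p: "degree p < n" "\<And>j. n - k \<le> j \<Longrightarrow> j < n \<Longrightarrow> fc (poly p) j = a j" by auto
    define i where "i = n - Suc k"
    have i: "i < n" using Suc assms by (simp add: i_def)
    define c where "c = (a i - fc (poly p) i) / lead ^ i"
    have f: "fc (poly (p + monom c i)) j = fc (poly p) j + fc (poly (monom c i)) j" for j
    proof -
      have "poly (p + monom c i) = (\<lambda>z. poly p z + poly (monom c i) z)" by (simp add: fun_eq_iff)
      then show ?thesis using fc_add[OF poly_analytic poly_analytic, of p "monom c i" j] by simp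
    qed
    have "degree (p + monom c i) < n" using p(1) i degree_monom_le[of c i] by (intro degree_add_less) auto
    moreover have "fc (poly (p + monom c i)) j = a j" if j: "n - Suc k \<le> j" "j < n" for j
    proof (cases "j = i")
      case True
      then show ?thesis unfolding f using fc_poly[of "monom c i" i] lead(1) degree_monom_le[of c i] by (simp add: c_def)
    next
      case False
      then have "degree (monom c i) < j" using j degree_monom_le[of c i] by (auto simp: i_def)
      then show ?thesis unfolding f using fc_poly_eq_0[of "monom c i" j] p(2)[of j] False j by (simp add: i_def)
    qed
    ultimately show ?case by blast
  qed
  from this[of n] show ?thesis using assms by force
qed

text \<open>The asymptotics pass to the derivative by Cauchy's estimate for
  \<open>Psi v - lead * v\<close> on the disc of radius |w|/2 about \<open>w\<close>. On this disc
  |v| is at most three times the radius, whence the factor 3 and the choice of e/4.\<close>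

lemma deriv_Psi_lim: "(deriv Psi \<longlongrightarrow> lead) at_infinity"
proof (rule tendstoI)
  fix e :: real assume e: "e > 0"
  define e' where "e' = e / 4"
  have e': "e' > 0" using e by (simp add: e'_def)
  have "\<forall>\<^sub>F w in at_infinity. dist (Psi w / w) lead < e'" using lead(2) e' by (rule tendstoD)
  then obtain M where M: "\<And>w. norm w \<ge> M \<Longrightarrow> dist (Psi w / w) lead < e'" by (auto simp: eventually_at_infinity)
  show "\<forall>\<^sub>F w in at_infinity. dist (deriv Psi w) lead < e"
    unfolding eventually_at_infinity
  proof (intro exI[of _ "2 * max M 2"] allI impI)
    fix w :: complex assume w: "2 * max M 2 \<le> norm w"
    define \<rho> where "\<rho> = norm w / 2"
    have \<rho>: "\<rho> \<ge> 2" "\<rho> \<ge> M" using w by (auto simp: \<rho>_def)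
    define g where "g v = Psi v - lead * v" for v
    have in_ball: "norm v \<ge> \<rho>" "norm v \<le> 3 * \<rho>" if "v \<in> cball w \<rho>" for v
      using that norm_triangle_ineq2[of w v] norm_triangle_ineq2[of v w] by (auto simp: dist_norm \<rho>_def norm_minus_commute)
    have gh: "g holomorphic_on cball w \<rho>"
      unfolding g_def by (intro holomorphic_intros holomorphic_on_subset[OF holo_Psi]) (use in_ball(1) \<rho> in force)
    have gb: "g v \<in> ball 0 (3 * e' * \<rho>)" if "v \<in> ball w \<rho>" for v
    proof -
      have v: "norm v \<ge> \<rho>" "norm v \<le> 3 * \<rho>" using in_ball[of v] that by auto
      then have v0: "v \<noteq> 0" using \<rho> by auto
      have "g v = (Psi v / v - lead) * v" using v0 by (simp add: g_def left_diff_distrib)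
      then have "norm (g v) = norm (Psi v / v - lead) * norm v" by (simp add: norm_mult)
      also have "\<dots> < e' * norm v" using M[of v] v \<rho> v0 by (intro mult_strict_right_mono) (auto simp: dist_norm)
      also have "\<dots> \<le> e' * (3 * \<rho>)" using v e' by simp
      finally show ?thesis by simp
    qed
    have "norm ((deriv ^^ 1) g w) \<le> fact 1 * (3 * e' * \<rho>) / \<rho> ^ 1"
    proof (rule Cauchy_higher_deriv_bound[where y = 0])
      show "g holomorphic_on ball w \<rho>" using gh holomorphic_on_subset ball_subset_cball by blast
      show "continuous_on (cball w \<rho>) g" using gh holomorphic_on_imp_continuous_on by blast
    qed (use gb \<rho> in auto)
    moreover have "deriv g w = deriv Psi w - lead"
    proof -
      have "Psi field_differentiable at w"
        using holomorphic_on_imp_differentiable_at[OF holo_Psi open_gt, of w] \<rho> w by auto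
      then show ?thesis unfolding g_def
        by (intro DERIV_imp_deriv) (auto intro!: derivative_eq_intros simp: DERIV_deriv_iff_field_differentiable)
    qed
    ultimately have "norm (deriv Psi w - lead) \<le> 3 * e'" using \<rho> by simp
    then show "dist (deriv Psi w) lead < e" using e by (simp add: dist_norm e'_def)
  qed
qed

text \<open>This is Cauchy's kernel in the coordinate w and, expanded in powers of 1/w, the
  generating function of the Faber polynomials. Its residue one at infinity gives the winding number
  in \<open>faber_bound\<close>.\<close>

lemma kernel_props:
  assumes s: "1 < s" and z: "z \<in> cD s"
  shows "(\<lambda>w. deriv Psi w / (Psi w - z)) holomorphic_on {w. s < norm w}"
    "((\<lambda>w. w * (deriv Psi w / (Psi w - z))) \<longlongrightarrow> 1) at_infinity"
proof -
  have ne: "Psi w \<noteq> z" if "s < norm w" for w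
    using z that s Psi_notin[of w] Phi_Psi[of w] by (auto simp: cD_def)
  show "(\<lambda>w. deriv Psi w / (Psi w - z)) holomorphic_on {w. s < norm w}"
    by (intro holomorphic_intros holomorphic_on_subset[OF holo_Psi]
      holomorphic_on_subset[OF holomorphic_deriv[OF holo_Psi open_gt]]) (use s ne in auto)
  have "((\<lambda>w. deriv Psi w / (Psi w / w - z * inverse w)) \<longlongrightarrow> lead / (lead - z * 0)) at_infinity"
    by (intro tendsto_intros deriv_Psi_lim lead tendsto_inverse_0) (use lead in auto)
  then have "((\<lambda>w. deriv Psi w / (Psi w / w - z * inverse w)) \<longlongrightarrow> 1) at_infinity" using lead by simp
  then show "((\<lambda>w. w * (deriv Psi w / (Psi w - z))) \<longlongrightarrow> 1) at_infinity"
  proof (rule Lim_transform_eventually)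
    show "\<forall>\<^sub>F w in at_infinity. deriv Psi w / (Psi w / w - z * inverse w) = w * (deriv Psi w / (Psi w - z))"
      unfolding eventually_at_infinity
    proof (intro exI[of _ "s + 1"] allI impI)
      fix w :: complex assume w: "s + 1 \<le> norm w"
      then have "w \<noteq> 0" using s by auto
      then have "Psi w / w - z * inverse w = (Psi w - z) / w" by (simp add: field_simps)
      then show "deriv Psi w / (Psi w / w - z * inverse w) = w * (deriv Psi w / (Psi w - z))" by simp
    qed
  qed
qed

text \<open>In Cauchy's formula over the level curve of index \<open>r\<close> the principal part
  \<open>h\<close> contributes nothing, since w times the kernel times \<open>h\<close> tends to 0
  at infinity. What remains is the power series, bounded on the circle by the sum of the moduli. The
  constant comes from the two level curves alone and so serves all functions at once.\<close>

theorem faber_bound: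
  assumes s: "1 < s" "s < r"
  obtains C where "C > 0" "\<And>R e z. ereal r < R \<Longrightarrow> e holomorphic_on D R \<Longrightarrow> z \<in> cD s \<Longrightarrow>
     norm (e z) \<le> C * (\<Sum>n. norm (fc e n) * r ^ n)"
proof -
  define \<gamma> where "\<gamma> = Psi \<circ> circlepath 0 r"
  have r: "1 < r" using s by simp
  have pim: "path_image \<gamma> = Psi ` sphere 0 r" using r by (simp add: \<gamma>_def path_image_compose)
  have vp: "valid_path \<gamma>" unfolding \<gamma>_def
    by (rule valid_path_compose_holomorphic[OF _ holo_Psi open_gt]) (use r in auto)
  have loop: "pathfinish \<gamma> = pathstart \<gamma>" by (simp add: \<gamma>_def pathfinish_compose pathstart_compose)
  have compP: "compact (Psi ` sphere 0 r)"
    by (intro compact_continuous_image continuous_on_subset[OF cont_Psi]) (use r in auto)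
  have disj: "Psi ` sphere 0 r \<inter> cD s = {}"
    using s r Psi_notin Phi_Psi by (auto simp: cD_def)
  obtain \<delta> where \<delta>: "\<delta> > 0" "\<And>x y. x \<in> Psi ` sphere 0 r \<Longrightarrow> y \<in> cD s \<Longrightarrow> \<delta> \<le> dist x y"
    using separate_compact_closed[OF compP compact_imp_closed[OF compact_cD] disj] by blast
  have "continuous_on (sphere 0 r) (deriv Psi)"
    by (rule continuous_on_subset[OF holomorphic_on_imp_continuous_on[OF holomorphic_deriv[OF holo_Psi open_gt]]]) (use r in auto)
  then have "compact (deriv Psi ` sphere 0 r)" by (intro compact_continuous_image) auto
  then obtain M0 where M0: "\<forall>x\<in>deriv Psi ` sphere 0 r. norm x \<le> M0" using compact_imp_bounded bounded_iff by metis
  define M where "M = max M0 1"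
  have M: "\<And>w. norm w = r \<Longrightarrow> norm (deriv Psi w) \<le> M" "M > 0" using M0 by (auto simp: M_def le_max_iff_disj)
  show ?thesis
  proof (rule that[of "M / \<delta> * r"])
    show "M / \<delta> * r > 0" using M \<delta> r by simp
    fix R e z assume R: "ereal r < R" and e: "e holomorphic_on D R" and z: "z \<in> cD s"
    have R1: "1 < R" using R r by (auto intro: less_trans[of _ "ereal r"])
    have an: "e analytic_on E" using e R1 open_D E_sub_D analytic_on_holomorphic by blast
    let ?k = "\<lambda>w. deriv Psi w / (Psi w - z)"
    have kh: "?k holomorphic_on {w. s < norm w}" and kl: "((\<lambda>w. w * ?k w) \<longlongrightarrow> 1) at_infinity"
      using kernel_props[OF s(1) z] by auto
    have ci: "contour_integral \<gamma> f = contour_integral (circlepath 0 r) (\<lambda>w. deriv Psi w * f (Psi w))" for f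
      unfolding \<gamma>_def
      by (rule contour_integral_comp_analyticW[of _ "{w. 1 < norm w}"])
        (use holo_Psi r in \<open>auto simp: analytic_on_open open_gt\<close>)
    \<comment> \<open>A point outside \<open>D R\<close> lies in the exterior of the curve, which is
      connected as an image of |w| > r and unbounded as the complement of a compact set.\<close>
    have out: "winding_number \<gamma> y = 0" if y: "y \<notin> D R" for y
    proof (rule winding_number_zero_in_outside)
      have yr: "y \<notin> E" "r < norm (\<Phi> y)"
      proof -
        show "y \<notin> E" using y E_sub_D by blast
        then have "R \<le> ereal (norm (\<Phi> y))" using y by (simp add: in_D)
        then have "ereal r < ereal (norm (\<Phi> y))" using R by (rule less_le_trans[rotated])
        then show "r < norm (\<Phi> y)" by simp
      qed
      define T where "T = Psi ` {w. r < norm w}"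
      have "{w::complex. r < norm w} = - cball 0 r" by auto
      then have "connected {w::complex. r < norm w}" using connected_complement_bounded_convex[of "cball (0::complex) r"] by auto
      then have conT: "connected T" unfolding T_def
        by (intro connected_continuous_image continuous_on_subset[OF cont_Psi]) (use r in auto)
      have T: "T = - cD r"
      proof -
        have "x \<in> T" if "x \<notin> E" "r < norm (\<Phi> x)" for x
          unfolding T_def using that by (intro image_eqI[of _ _ "\<Phi> x"]) auto
        moreover have "x \<in> - cD r" if "x \<in> T" for x using that r Psi_notin by (auto simp: T_def cD_def)
        ultimately show ?thesis by (intro equalityI subsetI) (auto simp: cD_def)
      qed
      have unb: "\<not> bounded T"
      proof
        assume "bounded T"
        then have "bounded (T \<union> cD r)" using compact_imp_bounded[OF compact_cD] by simp
        then show False by (simp add: T)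
      qed
      have Tsub: "T \<subseteq> - path_image \<gamma>" unfolding T pim using r Psi_notin by (auto simp: cD_def)
      have yT: "y \<in> T" using yr by (auto simp: T cD_def)
      then have "T \<subseteq> connected_component_set (- path_image \<gamma>) y" by (intro connected_component_maximal conT Tsub)
      then have "\<not> bounded (connected_component_set (- path_image \<gamma>) y)" using unb bounded_subset by blast
      then show "y \<in> outside (path_image \<gamma>)" using yT Tsub by (auto simp: outside_def)
    qed (use vp loop valid_path_imp_path in auto)
    have zD: "z \<in> D R"
    proof -
      have "ereal s < R" using s R by (auto intro: less_trans[of _ "ereal r"])
      then show ?thesis using z D_cD by blast
    qed
    have zn: "z \<notin> path_image \<gamma>" using disj z by (auto simp: pim)
    have pD: "path_image \<gamma> \<subseteq> D R" using R r by (auto simp: pim in_D Psi_notin)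
    have w1: "winding_number \<gamma> z = 1"
    proof -
      have "winding_number \<gamma> z = 1 / (2 * of_real pi * \<i>) * contour_integral \<gamma> (\<lambda>w. 1 / (w - z))"
        using winding_number_valid_path[OF vp zn] by simp
      also have "contour_integral \<gamma> (\<lambda>w. 1 / (w - z)) = contour_integral (circlepath 0 r) ?k"
        unfolding ci by simp
      also have "\<dots> = 2 * of_real pi * \<i> * 1"
        by (rule circle_integral_at_infinity[OF kh _ _ kl]) (use s in auto)
      finally show ?thesis by simp
    qed
    have "((\<lambda>w. e w / (w - z)) has_contour_integral (2 * pi * \<i> * winding_number \<gamma> z * e z)) \<gamma>"
      by (rule Cauchy_integral_formula_global[OF open_D[OF R1] e zD vp _ loop out]) (use zn pD in auto)
    then have "contour_integral \<gamma> (\<lambda>w. e w / (w - z)) = 2 * of_real pi * \<i> * e z"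
      using contour_integral_unique w1 by fastforce
    then have cf: "contour_integral (circlepath 0 r) (\<lambda>w. ?k w * e (Psi w)) = 2 * of_real pi * \<i> * e z"
      unfolding ci by simp
    have sR: "ereal s < R" using s R by (auto intro: less_trans[of _ "ereal r"])
    obtain h where h: "h holomorphic_on {w. s < norm w}" "(h \<longlongrightarrow> 0) at_infinity"
      and hs: "\<And>w. s < norm w \<Longrightarrow> ereal (norm w) < R \<Longrightarrow> (\<lambda>n. laurent_coeff (\<lambda>w. e (Psi w)) s n * w ^ n) sums (e (Psi w) - h w)"
      using laurent_decomposition[OF holo_comp_Psi[OF e] _ s(1) sR] by auto
    have lcfc: "laurent_coeff (\<lambda>w. e (Psi w)) s n = fc e n" for n
      using faber_coeff_eq[OF an e same_germ_refl s(1) sR] by simp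
    have sub: "sphere 0 r \<subseteq> {w. s < norm w}" using s by auto
    have ck: "continuous_on (sphere 0 r) ?k" and ch: "continuous_on (sphere 0 r) h"
      using kh h(1) sub holomorphic_on_imp_continuous_on continuous_on_subset by blast+
    have ce: "continuous_on (sphere 0 r) (\<lambda>w. e (Psi w))"
      by (rule continuous_on_subset[OF holomorphic_on_imp_continuous_on[OF holo_comp_Psi[OF e]]]) (use r R in auto)
    have "contour_integral (circlepath 0 r) (\<lambda>w. ?k w * h w) = 2 * of_real pi * \<i> * (1 * 0)"
    proof (rule circle_integral_at_infinity[of _ s])
      show "(\<lambda>w. ?k w * h w) holomorphic_on {w. s < norm w}" by (intro holomorphic_on_mult kh h)
      show "((\<lambda>w. w * (?k w * h w)) \<longlongrightarrow> 1 * 0) at_infinity"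
        using tendsto_mult[OF kl h(2)] by (simp add: mult.assoc)
    qed (use s in auto)
    then have h0: "contour_integral (circlepath 0 r) (\<lambda>w. ?k w * h w) = 0" by simp
    define S where "S = (\<Sum>n. norm (fc e n) * r ^ n)"
    have Sb: "norm (e (Psi w) - h w) \<le> S" if w: "norm w = r" for w
    proof -
      have sm: "(\<lambda>n. fc e n * w ^ n) sums (e (Psi w) - h w)" using hs[of w] w s R by (simp add: lcfc)
      have "summable (\<lambda>n. norm (fc e n) * r ^ n)"
        using laurent_coeff_summable[OF holo_comp_Psi[OF e] _ s(1) sR, of r] r R by (simp add: lcfc)
      then have "norm (\<Sum>n. fc e n * w ^ n) \<le> (\<Sum>n. norm (fc e n * w ^ n))"
        by (intro summable_norm) (simp add: norm_mult norm_power w)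
      then show ?thesis using sm by (simp add: sums_iff S_def norm_mult norm_power w)
    qed
    have "contour_integral (circlepath 0 r) (\<lambda>w. ?k w * e (Psi w)) - contour_integral (circlepath 0 r) (\<lambda>w. ?k w * h w)
      = contour_integral (circlepath 0 r) (\<lambda>w. ?k w * e (Psi w) - ?k w * h w)"
      using r by (intro contour_integral_diff[symmetric] contour_integrable_continuous_circlepath continuous_on_mult)
        (auto intro: ck ch ce)
    also have "\<dots> = contour_integral (circlepath 0 r) (\<lambda>w. ?k w * (e (Psi w) - h w))"
      by (simp add: right_diff_distrib)
    finally have eq: "2 * of_real pi * \<i> * e z = contour_integral (circlepath 0 r) (\<lambda>w. ?k w * (e (Psi w) - h w))"
      using cf h0 by simp
    have bound: "norm (2 * of_real pi * \<i> * e z) \<le> (M / \<delta> * S) * (2 * pi * r)"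
      unfolding eq
    proof (rule circle_integral_bound)
      show "continuous_on (sphere 0 r) (\<lambda>w. ?k w * (e (Psi w) - h w))"
        by (intro continuous_on_mult continuous_on_diff ck ch ce)
      show "norm (?k w * (e (Psi w) - h w)) \<le> M / \<delta> * S" if w: "norm w = r" for w
      proof -
        have "norm (?k w) \<le> M / \<delta>"
          unfolding norm_divide using M(1)[OF w] M(2) \<delta>(1) \<delta>(2)[of "Psi w" z] w z
          by (intro frac_le) (auto simp: dist_norm)
        then show ?thesis using Sb[OF w] unfolding norm_mult by (intro mult_mono) (auto intro: order_trans[OF norm_ge_zero])
      qed
    qed (use r in auto)
    show "norm (e z) \<le> M / \<delta> * r * (\<Sum>n. norm (fc e n) * r ^ n)"
    proof -
      have "norm (2 * of_real pi * \<i> * e z) = (2 * pi) * norm (e z)" by (simp add: norm_mult)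
      moreover have "(M / \<delta> * S) * (2 * pi * r) = (2 * pi) * (M / \<delta> * r * S)" by simp
      ultimately have "(2 * pi) * norm (e z) \<le> (2 * pi) * (M / \<delta> * r * S)" using bound by metis
      then show ?thesis unfolding S_def by (subst (asm) mult_le_cancel_left_pos) auto
    qed
  qed
qed

text \<open>A simple pole at \<xi> becomes one at \<open>w0\<close> with residue \<open>p w0\<close>
  in the coordinate w. It contributes exactly \<open>- p w0 / w0 ^ (n + 1)\<close>; the rest is
  holomorphic past |w0|, so its coefficients decay geometrically faster.\<close>

theorem simple_pole_lower_bound:
  assumes u: "u analytic_on E" and g1: "g1 holomorphic_on D R" "same_germ E g1 (\<lambda>z. (z - \<xi>) * u z)" "g1 \<xi> \<noteq> 0"
    and \<xi>: "\<xi> \<notin> E" "ereal (norm (\<Phi> \<xi>)) < R"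
  obtains c where "c > 0" "\<forall>\<^sub>F n in sequentially. c / norm (\<Phi> \<xi>) ^ n \<le> norm (fc u n)"
proof -
  define w0 where "w0 = \<Phi> \<xi>"
  have w0: "1 < norm w0" "Psi w0 = \<xi>" "w0 \<noteq> 0" "ereal (norm w0) < R" using norm_Phi[OF \<xi>(1)] \<xi> by (auto simp: w0_def)
  \<comment> \<open>The difference quotient of \<open>Psi\<close> vanishes nowhere: at
    \<open>w0\<close> because the derivative is nonzero, elsewhere because \<open>Psi\<close> is
    injective. Hence it can be divided by.\<close>
  define q where "q w = (if w = w0 then deriv Psi w0 else (Psi w - Psi w0) / (w - w0))" for w
  have qh: "q holomorphic_on {w. 1 < norm w}" unfolding q_def by (rule pole_lemma_open[OF holo_Psi open_gt])
  have qn: "q w \<noteq> 0" if "1 < norm w" for w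
  proof (cases "w = w0")
    case True then show ?thesis using deriv_Psi[OF w0(1)] by (auto simp: q_def)
  next
    case False
    have "Psi w \<noteq> Psi w0" using False Phi_Psi[OF that] Phi_Psi[OF w0(1)] by metis
    then show ?thesis using False by (simp add: q_def)
  qed
  let ?A = "{w. 1 < norm w \<and> ereal (norm w) < R}"
  define p where "p w = g1 (Psi w) / q w" for w
  have ph: "p holomorphic_on ?A" unfolding p_def
    by (intro holomorphic_on_divide holo_comp_Psi[OF g1(1)] holomorphic_on_subset[OF qh]) (use qn in auto)
  define k where "k w = (if w = w0 then deriv p w0 else (p w - p w0) / (w - w0))" for w
  have kh: "k holomorphic_on ?A" unfolding k_def by (rule pole_lemma_open[OF ph open_annulus])
  have pw0: "p w0 \<noteq> 0" using g1(3) w0 qn[OF w0(1)] by (simp add: p_def)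
  define g where "g z = g1 z / (z - \<xi>)" for z
  have gh: "g holomorphic_on D (ereal (norm w0))"
    unfolding g_def
  proof (intro holomorphic_intros holomorphic_on_subset[OF g1(1)])
    show "D (ereal (norm w0)) \<subseteq> D R" using w0(4) by (intro D_mono) auto
    show "z - \<xi> \<noteq> 0" if "z \<in> D (ereal (norm w0))" for z
      using that \<xi> by (auto simp: in_D w0_def)
  qed
  have gg: "same_germ E g u"
  proof -
    obtain V where V: "open V" "E \<subseteq> V" "\<And>z. z \<in> V \<Longrightarrow> g1 z = (z - \<xi>) * u z" using g1(2) by (auto simp: same_germ_def)
    show ?thesis unfolding same_germ_def
      by (rule exI[of _ "V - {\<xi>}"]) (use V \<xi> in \<open>auto simp: g_def\<close>)
  qed
  obtain r0 where r0: "1 < r0" "r0 < norm w0" using dense w0(1) by blast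
  obtain x where x: "norm w0 < x" "ereal x < R" using ereal_dense2[OF w0(4)] by auto
  have r0R: "ereal r0 < R" using r0 w0 by (auto intro: less_trans[of _ "ereal (norm w0)"])
  have ck: "continuous_on (sphere 0 y) k" if "1 < y" "ereal y < R" for y
    by (rule continuous_on_subset[OF holomorphic_on_imp_continuous_on[OF kh]]) (use that in auto)
  have fcn: "fc u n = laurent_coeff k r0 n - p w0 / w0 ^ (n + 1)" for n
  proof -
    have "fc u n = laurent_coeff (\<lambda>w. g (Psi w)) r0 n" using r0 by (intro faber_coeff_eq[OF u gh gg]) auto
    also have "\<dots> = laurent_coeff (\<lambda>w. k w + p w0 * (1 / (w - w0))) r0 n"
    proof (rule laurent_coeff_cong)
      fix w :: complex assume w: "norm w = r0"
      then have n: "w \<noteq> w0" "1 < norm w" using r0 by auto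
      have "g (Psi w) = p w / (w - w0)"
      proof -
        have "Psi w - \<xi> = q w * (w - w0)" using n w0 by (simp add: q_def)
        then show ?thesis using n qn[OF n(2)] by (simp add: g_def p_def)
      qed
      also have "\<dots> = k w + p w0 * (1 / (w - w0))" using n by (simp add: k_def diff_divide_distrib)
      finally show "g (Psi w) = k w + p w0 * (1 / (w - w0))" .
    qed (use r0 in auto)
    also have "\<dots> = laurent_coeff k r0 n + p w0 * laurent_coeff (\<lambda>w. 1 / (w - w0)) r0 n"
    proof -
      have c2: "continuous_on (sphere 0 r0) (\<lambda>w. 1 / (w - w0))" by (intro continuous_intros) (use r0 in auto)
      have "laurent_coeff (\<lambda>w. k w + p w0 * (1 / (w - w0))) r0 n = laurent_coeff k r0 n + laurent_coeff (\<lambda>w. p w0 * (1 / (w - w0))) r0 n"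
        by (rule laurent_coeff_add[OF ck[OF r0(1) r0R] continuous_on_mult_left[OF c2]]) (use r0 in auto)
      also have "laurent_coeff (\<lambda>w. p w0 * (1 / (w - w0))) r0 n = p w0 * laurent_coeff (\<lambda>w. 1 / (w - w0)) r0 n"
        by (rule laurent_coeff_cmult[OF c2]) (use r0 in auto)
      finally show ?thesis .
    qed
    finally show ?thesis using laurent_coeff_simple_fraction[of r0 w0] r0 by simp
  qed
  have lck: "laurent_coeff k r0 n = laurent_coeff k x n" for n
  proof (rule laurent_coeff_radius[OF kh open_annulus])
    fix w :: complex assume "r0 \<le> norm w" "norm w \<le> x"
    then have "ereal (norm w) < R" using le_less_trans[of "ereal (norm w)" "ereal x" R] x by simp
    then show "w \<in> ?A" using \<open>r0 \<le> norm w\<close> r0 by auto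
  qed (use r0 x in auto)
  have x1: "1 < x" using x w0 by simp
  have "compact (k ` sphere 0 x)" using ck[OF x1 x(2)] by (intro compact_continuous_image) auto
  then obtain B where B: "\<forall>x\<in>k ` sphere 0 x. norm x \<le> B" using compact_imp_bounded bounded_iff by metis
  have kb: "norm (laurent_coeff k r0 n) \<le> B / x ^ n" for n
    unfolding lck by (rule laurent_coeff_bound[OF ck[OF x1 x(2)]]) (use x1 B in auto)
  \<comment> \<open>Half the size of the polar term; the other half absorbs the remainder for large
    \<open>n\<close>.\<close>
  define c where "c = norm (p w0) / (2 * norm w0)"
  have c: "c > 0" using pw0 w0 by (simp add: c_def)
  show ?thesis
  proof (rule that[OF c])
    have "(\<lambda>n. B * (norm w0 / x) ^ n) \<longlonglongrightarrow> B * 0"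
      using x w0 by (intro tendsto_intros LIMSEQ_realpow_zero) auto
    then have "(\<lambda>n. B * (norm w0 / x) ^ n) \<longlonglongrightarrow> 0" by simp
    then have "\<forall>\<^sub>F n in sequentially. B * (norm w0 / x) ^ n < c" using c by (rule order_tendstoD)
    then show "\<forall>\<^sub>F n in sequentially. c / norm (\<Phi> \<xi>) ^ n \<le> norm (fc u n)"
    proof eventually_elim
      case (elim n)
      have pos: "norm w0 ^ n > 0" using w0 by simp
      have "B / x ^ n = (B * (norm w0 / x) ^ n) / norm w0 ^ n" using w0 by (simp add: power_divide)
      also have "\<dots> \<le> c / norm w0 ^ n" using elim pos by (intro divide_right_mono) auto
      finally have 1: "norm (laurent_coeff k r0 n) \<le> c / norm w0 ^ n" using kb[of n] by simp
      have 2: "norm (p w0 / w0 ^ (n + 1)) = 2 * c / norm w0 ^ n"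
        using w0 by (simp add: norm_divide norm_mult norm_power c_def field_simps)
      have "norm (p w0 / w0 ^ (n + 1)) \<le> norm (fc u n) + norm (laurent_coeff k r0 n)"
        unfolding fcn using norm_triangle_ineq4[of "laurent_coeff k r0 n" "laurent_coeff k r0 n - p w0 / w0 ^ (n + 1)"] by simp
      moreover have "2 * c / norm w0 ^ n = c / norm w0 ^ n + c / norm w0 ^ n" by simp
      ultimately show ?case using 1 2 unfolding w0_def[symmetric] by linarith
    qed
  qed
qed

end

section \<open>Polynomials and their Taylor coefficients\<close>

text \<open>Gaussian elimination, one equation and one unknown at a time.\<close>

lemma homogeneous_system_solution:
  fixes A :: "'i \<Rightarrow> 'j \<Rightarrow> 'k::field"
  assumes "finite I" "finite J" "card I < card J"
  shows "\<exists>x. (\<exists>j\<in>J. x j \<noteq> 0) \<and> (\<forall>i\<in>I. (\<Sum>j\<in>J. A i j * x j) = 0)"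
  using assms
proof (induction I arbitrary: J A rule: finite_induct)
  case empty
  then have "J \<noteq> {}" by auto
  then show ?case by (intro exI[of _ "\<lambda>_. 1"]) auto
next
  case (insert i0 I)
  show ?case
  proof (cases "\<forall>j\<in>J. A i0 j = 0")
    case True
    obtain x where "\<exists>j\<in>J. x j \<noteq> 0" "\<forall>i\<in>I. (\<Sum>j\<in>J. A i j * x j) = 0"
      using insert.IH[of J A] insert.prems insert.hyps by auto
    then show ?thesis using True by (intro exI[of _ x]) auto
  next
    case False
    then obtain j0 where j0: "j0 \<in> J" "A i0 j0 \<noteq> 0" by auto
    define J' where "J' = J - {j0}"
    define A' where "A' i j = A i j - A i j0 * A i0 j / A i0 j0" for i j
    have J': "finite J'" "J = insert j0 J'" "j0 \<notin> J'" using insert.prems j0 by (auto simp: J'_def)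
    then have "card I < card J'" using insert.prems insert.hyps by simp
    then obtain x' where x': "\<exists>j\<in>J'. x' j \<noteq> 0" "\<And>i. i \<in> I \<Longrightarrow> (\<Sum>j\<in>J'. A' i j * x' j) = 0"
      using insert.IH[of J' A'] J' by auto
    define x where "x j = (if j = j0 then - (\<Sum>j\<in>J'. A i0 j * x' j) / A i0 j0 else x' j)" for j
    have sum: "(\<Sum>j\<in>J. A i j * x j) = A i j0 * x j0 + (\<Sum>j\<in>J'. A i j * x' j)" for i
      using J' by (simp add: x_def) (intro sum.cong, auto)
    have "(\<Sum>j\<in>J. A i0 j * x j) = 0" unfolding sum using j0 by (simp add: x_def)
    moreover have "(\<Sum>j\<in>J. A i j * x j) = 0" if "i \<in> I" for i
    proof -
      have "0 = (\<Sum>j\<in>J'. A i j * x' j - A i j0 * A i0 j / A i0 j0 * x' j)"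
        using x'(2)[OF that] by (simp add: A'_def left_diff_distrib)
      also have "\<dots> = (\<Sum>j\<in>J'. A i j * x' j) - A i j0 / A i0 j0 * (\<Sum>j\<in>J'. A i0 j * x' j)"
        by (simp add: sum_subtractf sum_distrib_left mult.assoc)
      finally show ?thesis unfolding sum by (simp add: x_def)
    qed
    ultimately show ?thesis using x'(1) J' by (intro exI[of _ x]) (auto simp: x_def)
  qed
qed

section \<open>The coefficient norm and Taylor coefficients\<close>

lemma coeff_norm_eq:
  assumes "degree p \<le> M" shows "coeff_norm p = (\<Sum>i\<le>M. norm (coeff p i))"
  unfolding coeff_norm_def using assms by (intro sum.mono_neutral_left) (auto simp: coeff_eq_0)

lemma coeff_norm_nonneg: "0 \<le> coeff_norm p"
  by (simp add: coeff_norm_def sum_nonneg)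

lemma norm_coeff_le: "norm (coeff p i) \<le> coeff_norm p"
proof (cases "i \<le> degree p")
  case True then show ?thesis unfolding coeff_norm_def by (intro member_le_sum) auto
next
  case False then show ?thesis using coeff_norm_nonneg[of p] by (simp add: coeff_eq_0)
qed

lemma coeff_norm_0 [simp]: "coeff_norm 0 = 0"
  by (simp add: coeff_norm_def)

lemma coeff_norm_eq_0_iff: "coeff_norm p = 0 \<longleftrightarrow> p = 0"
proof
  assume "coeff_norm p = 0"
  then have "coeff p i = 0" for i using norm_coeff_le[of p i] by simp
  then show "p = 0" by (simp add: poly_eq_iff)
qed auto

lemma coeff_norm_add: "coeff_norm (p + q) \<le> coeff_norm p + coeff_norm q"
proof -
  define M where "M = max (degree p) (degree q)"
  have "degree (p + q) \<le> M" unfolding M_def by (rule degree_add_le_max)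
  then show ?thesis
    by (subst (1 2 3) coeff_norm_eq[of _ M])
      (auto simp: M_def sum.distrib[symmetric] intro!: sum_mono norm_triangle_ineq)
qed

lemma coeff_norm_smult: "coeff_norm (smult c p) = norm c * coeff_norm p"
  by (simp add: coeff_norm_eq[of _ "degree p"] sum_distrib_left norm_mult)

lemma coeff_norm_sum: "coeff_norm (\<Sum>i\<in>I. f i) \<le> (\<Sum>i\<in>I. coeff_norm (f i))"
proof (induction I rule: infinite_finite_induct)
  case (insert x F)
  then show ?case using coeff_norm_add[of "f x" "\<Sum>i\<in>F. f i"] by simp
qed auto

lemma poly_as_sum_le: "degree (p :: complex poly) \<le> M \<Longrightarrow> poly p z = (\<Sum>i\<le>M. coeff p i * z ^ i)"
  unfolding poly_altdef by (intro sum.mono_neutral_left) (auto simp: coeff_eq_0)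

lemma norm_poly_le:
  assumes "degree p \<le> M" "norm z \<le> B" "1 \<le> B"
  shows "norm (poly p z) \<le> coeff_norm p * B ^ M"
proof -
  have "norm (poly p z) \<le> (\<Sum>i\<le>M. norm (coeff p i * z ^ i))" unfolding poly_as_sum_le[OF assms(1)] by (rule norm_sum)
  also have "\<dots> \<le> (\<Sum>i\<le>M. norm (coeff p i) * B ^ M)"
  proof (rule sum_mono)
    fix i assume "i \<in> {..M}"
    then have "norm z ^ i \<le> B ^ M" using assms power_mono[of "norm z" B i] power_increasing[of i M B] by fastforce
    then show "norm (coeff p i * z ^ i) \<le> norm (coeff p i) * B ^ M"
      by (simp add: norm_mult norm_power mult_left_mono)
  qed
  also have "\<dots> = coeff_norm p * B ^ M" by (simp add: coeff_norm_eq[OF assms(1)] sum_distrib_right)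
  finally show ?thesis .
qed

text \<open>Taken from the translated polynomial rather than from derivatives: linear in
  \<open>p\<close>, free of factorials, and vanishing turns into divisibility by a monomial.\<close>

definition taylor_coeff :: "complex poly \<Rightarrow> complex \<Rightarrow> nat \<Rightarrow> complex" where
  "taylor_coeff p \<xi> i = coeff (p \<circ>\<^sub>p [:\<xi>, 1:]) i"

lemma taylor_coeff_add: "taylor_coeff (p + q) \<xi> i = taylor_coeff p \<xi> i + taylor_coeff q \<xi> i"
  and taylor_coeff_diff: "taylor_coeff (p - q) \<xi> i = taylor_coeff p \<xi> i - taylor_coeff q \<xi> i"
  and taylor_coeff_smult: "taylor_coeff (smult c p) \<xi> i = c * taylor_coeff p \<xi> i"
  and taylor_coeff_0 [simp]: "taylor_coeff 0 \<xi> i = 0"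
  and taylor_coeff_sum: "taylor_coeff (\<Sum>j\<in>J. f j) \<xi> i = (\<Sum>j\<in>J. taylor_coeff (f j) \<xi> i)"
  by (simp_all add: taylor_coeff_def pcompose_add pcompose_diff pcompose_smult pcompose_sum coeff_sum)

lemma taylor_coeff_shift_inverse: "(p \<circ>\<^sub>p [:\<xi>, 1:]) \<circ>\<^sub>p [:- \<xi>, 1:] = (p :: complex poly)"
  by (simp add: pcompose_assoc[symmetric] pcompose_pCons)

lemma poly_taylor_coeff_expand:
  assumes "degree p \<le> M" shows "poly p z = (\<Sum>i\<le>M. taylor_coeff p \<xi> i * (z - \<xi>) ^ i)"
proof -
  have "poly p z = poly (p \<circ>\<^sub>p [:\<xi>, 1:]) (z - \<xi>)" by (simp add: poly_pcompose)
  also have "\<dots> = (\<Sum>i\<le>M. taylor_coeff p \<xi> i * (z - \<xi>) ^ i)"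
    unfolding taylor_coeff_def by (rule poly_as_sum_le) (use degree_pcompose_le[of p "[:\<xi>, 1:]"] assms in auto)
  finally show ?thesis .
qed

lemma poly_sum_monoms: "degree (p :: complex poly) \<le> M \<Longrightarrow> p = (\<Sum>l\<le>M. smult (coeff p l) (monom 1 l))"
proof -
  assume "degree p \<le> M"
  then show ?thesis unfolding smult_monom mult_1_right by (rule poly_as_sum_of_monoms'[symmetric])
qed

lemma taylor_coeff_bound:
  obtains C where "C > 0" "\<And>p. degree p \<le> M \<Longrightarrow> norm (taylor_coeff p \<xi> i) \<le> C * coeff_norm p"
proof -
  define C where "C = (\<Sum>l\<le>M. norm (taylor_coeff (monom 1 l) \<xi> i)) + 1"
  show ?thesis
  proof (rule that[of C])
    show "C > 0" unfolding C_def by (intro add_nonneg_pos sum_nonneg) auto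
    fix p :: "complex poly" assume d: "degree p \<le> M"
    have "taylor_coeff p \<xi> i = (\<Sum>l\<le>M. coeff p l * taylor_coeff (monom 1 l) \<xi> i)"
      by (subst poly_sum_monoms[OF d]) (simp add: taylor_coeff_sum taylor_coeff_smult)
    also have "norm \<dots> \<le> (\<Sum>l\<le>M. norm (coeff p l * taylor_coeff (monom 1 l) \<xi> i))" by (rule norm_sum)
    also have "\<dots> \<le> (\<Sum>l\<le>M. coeff_norm p * norm (taylor_coeff (monom 1 l) \<xi> i))"
      by (intro sum_mono) (simp add: norm_mult mult_right_mono norm_coeff_le)
    also have "\<dots> \<le> C * coeff_norm p"
      using coeff_norm_nonneg[of p] by (simp add: C_def sum_distrib_left[symmetric] algebra_simps)
    finally show "norm (taylor_coeff p \<xi> i) \<le> C * coeff_norm p" .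
  qed
qed

lemma linear_power_dvd_iff_taylor_coeff: "[:- \<xi>, 1:] ^ t dvd p \<longleftrightarrow> (\<forall>i<t. taylor_coeff p \<xi> i = 0)"
proof -
  have c1: "([:- \<xi>, 1:] ^ t) \<circ>\<^sub>p [:\<xi>, 1:] = monom 1 t"
  proof (induction t)
    case (Suc t)
    have "[:- \<xi>, 1:] \<circ>\<^sub>p [:\<xi>, 1:] = [:0, 1:]" by (simp add: pcompose_pCons)
    then show ?case unfolding power_Suc pcompose_mult Suc.IH by (simp add: monom_Suc)
  qed (simp add: pcompose_1)
  have c2: "(monom 1 t) \<circ>\<^sub>p [:- \<xi>, 1:] = [:- \<xi>, 1:] ^ t"
    using taylor_coeff_shift_inverse[of "[:- \<xi>, 1:] ^ t" \<xi>] by (simp only: c1)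
  have "[:- \<xi>, 1:] ^ t dvd p \<longleftrightarrow> monom 1 t dvd p \<circ>\<^sub>p [:\<xi>, 1:]"
  proof
    assume "[:- \<xi>, 1:] ^ t dvd p"
    then obtain r where "p = [:- \<xi>, 1:] ^ t * r" by (rule dvdE)
    then have "p \<circ>\<^sub>p [:\<xi>, 1:] = monom 1 t * (r \<circ>\<^sub>p [:\<xi>, 1:])" by (simp only: pcompose_mult c1)
    then show "monom 1 t dvd p \<circ>\<^sub>p [:\<xi>, 1:]" by (rule dvdI)
  next
    assume "monom 1 t dvd p \<circ>\<^sub>p [:\<xi>, 1:]"
    then obtain r where r: "p \<circ>\<^sub>p [:\<xi>, 1:] = monom 1 t * r" by (rule dvdE)
    have "p = (p \<circ>\<^sub>p [:\<xi>, 1:]) \<circ>\<^sub>p [:- \<xi>, 1:]" by (simp only: taylor_coeff_shift_inverse)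
    also have "\<dots> = [:- \<xi>, 1:] ^ t * (r \<circ>\<^sub>p [:- \<xi>, 1:])" unfolding r by (simp only: pcompose_mult c2)
    finally show "[:- \<xi>, 1:] ^ t dvd p" by (rule dvdI)
  qed
  also have "\<dots> \<longleftrightarrow> (\<forall>i<t. taylor_coeff p \<xi> i = 0)" by (simp add: monom_1_dvd_iff' taylor_coeff_def)
  finally show ?thesis .
qed

section \<open>Polynomials with prescribed zeros and Hermite interpolation\<close>

definition root_poly :: "complex set \<Rightarrow> (complex \<Rightarrow> nat) \<Rightarrow> complex poly" where
  "root_poly Z \<tau> = (\<Prod>\<xi>\<in>Z. [:- \<xi>, 1:] ^ \<tau> \<xi>)"

lemma root_poly_insert: "finite Z \<Longrightarrow> \<xi> \<notin> Z \<Longrightarrow> root_poly (insert \<xi> Z) \<tau> = [:- \<xi>, 1:] ^ \<tau> \<xi> * root_poly Z \<tau>"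
  by (simp add: root_poly_def)

lemma poly_root_poly: "poly (root_poly Z \<tau>) z = (\<Prod>\<xi>\<in>Z. (z - \<xi>) ^ \<tau> \<xi>)"
  by (simp add: root_poly_def poly_prod)

lemma root_poly_nonzero: "finite Z \<Longrightarrow> z \<notin> Z \<Longrightarrow> poly (root_poly Z \<tau>) z \<noteq> 0"
  by (auto simp: poly_root_poly)

lemma root_poly_ne_0: "root_poly Z \<tau> \<noteq> 0"
  by (cases "finite Z") (auto simp: root_poly_def)

lemma degree_root_poly: "finite Z \<Longrightarrow> degree (root_poly Z \<tau>) = (\<Sum>\<xi>\<in>Z. \<tau> \<xi>)"
proof (induction rule: finite_induct)
  case (insert x F)
  then show ?case using root_poly_ne_0[of F \<tau>]
    by (simp add: root_poly_insert degree_mult_eq degree_linear_power)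
qed (simp add: root_poly_def)

lemma lead_coeff_root_poly: "lead_coeff (root_poly Z \<tau>) = 1"
  by (simp add: root_poly_def lead_coeff_prod lead_coeff_power)

lemma root_poly_dvd:
  assumes "finite Z" "\<And>\<xi>. \<xi> \<in> Z \<Longrightarrow> [:- \<xi>, 1:] ^ \<tau> \<xi> dvd p"
  shows "root_poly Z \<tau> dvd p"
proof (cases "p = 0")
  case False
  show ?thesis using assms
  proof (induction rule: finite_induct)
    case (insert \<xi> Z)
    then obtain r where r: "p = root_poly Z \<tau> * r" by (auto elim: dvdE)
    have "\<tau> \<xi> \<le> order \<xi> p" using insert.prems[of \<xi>] False by (simp add: order_divides)
    also have "\<dots> = order \<xi> (root_poly Z \<tau>) + order \<xi> r" using False unfolding r by (intro order_mult) simp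
    also have "order \<xi> (root_poly Z \<tau>) = 0" using root_poly_nonzero[OF insert.hyps] by (rule order_0I)
    finally have "[:- \<xi>, 1:] ^ \<tau> \<xi> dvd r" by (simp add: order_divides)
    then show ?case unfolding r root_poly_insert[OF insert.hyps] by (simp add: mult.commute mult_dvd_mono)
  qed (simp add: root_poly_def)
qed auto

lemma linear_power_dvd_root_poly: "finite Z \<Longrightarrow> \<xi> \<in> Z \<Longrightarrow> [:- \<xi>, 1:] ^ \<tau> \<xi> dvd root_poly Z \<tau>"
  unfolding root_poly_def by (rule dvd_prodI)

lemma taylor_coeff_zero_imp_zero:
  assumes "finite Z" "degree p < (\<Sum>\<xi>\<in>Z. \<tau> \<xi>)" "\<And>\<xi> i. \<xi> \<in> Z \<Longrightarrow> i < \<tau> \<xi> \<Longrightarrow> taylor_coeff p \<xi> i = 0"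
  shows "p = 0"
proof (rule ccontr)
  assume "p \<noteq> 0"
  have "root_poly Z \<tau> dvd p" using assms by (intro root_poly_dvd) (auto simp: linear_power_dvd_iff_taylor_coeff)
  then have "degree (root_poly Z \<tau>) \<le> degree p" using \<open>p \<noteq> 0\<close> by (rule dvd_imp_degree_le)
  then show False using assms by (simp add: degree_root_poly)
qed

text \<open>The datum to be attained is moved to the left with an additional unknown, that of index
  \<open>M\<close>; this makes \<open>M\<close> homogeneous equations in \<open>M + 1\<close>
  unknowns. The additional unknown cannot vanish, because zero data force the zero polynomial, and
  dividing by it normalises the datum.\<close>

lemma hermite_basis:
  assumes Z: "finite Z"
  obtains e where "\<And>\<xi> i. \<xi> \<in> Z \<Longrightarrow> i < \<tau> \<xi> \<Longrightarrow> degree (e \<xi> i) < (\<Sum>\<xi>\<in>Z. \<tau> \<xi>)"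
    "\<And>\<xi> i \<xi>' i'. \<xi> \<in> Z \<Longrightarrow> i < \<tau> \<xi> \<Longrightarrow> \<xi>' \<in> Z \<Longrightarrow> i' < \<tau> \<xi>' \<Longrightarrow>
       taylor_coeff (e \<xi> i) \<xi>' i' = (if \<xi> = \<xi>' \<and> i = i' then 1 else 0)"
proof -
  define M where "M = (\<Sum>\<xi>\<in>Z. \<tau> \<xi>)"
  define Pr where "Pr = (SIGMA \<xi>:Z. {..<\<tau> \<xi>})"
  have Pr: "finite Pr" "card Pr = M" using Z by (auto simp: Pr_def M_def)
  have "\<exists>e. degree e < M \<and> (\<forall>(\<xi>', i')\<in>Pr. taylor_coeff e \<xi>' i' = (if pr = (\<xi>', i') then 1 else 0))" if pr: "pr \<in> Pr" for pr
  proof -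
    have "0 < card Pr" using pr Pr by (auto simp: card_gt_0_iff)
    then have M0: "0 < M" using Pr by simp
    define A where "A = (\<lambda>(\<xi>', i') j. if j < M then taylor_coeff (monom 1 j) \<xi>' i' else if pr = (\<xi>', i') then -1 else 0)"
    obtain x where x: "\<exists>j\<in>{..M}. x j \<noteq> 0" "\<And>k. k \<in> Pr \<Longrightarrow> (\<Sum>j\<le>M. A k j * x j) = 0"
      using homogeneous_system_solution[of Pr "{..M}" A] Pr by auto
    define p where "p = (\<Sum>j<M. smult (x j) (monom 1 j))"
    have dp: "degree p < M" unfolding p_def
      using M0 by (intro degree_sum_less) (auto intro: le_less_trans[OF degree_smult_le] simp: degree_monom_eq)
    have tcp: "taylor_coeff p \<xi>' i' = (if pr = (\<xi>', i') then x M else 0)" if k: "(\<xi>', i') \<in> Pr" for \<xi>' i'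
    proof -
      have "{..M} = insert M {..<M}" by auto
      then have "0 = A (\<xi>', i') M * x M + (\<Sum>j<M. A (\<xi>', i') j * x j)" using x(2)[OF k] by simp
      also have "(\<Sum>j<M. A (\<xi>', i') j * x j) = taylor_coeff p \<xi>' i'"
        unfolding p_def taylor_coeff_sum taylor_coeff_smult by (rule sum.cong) (auto simp: A_def)
      finally show ?thesis by (auto simp: A_def)
    qed
    have "x M \<noteq> 0"
    proof
      assume "x M = 0"
      then have "p = 0" using taylor_coeff_zero_imp_zero[OF Z, of p \<tau>] dp tcp by (auto simp: M_def Pr_def)
      then have "x j = 0" if "j < M" for j
      proof -
        have "coeff p j = (\<Sum>i<M. if i = j then x i else 0)" unfolding p_def by (simp add: coeff_sum if_distrib cong: if_cong)
        then have "coeff p j = x j" using that by simp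
        then show ?thesis using \<open>p = 0\<close> by simp
      qed
      then show False using x(1) \<open>x M = 0\<close> by (metis atMost_iff le_neq_implies_less)
    qed
    then show ?thesis
      using dp tcp by (intro exI[of _ "smult (inverse (x M)) p"]) (auto simp: taylor_coeff_smult)
  qed
  then have "\<exists>e. \<forall>pr\<in>Pr. degree (e pr) < M \<and> (\<forall>(\<xi>', i')\<in>Pr. taylor_coeff (e pr) \<xi>' i' = (if pr = (\<xi>', i') then 1 else 0))"
    by (intro bchoice ballI)
  then obtain e where e: "\<And>pr. pr \<in> Pr \<Longrightarrow> degree (e pr) < M \<and> (\<forall>(\<xi>', i')\<in>Pr. taylor_coeff (e pr) \<xi>' i' = (if pr = (\<xi>', i') then 1 else 0))"
    by blast
  show ?thesis
  proof (rule that[of "\<lambda>\<xi> i. e (\<xi>, i)"])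
    show "degree (e (\<xi>, i)) < (\<Sum>\<xi>\<in>Z. \<tau> \<xi>)" if "\<xi> \<in> Z" "i < \<tau> \<xi>" for \<xi> i
      using e[of "(\<xi>, i)"] that by (simp add: Pr_def M_def)
    show "taylor_coeff (e (\<xi>, i)) \<xi>' i' = (if \<xi> = \<xi>' \<and> i = i' then 1 else 0)" if "\<xi> \<in> Z" "i < \<tau> \<xi>" "\<xi>' \<in> Z" "i' < \<tau> \<xi>'" for \<xi> i \<xi>' i'
      using e[of "(\<xi>, i)"] that by (auto simp: Pr_def)
  qed
qed

lemma hermite_expand:
  assumes Z: "finite Z"
    and e: "\<And>\<xi> i. \<xi> \<in> Z \<Longrightarrow> i < \<tau> \<xi> \<Longrightarrow> degree (e \<xi> i) < (\<Sum>\<xi>\<in>Z. \<tau> \<xi>)"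
    "\<And>\<xi> i \<xi>' i'. \<xi> \<in> Z \<Longrightarrow> i < \<tau> \<xi> \<Longrightarrow> \<xi>' \<in> Z \<Longrightarrow> i' < \<tau> \<xi>' \<Longrightarrow>
       taylor_coeff (e \<xi> i) \<xi>' i' = (if \<xi> = \<xi>' \<and> i = i' then 1 else 0)"
    and p: "p = 0 \<or> degree p < (\<Sum>\<xi>\<in>Z. \<tau> \<xi>)"
  shows "p = (\<Sum>\<xi>\<in>Z. \<Sum>i<\<tau> \<xi>. smult (taylor_coeff p \<xi> i) (e \<xi> i))"
proof (cases "p = 0")
  case False
  let ?r = "\<Sum>\<xi>\<in>Z. \<Sum>i<\<tau> \<xi>. smult (taylor_coeff p \<xi> i) (e \<xi> i)"
  have M: "0 < (\<Sum>\<xi>\<in>Z. \<tau> \<xi>)" using p False by auto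
  have "p - ?r = 0"
  proof (rule taylor_coeff_zero_imp_zero[OF Z])
    have "degree ?r < (\<Sum>\<xi>\<in>Z. \<tau> \<xi>)"
      using M e(1) by (intro degree_sum_less) (auto intro: le_less_trans[OF degree_smult_le])
    then show "degree (p - ?r) < (\<Sum>\<xi>\<in>Z. \<tau> \<xi>)" using p False degree_diff_less by blast
    fix \<xi> i assume z: "\<xi> \<in> Z" "i < \<tau> \<xi>"
    have "taylor_coeff ?r \<xi> i = (\<Sum>\<xi>'\<in>Z. \<Sum>i'<\<tau> \<xi>'. taylor_coeff p \<xi>' i' * taylor_coeff (e \<xi>' i') \<xi> i)"
      by (simp add: taylor_coeff_sum taylor_coeff_smult)
    also have "\<dots> = (\<Sum>\<xi>'\<in>Z. if \<xi>' = \<xi> then taylor_coeff p \<xi> i else 0)"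
    proof (intro sum.cong refl)
      fix \<xi>' assume z': "\<xi>' \<in> Z"
      show "(\<Sum>i'<\<tau> \<xi>'. taylor_coeff p \<xi>' i' * taylor_coeff (e \<xi>' i') \<xi> i) = (if \<xi>' = \<xi> then taylor_coeff p \<xi> i else 0)"
      proof (cases "\<xi>' = \<xi>")
        case True
        have "(\<Sum>i'<\<tau> \<xi>'. taylor_coeff p \<xi>' i' * taylor_coeff (e \<xi>' i') \<xi> i) = (\<Sum>i'<\<tau> \<xi>. if i' = i then taylor_coeff p \<xi> i else 0)"
          unfolding True by (intro sum.cong refl) (use z e(2) in auto)
        then show ?thesis using True z by simp
      next
        case False
        then show ?thesis using e(2)[OF z' _ z] by (simp add: sum.neutral)
      qed
    qed
    also have "\<dots> = taylor_coeff p \<xi> i" using z Z by simp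
    finally show "taylor_coeff (p - ?r) \<xi> i = 0" by (simp add: taylor_coeff_diff)
  qed
  then show ?thesis by simp
qed auto

text \<open>Among polynomials of degree at most the sum \<open>M\<close> of the multiplicities, the
  Taylor data at the zeros miss exactly the multiples of \<open>root_poly\<close>. Removing the top
  coefficient by such a multiple leaves degree below \<open>M\<close> and the same data, and the
  Hermite basis applies.\<close>

lemma hermite_stability:
  assumes Z: "finite Z"
  obtains C where "C > 0" "\<And>p b. degree p \<le> (\<Sum>\<xi>\<in>Z. \<tau> \<xi>) \<Longrightarrow>
     (\<And>\<xi> i. \<xi> \<in> Z \<Longrightarrow> i < \<tau> \<xi> \<Longrightarrow> norm (taylor_coeff p \<xi> i) \<le> b) \<Longrightarrow>
     0 \<le> b \<Longrightarrow> coeff_norm (p - smult (coeff p (\<Sum>\<xi>\<in>Z. \<tau> \<xi>)) (root_poly Z \<tau>)) \<le> C * b"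
proof -
  obtain e where e: "\<And>\<xi> i. \<xi> \<in> Z \<Longrightarrow> i < \<tau> \<xi> \<Longrightarrow> degree (e \<xi> i) < (\<Sum>\<xi>\<in>Z. \<tau> \<xi>)"
    "\<And>\<xi> i \<xi>' i'. \<xi> \<in> Z \<Longrightarrow> i < \<tau> \<xi> \<Longrightarrow> \<xi>' \<in> Z \<Longrightarrow> i' < \<tau> \<xi>' \<Longrightarrow>
       taylor_coeff (e \<xi> i) \<xi>' i' = (if \<xi> = \<xi>' \<and> i = i' then 1 else 0)"
    using hermite_basis[OF Z, where \<tau> = \<tau>] by metis
  define M where "M = (\<Sum>\<xi>\<in>Z. \<tau> \<xi>)"
  define C where "C = (\<Sum>\<xi>\<in>Z. \<Sum>i<\<tau> \<xi>. coeff_norm (e \<xi> i)) + 1"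
  have C: "C > 0" unfolding C_def by (intro add_nonneg_pos sum_nonneg coeff_norm_nonneg) auto
  show ?thesis
  proof (rule that[OF C])
    fix p :: "complex poly" and b :: real
    assume d: "degree p \<le> (\<Sum>\<xi>\<in>Z. \<tau> \<xi>)" and b: "\<And>\<xi> i. \<xi> \<in> Z \<Longrightarrow> i < \<tau> \<xi> \<Longrightarrow> norm (taylor_coeff p \<xi> i) \<le> b" "0 \<le> b"
    define r where "r = p - smult (coeff p M) (root_poly Z \<tau>)"
    have dr: "degree (root_poly Z \<tau>) = M" unfolding M_def by (rule degree_root_poly[OF Z])
    have "coeff (root_poly Z \<tau>) M = 1" using lead_coeff_root_poly[of Z \<tau>] dr by simp
    then have "coeff r M = 0" by (simp add: r_def)
    moreover have "degree r \<le> M" unfolding r_def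
      using d dr by (intro degree_diff_le order_trans[OF degree_smult_le]) (auto simp: M_def)
    ultimately have "r = 0 \<or> degree r < M" by (metis le_neq_implies_less leading_coeff_0_iff)
    then have "r = (\<Sum>\<xi>\<in>Z. \<Sum>i<\<tau> \<xi>. smult (taylor_coeff r \<xi> i) (e \<xi> i))"
      unfolding M_def by (intro hermite_expand[OF Z e]) auto
    then have "coeff_norm r = coeff_norm (\<Sum>\<xi>\<in>Z. \<Sum>i<\<tau> \<xi>. smult (taylor_coeff r \<xi> i) (e \<xi> i))"
      by (rule arg_cong)
    also have "\<dots> \<le> (\<Sum>\<xi>\<in>Z. \<Sum>i<\<tau> \<xi>. coeff_norm (smult (taylor_coeff r \<xi> i) (e \<xi> i)))"
      by (rule order_trans[OF coeff_norm_sum sum_mono[OF coeff_norm_sum]])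
    also have "\<dots> \<le> (\<Sum>\<xi>\<in>Z. \<Sum>i<\<tau> \<xi>. b * coeff_norm (e \<xi> i))"
    proof (intro sum_mono)
      fix \<xi> i assume z: "\<xi> \<in> Z" "i \<in> {..<\<tau> \<xi>}"
      have "taylor_coeff (root_poly Z \<tau>) \<xi> i = 0"
        using linear_power_dvd_root_poly[OF Z z(1), of \<tau>] z by (simp add: linear_power_dvd_iff_taylor_coeff)
      then have "taylor_coeff r \<xi> i = taylor_coeff p \<xi> i" by (simp add: r_def taylor_coeff_diff taylor_coeff_smult)
      then show "coeff_norm (smult (taylor_coeff r \<xi> i) (e \<xi> i)) \<le> b * coeff_norm (e \<xi> i)"
        using b(1)[of \<xi> i] z coeff_norm_nonneg by (simp add: coeff_norm_smult mult_right_mono)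
    qed
    also have "\<dots> \<le> C * b" using b by (simp add: C_def sum_distrib_left[symmetric] algebra_simps)
    finally show "coeff_norm (p - smult (coeff p (\<Sum>\<xi>\<in>Z. \<tau> \<xi>)) (root_poly Z \<tau>)) \<le> C * b" by (simp add: r_def M_def)
  qed
qed

section \<open>Holomorphic multiples and exact poles\<close>

lemma poly_holo: "poly p holomorphic_on S" for p :: "complex poly"
  by (auto simp: holomorphic_on_def field_differentiable_def intro: has_field_derivative_at_within poly_DERIV)

context exterior
begin

lemma holo_ext_holo: "g holomorphic_on D R \<Longrightarrow> holo_ext g R"
  using same_germ_refl by (auto simp: holo_ext_def)

lemma holo_ext_poly: "holo_ext (poly p) R"
  by (rule holo_ext_holo) (rule poly_holo)

lemma holo_ext_add: "holo_ext u R \<Longrightarrow> holo_ext v R \<Longrightarrow> holo_ext (\<lambda>z. u z + v z) R"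
  and holo_ext_mult: "holo_ext u R \<Longrightarrow> holo_ext v R \<Longrightarrow> holo_ext (\<lambda>z. u z * v z) R"
proof -
  assume "holo_ext u R" "holo_ext v R"
  then obtain g h where *: "g holomorphic_on D R" "same_germ E g u" "h holomorphic_on D R" "same_germ E h v"
    by (auto simp: holo_ext_def)
  show "holo_ext (\<lambda>z. u z + v z) R" unfolding holo_ext_def
    by (rule exI[of _ "\<lambda>z. g z + h z"]) (use * in \<open>auto intro!: holomorphic_intros intro: same_germ_combine[OF *(2,4)]\<close>)
  show "holo_ext (\<lambda>z. u z * v z) R" unfolding holo_ext_def
    by (rule exI[of _ "\<lambda>z. g z * h z"]) (use * in \<open>auto intro!: holomorphic_intros intro: same_germ_combine[OF *(2,4)]\<close>)
qed

lemma holo_ext_cmult: "holo_ext u R \<Longrightarrow> holo_ext (\<lambda>z. c * u z) R"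
  using holo_ext_mult[of "poly [:c:]" R u] holo_ext_poly[of "[:c:]" R] by simp

lemma holo_ext_poly_mult: "holo_ext u R \<Longrightarrow> holo_ext (\<lambda>z. poly p z * u z) R"
  by (rule holo_ext_mult[OF holo_ext_poly])

text \<open>The quotient is formed away from the zeros of \<open>p\<close>, and all of these lie
  where \<open>u\<close> is already holomorphic. This is how factors with zeros in \<open>E\<close>
  or at levels already passed are cancelled.\<close>

lemma holo_ext_divide:
  assumes u: "holo_ext u R" "1 < R" and pu: "holo_ext (\<lambda>z. poly p z * u z) R'" "1 < R'"
    and zeros: "\<And>z. z \<in> D R' \<Longrightarrow> poly p z = 0 \<Longrightarrow> z \<in> D R" and p0: "p \<noteq> 0"
  shows "holo_ext u R'"
proof (cases "R' \<le> R")
  case True then show ?thesis using u holo_ext_mono by blast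
next
  case False
  then have RR: "R \<le> R'" by simp
  obtain g where g: "g holomorphic_on D R" "same_germ E g u" using u by (auto simp: holo_ext_def)
  obtain h where h: "h holomorphic_on D R'" "same_germ E h (\<lambda>z. poly p z * u z)" using pu by (auto simp: holo_ext_def)
  have eq: "poly p z * g z = h z" if z: "z \<in> D R" for z
  proof (rule D_identity[OF u(2) _ _ _ z])
    show "(\<lambda>z. poly p z * g z) holomorphic_on D R" by (intro holomorphic_intros poly_holo g)
    show "h holomorphic_on D R" using h(1) D_mono[OF RR] holomorphic_on_subset by blast
    have "same_germ E (\<lambda>z. poly p z * g z) (\<lambda>z. poly p z * u z)" by (rule same_germ_map[OF g(2)]) simp
    then show "same_germ E (\<lambda>z. poly p z * g z) h" using h(2) same_germ_sym same_germ_trans by blast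
  qed
  define k where "k z = (if z \<in> D R then g z else h z / poly p z)" for z
  let ?T = "D R' - {z. poly p z = 0}"
  have opT: "open ?T" using open_D[OF pu(2)] finite_imp_closed[OF poly_roots_finite[OF p0]] by auto
  have "k holomorphic_on D R \<union> ?T"
  proof (rule holomorphic_on_Un_open[OF _ _ open_D[OF u(2)] opT])
    show "k holomorphic_on D R" by (rule holomorphic_transform[OF g(1)]) (simp add: k_def)
    have "(\<lambda>z. h z / poly p z) holomorphic_on ?T"
      by (intro holomorphic_intros poly_holo holomorphic_on_subset[OF h(1)]) auto
    then show "k holomorphic_on ?T"
    proof (rule holomorphic_transform)
      fix z assume "z \<in> ?T"
      then show "h z / poly p z = k z" using eq[of z] by (auto simp: k_def field_simps)
    qed
  qed
  moreover have "D R' \<subseteq> D R \<union> ?T" using zeros by auto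
  ultimately have "k holomorphic_on D R'" using holomorphic_on_subset by blast
  moreover have "same_germ E k u"
  proof -
    have "same_germ E k g" unfolding same_germ_def
      by (rule exI[of _ "D R"]) (use open_D[OF u(2)] E_sub_D in \<open>auto simp: k_def\<close>)
    then show ?thesis using g(2) same_germ_trans by blast
  qed
  ultimately show ?thesis by (auto simp: holo_ext_def)
qed

lemma analytic_holo_ext': assumes "u analytic_on E" obtains R where "1 < R" "holo_ext u R"
proof -
  obtain r where "1 < r" "u holomorphic_on D (ereal r)" using analytic_holo_ext[OF assms] .
  then show ?thesis using that[of "ereal r"] holo_ext_holo by auto
qed

lemma holo_ext_divide_no_zero:
  assumes "u analytic_on E" "holo_ext (\<lambda>z. poly p z * u z) R" "1 < R" "\<And>z. z \<in> D R \<Longrightarrow> poly p z \<noteq> 0" "p \<noteq> 0"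
  shows "holo_ext u R"
proof -
  obtain R0 where "1 < R0" "holo_ext u R0" using analytic_holo_ext'[OF assms(1)] .
  then show ?thesis using holo_ext_divide[of u R0 p R] assms by blast
qed

text \<open>One zero of the numerator cancels one factor; if \<open>a\<close> lies outside
  \<open>D R\<close> there is nothing to cancel.\<close>

lemma holo_ext_divide_linear:
  assumes h: "h holomorphic_on D R" "same_germ E h (\<lambda>z. (z - a) * u z)" and a: "a \<notin> E" "a \<in> D R \<Longrightarrow> h a = 0" and R: "1 < R"
  shows "holo_ext u R"
proof -
  define k where "k z = (if z = a then deriv h a else (h z - h a) / (z - a))" for z
  define k' where "k' = (if a \<in> D R then k else (\<lambda>z. h z / (z - a)))"
  have "k holomorphic_on D R" unfolding k_def by (rule pole_lemma_open[OF h(1) open_D[OF R]])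
  moreover have "(\<lambda>z. h z / (z - a)) holomorphic_on D R" if "a \<notin> D R"
    by (intro holomorphic_intros h) (use that in auto)
  ultimately have "k' holomorphic_on D R" by (auto simp: k'_def)
  moreover have "same_germ E k' u"
  proof -
    obtain W where W: "open W" "E \<subseteq> W" "\<And>z. z \<in> W \<Longrightarrow> h z = (z - a) * u z" using h(2) by (auto simp: same_germ_def)
    show ?thesis unfolding same_germ_def
      by (rule exI[of _ "W - {a}"]) (use W a in \<open>auto simp: k'_def k_def\<close>)
  qed
  ultimately show ?thesis by (auto simp: holo_ext_def)
qed

text \<open>For \<open>\<xi>\<close> outside \<open>D R\<close> the value \<open>h \<xi>\<close> is arbitrary, so the condition on it is then void.\<close>

definition exact_pole :: "(complex \<Rightarrow> complex) \<Rightarrow> complex \<Rightarrow> nat \<Rightarrow> ereal \<Rightarrow> bool" where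
  "exact_pole G \<xi> t R \<longleftrightarrow> (\<exists>h. h holomorphic_on D R \<and> same_germ E h (\<lambda>z. (z - \<xi>) ^ t * G z) \<and> h \<xi> \<noteq> 0)"

lemma exact_pole_mono: "exact_pole G \<xi> t R \<Longrightarrow> R' \<le> R \<Longrightarrow> exact_pole G \<xi> t R'"
  unfolding exact_pole_def using holomorphic_on_subset[OF _ D_mono] by blast

lemma exact_pole_holo_ext_high:
  assumes "exact_pole G \<xi> t R" "t \<le> l" shows "holo_ext (\<lambda>z. (z - \<xi>) ^ l * G z) R"
proof -
  have "holo_ext (\<lambda>z. (z - \<xi>) ^ t * G z) R" using assms by (auto simp: exact_pole_def holo_ext_def)
  then have "holo_ext (\<lambda>z. poly ([:- \<xi>, 1:] ^ (l - t)) z * ((z - \<xi>) ^ t * G z)) R" by (rule holo_ext_poly_mult)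
  moreover have "(\<lambda>z. poly ([:- \<xi>, 1:] ^ (l - t)) z * ((z - \<xi>) ^ t * G z)) = (\<lambda>z. (z - \<xi>) ^ l * G z)"
    using assms(2) by (simp add: mult.assoc[symmetric] power_add[symmetric])
  ultimately show ?thesis by (simp only:)
qed

text \<open>The point \<xi> lies on the boundary of this domain, so even a power too low to cancel
  the pole gives a function holomorphic inside.\<close>

lemma exact_pole_holo_ext_low:
  assumes "exact_pole G \<xi> t R" "\<xi> \<notin> E" "ereal (norm (\<Phi> \<xi>)) \<le> R" "G analytic_on E"
  shows "holo_ext (\<lambda>z. (z - \<xi>) ^ l * G z) (ereal (norm (\<Phi> \<xi>)))"
proof -
  have R: "1 < ereal (norm (\<Phi> \<xi>))" using norm_Phi[OF assms(2)] by simp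
  have "holo_ext (\<lambda>z. (z - \<xi>) ^ t * G z) (ereal (norm (\<Phi> \<xi>)))"
    using exact_pole_holo_ext_high[OF assms(1) order_refl] assms(3) holo_ext_mono by blast
  then have "holo_ext G (ereal (norm (\<Phi> \<xi>)))"
    by (intro holo_ext_divide_no_zero[where p = "[:- \<xi>, 1:] ^ t" and u = G] assms R)
      (use assms(2) in \<open>auto simp: in_D\<close>)
  then have "holo_ext (\<lambda>z. poly ([:- \<xi>, 1:] ^ l) z * G z) (ereal (norm (\<Phi> \<xi>)))" by (rule holo_ext_poly_mult)
  then show ?thesis by simp
qed

lemma poly_mult_analytic: "u analytic_on E \<Longrightarrow> (\<lambda>z. poly p z * u z) analytic_on E"
  by (intro analytic_on_mult poly_analytic)

lemma fc_poly_mult_taylor_coeff: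
  assumes "u analytic_on E" "degree q \<le> M"
  shows "fc (\<lambda>z. poly q z * u z) n = (\<Sum>l\<le>M. taylor_coeff q \<xi> l * fc (\<lambda>z. (z - \<xi>) ^ l * u z) n)"
proof -
  have "(\<lambda>z. poly q z * u z) = (\<lambda>z. \<Sum>l\<le>M. taylor_coeff q \<xi> l * ((z - \<xi>) ^ l * u z))"
    by (rule ext) (simp add: poly_taylor_coeff_expand[OF assms(2), of _ \<xi>] sum_distrib_right mult.assoc)
  then show ?thesis by (simp only:) (rule fc_sum, intro analytic_intros assms)
qed

lemma fc_poly_mult_coeff:
  assumes "u analytic_on E" "degree q \<le> M"
  shows "fc (\<lambda>z. poly q z * u z) n = (\<Sum>l\<le>M. coeff q l * fc (\<lambda>z. z ^ l * u z) n)"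
proof -
  have "(\<lambda>z. poly q z * u z) = (\<lambda>z. \<Sum>l\<le>M. coeff q l * (z ^ l * u z))"
    by (rule ext) (simp add: poly_as_sum_le[OF assms(2)] sum_distrib_right mult.assoc)
  then show ?thesis by (simp only:) (rule fc_sum, intro analytic_intros assms)
qed

text \<open>The bound is uniform in \<open>q\<close> and linear in its norm, so that it can be
  applied to the varying polynomial \<open>Q n - R\<close>.\<close>

lemma fc_poly_mult_bound:
  assumes u: "u analytic_on E" and h: "holo_ext u R" and x: "1 < x" "ereal x < R"
  obtains B where "B > 0" "\<And>n q. degree q \<le> M \<Longrightarrow> norm (fc (\<lambda>z. poly q z * u z) n) \<le> B * coeff_norm q / x ^ n"
proof -
  have "\<exists>B>0. \<forall>n. norm (fc (\<lambda>z. z ^ l * u z) n) \<le> B / x ^ n" for l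
  proof -
    have "holo_ext (\<lambda>z. poly (monom 1 l) z * u z) R" by (rule holo_ext_poly_mult[OF h])
    then have h': "holo_ext (\<lambda>z. z ^ l * u z) R" by (simp add: poly_monom)
    have "(\<lambda>z. z ^ l * u z) analytic_on E" by (intro analytic_intros u)
    from fc_bound[OF this h' x] show ?thesis by blast
  qed
  then have "\<exists>B. \<forall>l. B l > 0 \<and> (\<forall>n. norm (fc (\<lambda>z. z ^ l * u z) n) \<le> B l / x ^ n)" by (intro choice) auto
  then obtain B where B: "\<And>l. B l > 0" "\<And>l n. norm (fc (\<lambda>z. z ^ l * u z) n) \<le> B l / x ^ n" by blast
  show ?thesis
  proof (rule that[of "\<Sum>l\<le>M. B l"])
    show "(\<Sum>l\<le>M. B l) > 0" using B(1) by (intro sum_pos) auto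
    fix n q assume d: "degree (q :: complex poly) \<le> M"
    have "norm (fc (\<lambda>z. poly q z * u z) n) \<le> (\<Sum>l\<le>M. norm (coeff q l * fc (\<lambda>z. z ^ l * u z) n))"
      unfolding fc_poly_mult_coeff[OF u d] by (rule norm_sum)
    also have "\<dots> \<le> (\<Sum>l\<le>M. coeff_norm q * (B l / x ^ n))"
      by (intro sum_mono) (unfold norm_mult, intro mult_mono norm_coeff_le B(2) coeff_norm_nonneg norm_ge_zero)
    also have "\<dots> = (\<Sum>l\<le>M. B l) * coeff_norm q / x ^ n"
      by (simp add: sum_distrib_left sum_divide_distrib mult.commute)
    finally show "norm (fc (\<lambda>z. poly q z * u z) n) \<le> (\<Sum>l\<le>M. B l) * coeff_norm q / x ^ n" .
  qed
qed

end

section \<open>The linear system for the denominators\<close>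

locale pade = exterior +
  fixes d :: nat and m :: "nat \<Rightarrow> nat" and F :: "nat \<Rightarrow> complex \<Rightarrow> complex"
  assumes d_pos: "1 \<le> d" and m_pos: "\<And>\<alpha>. \<alpha> \<in> {1..d} \<Longrightarrow> 1 \<le> m \<alpha>"
    and F_analytic: "\<And>\<alpha>. \<alpha> \<in> {1..d} \<Longrightarrow> F \<alpha> analytic_on E"
begin

abbreviation "N \<equiv> msize d m"
abbreviation "V \<equiv> poly_combs d m F"

text \<open>Combinations are given coordinates with respect to the \<open>N\<close> functions z^k
  F_\<alpha>. These are not assumed independent, so coordinates need not be unique.\<close>

definition index_set :: "(nat \<times> nat) set" where "index_set = (SIGMA \<alpha>:{1..d}. {..<m \<alpha>})"
definition bas :: "nat \<times> nat \<Rightarrow> complex \<Rightarrow> complex" where "bas i z = z ^ snd i * F (fst i) z"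

lemma finite_index_set: "finite index_set" and card_index_set: "card index_set = N"
  by (auto simp: index_set_def msize_def)

lemma N_pos: "1 \<le> N"
proof -
  have "m 1 \<le> N" unfolding msize_def using d_pos by (intro member_le_sum) auto
  then show ?thesis using m_pos[of 1] d_pos by auto
qed

lemma bas_analytic: "i \<in> index_set \<Longrightarrow> bas i analytic_on E"
  unfolding bas_def by (intro analytic_intros F_analytic) (auto simp: index_set_def)

lemma V_iff: "G \<in> V \<longleftrightarrow> (\<exists>x. G = (\<lambda>z. \<Sum>i\<in>index_set. x i * bas i z))"
proof
  assume "G \<in> V"
  then obtain v where v: "G = (\<lambda>z. \<Sum>\<alpha>\<in>{1..d}. poly (v \<alpha>) z * F \<alpha> z)" "\<forall>\<alpha>\<in>{1..d}. degree (v \<alpha>) < m \<alpha>"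
    by (auto simp: poly_combs_def)
  have "G z = (\<Sum>i\<in>index_set. coeff (v (fst i)) (snd i) * bas i z)" for z
  proof -
    have "(\<Sum>i\<in>index_set. coeff (v (fst i)) (snd i) * bas i z) = (\<Sum>\<alpha>\<in>{1..d}. \<Sum>k<m \<alpha>. coeff (v \<alpha>) k * (z ^ k * F \<alpha> z))"
      unfolding index_set_def bas_def by (subst sum.Sigma) (auto simp: case_prod_beta)
    also have "\<dots> = (\<Sum>\<alpha>\<in>{1..d}. poly (v \<alpha>) z * F \<alpha> z)"
    proof (rule sum.cong)
      fix \<alpha> assume a: "\<alpha> \<in> {1..d}"
      then have "{..<m \<alpha>} = {..m \<alpha> - 1}" "degree (v \<alpha>) \<le> m \<alpha> - 1" using m_pos[of \<alpha>] v(2) by fastforce+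
      then show "(\<Sum>k<m \<alpha>. coeff (v \<alpha>) k * (z ^ k * F \<alpha> z)) = poly (v \<alpha>) z * F \<alpha> z"
        by (simp add: poly_as_sum_le[of _ "m \<alpha> - 1"] sum_distrib_right mult.assoc)
    qed simp
    finally show ?thesis using v(1) by simp
  qed
  then show "\<exists>x. G = (\<lambda>z. \<Sum>i\<in>index_set. x i * bas i z)" by (intro exI[of _ "\<lambda>i. coeff (v (fst i)) (snd i)"] ext)
next
  assume "\<exists>x. G = (\<lambda>z. \<Sum>i\<in>index_set. x i * bas i z)"
  then obtain x where x: "G = (\<lambda>z. \<Sum>i\<in>index_set. x i * bas i z)" by blast
  define v where "v \<alpha> = (\<Sum>k<m \<alpha>. monom (x (\<alpha>, k)) k)" for \<alpha>
  have "degree (v \<alpha>) < m \<alpha>" if "\<alpha> \<in> {1..d}" for \<alpha>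
    unfolding v_def using m_pos[OF that] by (intro degree_sum_less) (auto intro: le_less_trans[OF degree_monom_le])
  moreover have "G z = (\<Sum>\<alpha>\<in>{1..d}. poly (v \<alpha>) z * F \<alpha> z)" for z
  proof -
    have "(\<Sum>\<alpha>\<in>{1..d}. poly (v \<alpha>) z * F \<alpha> z) = (\<Sum>\<alpha>\<in>{1..d}. \<Sum>k<m \<alpha>. x (\<alpha>, k) * (z ^ k * F \<alpha> z))"
      by (simp add: v_def poly_sum poly_monom sum_distrib_right mult.assoc)
    also have "\<dots> = (\<Sum>i\<in>index_set. x i * bas i z)"
      unfolding index_set_def bas_def by (subst sum.Sigma) (auto simp: case_prod_beta)
    finally show ?thesis by (simp add: x)
  qed
  ultimately show "G \<in> V" unfolding poly_combs_def by blast
qed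

lemma V_lin: "G \<in> V \<Longrightarrow> H \<in> V \<Longrightarrow> (\<lambda>z. a * G z + b * H z) \<in> V"
proof -
  assume "G \<in> V" "H \<in> V"
  then obtain x y where "G = (\<lambda>z. \<Sum>i\<in>index_set. x i * bas i z)" "H = (\<lambda>z. \<Sum>i\<in>index_set. y i * bas i z)"
    by (auto simp: V_iff)
  then show ?thesis unfolding V_iff
    by (intro exI[of _ "\<lambda>i. a * x i + b * y i"]) (simp add: sum_distrib_left sum.distrib ring_distribs mult.assoc)
qed

lemma V_analytic: "G \<in> V \<Longrightarrow> G analytic_on E"
  unfolding V_iff using bas_analytic by (auto intro!: analytic_intros)

definition Sol :: "nat \<Rightarrow> complex poly \<Rightarrow> bool" where
  "Sol n q \<longleftrightarrow> degree q \<le> N \<and> (\<forall>i\<in>index_set. fc (\<lambda>z. poly q z * bas i z) n = 0)"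

lemma Sol_degree: "Sol n q \<Longrightarrow> degree q \<le> N"
  by (simp add: Sol_def)

lemma Sol_V: assumes "Sol n q" "G \<in> V" shows "fc (\<lambda>z. poly q z * G z) n = 0"
proof -
  obtain x where x: "G = (\<lambda>z. \<Sum>i\<in>index_set. x i * bas i z)" using assms by (auto simp: V_iff)
  have "(\<lambda>z. poly q z * G z) = (\<lambda>z. \<Sum>i\<in>index_set. x i * (poly q z * bas i z))"
    by (simp add: x sum_distrib_left mult.left_commute)
  then have "fc (\<lambda>z. poly q z * G z) n = (\<Sum>i\<in>index_set. x i * fc (\<lambda>z. poly q z * bas i z) n)"
    by (simp only:) (rule fc_sum, intro poly_mult_analytic bas_analytic)
  then show ?thesis using assms by (simp add: Sol_def)
qed

lemma Sol_lin:
  assumes "Sol n p" "Sol n q" shows "Sol n (smult a p + smult b q)"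
proof -
  have "fc (\<lambda>z. poly (smult a p + smult b q) z * bas i z) n = 0" if i: "i \<in> index_set" for i
  proof -
    have "fc (\<lambda>z. poly (smult a p + smult b q) z * bas i z) n
        = fc (\<lambda>z. a * (poly p z * bas i z) + b * (poly q z * bas i z)) n"
      by (simp add: algebra_simps)
    also have "\<dots> = a * fc (\<lambda>z. poly p z * bas i z) n + b * fc (\<lambda>z. poly q z * bas i z) n"
      using i by (subst fc_add) (auto intro!: analytic_on_mult poly_mult_analytic bas_analytic simp: fc_cmult poly_mult_analytic bas_analytic)
    finally show ?thesis using assms i by (simp add: Sol_def)
  qed
  moreover have "degree (smult a p + smult b q) \<le> N"
    using assms by (intro degree_add_le order_trans[OF degree_smult_le]) (auto simp: Sol_def)
  ultimately show ?thesis by (simp add: Sol_def)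
qed

lemma bas_pair: "bas (\<alpha>, k) = (\<lambda>z. z ^ k * F \<alpha> z)"
  by (auto simp: bas_def)

lemma pade_faber_imp_Sol:
  assumes "pade_faber E \<Phi> d m F n q p" "1 \<le> n"
  shows "Sol n q" "q \<noteq> 0"
    "\<And>\<alpha> k j. \<alpha> \<in> {1..d} \<Longrightarrow> k < m \<alpha> \<Longrightarrow> j \<le> n \<Longrightarrow> fc (poly (p k \<alpha>)) j = fc (\<lambda>z. poly q z * bas (\<alpha>, k) z) j"
proof -
  show *: "fc (poly (p k \<alpha>)) j = fc (\<lambda>z. poly q z * bas (\<alpha>, k) z) j" if "\<alpha> \<in> {1..d}" "k < m \<alpha>" "j \<le> n" for \<alpha> k j
  proof -
    have "0 = fc (\<lambda>z. poly q z * z ^ k * F \<alpha> z - poly (p k \<alpha>) z) j" using assms that by (auto simp: pade_faber_def)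
    also have "\<dots> = fc (\<lambda>z. poly q z * bas (\<alpha>, k) z - poly (p k \<alpha>) z) j" by (simp add: bas_pair mult.assoc)
    also have "\<dots> = fc (\<lambda>z. poly q z * bas (\<alpha>, k) z) j - fc (poly (p k \<alpha>)) j"
      using that by (intro fc_diff poly_mult_analytic poly_analytic bas_analytic) (auto simp: index_set_def)
    finally show ?thesis by simp
  qed
  show "q \<noteq> 0" using assms by (simp add: pade_faber_def)
  have "fc (\<lambda>z. poly q z * bas i z) n = 0" if i: "i \<in> index_set" for i
  proof -
    obtain \<alpha> k where ik: "i = (\<alpha>, k)" "\<alpha> \<in> {1..d}" "k < m \<alpha>" using i by (auto simp: index_set_def)
    have "degree (p k \<alpha>) \<le> n - 1" using assms ik by (auto simp: pade_faber_def)
    then have "fc (poly (p k \<alpha>)) n = 0" using assms(2) by (intro fc_poly_eq_0) auto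
    then show ?thesis using *[of \<alpha> k n] ik by simp
  qed
  then show "Sol n q" using assms by (auto simp: Sol_def pade_faber_def)
qed

text \<open>The coefficients below \<open>n\<close> can be matched by a numerator for any
  \<open>q\<close>; at index \<open>n\<close> a numerator of degree at most n - 1 contributes
  nothing, which leaves a condition on \<open>q\<close> alone.\<close>

lemma pade_faber_iff:
  assumes "1 \<le> n"
  shows "(\<exists>p. pade_faber E \<Phi> d m F n q p) \<longleftrightarrow> q \<noteq> 0 \<and> Sol n q"
proof
  assume "\<exists>p. pade_faber E \<Phi> d m F n q p"
  then show "q \<noteq> 0 \<and> Sol n q" using pade_faber_imp_Sol assms by blast
next
  assume q: "q \<noteq> 0 \<and> Sol n q"
  have "\<exists>p. degree p \<le> n - 1 \<and> (\<forall>j<n. fc (poly p) j = fc (\<lambda>z. poly q z * bas (\<alpha>, k) z) j)" for k \<alpha>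
    by (rule faber_poly_exists[OF assms])
  note ex = this
  define p where "p k \<alpha> = (SOME p. degree p \<le> n - 1 \<and> (\<forall>j<n. fc (poly p) j = fc (\<lambda>z. poly q z * bas (\<alpha>, k) z) j))" for k \<alpha>
  have p: "degree (p k \<alpha>) \<le> n - 1" "j < n \<Longrightarrow> fc (poly (p k \<alpha>)) j = fc (\<lambda>z. poly q z * bas (\<alpha>, k) z) j" for k \<alpha> j
    using someI_ex[OF ex[of \<alpha> k]] unfolding p_def by auto
  have "fc (\<lambda>z. poly q z * z ^ k * F \<alpha> z - poly (p k \<alpha>) z) j = 0"
    if "\<alpha> \<in> {1..d}" "k < m \<alpha>" "j \<le> n" for \<alpha> k j
  proof -
    have i: "(\<alpha>, k) \<in> index_set" using that by (auto simp: index_set_def)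
    have "fc (\<lambda>z. poly q z * z ^ k * F \<alpha> z - poly (p k \<alpha>) z) j = fc (\<lambda>z. poly q z * bas (\<alpha>, k) z - poly (p k \<alpha>) z) j"
      by (simp add: bas_pair mult.assoc)
    also have "\<dots> = fc (\<lambda>z. poly q z * bas (\<alpha>, k) z) j - fc (poly (p k \<alpha>)) j"
      by (intro fc_diff poly_mult_analytic poly_analytic bas_analytic i)
    also have "\<dots> = 0"
    proof (cases "j = n")
      case True
      have "degree (p k \<alpha>) < n" using p(1)[of k \<alpha>] assms by simp
      then show ?thesis using True q i by (simp add: fc_poly_eq_0 Sol_def)
    next
      case False then show ?thesis using p(2)[of j k \<alpha>] that by simp
    qed
    finally show ?thesis .
  qed
  then show "\<exists>p. pade_faber E \<Phi> d m F n q p"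
    using q p(1) by (intro exI[of _ p]) (auto simp: pade_faber_def Sol_def)
qed

text \<open>The relation is applied to the combination with a pole of order exactly i + 1, with
  \<open>q\<close> expanded at \<xi>. Powers above \<open>i\<close> cancel the pole and give terms
  of size (y/|\<Phi> \<xi>|)^n; the power \<open>i\<close> leaves a simple pole, whose coefficient
  is at least a multiple of |\<Phi> \<xi>|^(-n); the lower powers are controlled by induction on
  \<open>i\<close>.\<close>

theorem Sol_taylor_coeff_bound:
  assumes \<xi>: "\<xi> \<notin> E" and G: "\<And>s. s \<in> {1..t} \<Longrightarrow> G s \<in> V"
    and x: "\<And>s. s \<in> {1..t} \<Longrightarrow> exact_pole (G s) \<xi> s (\<rho> s)"
    and y: "0 < y" "y < 1" "\<And>s. s \<in> {1..t} \<Longrightarrow> ereal (norm (\<Phi> \<xi>) / y) < \<rho> s"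
    and i: "i < t"
  shows "\<exists>C. \<forall>\<^sub>F n in sequentially. \<forall>q. Sol n q \<longrightarrow> norm (taylor_coeff q \<xi> i) \<le> C * y ^ n * coeff_norm q"
  using y i
proof (induction i arbitrary: y rule: less_induct)
  case (less i)
  define a where "a = norm (\<Phi> \<xi>)"
  have a: "1 < a" using norm_Phi[OF \<xi>] by (simp add: a_def)
  obtain x1 where x1: "a / y < x1" "\<And>s. s \<in> {1..t} \<Longrightarrow> ereal x1 < \<rho> s"
  proof -
    have "ereal (a / y) < Min (\<rho> ` {1..t})" using less.prems by (subst Min_gr_iff) (auto simp: a_def)
    then obtain x where x: "ereal (a / y) < ereal x" "ereal x < Min (\<rho> ` {1..t})" using ereal_dense2 by blast
    have "ereal x < \<rho> s" if "s \<in> {1..t}" for s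
      using x(2) that by (subst (asm) Min_gr_iff) auto
    then show ?thesis using that x by auto
  qed
  have ay: "a < a / y" using a less.prems by (simp add: less_divide_eq)
  \<comment> \<open>For powers below \<open>i\<close> the coefficients are bounded only by x2^(-n)
    with x2 < |\<Phi> \<xi>|. This loss is made up for by using the induction hypothesis with a rate
    \<open>y1\<close> slightly better than \<open>y\<close>, available because all the indices
    exceed |\<Phi> \<xi>|/y strictly.\<close>
  define y1 where "y1 = a / x1"
  have x1p: "a < x1" using ay x1 by simp
  have y1: "0 < y1" "y1 < y" "a / y1 = x1"
    using a x1p x1 less.prems by (auto simp: y1_def field_simps)
  obtain x2 where x2: "1 < x2" "x2 < a" "y1 * a / y < x2"
  proof -
    have "y1 * a / y < a" using y1 a less.prems by (simp add: divide_less_eq)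
    then have "max 1 (y1 * a / y) < a" using a by simp
    then show ?thesis using dense that by (metis max_less_iff_conj)
  qed
  define k where "k = i + 1"
  have k: "k \<in> {1..t}" using less.prems by (simp add: k_def)
  have anG: "G k analytic_on E" using V_analytic G k by blast
  define u where "u l = (\<lambda>z. (z - \<xi>) ^ l * G k z)" for l
  have an: "u l analytic_on E" for l unfolding u_def by (intro analytic_intros anG)
  have \<rho>: "ereal a < \<rho> k" "ereal (a / y) < \<rho> k"
    using less.prems(3)[OF k] ay by (auto simp: a_def intro: less_trans[of _ "ereal (a / y)"])
  have lower: "\<exists>c>0. \<forall>\<^sub>F n in sequentially. c / a ^ n \<le> norm (fc (u i) n)"
  proof -
    obtain h where h: "h holomorphic_on D (\<rho> k)" "same_germ E h (\<lambda>z. (z - \<xi>) ^ k * G k z)" "h \<xi> \<noteq> 0"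
      using x[OF k] by (auto simp: exact_pole_def)
    have "same_germ E h (\<lambda>z. (z - \<xi>) * u i z)" using h(2) by (simp add: u_def k_def mult.assoc)
    from simple_pole_lower_bound[OF an h(1) this h(3) \<xi>] show ?thesis using \<rho> unfolding a_def by metis
  qed
  have upper: "\<exists>K. \<forall>\<^sub>F n in sequentially. \<forall>q. Sol n q \<longrightarrow> norm (taylor_coeff q \<xi> l * fc (u l) n) \<le> K * (y / a) ^ n * coeff_norm q"
    if l: "l \<noteq> i" for l
  proof (cases "l < i")
    case True
    obtain C where C: "\<forall>\<^sub>F n in sequentially. \<forall>q. Sol n q \<longrightarrow> norm (taylor_coeff q \<xi> l) \<le> C * y1 ^ n * coeff_norm q"
      using less.IH[OF True, of y1] y1 x1 less.prems True by (auto simp: a_def)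
    have "holo_ext (u l) (ereal a)" unfolding u_def a_def
      using exact_pole_holo_ext_low[OF x[OF k] \<xi> _ anG] \<rho> by (auto simp: a_def)
    moreover have "ereal x2 < ereal a" using x2 by simp
    ultimately obtain B where B: "B > 0" "\<And>n. norm (fc (u l) n) \<le> B / x2 ^ n" using fc_bound[OF an _ x2(1)] by blast
    show ?thesis
    proof (rule exI[of _ "\<bar>C\<bar> * B"])
      show "\<forall>\<^sub>F n in sequentially. \<forall>q. Sol n q \<longrightarrow> norm (taylor_coeff q \<xi> l * fc (u l) n) \<le> \<bar>C\<bar> * B * (y / a) ^ n * coeff_norm q"
        using C
      proof eventually_elim
        case (elim n)
        show ?case
        proof (intro allI impI)
          fix q assume q: "Sol n q"
          have "norm (taylor_coeff q \<xi> l * fc (u l) n) \<le> (\<bar>C\<bar> * y1 ^ n * coeff_norm q) * (B / x2 ^ n)"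
            unfolding norm_mult
          proof (rule mult_mono[OF _ B(2)])
            have "C * (y1 ^ n * coeff_norm q) \<le> \<bar>C\<bar> * (y1 ^ n * coeff_norm q)"
              using y1 coeff_norm_nonneg by (intro mult_right_mono) auto
            moreover have "norm (taylor_coeff q \<xi> l) \<le> C * y1 ^ n * coeff_norm q" using elim q by blast
            ultimately show "norm (taylor_coeff q \<xi> l) \<le> \<bar>C\<bar> * y1 ^ n * coeff_norm q" by (simp only: mult.assoc)
          qed (use y1 coeff_norm_nonneg in auto)
          also have "\<dots> = \<bar>C\<bar> * B * (y1 / x2) ^ n * coeff_norm q" by (simp add: power_divide)
          also have "\<dots> \<le> \<bar>C\<bar> * B * (y / a) ^ n * coeff_norm q"
          proof -
            have "y1 / x2 \<le> y / a" using x2(3) x2(1) a less.prems(1) by (simp add: field_simps)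
            then have "(y1 / x2) ^ n \<le> (y / a) ^ n" using y1 x2 by (intro power_mono) auto
            then show ?thesis using B coeff_norm_nonneg by (intro mult_right_mono mult_left_mono) auto
          qed
          finally show "norm (taylor_coeff q \<xi> l * fc (u l) n) \<le> \<bar>C\<bar> * B * (y / a) ^ n * coeff_norm q" .
        qed
      qed
    qed
  next
    case False
    then have "k \<le> l" using l by (simp add: k_def)
    then have "holo_ext (u l) (\<rho> k)" unfolding u_def by (rule exact_pole_holo_ext_high[OF x[OF k]])
    then obtain B where B: "B > 0" "\<And>n. norm (fc (u l) n) \<le> B / (a / y) ^ n"
      using fc_bound[OF an, of l "\<rho> k" "a / y"] \<rho> ay a by auto
    obtain C where C: "C > 0" "\<And>p. degree p \<le> N \<Longrightarrow> norm (taylor_coeff p \<xi> l) \<le> C * coeff_norm p" using taylor_coeff_bound by metis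
    have "norm (taylor_coeff q \<xi> l * fc (u l) n) \<le> C * B * (y / a) ^ n * coeff_norm q" if "Sol n q" for n q
    proof -
      have "norm (taylor_coeff q \<xi> l * fc (u l) n) \<le> (C * coeff_norm q) * (B / (a / y) ^ n)"
        unfolding norm_mult using C Sol_degree[OF that] B coeff_norm_nonneg[of q] by (intro mult_mono) auto
      then show ?thesis using less.prems a by (simp add: power_divide mult_ac)
    qed
    then show ?thesis by (intro exI[of _ "C * B"]) auto
  qed
  obtain c where c: "c > 0" "\<forall>\<^sub>F n in sequentially. c / a ^ n \<le> norm (fc (u i) n)" using lower by blast
  obtain K where K: "\<And>l. l \<noteq> i \<Longrightarrow> \<forall>\<^sub>F n in sequentially. \<forall>q. Sol n q \<longrightarrow> norm (taylor_coeff q \<xi> l * fc (u l) n) \<le> K l * (y / a) ^ n * coeff_norm q"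
  proof -
    have "\<forall>l. \<exists>K. l \<noteq> i \<longrightarrow> (\<forall>\<^sub>F n in sequentially. \<forall>q. Sol n q \<longrightarrow> norm (taylor_coeff q \<xi> l * fc (u l) n) \<le> K * (y / a) ^ n * coeff_norm q)"
      using upper by blast
    from choice[OF this] show ?thesis using that by blast
  qed
  \<comment> \<open>\<open>i\<close> may exceed \<open>N\<close>; the range is widened so that the
    term of index \<open>i\<close> can be singled out in every case.\<close>
  let ?L = "{..max N i} - {i}"
  have "\<forall>\<^sub>F n in sequentially. \<forall>l\<in>?L. \<forall>q. Sol n q \<longrightarrow> norm (taylor_coeff q \<xi> l * fc (u l) n) \<le> K l * (y / a) ^ n * coeff_norm q"
    by (rule eventually_ball_finite) (use K in auto)
  then have "\<forall>\<^sub>F n in sequentially. \<forall>q. Sol n q \<longrightarrow> norm (taylor_coeff q \<xi> i) \<le> ((\<Sum>l\<in>?L. K l) / c) * y ^ n * coeff_norm q"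
    using c(2)
  proof eventually_elim
    case (elim n)
    show ?case
    proof (intro allI impI)
      fix q assume q: "Sol n q"
      have dq: "degree q \<le> max N i" using Sol_degree[OF q] by simp
      have "0 = (\<Sum>l\<le>max N i. taylor_coeff q \<xi> l * fc (u l) n)"
        using Sol_V[OF q G[OF k]] unfolding fc_poly_mult_taylor_coeff[OF anG dq, of n \<xi>] u_def by simp
      also have "\<dots> = taylor_coeff q \<xi> i * fc (u i) n + (\<Sum>l\<in>?L. taylor_coeff q \<xi> l * fc (u l) n)"
        by (subst sum.remove[of _ i]) auto
      finally have "taylor_coeff q \<xi> i * fc (u i) n = - (\<Sum>l\<in>?L. taylor_coeff q \<xi> l * fc (u l) n)" by (simp add: eq_neg_iff_add_eq_0)
      then have "norm (taylor_coeff q \<xi> i) * norm (fc (u i) n) = norm (\<Sum>l\<in>?L. taylor_coeff q \<xi> l * fc (u l) n)"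
        by (metis norm_minus_cancel norm_mult)
      also have "\<dots> \<le> (\<Sum>l\<in>?L. K l * (y / a) ^ n * coeff_norm q)"
        using elim(1) q by (intro order_trans[OF norm_sum] sum_mono) auto
      also have "\<dots> = (\<Sum>l\<in>?L. K l) * (y / a) ^ n * coeff_norm q" by (simp add: sum_distrib_right)
      finally have "norm (taylor_coeff q \<xi> i) * norm (fc (u i) n) \<le> (\<Sum>l\<in>?L. K l) * (y / a) ^ n * coeff_norm q" .
      moreover have "norm (taylor_coeff q \<xi> i) * (c / a ^ n) \<le> norm (taylor_coeff q \<xi> i) * norm (fc (u i) n)"
        using elim(2) by (intro mult_left_mono) auto
      ultimately have "norm (taylor_coeff q \<xi> i) * (c / a ^ n) \<le> (\<Sum>l\<in>?L. K l) * (y / a) ^ n * coeff_norm q" by linarith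
      then show "norm (taylor_coeff q \<xi> i) \<le> ((\<Sum>l\<in>?L. K l) / c) * y ^ n * coeff_norm q"
        using c(1) a by (simp add: power_divide field_simps)
    qed
  qed
  then show ?case by blast
qed

end

section \<open>Convergence of the denominators and its consequences\<close>

text \<open>At a strict step one vector outside the smaller space is spent on moving the others into it.\<close>

lemma chain_dependent:
  fixes W :: "nat \<Rightarrow> ('i \<Rightarrow> complex) set" and v :: "'j \<Rightarrow> 'i \<Rightarrow> complex"
  assumes lin: "\<And>k x y a b. k \<le> M \<Longrightarrow> x \<in> W k \<Longrightarrow> y \<in> W k \<Longrightarrow> (\<lambda>i. a * x i + b * y i) \<in> W k"
    and step: "\<And>k x y. k < M \<Longrightarrow> x \<in> W k \<Longrightarrow> y \<in> W k \<Longrightarrow>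
       \<exists>a b. (a \<noteq> 0 \<or> b \<noteq> 0) \<and> (\<lambda>i. a * x i + b * y i) \<in> W (Suc k)"
    and last: "W M \<subseteq> {\<lambda>i. 0}"
    and J: "k \<le> M" "finite J" "card {j. k \<le> j \<and> j < M \<and> \<not> W j \<subseteq> W (Suc j)} < card J" "\<And>j. j \<in> J \<Longrightarrow> v j \<in> W k"
  shows "\<exists>c. (\<exists>j\<in>J. c j \<noteq> 0) \<and> (\<forall>i. (\<Sum>j\<in>J. c j * v j i) = 0)"
  using J
proof (induction "M - k" arbitrary: k J v)
  case 0
  then have "k = M" by simp
  then have "v j i = 0" if "j \<in> J" for j i using 0 last that by fastforce
  moreover have "J \<noteq> {}" using 0 by auto
  ultimately show ?case by (intro exI[of _ "\<lambda>_. 1"]) auto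
next
  case (Suc l)
  then have k: "k < M" "l = M - Suc k" "Suc k \<le> M" by auto
  define T where "T k = {j. k \<le> j \<and> j < M \<and> \<not> W j \<subseteq> W (Suc j)}" for k
  have fT: "finite (T k)" for k by (rule finite_subset[of _ "{..<M}"]) (auto simp: T_def)
  have Tk: "card (T k) < card J" using Suc.prems by (simp add: T_def)
  show ?case
  proof (cases "\<forall>j\<in>J. v j \<in> W (Suc k)")
    case True
    have "T (Suc k) \<subseteq> T k" by (auto simp: T_def)
    then have "card (T (Suc k)) < card J" using card_mono[OF fT] Tk le_less_trans by blast
    then show ?thesis using Suc.hyps(1)[OF k(2,3) Suc.prems(2), of v] True by (simp add: T_def)
  next
    case False
    then obtain j0 where j0: "j0 \<in> J" "v j0 \<notin> W (Suc k)" by auto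
    have "k \<in> T k" using k j0 Suc.prems by (auto simp: T_def)
    moreover have "T (Suc k) = T k - {k}" by (auto simp: T_def)
    ultimately have c1: "card (T (Suc k)) < card (J - {j0})"
      using Tk card_Suc_Diff1[OF fT, of k k] card_Suc_Diff1[OF Suc.prems(2) j0(1)] by simp
    have "\<exists>t. (\<lambda>i. v j i + t * v j0 i) \<in> W (Suc k)" if j: "j \<in> J" for j
    proof -
      obtain a b where ab: "a \<noteq> 0 \<or> b \<noteq> 0" "(\<lambda>i. a * v j i + b * v j0 i) \<in> W (Suc k)"
        using step[OF k(1), of "v j" "v j0"] Suc.prems j j0 by blast
      \<comment> \<open>Otherwise a nonzero multiple of \<open>v j0\<close> alone would lie in the
        smaller space.\<close>
      have "a \<noteq> 0"
      proof
        assume "a = 0"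
        then have "(\<lambda>i. inverse b * (a * v j i + b * v j0 i) + 0 * (a * v j i + b * v j0 i)) \<in> W (Suc k)"
          by (intro lin[OF k(3)] ab)
        then show False using \<open>a = 0\<close> ab j0 by (simp add: mult.assoc[symmetric])
      qed
      have "(\<lambda>i. inverse a * (a * v j i + b * v j0 i) + 0 * (a * v j i + b * v j0 i)) \<in> W (Suc k)"
        by (intro lin[OF k(3)] ab)
      moreover have "(\<lambda>i. inverse a * (a * v j i + b * v j0 i) + 0 * (a * v j i + b * v j0 i)) = (\<lambda>i. v j i + (b / a) * v j0 i)"
        using \<open>a \<noteq> 0\<close> by (auto simp: field_simps)
      ultimately show ?thesis by metis
    qed
    then obtain t where t: "\<And>j. j \<in> J \<Longrightarrow> (\<lambda>i. v j i + t j * v j0 i) \<in> W (Suc k)" by metis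
    obtain c where c: "\<exists>j\<in>J - {j0}. c j \<noteq> 0" "\<And>i. (\<Sum>j\<in>J - {j0}. c j * (v j i + t j * v j0 i)) = 0"
      using Suc.hyps(1)[OF k(2,3), of "J - {j0}" "\<lambda>j i. v j i + t j * v j0 i"] Suc.prems c1 t by (auto simp: T_def)
    define c' where "c' j = (if j = j0 then (\<Sum>j\<in>J - {j0}. c j * t j) else c j)" for j
    have "(\<Sum>j\<in>J. c' j * v j i) = 0" for i
    proof -
      have "(\<Sum>j\<in>J. c' j * v j i) = c' j0 * v j0 i + (\<Sum>j\<in>J - {j0}. c' j * v j i)"
        using Suc.prems j0 by (intro sum.remove) auto
      also have "(\<Sum>j\<in>J - {j0}. c' j * v j i) = (\<Sum>j\<in>J - {j0}. c j * v j i)"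
        by (intro sum.cong) (auto simp: c'_def)
      also have "c' j0 * v j0 i = (\<Sum>j\<in>J - {j0}. c j * t j * v j0 i)" by (simp add: c'_def sum_distrib_right)
      also have "\<dots> + (\<Sum>j\<in>J - {j0}. c j * v j i) = (\<Sum>j\<in>J - {j0}. c j * (v j i + t j * v j0 i))"
        by (simp add: sum.distrib[symmetric] algebra_simps)
      finally show ?thesis using c(2) by simp
    qed
    then show ?thesis using c(1) by (intro exI[of _ c']) (auto simp: c'_def)
  qed
qed

text \<open>A list and not a multiset, since the zeros are removed in a prescribed order and the
  remaining factors belong to a tail of the list.\<close>

definition list_poly :: "complex list \<Rightarrow> complex poly" where
  "list_poly zs = prod_list (map (\<lambda>z. [:- z, 1:]) zs)"

lemma list_poly_simps [simp]: "list_poly [] = 1" "list_poly (z # zs) = [:- z, 1:] * list_poly zs" "list_poly (xs @ ys) = list_poly xs * list_poly ys"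
  by (simp_all add: list_poly_def)

lemma list_poly_replicate: "list_poly (replicate t z) = [:- z, 1:] ^ t"
  by (induction t) auto

lemma poly_list_poly_eq_0_iff: "poly (list_poly zs) z = 0 \<longleftrightarrow> z \<in> set zs"
  by (induction zs) auto

lemma list_poly_ne_0: "list_poly zs \<noteq> 0"
  by (auto simp: list_poly_def prod_list_zero_iff)

lemma degree_list_poly: "degree (list_poly zs) = length zs"
proof (induction zs)
  case (Cons z zs)
  then show ?case unfolding list_poly_simps using list_poly_ne_0[of zs] by (subst degree_mult_eq) auto
qed auto

context pade
begin

definition gen :: "(nat \<times> nat \<Rightarrow> complex) \<Rightarrow> complex \<Rightarrow> complex" where
  "gen x z = (\<Sum>i\<in>index_set. x i * bas i z)"

lemma gen_V: "gen x \<in> V"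
  unfolding V_iff gen_def[abs_def] by blast

lemma gen_lin: "gen (\<lambda>i. a * x i + b * y i) z = a * gen x z + b * gen y z"
  by (simp add: gen_def sum_distrib_left sum.distrib ring_distribs mult.assoc)

text \<open>The bound is relative to the norm of \<open>q\<close> and holds for all solutions, not
  only monic ones: both uniqueness and boundedness of the monic solutions are drawn from it. It
  comes from the Taylor bounds at all zeros together with \<open>hermite_stability\<close>.\<close>

theorem Sol_convergence:
  assumes Z: "finite Z" "Z \<inter> E = {}" "(\<Sum>\<xi>\<in>Z. \<tau> \<xi>) = N" and y: "0 < y" "y < 1"
    and sys: "\<And>\<xi> s. \<xi> \<in> Z \<Longrightarrow> s \<in> {1..\<tau> \<xi>} \<Longrightarrow> \<exists>G\<in>V. \<exists>\<rho>. ereal (norm (\<Phi> \<xi>) / y) < \<rho> \<and> exact_pole G \<xi> s \<rho>"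
  shows "\<exists>C>0. \<forall>\<^sub>F n in sequentially. \<forall>q. Sol n q \<longrightarrow>
      coeff_norm (q - smult (coeff q N) (root_poly Z \<tau>)) \<le> C * y ^ n * coeff_norm q"
proof -
  define Pr where "Pr = (SIGMA \<xi>:Z. {..<\<tau> \<xi>})"
  have fPr: "finite Pr" using Z by (simp add: Pr_def)
  have "\<exists>C. \<forall>\<^sub>F n in sequentially. \<forall>q. Sol n q \<longrightarrow> norm (taylor_coeff q (fst pr) (snd pr)) \<le> C * y ^ n * coeff_norm q" if pr: "pr \<in> Pr" for pr
  proof -
    obtain \<xi> i where p: "pr = (\<xi>, i)" "\<xi> \<in> Z" "i < \<tau> \<xi>" using pr by (auto simp: Pr_def)
    have "\<forall>s\<in>{1..\<tau> \<xi>}. \<exists>Gr. fst Gr \<in> V \<and> ereal (norm (\<Phi> \<xi>) / y) < snd Gr \<and> exact_pole (fst Gr) \<xi> s (snd Gr)"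
      using sys[OF p(2)] by fastforce
    from bchoice[OF this] obtain Gr where Gr: "\<forall>s\<in>{1..\<tau> \<xi>}. fst (Gr s) \<in> V \<and> ereal (norm (\<Phi> \<xi>) / y) < snd (Gr s) \<and> exact_pole (fst (Gr s)) \<xi> s (snd (Gr s))" ..
    have "\<exists>C. \<forall>\<^sub>F n in sequentially. \<forall>q. Sol n q \<longrightarrow> norm (taylor_coeff q \<xi> i) \<le> C * y ^ n * coeff_norm q"
      by (rule Sol_taylor_coeff_bound[where t = "\<tau> \<xi>" and G = "\<lambda>s. fst (Gr s)" and \<rho> = "\<lambda>s. snd (Gr s)"])
        (use Gr p y Z in auto)
    then show ?thesis by (simp add: p)
  qed
  then have "\<forall>pr\<in>Pr. \<exists>C. \<forall>\<^sub>F n in sequentially. \<forall>q. Sol n q \<longrightarrow> norm (taylor_coeff q (fst pr) (snd pr)) \<le> C * y ^ n * coeff_norm q" by blast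
  from bchoice[OF this] obtain C where C: "\<And>pr. pr \<in> Pr \<Longrightarrow> \<forall>\<^sub>F n in sequentially. \<forall>q. Sol n q \<longrightarrow> norm (taylor_coeff q (fst pr) (snd pr)) \<le> C pr * y ^ n * coeff_norm q" by blast
  define K where "K = (\<Sum>pr\<in>Pr. \<bar>C pr\<bar>) + 1"
  have K: "K > 0" "\<And>pr. pr \<in> Pr \<Longrightarrow> C pr \<le> K"
  proof -
    show "K > 0" unfolding K_def by (intro add_nonneg_pos sum_nonneg) auto
    show "C pr \<le> K" if "pr \<in> Pr" for pr
      using member_le_sum[OF that, of "\<lambda>pr. \<bar>C pr\<bar>"] fPr unfolding K_def by (smt (verit))
  qed
  obtain H where H: "H > 0" "\<And>p b. degree p \<le> N \<Longrightarrow> (\<And>\<xi> i. \<xi> \<in> Z \<Longrightarrow> i < \<tau> \<xi> \<Longrightarrow> norm (taylor_coeff p \<xi> i) \<le> b) \<Longrightarrow> 0 \<le> b \<Longrightarrow>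
     coeff_norm (p - smult (coeff p N) (root_poly Z \<tau>)) \<le> H * b"
    using hermite_stability[OF Z(1), of \<tau>] unfolding Z(3) by blast
  have "\<forall>\<^sub>F n in sequentially. \<forall>pr\<in>Pr. \<forall>q. Sol n q \<longrightarrow> norm (taylor_coeff q (fst pr) (snd pr)) \<le> C pr * y ^ n * coeff_norm q"
    by (rule eventually_ball_finite[OF fPr]) (use C in auto)
  then have "\<forall>\<^sub>F n in sequentially. \<forall>q. Sol n q \<longrightarrow>
      coeff_norm (q - smult (coeff q N) (root_poly Z \<tau>)) \<le> (H * K) * y ^ n * coeff_norm q"
  proof eventually_elim
    case (elim n)
    show ?case
    proof (intro allI impI)
      fix q assume q: "Sol n q"
      have "coeff_norm (q - smult (coeff q N) (root_poly Z \<tau>)) \<le> H * (K * (y ^ n * coeff_norm q))"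
      proof (rule H(2)[OF Sol_degree[OF q]])
        fix \<xi> i assume "\<xi> \<in> Z" "i < \<tau> \<xi>"
        then have pr: "(\<xi>, i) \<in> Pr" by (simp add: Pr_def)
        have "norm (taylor_coeff q \<xi> i) \<le> C (\<xi>, i) * (y ^ n * coeff_norm q)" using elim pr q by (fastforce simp: mult.assoc)
        also have "\<dots> \<le> K * (y ^ n * coeff_norm q)"
          using K(2)[OF pr] y coeff_norm_nonneg by (intro mult_right_mono) auto
        finally show "norm (taylor_coeff q \<xi> i) \<le> K * (y ^ n * coeff_norm q)" .
      qed (use K y coeff_norm_nonneg in auto)
      then show "coeff_norm (q - smult (coeff q N) (root_poly Z \<tau>)) \<le> (H * K) * y ^ n * coeff_norm q" by (simp add: mult.assoc)
    qed
  qed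
  then show ?thesis using H K by (intro exI[of _ "H * K"]) auto
qed

text \<open>Once C y^n < 1/2, a solution with vanishing top coefficient has norm at most half of its
  own norm and is zero. Hence monic solutions have degree exactly \<open>N\<close>, and the same
  inequality bounds their norm by twice that of \<open>root_poly\<close>.\<close>

corollary Sol_unique_rate:
  assumes Z: "finite Z" "Z \<inter> E = {}" "(\<Sum>\<xi>\<in>Z. \<tau> \<xi>) = N" and y: "0 < y" "y < 1"
    and sys: "\<And>\<xi> s. \<xi> \<in> Z \<Longrightarrow> s \<in> {1..\<tau> \<xi>} \<Longrightarrow> \<exists>G\<in>V. \<exists>\<rho>. ereal (norm (\<Phi> \<xi>) / y) < \<rho> \<and> exact_pole G \<xi> s \<rho>"
  shows "\<forall>\<^sub>F n in sequentially. \<forall>q. Sol n q \<and> coeff q N = 0 \<longrightarrow> q = 0"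
    "\<exists>C. \<forall>\<^sub>F n in sequentially. \<forall>q. Sol n q \<and> lead_coeff q = 1 \<longrightarrow>
       degree q = N \<and> coeff_norm (q - root_poly Z \<tau>) \<le> C * y ^ n"
proof -
  obtain C where C: "C > 0" "\<forall>\<^sub>F n in sequentially. \<forall>q. Sol n q \<longrightarrow>
      coeff_norm (q - smult (coeff q N) (root_poly Z \<tau>)) \<le> C * y ^ n * coeff_norm q"
    using Sol_convergence[OF assms] by blast
  have "(\<lambda>n. C * y ^ n) \<longlonglongrightarrow> C * 0" using y by (intro tendsto_intros LIMSEQ_realpow_zero) auto
  then have small: "\<forall>\<^sub>F n in sequentially. C * y ^ n < 1/2" by (intro order_tendstoD) auto
  show zero: "\<forall>\<^sub>F n in sequentially. \<forall>q. Sol n q \<and> coeff q N = 0 \<longrightarrow> q = 0"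
    using C(2) small
  proof eventually_elim
    case (elim n)
    show ?case
    proof (intro allI impI)
      fix q assume q: "Sol n q \<and> coeff q N = 0"
      then have "coeff_norm q \<le> C * y ^ n * coeff_norm q" using elim(1)[rule_format, of q] by simp
      also have "\<dots> \<le> 1/2 * coeff_norm q" using elim(2) coeff_norm_nonneg by (intro mult_right_mono) auto
      finally show "q = 0" using coeff_norm_nonneg[of q] coeff_norm_eq_0_iff[of q] by simp
    qed
  qed
  have "\<forall>\<^sub>F n in sequentially. \<forall>q. Sol n q \<and> lead_coeff q = 1 \<longrightarrow>
       degree q = N \<and> coeff_norm (q - root_poly Z \<tau>) \<le> (2 * C * coeff_norm (root_poly Z \<tau>)) * y ^ n"
    using C(2) small zero
  proof eventually_elim
    case (elim n)
    show ?case
    proof (intro allI impI)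
      fix q assume q: "Sol n q \<and> lead_coeff q = 1"
      then have "coeff q N \<noteq> 0" using elim(3) by force
      then have "N \<le> degree q" by (rule le_degree)
      then have dq: "degree q = N" using q Sol_degree by fastforce
      then have c1: "coeff q N = 1" using q by simp
      have 1: "coeff_norm (q - root_poly Z \<tau>) \<le> C * y ^ n * coeff_norm q"
        using elim(1)[rule_format, of q] q c1 by simp
      also have "\<dots> \<le> 1/2 * coeff_norm q" using elim(2) coeff_norm_nonneg by (intro mult_right_mono) auto
      finally have "coeff_norm (q - root_poly Z \<tau>) \<le> 1/2 * coeff_norm q" .
      moreover have "coeff_norm q \<le> coeff_norm (q - root_poly Z \<tau>) + coeff_norm (root_poly Z \<tau>)"
        using coeff_norm_add[of "q - root_poly Z \<tau>" "root_poly Z \<tau>"] by simp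
      ultimately have "coeff_norm q \<le> 2 * coeff_norm (root_poly Z \<tau>)" by simp
      then have "C * y ^ n * coeff_norm q \<le> C * y ^ n * (2 * coeff_norm (root_poly Z \<tau>))"
        using C y by (intro mult_left_mono) auto
      then show "degree q = N \<and> coeff_norm (q - root_poly Z \<tau>) \<le> (2 * C * coeff_norm (root_poly Z \<tau>)) * y ^ n"
        using 1 dq by (simp add: mult_ac)
    qed
  qed
  then show "\<exists>C. \<forall>\<^sub>F n in sequentially. \<forall>q. Sol n q \<and> lead_coeff q = 1 \<longrightarrow>
       degree q = N \<and> coeff_norm (q - root_poly Z \<tau>) \<le> C * y ^ n" by blast
qed

end

text \<open>A limsup below \<theta> enters as an eventual inequality without a constant. The locale
  serves the unknown limit in (b) and also the system polynomial, when a convergence that is too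
  fast is to be refuted.\<close>

locale pade_limit = pade +
  fixes Q :: "nat \<Rightarrow> complex poly" and R :: "complex poly" and \<theta> :: real
  assumes Q_Sol: "\<And>n. 1 \<le> n \<Longrightarrow> Sol n (Q n)" and Q_monic: "\<And>n. 1 \<le> n \<Longrightarrow> lead_coeff (Q n) = 1"
    and degree_R: "degree R = N" and \<theta>: "0 < \<theta>" "\<theta> < 1"
    and Q_limit: "\<forall>\<^sub>F n in sequentially. coeff_norm (Q n - R) \<le> \<theta> ^ n"
begin

lemma Q_coeff_limit: "(\<lambda>n. coeff (Q n) i) \<longlonglongrightarrow> coeff R i"
proof -
  have "(\<lambda>n. coeff (Q n) i - coeff R i) \<longlonglongrightarrow> 0"
  proof (rule Lim_null_comparison)
    show "\<forall>\<^sub>F n in sequentially. norm (coeff (Q n) i - coeff R i) \<le> \<theta> ^ n"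
      using Q_limit by eventually_elim (metis coeff_diff norm_coeff_le order_trans)
    show "(\<lambda>n. \<theta> ^ n) \<longlonglongrightarrow> 0" using \<theta> by (intro LIMSEQ_realpow_zero) auto
  qed
  then show ?thesis by (rule LIM_zero_cancel)
qed

lemma R_ne_0: "R \<noteq> 0"
  using degree_R N_pos by auto

lemma Q_degree: "\<forall>\<^sub>F n in sequentially. degree (Q n) = N"
  and R_monic: "lead_coeff R = 1"
proof -
  have "coeff R N \<noteq> 0" using R_ne_0 degree_R by (metis leading_coeff_0_iff)
  then have "\<forall>\<^sub>F n in sequentially. coeff (Q n) N \<noteq> 0" using tendsto_imp_eventually_ne[OF Q_coeff_limit] by blast
  then show ev: "\<forall>\<^sub>F n in sequentially. degree (Q n) = N"
    using eventually_ge_at_top[of 1]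
  proof eventually_elim
    case (elim n)
    then show ?case using le_degree[of "Q n" N] Sol_degree[OF Q_Sol[of n]] by simp
  qed
  have "\<forall>\<^sub>F n in sequentially. coeff (Q n) N = 1"
    using ev eventually_ge_at_top[of 1]
  proof eventually_elim
    case (elim n)
    then show ?case using Q_monic[OF elim(2)] by simp
  qed
  then have "(\<lambda>n. coeff (Q n) N) \<longlonglongrightarrow> 1" by (rule tendsto_eventually)
  then show "lead_coeff R = 1" using LIMSEQ_unique[OF Q_coeff_limit] degree_R by auto
qed

lemma Q_bounded: "\<forall>\<^sub>F n in sequentially. coeff_norm (Q n) \<le> coeff_norm R + 1"
  using Q_limit
proof eventually_elim
  case (elim n)
  have "\<theta> ^ n \<le> 1" using \<theta> by (intro power_le_one) auto
  then show ?case using coeff_norm_add[of "Q n - R" R] elim by simp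
qed

text \<open>The relation for \<open>G\<close> gives [R G]_n = - [(Q_n - R) G]_n. The norm of Q_n - R
  supplies \<theta>^n and the continuation of \<open>G\<close> supplies x'^(-n) for every x' <
  r.\<close>

lemma gain:
  assumes G: "G \<in> V" "holo_ext G (ereal r)" "1 < r"
  shows "holo_ext (\<lambda>z. poly R z * G z) (ereal (r / \<theta>))"
proof (rule holo_ext_if_fc_bound)
  have an: "G analytic_on E" using V_analytic G by blast
  show "(\<lambda>z. poly R z * G z) analytic_on E" by (rule poly_mult_analytic[OF an])
  have "r < r / \<theta>" using \<theta> G by (simp add: less_divide_eq)
  then show "1 < ereal (r / \<theta>)" using G by simp
  fix x assume x: "1 < x" "ereal x < ereal (r / \<theta>)"
  then have "x * \<theta> < r" using \<theta> by (simp add: less_divide_eq)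
  then obtain x' where x': "max 1 (x * \<theta>) < x'" "x' < r" using G dense by (metis max_less_iff_conj)
  then have "1 < x'" "x * \<theta> < x'" by auto
  obtain B where B: "B > 0" "\<And>n q. degree q \<le> N \<Longrightarrow> norm (fc (\<lambda>z. poly q z * G z) n) \<le> B * coeff_norm q / x' ^ n"
    using fc_poly_mult_bound[OF an G(2) \<open>1 < x'\<close>, of N] x' by auto
  have "\<forall>\<^sub>F n in sequentially. norm (fc (\<lambda>z. poly R z * G z) n) \<le> B / x ^ n"
    using Q_limit eventually_ge_at_top[of 1]
  proof eventually_elim
    case (elim n)
    have "fc (\<lambda>z. poly (Q n - R) z * G z) n = fc (\<lambda>z. poly (Q n) z * G z - poly R z * G z) n" by (simp add: algebra_simps)
    also have "\<dots> = - fc (\<lambda>z. poly R z * G z) n"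
      using Sol_V[OF Q_Sol[OF elim(2)] G(1)] by (subst fc_diff) (auto intro: poly_mult_analytic an)
    finally have "norm (fc (\<lambda>z. poly R z * G z) n) = norm (fc (\<lambda>z. poly (Q n - R) z * G z) n)" by simp
    also have "\<dots> \<le> B * coeff_norm (Q n - R) / x' ^ n"
      using Sol_degree[OF Q_Sol[OF elim(2)]] degree_R by (intro B degree_diff_le) auto
    also have "\<dots> \<le> B * \<theta> ^ n / x' ^ n"
      using elim B \<open>1 < x'\<close> by (intro divide_right_mono mult_left_mono) auto
    also have "\<dots> = B * (\<theta> / x') ^ n" by (simp add: power_divide)
    also have "\<dots> \<le> B * (1 / x) ^ n"
      using \<open>x * \<theta> < x'\<close> \<open>1 < x'\<close> x \<theta> B by (intro mult_left_mono power_mono) (auto simp: field_simps)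
    finally show ?case by (simp add: power_divide)
  qed
  then show "\<exists>B. \<forall>\<^sub>F n in sequentially. norm (fc (\<lambda>z. poly R z * G z) n) \<le> B / x ^ n" by blast
qed

text \<open>The Taylor coefficients of \<open>Q n\<close> at \<xi> below order \<open>t\<close> tend
  to 0 by \<open>Sol_taylor_coeff_bound\<close>, but also to those of \<open>R\<close>.\<close>

lemma order_le:
  assumes \<xi>: "\<xi> \<notin> E" and sys: "\<And>s. s \<in> {1..t} \<Longrightarrow> \<exists>G\<in>V. \<exists>\<rho>. ereal (norm (\<Phi> \<xi>)) < \<rho> \<and> exact_pole G \<xi> s \<rho>"
  shows "t \<le> order \<xi> R"
proof -
  have "\<forall>s\<in>{1..t}. \<exists>Gr. fst Gr \<in> V \<and> ereal (norm (\<Phi> \<xi>)) < snd Gr \<and> exact_pole (fst Gr) \<xi> s (snd Gr)"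
    using sys by fastforce
  from bchoice[OF this] obtain Gr where Gr: "\<forall>s\<in>{1..t}. fst (Gr s) \<in> V \<and> ereal (norm (\<Phi> \<xi>)) < snd (Gr s) \<and> exact_pole (fst (Gr s)) \<xi> s (snd (Gr s))" ..
  define a where "a = norm (\<Phi> \<xi>)"
  have a: "1 < a" using norm_Phi[OF \<xi>] by (simp add: a_def)
  obtain x where x: "a < x" "\<And>s. s \<in> {1..t} \<Longrightarrow> ereal x < snd (Gr s)"
  proof -
    have "ereal a < Min (insert \<infinity> ((\<lambda>s. snd (Gr s)) ` {1..t}))" using Gr by (subst Min_gr_iff) (auto simp: a_def)
    then obtain x where x: "ereal a < ereal x" "ereal x < Min (insert \<infinity> ((\<lambda>s. snd (Gr s)) ` {1..t}))" using ereal_dense2 by blast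
    have "ereal x < snd (Gr s)" if "s \<in> {1..t}" for s
      using x(2) that by (subst (asm) Min_gr_iff) auto
    then show ?thesis using that[of x] x(1) by auto
  qed
  define y where "y = a / x"
  have y: "0 < y" "y < 1" "a / y = x" using a x by (auto simp: y_def)
  have "taylor_coeff R \<xi> i = 0" if i: "i < t" for i
  proof -
    obtain C where C: "\<forall>\<^sub>F n in sequentially. \<forall>q. Sol n q \<longrightarrow> norm (taylor_coeff q \<xi> i) \<le> C * y ^ n * coeff_norm q"
      using Sol_taylor_coeff_bound[OF \<xi>, of t "\<lambda>s. fst (Gr s)" "\<lambda>s. snd (Gr s)" y i] Gr y x i unfolding a_def[symmetric] by auto
    obtain K where K: "K > 0" "\<And>p. degree p \<le> N \<Longrightarrow> norm (taylor_coeff p \<xi> i) \<le> K * coeff_norm p" using taylor_coeff_bound by metis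
    have "\<forall>\<^sub>F n in sequentially. norm (taylor_coeff R \<xi> i) \<le> \<bar>C\<bar> * (coeff_norm R + 1) * y ^ n + K * \<theta> ^ n"
      using C Q_bounded Q_limit eventually_ge_at_top[of 1]
    proof eventually_elim
      case (elim n)
      have "norm (taylor_coeff (Q n) \<xi> i) \<le> C * (y ^ n * coeff_norm (Q n))" using elim Q_Sol by (simp add: mult.assoc)
      also have "\<dots> \<le> \<bar>C\<bar> * (y ^ n * (coeff_norm R + 1))"
        using elim y coeff_norm_nonneg by (intro mult_mono) auto
      finally have 1: "norm (taylor_coeff (Q n) \<xi> i) \<le> \<bar>C\<bar> * (coeff_norm R + 1) * y ^ n" by (simp add: mult_ac)
      have "norm (taylor_coeff (Q n - R) \<xi> i) \<le> K * coeff_norm (Q n - R)"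
        using Sol_degree[OF Q_Sol[OF elim(4)]] degree_R by (intro K degree_diff_le) auto
      also have "\<dots> \<le> K * \<theta> ^ n" using elim K by simp
      finally have 2: "norm (taylor_coeff (Q n) \<xi> i - taylor_coeff R \<xi> i) \<le> K * \<theta> ^ n" by (simp add: taylor_coeff_diff)
      show ?case using 1 2 norm_triangle_sub[of "taylor_coeff R \<xi> i" "taylor_coeff (Q n) \<xi> i"] by (simp add: norm_minus_commute)
    qed
    moreover have "(\<lambda>n. \<bar>C\<bar> * (coeff_norm R + 1) * y ^ n + K * \<theta> ^ n) \<longlonglongrightarrow> \<bar>C\<bar> * (coeff_norm R + 1) * 0 + K * 0"
      using y \<theta> by (intro tendsto_intros LIMSEQ_realpow_zero) auto
    ultimately have "norm (taylor_coeff R \<xi> i) \<le> \<bar>C\<bar> * (coeff_norm R + 1) * 0 + K * 0"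
      by (intro tendsto_lowerbound[OF _ _ sequentially_bot]) auto
    then show ?thesis by simp
  qed
  then have "[:- \<xi>, 1:] ^ t dvd R" by (simp add: linear_power_dvd_iff_taylor_coeff)
  then show ?thesis using R_ne_0 by (simp add: order_divides)
qed

text \<open>Let \<open>R0\<close> be the index of the product \<open>u\<close> of \<open>G\<close>
  with the remaining factors. If it were finite and did not exceed the next level, no remaining zero
  would lie in \<open>D R0\<close>; so \<open>G\<close> itself would continue there, and
  \<open>R * G\<close> to index R0/\<theta> by \<open>gain\<close>. The factors by which
  \<open>R * G\<close> and \<open>u\<close> differ have their zeros in \<open>E\<close> or at levels
  below \<rho>, hence inside \<open>D R0\<close>, and dividing by them would continue
  \<open>u\<close> beyond its index.\<close>

lemma bootstrap:
  assumes Rf: "R = P0 * list_poly zs" "\<And>z. poly P0 z = 0 \<Longrightarrow> z \<in> E"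
    and zs: "set zs \<inter> E = {}" "sorted (map (\<lambda>z. norm (\<Phi> z)) zs)"
    and G: "G \<in> V" and k: "k \<le> length zs"
    and h: "holo_ext (\<lambda>z. poly (list_poly (drop k zs)) z * G z) \<rho>" "1 < \<rho>" "0 < k \<Longrightarrow> ereal (norm (\<Phi> (zs ! (k - 1)))) < \<rho>"
  shows "if k < length zs then \<exists>r. ereal (norm (\<Phi> (zs ! k))) < r \<and> holo_ext (\<lambda>z. poly (list_poly (drop k zs)) z * G z) r
     else holo_ext G \<infinity>"
proof -
  define u where "u = (\<lambda>z. poly (list_poly (drop k zs)) z * G z)"
  have an: "G analytic_on E" using V_analytic G by blast
  have anu: "u analytic_on E" unfolding u_def by (rule poly_mult_analytic[OF an])
  define R0 where "R0 = mero_index E \<Phi> 0 u"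
  have R0: "holo_ext u R0" "1 < R0" "\<rho> \<le> R0"
    using mero_index_holo_ext[OF anu] h by (auto simp: R0_def u_def)
  \<comment> \<open>With no zero left there is no next level, and the same argument excludes every
    finite index.\<close>
  define a where "a = (if k < length zs then ereal (norm (\<Phi> (zs ! k))) else \<infinity>)"
  have main: "a < R0 \<or> R0 = \<infinity>"
  proof (rule ccontr)
    assume neg: "\<not> ?thesis"
    then obtain r where r: "R0 = ereal r" using R0(2) by (cases R0) auto
    have r1: "1 < r" using R0(2) r by simp
    have hG: "holo_ext G R0"
    proof (rule holo_ext_divide_no_zero[OF an R0(1)[unfolded u_def] R0(2) _ list_poly_ne_0])
      fix z assume z: "z \<in> D R0"
      show "poly (list_poly (drop k zs)) z \<noteq> 0"
      proof
        assume "poly (list_poly (drop k zs)) z = 0"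
        then have "z \<in> set (drop k zs)" by (simp add: poly_list_poly_eq_0_iff)
        then obtain i where i: "i < length (drop k zs)" "z = drop k zs ! i" by (auto simp: in_set_conv_nth)
        define j where "j = k + i"
        have j: "z = zs ! j" "k \<le> j" "j < length zs" using i by (auto simp: j_def)
        then have "norm (\<Phi> (zs ! k)) \<le> norm (\<Phi> z)" using sorted_nth_mono[OF zs(2) j(2)] by simp
        moreover have "R0 \<le> ereal (norm (\<Phi> (zs ! k)))" using neg j by (auto simp: a_def not_less)
        ultimately have "R0 \<le> ereal (norm (\<Phi> z))" by (metis ereal_less_eq(3) order_trans)
        moreover have "z \<notin> E" using nth_mem[OF j(3)] j(1) zs(1) by auto
        ultimately show False using z by (simp add: in_D)
      qed
    qed
    have "holo_ext (\<lambda>z. poly R z * G z) (ereal (r / \<theta>))" using gain[OF G] hG r r1 by simp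
    moreover have "(\<lambda>z. poly R z * G z) = (\<lambda>z. poly (P0 * list_poly (take k zs)) z * u z)"
    proof -
      have "list_poly zs = list_poly (take k zs) * list_poly (drop k zs)" using list_poly_simps(3)[of "take k zs" "drop k zs"] by simp
      then show ?thesis by (simp add: Rf(1) u_def mult.assoc)
    qed
    ultimately have h2: "holo_ext (\<lambda>z. poly (P0 * list_poly (take k zs)) z * u z) (ereal (r / \<theta>))" by simp
    have rr: "r < r / \<theta>" using \<theta> r1 by (simp add: less_divide_eq)
    have "holo_ext u (ereal (r / \<theta>))"
    proof (rule holo_ext_divide[OF R0(1,2) h2])
      show "1 < ereal (r / \<theta>)" using rr r1 by simp
      show "P0 * list_poly (take k zs) \<noteq> 0" using R_ne_0 Rf list_poly_ne_0 by auto
      fix z assume "poly (P0 * list_poly (take k zs)) z = 0"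
      then consider "z \<in> E" | "z \<in> set (take k zs)" using Rf(2) by (auto simp: poly_list_poly_eq_0_iff)
      then show "z \<in> D R0"
      proof cases
        case 1 then show ?thesis using E_sub_D by blast
      next
        case 2
        then obtain j where j: "z = zs ! j" "j < k" "j < length zs" by (auto simp: in_set_conv_nth)
        then have "norm (\<Phi> z) \<le> norm (\<Phi> (zs ! (k - 1)))" using sorted_nth_mono[OF zs(2), of j "k - 1"] k by auto
        then have "ereal (norm (\<Phi> z)) \<le> ereal (norm (\<Phi> (zs ! (k - 1))))" by simp
        also have "\<dots> < \<rho>" using h(3) j by simp
        also have "\<rho> \<le> R0" by (rule R0(3))
        finally have "ereal (norm (\<Phi> z)) < R0" .
        moreover have "z \<notin> E" using nth_mem[OF j(3)] j(1) zs(1) by auto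
        ultimately show ?thesis by (simp add: in_D)
      qed
    qed
    then have "ereal (r / \<theta>) \<le> R0" using mero_index_holo_ext(3)[OF anu] rr r1 by (simp add: R0_def)
    then show False using rr r by simp
  qed
  show ?thesis
  proof (cases "k < length zs")
    case True
    then show ?thesis using main R0(1) by (auto simp: a_def u_def intro!: exI[of _ R0])
  next
    case False
    then have "R0 = \<infinity>" using main by (auto simp: a_def)
    then show ?thesis using R0(1) False k by (simp add: u_def)
  qed
qed

end

section \<open>Entire combinations vanish\<close>

text \<open>Decay faster than every geometric sequence allows the rate \<open>X\<close> to be chosen
  after \<open>C\<close>. It is taken so large that q = 3/X satisfies C q/(1 - q) \<le> 1/2, which
  makes the recursion a contraction.\<close>

lemma superexponential_recursion_zero:
  fixes b :: "nat \<Rightarrow> real"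
  assumes b: "\<And>l. 0 \<le> b l" and C: "0 \<le> C"
    and rec: "\<And>m. m0 \<le> m \<Longrightarrow> b m \<le> C / 3 ^ m * (\<Sum>l. b (l + Suc m) * 3 ^ (l + Suc m))"
    and decay: "\<And>X. 0 < X \<Longrightarrow> \<exists>B. \<forall>l. b l \<le> B / X ^ l"
    and m: "m0 \<le> m"
  shows "b m = 0"
proof -
  define q where "q = 1 / (2 * C + 2)"
  define X where "X = 3 / q"
  have q: "0 < q" "q < 1" "C * (q / (1 - q)) \<le> 1/2"
  proof -
    show "0 < q" "q < 1" using C by (auto simp: q_def)
    have "q / (1 - q) = 1 / (2 * C + 1)" using C by (simp add: q_def field_simps)
    then show "C * (q / (1 - q)) \<le> 1/2" using C by (simp add: divide_le_eq)
  qed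
  have X: "0 < X" "3 / X = q" using q by (auto simp: X_def)
  obtain B where B: "\<And>l. b l \<le> B / X ^ l" using decay[OF X(1)] by blast
  have B0: "0 \<le> B" using B[of 0] b[of 0] by simp
  have claim: "\<forall>m\<ge>m0. b m \<le> (B / 2 ^ k) / X ^ m" for k \<comment> \<open>each pass through the recursion halves the constant\<close>
  proof (induction k)
    case 0 then show ?case using B by simp
  next
    case (Suc k)
    define A where "A = B / 2 ^ k"
    show ?case
    proof (intro allI impI)
      fix m assume m: "m0 \<le> m"
      have g: "(\<lambda>l. A * q ^ Suc m * q ^ l) sums (A * q ^ Suc m * (1 / (1 - q)))"
        using q by (intro sums_mult geometric_sums) auto
      have le: "b (l + Suc m) * 3 ^ (l + Suc m) \<le> A * q ^ Suc m * q ^ l" for l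
      proof -
        have "b (l + Suc m) * 3 ^ (l + Suc m) \<le> A / X ^ (l + Suc m) * 3 ^ (l + Suc m)"
          using Suc.IH[rule_format, of "l + Suc m"] m unfolding A_def by (intro mult_right_mono) auto
        also have "\<dots> = A * q ^ (l + Suc m)" unfolding X(2)[symmetric] by (simp only: power_divide) simp
        finally show ?thesis by (simp add: power_add mult_ac)
      qed
      have nn: "0 \<le> b (l + Suc m) * 3 ^ (l + Suc m)" for l using b by simp
      have "summable (\<lambda>l. b (l + Suc m) * 3 ^ (l + Suc m))"
        by (rule summable_comparison_test'[OF sums_summable[OF g], of 0]) (use le nn in auto)
      then have "(\<Sum>l. b (l + Suc m) * 3 ^ (l + Suc m)) \<le> A * q ^ Suc m * (1 / (1 - q))"
        using suminf_le[OF le _ sums_summable[OF g]] sums_unique[OF g] by simp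
      then have "b m \<le> C / 3 ^ m * (A * q ^ Suc m * (1 / (1 - q)))"
        using rec[OF m] C by (meson divide_nonneg_nonneg mult_left_mono order_trans zero_le_numeral zero_le_power)
      also have "\<dots> = (C * (q / (1 - q))) * (A * (q / 3) ^ m)" by (simp add: power_divide mult_ac)
      also have "\<dots> \<le> 1/2 * (A * (q / 3) ^ m)"
        using q B0 by (intro mult_right_mono) (auto simp: A_def)
      also have "q / 3 = 1 / X" using q by (simp add: X_def)
      finally show "b m \<le> (B / 2 ^ Suc k) / X ^ m" by (simp add: A_def power_divide)
    qed
  qed
  have "(\<lambda>k. B / X ^ m * (1/2) ^ k) \<longlonglongrightarrow> B / X ^ m * 0" by (intro tendsto_intros LIMSEQ_realpow_zero) auto
  then have "b m \<le> B / X ^ m * 0"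
    by (rule tendsto_lowerbound) (use claim m in \<open>auto simp: power_divide mult_ac intro!: always_eventually\<close>)
  then show ?thesis using b[of m] by simp
qed

context exterior
begin

text \<open>After subtracting the polynomial with the same low coefficients all Faber coefficients
  vanish, and \<open>faber_bound\<close> turns this into vanishing near \<open>E\<close>.\<close>

lemma fc_eventually_zero_imp_poly:
  assumes g: "g holomorphic_on UNIV" and z: "\<And>l. m0 \<le> l \<Longrightarrow> fc g l = 0"
  obtains p where "same_germ E g (poly p)"
proof -
  define n where "n = max m0 1"
  have ang: "g analytic_on E" using g analytic_on_holomorphic by blast
  obtain p where p: "degree p \<le> n - 1" "\<And>j. j < n \<Longrightarrow> fc (poly p) j = fc g j"
    using faber_poly_exists[of n "fc g"] by (auto simp: n_def)
  define e where "e z = g z - poly p z" for z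
  have "fc e j = 0" for j
  proof -
    have "fc e j = fc g j - fc (poly p) j" unfolding e_def by (rule fc_diff[OF ang poly_analytic])
    also have "\<dots> = 0"
    proof (cases "j < n")
      case False
      then have "degree p < j" using p(1) by (auto simp: n_def)
      then show ?thesis using z[of j] False by (simp add: fc_poly_eq_0 n_def)
    qed (simp add: p(2))
    finally show ?thesis .
  qed
  note e0 = this
  have eh: "e holomorphic_on D \<infinity>" unfolding e_def D_infty by (intro holomorphic_intros g poly_holo)
  obtain C where C: "C > 0" "\<And>R e z. ereal 3 < R \<Longrightarrow> e holomorphic_on D R \<Longrightarrow> z \<in> cD 2 \<Longrightarrow>
     norm (e z) \<le> C * (\<Sum>n. norm (fc e n) * 3 ^ n)" using faber_bound[of 2 3] by auto
  have "e z = 0" if "z \<in> cD 2" for z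
    using C(2)[OF _ eh that] by (simp add: e0)
  then have "same_germ E g (poly p)" unfolding same_germ_def
    by (intro exI[of _ "D (ereal 2)"]) (use E_sub_D D_sub_cD[of 2] open_D[of "ereal 2"] in \<open>auto simp: e_def\<close>)
  then show ?thesis using that by blast
qed

end

context pade_limit
begin

text \<open>Index m + N is the highest one to which the \<open>m\<close>-th term of \<open>G\<close>
  contributes after multiplication by the denominator, and it does so with the nonzero factor
  \<open>lead ^ N\<close>, since \<open>Q n\<close> is monic of degree \<open>N\<close>. Earlier
  terms and the principal part do not reach this index, and later terms are bounded on the circle
  |w| = 3 by their tail. So the relation at n = m + N bounds a coefficient by the later
  ones.\<close>

lemma entire_tail_recursion:
  assumes G: "G \<in> V" and g: "g holomorphic_on UNIV" "same_germ E g G"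
  obtains C m0 where "0 \<le> C" "\<And>m. m0 \<le> m \<Longrightarrow>
    norm (fc G m) \<le> C / 3 ^ m * (\<Sum>l. norm (fc G (l + Suc m)) * 3 ^ (l + Suc m))"
proof -
  have an: "G analytic_on E" using V_analytic G by blast
  have gD: "g holomorphic_on D \<infinity>" using g by (simp add: D_infty)
  define f where "f w = g (Psi w)" for w
  have fh: "f holomorphic_on {w. 1 < norm w \<and> ereal (norm w) < \<infinity>}" unfolding f_def by (rule holo_comp_Psi[OF gD])
  then have fh': "f holomorphic_on {w. 1 < norm w}" by simp
  have lcf: "laurent_coeff f 2 l = fc G l" for l
    unfolding f_def using faber_coeff_eq[OF an gD g(2), of 2 l] by simp
  obtain h where h: "h holomorphic_on {w. 2 < norm w}" "(h \<longlongrightarrow> 0) at_infinity"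
    and hs: "\<And>w. 2 < norm w \<Longrightarrow> (\<lambda>l. fc G l * w ^ l) sums (f w - h w)"
    using laurent_decomposition[OF fh, of 2] by (auto simp: lcf)
  have hG: "holo_ext G \<infinity>" using g by (auto simp: holo_ext_def D_infty)
  have sm: "summable (\<lambda>l. norm (fc G l) * 3 ^ l)"
  proof -
    obtain B where "\<And>n. norm (fc G n) \<le> B / 4 ^ n" using fc_bound[OF an hG, of 4] by auto
    then show ?thesis by (intro power_bounded_imp_summable[of _ B 4]) auto
  qed
  have "compact (Psi ` sphere 0 3)" by (intro compact_continuous_image continuous_on_subset[OF cont_Psi]) auto
  then obtain B0 where "\<forall>x\<in>Psi ` sphere 0 3. norm x \<le> B0" using compact_imp_bounded bounded_iff by metis
  then have B: "norm (Psi w) \<le> max B0 1" if "norm w = 3" for w using that by (auto simp: le_max_iff_disj)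
  define K where "K = (coeff_norm R + 1) * max B0 1 ^ N"
  have K0: "0 \<le> K" using coeff_norm_nonneg[of R] by (simp add: K_def)
  have "\<forall>\<^sub>F n in sequentially. degree (Q n) = N \<and> coeff_norm (Q n) \<le> coeff_norm R + 1 \<and> 1 \<le> n"
    using Q_degree Q_bounded eventually_ge_at_top[of 1] by eventually_elim auto
  then obtain n0 where n0: "\<And>n. n0 \<le> n \<Longrightarrow> degree (Q n) = N \<and> coeff_norm (Q n) \<le> coeff_norm R + 1 \<and> 1 \<le> n"
    by (auto simp: eventually_sequentially)
  have lN: "norm (lead ^ N) > 0" using lead by simp
  show ?thesis
  proof (rule that[of "K / norm (lead ^ N)" n0])
    show "0 \<le> K / norm (lead ^ N)" using K0 by simp
    fix m assume m: "n0 \<le> m"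
    define n where "n = m + N"
    have n: "degree (Q n) = N" "coeff_norm (Q n) \<le> coeff_norm R + 1" "1 \<le> n" using n0[of n] m by (auto simp: n_def)
    have cN: "coeff (Q n) N = 1" using Q_monic[OF n(3)] n(1) by simp
    define \<kappa> where "\<kappa> w = poly (Q n) (Psi w)" for w
    have \<kappa>h: "\<kappa> holomorphic_on {w. 1 < norm w}" unfolding \<kappa>_def by (rule poly_Psi_holo)
    have \<kappa>l: "((\<lambda>w. \<kappa> w / w ^ N) \<longlongrightarrow> lead ^ N) at_infinity"
      using poly_Psi_asymp[of "Q n" N] n(1) cN by (simp add: \<kappa>_def)
    \<comment> \<open>\<open>S\<close> is of smaller growth than w^m, so \<kappa> S has no
      coefficient of index \<open>n\<close>; \<open>T\<close> is what the series leaves after the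
      term \<open>m\<close>.\<close>
    define S where "S w = (\<Sum>l<m. fc G l * w ^ l) + h w" for w
    define T where "T w = f w - S w - fc G m * w ^ m" for w
    have Sh: "S holomorphic_on {w. 2 < norm w}" unfolding S_def by (intro holomorphic_intros h)
    have sub: "sphere 0 3 \<subseteq> {w::complex. 2 < norm w}" "sphere 0 3 \<subseteq> {w::complex. 1 < norm w}" by auto
    have cS: "continuous_on (sphere 0 3) S" and c\<kappa>: "continuous_on (sphere 0 3) \<kappa>" and cf: "continuous_on (sphere 0 3) f"
      using Sh \<kappa>h fh' sub holomorphic_on_imp_continuous_on continuous_on_subset by blast+
    have cT: "continuous_on (sphere 0 3) T" unfolding T_def by (intro continuous_intros cf cS)
    have S0: "((\<lambda>w. S w / w ^ m) \<longlongrightarrow> 0) at_infinity"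
    proof -
      have 1: "((\<lambda>w::complex. w ^ l / w ^ m) \<longlongrightarrow> 0) at_infinity" if "l < m" for l
      proof -
        have "((\<lambda>w::complex. (inverse w) ^ (m - l)) \<longlongrightarrow> 0 ^ (m - l)) at_infinity"
          by (intro tendsto_power tendsto_inverse_0)
        then have "((\<lambda>w::complex. (inverse w) ^ (m - l)) \<longlongrightarrow> 0) at_infinity" using that by (simp add: power_0_left)
        then show ?thesis
        proof (rule Lim_transform_eventually)
          have *: "(inverse w) ^ (m - l) = w ^ l / w ^ m" if "w \<noteq> 0" for w :: complex
            using that \<open>l < m\<close> by (simp add: power_diff power_inverse field_simps)
          show "\<forall>\<^sub>F w::complex in at_infinity. (inverse w) ^ (m - l) = w ^ l / w ^ m"
            using eventually_not_equal_at_infinity[of 0] by eventually_elim (rule *)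
        qed
      qed
      have 2: "((\<lambda>w::complex. (inverse w) ^ m * h w) \<longlongrightarrow> 0 ^ m * 0) at_infinity"
        by (intro tendsto_intros tendsto_inverse_0 h)
      have "((\<lambda>w. (\<Sum>l<m. fc G l * (w ^ l / w ^ m)) + (inverse w) ^ m * h w) \<longlongrightarrow> (\<Sum>l<m. fc G l * 0) + 0 ^ m * 0) at_infinity"
        by (intro tendsto_add tendsto_sum tendsto_mult tendsto_const 2) (use 1 in auto)
      moreover have "S w / w ^ m = (\<Sum>l<m. fc G l * (w ^ l / w ^ m)) + (inverse w) ^ m * h w" for w
        by (simp add: S_def add_divide_distrib sum_divide_distrib) (simp add: divide_inverse power_inverse)
      ultimately show ?thesis by simp
    qed
    have wn: "w ^ n = w ^ N * w ^ m" for w :: complex by (simp add: n_def power_add)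
    have i1: "laurent_coeff (\<lambda>w. \<kappa> w * S w) 3 n = 0"
    proof (rule laurent_coeff_at_infinity[of _ 2])
      show "(\<lambda>w. \<kappa> w * S w) holomorphic_on {w. 2 < norm w}"
        by (intro holomorphic_on_mult Sh holomorphic_on_subset[OF \<kappa>h]) auto
      show "((\<lambda>w. \<kappa> w * S w / w ^ n) \<longlongrightarrow> 0) at_infinity"
        using tendsto_mult[OF \<kappa>l S0] by (simp add: wn)
    qed auto
    have i2: "laurent_coeff (\<lambda>w. \<kappa> w * w ^ m) 3 n = lead ^ N"
    proof (rule laurent_coeff_at_infinity[of _ 2])
      show "(\<lambda>w. \<kappa> w * w ^ m) holomorphic_on {w. 2 < norm w}"
        by (intro holomorphic_intros holomorphic_on_subset[OF \<kappa>h]) auto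
      show "((\<lambda>w. \<kappa> w * w ^ m / w ^ n) \<longlongrightarrow> lead ^ N) at_infinity"
      proof (rule Lim_transform_eventually[OF \<kappa>l])
        have *: "\<kappa> w / w ^ N = \<kappa> w * w ^ m / w ^ n" if "w \<noteq> 0" for w using that by (simp add: wn)
        show "\<forall>\<^sub>F w in at_infinity. \<kappa> w / w ^ N = \<kappa> w * w ^ m / w ^ n"
          using eventually_not_equal_at_infinity[of 0] by eventually_elim (rule *)
      qed
    qed auto
    have ckm: "continuous_on (sphere 0 3) (\<lambda>w. \<kappa> w * w ^ m)" by (intro continuous_intros c\<kappa>)
    have "0 = fc (\<lambda>z. poly (Q n) z * G z) n" using Sol_V[OF Q_Sol[OF n(3)] G] by simp
    also have "\<dots> = laurent_coeff (\<lambda>w. poly (Q n) (Psi w) * g (Psi w)) 3 n"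
    proof (rule faber_coeff_eq[where R = \<infinity>])
      show "(\<lambda>z. poly (Q n) z * G z) analytic_on E" by (rule poly_mult_analytic[OF an])
      show "(\<lambda>z. poly (Q n) z * g z) holomorphic_on D \<infinity>" by (intro holomorphic_intros poly_holo gD)
      show "same_germ E (\<lambda>z. poly (Q n) z * g z) (\<lambda>z. poly (Q n) z * G z)" by (rule same_germ_map[OF g(2)]) simp
    qed auto
    also have "\<dots> = laurent_coeff (\<lambda>w. (\<kappa> w * S w + fc G m * (\<kappa> w * w ^ m)) + \<kappa> w * T w) 3 n"
      by (rule laurent_coeff_cong) (auto simp: \<kappa>_def T_def f_def algebra_simps)
    also have "\<dots> = laurent_coeff (\<lambda>w. \<kappa> w * S w + fc G m * (\<kappa> w * w ^ m)) 3 n + laurent_coeff (\<lambda>w. \<kappa> w * T w) 3 n"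
      by (intro laurent_coeff_add continuous_on_add continuous_on_mult continuous_on_const c\<kappa> cS cT ckm) simp
    also have "laurent_coeff (\<lambda>w. \<kappa> w * S w + fc G m * (\<kappa> w * w ^ m)) 3 n = laurent_coeff (\<lambda>w. \<kappa> w * S w) 3 n + laurent_coeff (\<lambda>w. fc G m * (\<kappa> w * w ^ m)) 3 n"
      by (intro laurent_coeff_add continuous_on_mult continuous_on_const c\<kappa> cS ckm) simp
    also have "laurent_coeff (\<lambda>w. fc G m * (\<kappa> w * w ^ m)) 3 n = fc G m * lead ^ N"
      by (subst laurent_coeff_cmult[OF ckm]) (auto simp: i2)
    finally have "fc G m * lead ^ N = - laurent_coeff (\<lambda>w. \<kappa> w * T w) 3 n" using i1 by (simp add: eq_neg_iff_add_eq_0)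
    then have eq: "norm (fc G m) * norm (lead ^ N) = norm (laurent_coeff (\<lambda>w. \<kappa> w * T w) 3 n)"
      by (metis norm_minus_cancel norm_mult)
    define \<tau> where "\<tau> = (\<Sum>l. norm (fc G (l + Suc m)) * 3 ^ (l + Suc m))"
    have sm': "summable (\<lambda>l. norm (fc G (l + Suc m)) * 3 ^ (l + Suc m))"
      using sm by (subst summable_iff_shift[of "\<lambda>l. norm (fc G l) * 3 ^ l"])
    have \<tau>0: "0 \<le> \<tau>" unfolding \<tau>_def by (intro suminf_nonneg sm') auto
    have Tb: "norm (T w) \<le> \<tau>" if w: "norm w = 3" for w
    proof -
      have "(\<lambda>l. fc G (l + Suc m) * w ^ (l + Suc m)) sums ((f w - h w) - (\<Sum>l<Suc m. fc G l * w ^ l))"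
        using hs[of w] w by (intro sums_split_initial_segment) auto
      then have "(\<Sum>l. fc G (l + Suc m) * w ^ (l + Suc m)) = T w"
        by (simp add: sums_iff T_def S_def algebra_simps)
      moreover have "norm (\<Sum>l. fc G (l + Suc m) * w ^ (l + Suc m)) \<le> (\<Sum>l. norm (fc G (l + Suc m) * w ^ (l + Suc m)))"
        using sm' by (intro summable_norm) (simp only: norm_mult norm_power w)
      ultimately show ?thesis unfolding \<tau>_def norm_mult norm_power w by simp
    qed
    have "norm (laurent_coeff (\<lambda>w. \<kappa> w * T w) 3 n) \<le> (K * \<tau>) / 3 ^ n"
    proof (rule laurent_coeff_bound)
      show "norm (\<kappa> w * T w) \<le> K * \<tau>" if w: "norm w = 3" for w
      proof -
        have "norm (\<kappa> w) \<le> coeff_norm (Q n) * max B0 1 ^ N"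
          unfolding \<kappa>_def using n(1) B[OF w] by (intro norm_poly_le) auto
        also have "\<dots> \<le> K" unfolding K_def using n(2) by (intro mult_right_mono) auto
        finally show ?thesis unfolding norm_mult using Tb[OF w] K0 by (intro mult_mono) auto
      qed
    qed (auto intro!: continuous_on_mult c\<kappa> cT)
    also have "\<dots> \<le> (K * \<tau>) / 3 ^ m"
      using K0 \<tau>0 by (intro divide_left_mono power_increasing mult_nonneg_nonneg) (auto simp: n_def)
    finally have "norm (fc G m) * norm (lead ^ N) \<le> (K * \<tau>) / 3 ^ m" using eq by simp
    then have "norm (fc G m) \<le> (K * \<tau>) / 3 ^ m / norm (lead ^ N)" by (subst pos_le_divide_eq[OF lN])
    then show "norm (fc G m) \<le> K / norm (lead ^ N) / 3 ^ m * (\<Sum>l. norm (fc G (l + Suc m)) * 3 ^ (l + Suc m))"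
      unfolding \<tau>_def by (simp add: mult_ac)
  qed
qed

text \<open>An entire combination coincides near \<open>E\<close> with a polynomial, so for large
  \<open>n\<close> its relation holds for every \<open>q\<close> of degree at most \<open>N\<close>.
  One of the \<open>N\<close> equations then follows from the others, there are solutions besides
  the multiples of \<open>Q n\<close>, and a second monic solution contradicts uniqueness.\<close>

lemma not_entire:
  assumes uniq: "\<forall>\<^sub>F n in sequentially. \<forall>q q'. Sol n q \<and> lead_coeff q = 1 \<and> Sol n q' \<and> lead_coeff q' = 1 \<longrightarrow> q = q'"
    and h: "holo_ext (gen x) \<infinity>" and i0: "i0 \<in> index_set"
  shows "x i0 = 0"
proof (rule ccontr)
  assume x0: "x i0 \<noteq> 0"
  define G where "G = gen x"
  have GV: "G \<in> V" unfolding G_def by (rule gen_V)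
  have an: "G analytic_on E" using V_analytic GV by blast
  obtain g where g: "g holomorphic_on UNIV" "same_germ E g G" using h by (auto simp: holo_ext_def D_infty G_def)
  obtain C m0 where C: "0 \<le> C" "\<And>m. m0 \<le> m \<Longrightarrow> norm (fc G m) \<le> C / 3 ^ m * (\<Sum>l. norm (fc G (l + Suc m)) * 3 ^ (l + Suc m))"
    using entire_tail_recursion[OF GV g] by blast
  have decay: "\<exists>B. \<forall>l. norm (fc G l) \<le> B / X ^ l" if X: "0 < X" for X
  proof -
    obtain B where B: "B > 0" "\<And>n. norm (fc G n) \<le> B / (X + 1) ^ n"
      using fc_bound[OF an, of \<infinity> "X + 1"] h X by (auto simp: G_def)
    have "B / (X + 1) ^ n \<le> B / X ^ n" for n
      using X B(1) by (intro divide_left_mono power_mono) auto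
    then show "\<exists>B. \<forall>l. norm (fc G l) \<le> B / X ^ l" using B(2) order_trans by blast
  qed
  have "norm (fc G l) = 0" if l: "m0 \<le> l" for l
    by (rule superexponential_recursion_zero[of "\<lambda>l. norm (fc G l)", OF norm_ge_zero C(1) _ decay l]) (rule C(2))
  then have zero: "fc g l = 0" if "m0 \<le> l" for l
    using that fc_germ[of g G l] an g analytic_on_holomorphic by auto
  obtain p where p: "same_germ E g (poly p)" using fc_eventually_zero_imp_poly[OF g(1) zero] by blast
  have Gp: "same_germ E G (poly p)" using g(2) p same_germ_sym same_germ_trans by blast
  have van: "fc (\<lambda>z. poly q z * G z) n = 0" if "degree q \<le> N" "N + degree p < n" for q n
  proof -
    have "fc (\<lambda>z. poly q z * G z) n = fc (poly (q * p)) n"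
      by (rule fc_germ) (auto intro: poly_mult_analytic an poly_analytic same_germ_map[OF Gp])
    also have "\<dots> = 0" using that degree_mult_le[of q p] by (intro fc_poly_eq_0) auto
    finally show ?thesis .
  qed
  obtain n where n: "N + degree p < n" "1 \<le> n"
      "\<And>q q'. Sol n q \<Longrightarrow> lead_coeff q = 1 \<Longrightarrow> Sol n q' \<Longrightarrow> lead_coeff q' = 1 \<Longrightarrow> q = q'"
  proof -
    have "\<forall>\<^sub>F n in sequentially. (\<forall>q q'. Sol n q \<and> lead_coeff q = 1 \<and> Sol n q' \<and> lead_coeff q' = 1 \<longrightarrow> q = q') \<and> N + degree p < n \<and> 1 \<le> n"
      using uniq eventually_gt_at_top[of "N + degree p"] eventually_ge_at_top[of 1] by eventually_elim blast
    then obtain n where "(\<forall>q q'. Sol n q \<and> lead_coeff q = 1 \<and> Sol n q' \<and> lead_coeff q' = 1 \<longrightarrow> q = q') \<and> N + degree p < n \<and> 1 \<le> n"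
      unfolding eventually_sequentially by blast
    then show ?thesis using that[of n] by blast
  qed
  define e where "e = degree (Q n)"
  \<comment> \<open>The equation of \<open>i0\<close> is dropped, and in its place, as row
    \<open>None\<close>, the coefficient at the degree \<open>e\<close> of \<open>Q n\<close> is
    required to vanish; this keeps the solution from being a nonzero multiple of
    \<open>Q n\<close>.\<close>
  define A where "A o' l = (case o' of None \<Rightarrow> if l = e then 1 else 0 | Some i \<Rightarrow> fc (\<lambda>z. z ^ l * bas i z) n)" for o' l
  define I where "I = insert None (Some ` (index_set - {i0}))"
  have "card I = N"
  proof -
    have "card (Some ` (index_set - {i0})) = N - 1" using i0 finite_index_set card_index_set by (simp add: card_image)
    moreover have "None \<notin> Some ` (index_set - {i0})" by auto
    ultimately show ?thesis unfolding I_def using finite_index_set N_pos by (subst card_insert_disjoint) auto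
  qed
  then obtain c where c: "\<exists>l\<in>{..N}. c l \<noteq> 0" "\<And>o'. o' \<in> I \<Longrightarrow> (\<Sum>l\<le>N. A o' l * c l) = 0"
    using homogeneous_system_solution[of I "{..N}" A] finite_index_set by (auto simp: I_def)
  define q where "q = (\<Sum>l\<le>N. monom (c l) l)"
  have cq: "coeff q l = (if l \<le> N then c l else 0)" for l
    by (simp add: q_def coeff_sum)
  have dq: "degree q \<le> N" unfolding q_def by (intro degree_sum_le) (auto intro: order_trans[OF degree_monom_le])
  have "q \<noteq> 0" using c(1) cq by (metis atMost_iff coeff_0)
  have fq: "fc (\<lambda>z. poly q z * bas i z) n = (\<Sum>l\<le>N. c l * fc (\<lambda>z. z ^ l * bas i z) n)" if "i \<in> index_set" for i
    unfolding fc_poly_mult_coeff[OF bas_analytic[OF that] dq] by (simp add: cq)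
  have others: "fc (\<lambda>z. poly q z * bas i z) n = 0" if "i \<in> index_set" "i \<noteq> i0" for i
  proof -
    have "Some i \<in> I" using that by (auto simp: I_def)
    from c(2)[OF this] show ?thesis unfolding fq[OF that(1)] by (simp add: A_def mult.commute)
  qed
  have "0 = fc (\<lambda>z. poly q z * G z) n" using van[OF dq n(1)] by simp
  also have "(\<lambda>z. poly q z * G z) = (\<lambda>z. \<Sum>i\<in>index_set. x i * (poly q z * bas i z))"
    by (simp add: G_def gen_def[abs_def] sum_distrib_left mult.left_commute)
  also have "fc \<dots> n = (\<Sum>i\<in>index_set. x i * fc (\<lambda>z. poly q z * bas i z) n)"
    by (rule fc_sum) (intro poly_mult_analytic bas_analytic)
  also have "\<dots> = x i0 * fc (\<lambda>z. poly q z * bas i0 z) n"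
    using others i0 finite_index_set by (subst sum.remove[OF finite_index_set i0]) (auto intro: sum.neutral)
  finally have "fc (\<lambda>z. poly q z * bas i0 z) n = 0" using x0 by simp
  then have Sq: "Sol n q" using others dq by (auto simp: Sol_def)
  have qe: "coeff q e = 0"
  proof -
    have eN: "e \<le> N" unfolding e_def using Sol_degree[OF Q_Sol[OF n(2)]] .
    have "0 = (\<Sum>l\<le>N. A None l * c l)" using c(2)[of None] by (simp add: I_def)
    also have "\<dots> = (\<Sum>l\<le>N. if l = e then c l else 0)" by (intro sum.cong) (auto simp: A_def)
    also have "\<dots> = c e" using eN by simp
    finally show ?thesis by (simp add: cq)
  qed
  \<comment> \<open>Below degree \<open>e\<close> the sum \<open>Q n + q\<close> is monic again;
    above it \<open>q\<close> itself is normalised. Degree \<open>e\<close> is excluded by the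
    additional condition.\<close>
  show False
  proof (cases "degree q < e")
    case True
    have 1: "Sol n (smult 1 (Q n) + smult 1 q)" by (intro Sol_lin Q_Sol n(2) Sq)
    have "degree (Q n + q) = e" unfolding e_def using True by (intro degree_add_eq_left) (simp add: e_def)
    then have "lead_coeff (Q n + q) = 1" using Q_monic[OF n(2)] qe by (simp add: e_def)
    then have "Q n + q = Q n" using n(3)[of "Q n + q" "Q n"] 1 Q_Sol[OF n(2)] Q_monic[OF n(2)] by simp
    then show False using \<open>q \<noteq> 0\<close> by simp
  next
    case False
    have "degree q \<noteq> e" using qe \<open>q \<noteq> 0\<close> by (metis leading_coeff_0_iff)
    then have "e < degree q" using False by simp
    define q' where "q' = smult (inverse (lead_coeff q)) q"
    have "Sol n (smult (inverse (lead_coeff q)) q + smult 0 q)" by (intro Sol_lin Sq)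
    moreover have "lead_coeff q' = 1" using \<open>q \<noteq> 0\<close> by (simp add: q'_def)
    ultimately have "q' = Q n" using n(3)[of q' "Q n"] Q_Sol[OF n(2)] Q_monic[OF n(2)] by (simp add: q'_def)
    then have "degree q = e" using \<open>q \<noteq> 0\<close> by (metis degree_smult_eq e_def inverse_zero_imp_zero leading_coeff_0_iff q'_def)
    then show False using \<open>e < degree q\<close> by simp
  qed
qed

text \<open>\<open>W k\<close> collects the coefficient vectors whose combination, times the
  remaining factors, continues beyond the level of the zero at position \<open>k\<close>. By
  \<open>bootstrap\<close>, entering the next space takes only that this product vanish at that
  zero, one linear condition. At most \<open>N\<close> steps lead from dimension \<open>N\<close> to
  0 by \<open>not_entire\<close>, so there are exactly \<open>N\<close> and each is strict.
  Coordinate vectors are filtered rather than functions, since the functions are not known in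
  advance to be independent.\<close>

lemma chain_strict:
  assumes uniq: "\<forall>\<^sub>F n in sequentially. \<forall>q q'. Sol n q \<and> lead_coeff q = 1 \<and> Sol n q' \<and> lead_coeff q' = 1 \<longrightarrow> q = q'"
    and Rf: "R = P0 * list_poly zs" "\<And>z. poly P0 z = 0 \<Longrightarrow> z \<in> E"
    and zs: "set zs \<inter> E = {}" "sorted (map (\<lambda>z. norm (\<Phi> z)) zs)"
  shows "length zs = N"
    "k < length zs \<Longrightarrow> \<exists>x r h. ereal (norm (\<Phi> (zs ! k))) < r \<and> h holomorphic_on D r \<and>
       same_germ E h (\<lambda>z. poly (list_poly (drop k zs)) z * gen x z) \<and> h (zs ! k) \<noteq> 0"
proof -
  define M where "M = length zs"
  define U where "U = {x :: nat \<times> nat \<Rightarrow> complex. \<forall>i. i \<notin> index_set \<longrightarrow> x i = 0}"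
  define W where "W k = {x \<in> U. if k < M then \<exists>r. ereal (norm (\<Phi> (zs ! k))) < r \<and> holo_ext (\<lambda>z. poly (list_poly (drop k zs)) z * gen x z) r
     else holo_ext (gen x) \<infinity>}" for k
  have W_boot: "x \<in> W k" if "x \<in> U" "k \<le> M" "holo_ext (\<lambda>z. poly (list_poly (drop k zs)) z * gen x z) \<rho>" "1 < \<rho>"
     "0 < k \<Longrightarrow> ereal (norm (\<Phi> (zs ! (k - 1)))) < \<rho>" for x k \<rho>
  proof -
    have "if k < length zs then \<exists>r. ereal (norm (\<Phi> (zs ! k))) < r \<and> holo_ext (\<lambda>z. poly (list_poly (drop k zs)) z * gen x z) r
       else holo_ext (gen x) \<infinity>"
      by (rule bootstrap[OF Rf(1) _ zs gen_V _ that(3,4)]) (use Rf(2) that in \<open>auto simp: M_def\<close>)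
    then show ?thesis using that(1) by (auto simp: W_def M_def split: if_splits)
  qed
  have gl: "(\<lambda>z. p z * gen (\<lambda>i. a * x i + b * y i) z) = (\<lambda>z. a * (p z * gen x z) + b * (p z * gen y z))" for p a b x y
    unfolding gen_lin by (simp add: algebra_simps)
  have Ulin: "(\<lambda>i. a * x i + b * y i) \<in> U" if "x \<in> U" "y \<in> U" for a b x y using that by (auto simp: U_def)
  have lin: "(\<lambda>i. a * x i + b * y i) \<in> W k" if k: "k \<le> M" and xy: "x \<in> W k" "y \<in> W k" for k x y a b
  proof (cases "k < M")
    case True
    then obtain r1 r2 where r: "ereal (norm (\<Phi> (zs ! k))) < r1" "holo_ext (\<lambda>z. poly (list_poly (drop k zs)) z * gen x z) r1"
      "ereal (norm (\<Phi> (zs ! k))) < r2" "holo_ext (\<lambda>z. poly (list_poly (drop k zs)) z * gen y z) r2"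
      using xy by (auto simp: W_def)
    have "holo_ext (\<lambda>z. a * (poly (list_poly (drop k zs)) z * gen x z) + b * (poly (list_poly (drop k zs)) z * gen y z)) (min r1 r2)"
      using r by (intro holo_ext_add holo_ext_cmult) (auto intro: holo_ext_mono)
    moreover have "ereal (norm (\<Phi> (zs ! k))) < min r1 r2" using r by auto
    ultimately have "\<exists>r. ereal (norm (\<Phi> (zs ! k))) < r \<and>
       holo_ext (\<lambda>z. a * (poly (list_poly (drop k zs)) z * gen x z) + b * (poly (list_poly (drop k zs)) z * gen y z)) r" by blast
    moreover have "x \<in> U" "y \<in> U" using xy by (auto simp: W_def)
    ultimately show ?thesis using True Ulin unfolding W_def mem_Collect_eq gl by simp
  next
    case False
    then have "holo_ext (\<lambda>z. a * gen x z + b * gen y z) \<infinity>" using xy by (intro holo_ext_add holo_ext_cmult) (auto simp: W_def)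
    then show ?thesis using False xy Ulin by (auto simp: W_def gen_lin[abs_def])
  qed
  have nE: "zs ! k \<notin> E" if "k < M" for k using nth_mem[of k zs] that zs(1) by (auto simp: M_def disjoint_iff)
  have dropk: "list_poly (drop k zs) = [:- (zs ! k), 1:] * list_poly (drop (Suc k) zs)" if "k < M" for k
    using that Cons_nth_drop_Suc[of k zs] list_poly_simps(2) by (simp only: M_def) metis
  have divk: "x \<in> W (Suc k)" if k: "k < M" and x: "x \<in> U" and h: "h holomorphic_on D r"
     "same_germ E h (\<lambda>z. poly (list_poly (drop k zs)) z * gen x z)" "h (zs ! k) = 0" "ereal (norm (\<Phi> (zs ! k))) < r" for k x h r
  proof (rule W_boot[OF x])
    have "1 < ereal (norm (\<Phi> (zs ! k)))" using norm_Phi[OF nE[OF k]] by simp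
    then show r1: "1 < r" using h(4) by (rule less_trans)
    have "same_germ E h (\<lambda>z. (z - zs ! k) * (poly (list_poly (drop (Suc k) zs)) z * gen x z))"
      using h(2) by (simp add: dropk[OF k] algebra_simps)
    from holo_ext_divide_linear[OF h(1) this nE[OF k] h(3) r1] show "holo_ext (\<lambda>z. poly (list_poly (drop (Suc k) zs)) z * gen x z) r" .
  qed (use k h in auto)
  have step: "\<exists>a b. (a \<noteq> 0 \<or> b \<noteq> 0) \<and> (\<lambda>i. a * x i + b * y i) \<in> W (Suc k)" if k: "k < M" and xy: "x \<in> W k" "y \<in> W k" for k x y
  proof -
    obtain r1 r2 where r: "ereal (norm (\<Phi> (zs ! k))) < r1" "holo_ext (\<lambda>z. poly (list_poly (drop k zs)) z * gen x z) r1"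
      "ereal (norm (\<Phi> (zs ! k))) < r2" "holo_ext (\<lambda>z. poly (list_poly (drop k zs)) z * gen y z) r2"
      using xy k by (auto simp: W_def)
    define r where "r = min r1 r2"
    have r': "ereal (norm (\<Phi> (zs ! k))) < r" using r by (auto simp: r_def)
    have "holo_ext (\<lambda>z. poly (list_poly (drop k zs)) z * gen x z) r" "holo_ext (\<lambda>z. poly (list_poly (drop k zs)) z * gen y z) r"
      using r holo_ext_mono unfolding r_def by (meson min.cobounded1 min.cobounded2)+
    then obtain hx hy where hx: "hx holomorphic_on D r" "same_germ E hx (\<lambda>z. poly (list_poly (drop k zs)) z * gen x z)"
      and hy: "hy holomorphic_on D r" "same_germ E hy (\<lambda>z. poly (list_poly (drop k zs)) z * gen y z)" by (auto simp: holo_ext_def)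
    have "\<exists>a b. (a \<noteq> 0 \<or> b \<noteq> 0) \<and> a * hx (zs ! k) + b * hy (zs ! k) = 0"
    proof (cases "hy (zs ! k) = 0")
      case True then show ?thesis by (intro exI[of _ 0] exI[of _ 1]) auto
    next
      case False then show ?thesis by (intro exI[of _ "hy (zs ! k)"] exI[of _ "- hx (zs ! k)"]) auto
    qed
    then obtain a b where ab: "a \<noteq> 0 \<or> b \<noteq> 0" "a * hx (zs ! k) + b * hy (zs ! k) = 0" by blast
    have "(\<lambda>i. a * x i + b * y i) \<in> W (Suc k)"
    proof (rule divk[where k = k and r = r and h = "\<lambda>z. a * hx z + b * hy z"])
      show "(\<lambda>i. a * x i + b * y i) \<in> U" using xy by (intro Ulin) (auto simp: W_def)
      show "(\<lambda>z. a * hx z + b * hy z) holomorphic_on D r" by (intro holomorphic_intros hx hy)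
      show "same_germ E (\<lambda>z. a * hx z + b * hy z) (\<lambda>z. poly (list_poly (drop k zs)) z * gen (\<lambda>i. a * x i + b * y i) z)"
        unfolding gl by (rule same_germ_combine[OF hx(2) hy(2)]) simp
    qed (use k ab r' in auto)
    then show ?thesis using ab(1) by blast
  qed
  have last: "W M \<subseteq> {\<lambda>i. 0}"
  proof
    fix x assume x: "x \<in> W M"
    have "x i = 0" for i
    proof (cases "i \<in> index_set")
      case True then show ?thesis using not_entire[OF uniq, of x i] x by (simp add: W_def)
    next
      case False then show ?thesis using x unfolding W_def U_def by blast
    qed
    then show "x \<in> {\<lambda>i. 0}" by auto
  qed
  define v where "v j i = (if i = j then 1 else 0 :: complex)" for j i :: "nat \<times> nat"
  have v0: "v j \<in> W 0" if j: "j \<in> index_set" for j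
  proof -
    obtain \<rho> where \<rho>: "1 < \<rho>" "holo_ext (\<lambda>z. poly (list_poly (drop 0 zs)) z * gen (v j) z) \<rho>"
      using analytic_holo_ext'[OF poly_mult_analytic[OF V_analytic[OF gen_V]]] by blast
    show ?thesis by (rule W_boot[OF _ _ \<rho>(2,1)]) (use j in \<open>auto simp: U_def v_def\<close>)
  qed
  define S where "S = {j. 0 \<le> j \<and> j < M \<and> \<not> W j \<subseteq> W (Suc j)}"
  have "\<not> card S < card index_set"
  proof
    assume "card S < card index_set"
    then obtain c where c: "\<exists>j\<in>index_set. c j \<noteq> 0" "\<And>i. (\<Sum>j\<in>index_set. c j * v j i) = 0"
      using chain_dependent[where M = M and W = W and k = 0 and J = index_set and v = v, OF lin step last _ finite_index_set] v0
      unfolding S_def by blast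
    have "c i = 0" if "i \<in> index_set" for i
    proof -
      have "(\<Sum>j\<in>index_set. c j * v j i) = (\<Sum>j\<in>index_set. if j = i then c j else 0)" by (intro sum.cong) (auto simp: v_def)
      then show ?thesis using c(2)[of i] that finite_index_set by simp
    qed
    then show False using c(1) by blast
  qed
  then have S_ge: "N \<le> card S" by (simp add: card_index_set)
  have S_sub: "S \<subseteq> {..<M}" by (auto simp: S_def)
  have "card S \<le> M" using card_mono[OF _ S_sub] by simp
  moreover have "M \<le> N"
  proof -
    have "P0 \<noteq> 0" using R_ne_0 Rf by auto
    then have "degree R = degree P0 + M" unfolding Rf(1) using list_poly_ne_0 by (simp add: degree_mult_eq degree_list_poly M_def)
    then show ?thesis using degree_R by simp
  qed
  ultimately have MN: "M = N" "card S = M" using S_ge by auto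
  show "length zs = N" using MN by (simp add: M_def)
  assume "k < length zs"
  then have k: "k < M" by (simp add: M_def)
  have "S = {..<M}" using card_subset_eq[OF _ S_sub] MN by simp
  then have "k \<in> S" using k by simp
  then obtain x where x: "x \<in> W k" "x \<notin> W (Suc k)" by (auto simp: S_def)
  obtain r h where h: "ereal (norm (\<Phi> (zs ! k))) < r" "h holomorphic_on D r" "same_germ E h (\<lambda>z. poly (list_poly (drop k zs)) z * gen x z)"
    using x(1) k by (auto simp: W_def holo_ext_def)
  have "x \<in> U" using x(1) by (simp add: W_def)
  then have "h (zs ! k) \<noteq> 0" using divk[OF k _ h(2,3) _ h(1)] x(2) by blast
  then show "\<exists>x r h. ereal (norm (\<Phi> (zs ! k))) < r \<and> h holomorphic_on D r \<and>
       same_germ E h (\<lambda>z. poly (list_poly (drop k zs)) z * gen x z) \<and> h (zs ! k) \<noteq> 0" using h by blast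
qed

end

section \<open>System poles\<close>

lemma list_poly_cong_mset: "mset xs = mset ys \<Longrightarrow> list_poly xs = list_poly ys"
proof -
  have "list_poly xs = (\<Prod>z\<in>#mset xs. [:- z, 1:])" for xs by (induction xs) auto
  then show "mset xs = mset ys \<Longrightarrow> list_poly xs = list_poly ys" by metis
qed

lemma order_list_poly: "order \<xi> (list_poly zs) = count_list zs \<xi>"
proof (induction zs)
  case Nil then show ?case by (auto intro: order_0I)
next
  case (Cons z zs)
  have "order \<xi> [:- z, 1:] = (if z = \<xi> then 1 else 0)"
    using order_power_n_n[of \<xi> 1] by (auto intro: order_0I)
  moreover have "order \<xi> ([:- z, 1:] * list_poly zs) = order \<xi> [:- z, 1:] + order \<xi> (list_poly zs)"
    using list_poly_ne_0[of zs] by (intro order_mult) (simp del: mult_pCons_left)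
  ultimately show ?case using Cons by (simp del: mult_pCons_left)
qed

lemma monic_eq_list_poly:
  fixes R :: "complex poly" assumes "lead_coeff R = 1" shows "\<exists>xs. R = list_poly xs"
proof -
  have "R \<noteq> 0" using assms by auto
  then obtain A where A: "size A = degree R" "R = smult (lead_coeff R) (\<Prod>x\<in>#A. [:- x, 1:])"
    using alg_closed_imp_factorization by blast
  obtain xs where xs: "mset xs = A" using ex_mset by blast
  have "R = (\<Prod>x\<in>#mset xs. [:- x, 1:])" using A(2) xs assms by simp
  also have "\<dots> = list_poly xs" by (induction xs) auto
  finally show ?thesis by blast
qed

context pade_limit
begin

text \<open>The list may be ordered freely among zeros of equal level. With the copies of \<xi> last
  among the zeros of level at most |\<Phi> \<xi>|, and all but \<open>t\<close> of them removed,
  \<open>chain_strict\<close> gives a combination whose remaining factors are (z - \<xi>)^t and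
  factors with zeros at higher levels, which are divided out. Zeros in \<open>E\<close> are excluded
  beforehand by counting: those outside already number \<open>N\<close>.\<close>

theorem limit_zeros_are_system_poles:
  assumes uniq: "\<forall>\<^sub>F n in sequentially. \<forall>q q'. Sol n q \<and> lead_coeff q = 1 \<and> Sol n q' \<and> lead_coeff q' = 1 \<longrightarrow> q = q'"
    and \<xi>: "poly R \<xi> = 0"
  shows "\<xi> \<notin> E" "1 \<le> t \<Longrightarrow> t \<le> order \<xi> R \<Longrightarrow> \<exists>G\<in>V. \<exists>r. ereal (norm (\<Phi> \<xi>)) < r \<and> exact_pole G \<xi> t r"
proof -
  obtain xs where Rxs: "R = list_poly xs" using monic_eq_list_poly[OF R_monic] by blast
  have lxs: "length xs = N" using degree_R by (simp add: Rxs degree_list_poly)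
  define inE where "inE = filter (\<lambda>z. z \<in> E) xs"
  define out where "out = filter (\<lambda>z. z \<notin> E) xs"
  have split: "mset xs = mset inE + mset out" by (simp add: inE_def out_def)
  have arr: "R = list_poly inE * list_poly zs" if "mset zs = mset out" for zs
    unfolding Rxs list_poly_simps(3)[symmetric] by (rule list_poly_cong_mset) (simp add: split that)
  have inE0: "z \<in> E" if "poly (list_poly inE) z = 0" for z using that by (auto simp: poly_list_poly_eq_0_iff inE_def)
  define \<kappa> where "\<kappa> z = norm (\<Phi> z)" for z
  have "length out = N"
  proof -
    have "length (sort_key \<kappa> out) = N"
    proof (rule chain_strict(1)[OF uniq arr inE0])
      show "set (sort_key \<kappa> out) \<inter> E = {}" by (auto simp: out_def)
      show "sorted (map (\<lambda>z. norm (\<Phi> z)) (sort_key \<kappa> out))" using sorted_sort_key[of \<kappa> out] by (simp add: \<kappa>_def[abs_def])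
    qed auto
    then show ?thesis by simp
  qed
  then have "length inE = 0" using split lxs by (metis add_cancel_left_left size_mset size_union)
  then have "\<forall>z\<in>set xs. z \<notin> E" unfolding inE_def by (simp add: filter_empty_conv)
  then show \<xi>E: "\<xi> \<notin> E" using \<xi> by (simp add: Rxs poly_list_poly_eq_0_iff)
  assume t: "1 \<le> t" "t \<le> order \<xi> R"
  define \<mu> where "\<mu> = count_list out \<xi>"
  have "order \<xi> R = order \<xi> (list_poly inE) + order \<xi> (list_poly out)"
    unfolding arr[OF refl] using list_poly_ne_0 by (intro order_mult) simp
  also have "order \<xi> (list_poly inE) = 0" using inE0 \<xi>E by (intro order_0I) blast
  finally have t\<mu>: "t \<le> \<mu>" using t by (simp add: order_list_poly \<mu>_def)
  define As where "As = sort_key \<kappa> (filter (\<lambda>z. z \<noteq> \<xi> \<and> \<kappa> z \<le> \<kappa> \<xi>) out)"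
  define Bs where "Bs = sort_key \<kappa> (filter (\<lambda>z. \<kappa> z > \<kappa> \<xi>) out)"
  define zs where "zs = As @ replicate \<mu> \<xi> @ Bs"
  have mz: "mset zs = mset out"
  proof (rule multiset_eqI)
    fix z
    show "count (mset zs) z = count (mset out) z"
    proof (cases "z = \<xi>")
      case True
      then show ?thesis by (simp add: zs_def As_def Bs_def \<mu>_def count_mset)
    next
      case False
      then show ?thesis by (cases "\<kappa> z \<le> \<kappa> \<xi>") (simp_all add: zs_def As_def Bs_def)
    qed
  qed
  have set_out: "set zs \<inter> E = {}" using mset_eq_setD[OF mz] by (auto simp: out_def)
  have sorted: "sorted (map (\<lambda>z. norm (\<Phi> z)) zs)"
  proof -
    have "sorted (map \<kappa> zs)"
      unfolding zs_def map_append sorted_append by (auto simp: As_def Bs_def)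
    then show ?thesis by (simp add: \<kappa>_def[abs_def])
  qed
  \<comment> \<open>From position \<open>k\<close> on exactly \<open>t\<close> of the \<mu> copies
    of \<xi> remain.\<close>
  define k where "k = length As + (\<mu> - t)"
  have k: "k < length zs" using t t\<mu> by (simp add: k_def zs_def)
  have dk: "drop k zs = replicate t \<xi> @ Bs" using t\<mu> by (simp add: k_def zs_def)
  have zk: "zs ! k = \<xi>"
    using hd_drop_conv_nth[OF k] t(1) unfolding dk by (cases t) auto
  obtain x r h where h: "ereal (norm (\<Phi> (zs ! k))) < r" "h holomorphic_on D r"
     "same_germ E h (\<lambda>z. poly (list_poly (drop k zs)) z * gen x z)" "h (zs ! k) \<noteq> 0"
    using chain_strict(2)[OF uniq arr[OF mz] inE0 set_out sorted k] by blast
  \<comment> \<open>The domain is shrunk so as to contain no zero from \<open>Bs\<close> but still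
    the point \<xi>.\<close>
  define r' where "r' = Min (insert r ((\<lambda>z. ereal (\<kappa> z)) ` set Bs))"
  have Bgt: "\<kappa> \<xi> < \<kappa> z" if "z \<in> set Bs" for z using that by (auto simp: Bs_def)
  have r': "ereal (\<kappa> \<xi>) < r'" unfolding r'_def
    using h(1) Bgt by (subst Min_gr_iff) (auto simp: zk \<kappa>_def)
  have r'r: "r' \<le> r" unfolding r'_def by (intro Min_le) auto
  have r'1: "1 < r'"
  proof -
    have "1 < ereal (\<kappa> \<xi>)" using norm_Phi[OF \<xi>E] by (simp add: \<kappa>_def)
    then show ?thesis using r' by (rule less_trans)
  qed
  have nz: "poly (list_poly Bs) z \<noteq> 0" if z: "z \<in> D r'" for z
  proof
    assume "poly (list_poly Bs) z = 0"
    then have zB: "z \<in> set Bs" by (simp add: poly_list_poly_eq_0_iff)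
    then have "r' \<le> ereal (\<kappa> z)" unfolding r'_def by (intro Min_le) auto
    moreover have "z \<notin> E" using zB by (auto simp: Bs_def out_def)
    ultimately show False using z by (simp add: in_D \<kappa>_def)
  qed
  define u where "u z = (z - \<xi>) ^ t * gen x z" for z
  have germ: "same_germ E h (\<lambda>z. poly (list_poly Bs) z * u z)"
    using h(3) unfolding dk by (simp add: list_poly_replicate u_def mult_ac)
  have anu: "u analytic_on E" unfolding u_def by (intro analytic_intros V_analytic[OF gen_V])
  have hr': "h holomorphic_on D r'" using h(2) D_mono[OF r'r] holomorphic_on_subset by blast
  have "holo_ext (\<lambda>z. poly (list_poly Bs) z * u z) r'" unfolding holo_ext_def using hr' germ by blast
  then have "holo_ext u r'" by (rule holo_ext_divide_no_zero[OF anu _ r'1 nz list_poly_ne_0])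
  then obtain h' where h': "h' holomorphic_on D r'" "same_germ E h' u" by (auto simp: holo_ext_def)
  have "poly (list_poly Bs) \<xi> * h' \<xi> = h \<xi>"
  proof (rule D_identity[OF r'1 _ hr'])
    show "(\<lambda>z. poly (list_poly Bs) z * h' z) holomorphic_on D r'" by (intro holomorphic_intros poly_holo h')
    have "same_germ E (\<lambda>z. poly (list_poly Bs) z * h' z) (\<lambda>z. poly (list_poly Bs) z * u z)"
      by (rule same_germ_map[OF h'(2)]) simp
    then show "same_germ E (\<lambda>z. poly (list_poly Bs) z * h' z) h" using germ same_germ_sym same_germ_trans by blast
    show "\<xi> \<in> D r'" using r' \<xi>E by (simp add: in_D \<kappa>_def)
  qed
  then have "h' \<xi> \<noteq> 0" using h(4) zk by auto
  then have "exact_pole (gen x) \<xi> t r'" unfolding exact_pole_def using h' by (auto simp: u_def[abs_def])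
  then show "\<exists>G\<in>V. \<exists>r. ereal (norm (\<Phi> \<xi>)) < r \<and> exact_pole G \<xi> t r"
    using gen_V r' by (auto simp: \<kappa>_def)
qed

end

section \<open>Exact poles, meromorphic indices and system poles\<close>

context exterior
begin

lemma only_pole_iff_exact_pole:
  assumes G: "G analytic_on E" and \<xi>: "\<xi> \<notin> E" and t: "1 \<le> t"
  shows "only_pole E \<Phi> G \<xi> t \<longleftrightarrow> (\<exists>r. ereal (norm (\<Phi> \<xi>)) < r \<and> exact_pole G \<xi> t r)"
proof
  define a where "a = norm (\<Phi> \<xi>)"
  have a: "1 < a" using norm_Phi[OF \<xi>] by (simp add: a_def)
  assume "only_pole E \<Phi> G \<xi> t"
  then obtain U g where U: "open U" "cD a \<subseteq> U" "same_germ E g G" "g holomorphic_on U - {\<xi>}" "is_pole g \<xi>" "pole_order g \<xi> = t"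
    by (auto simp: only_pole_def a_def[symmetric] closure_D[OF a])
  obtain r where r: "a < r" "D (ereal r) \<subseteq> U" using D_neighborhood[OF U(1,2)] a by auto
  have r1: "1 < ereal r" using r a by simp
  have \<xi>D: "\<xi> \<in> D (ereal r)" using \<xi> r by (simp add: in_D a_def)
  have gD: "g holomorphic_on D (ereal r) - {\<xi>}" using U(4) r(2) holomorphic_on_subset by blast
  obtain \<rho> where \<rho>: "\<rho> > 0" "cball \<xi> \<rho> \<subseteq> D (ereal r)" "zor_poly g \<xi> holomorphic_on cball \<xi> \<rho>" "zor_poly g \<xi> \<xi> \<noteq> 0"
     "\<forall>w\<in>cball \<xi> \<rho> - {\<xi>}. g w = zor_poly g \<xi> w / (w - \<xi>) ^ t"
    using zorder_exist_pole[OF gD open_D[OF r1] \<xi>D U(5)] U(6) by (auto simp: pole_order_def)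
  define h where "h z = (if z \<in> ball \<xi> \<rho> then zor_poly g \<xi> z else (z - \<xi>) ^ t * g z)" for z
  have h2: "h z = (z - \<xi>) ^ t * g z" if "z \<noteq> \<xi>" for z
    using that \<rho>(5) by (auto simp: h_def)
  have "h holomorphic_on ball \<xi> \<rho> \<union> (D (ereal r) - {\<xi>})"
  proof (rule holomorphic_on_Un_open)
    have "zor_poly g \<xi> holomorphic_on ball \<xi> \<rho>" using \<rho>(3) ball_subset_cball holomorphic_on_subset by blast
    then show "h holomorphic_on ball \<xi> \<rho>" by (rule holomorphic_transform) (simp add: h_def)
    have "(\<lambda>z. (z - \<xi>) ^ t * g z) holomorphic_on D (ereal r) - {\<xi>}" by (intro holomorphic_intros gD)
    then show "h holomorphic_on D (ereal r) - {\<xi>}" by (rule holomorphic_transform) (simp add: h2)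
    show "open (D (ereal r) - {\<xi>})" using open_D[OF r1] by auto
  qed auto
  moreover have "D (ereal r) \<subseteq> ball \<xi> \<rho> \<union> (D (ereal r) - {\<xi>})" using \<rho>(1) by auto
  ultimately have "h holomorphic_on D (ereal r)" using holomorphic_on_subset by blast
  moreover have "same_germ E h (\<lambda>z. (z - \<xi>) ^ t * G z)"
  proof -
    obtain W where W: "open W" "E \<subseteq> W" "\<forall>z\<in>W. g z = G z" using U(3) by (auto simp: same_germ_def)
    show ?thesis unfolding same_germ_def by (rule exI[of _ "W - {\<xi>}"]) (use W \<xi> h2 in auto)
  qed
  moreover have "h \<xi> \<noteq> 0" using \<rho> by (simp add: h_def)
  ultimately have "exact_pole G \<xi> t (ereal r)" by (auto simp: exact_pole_def)
  then show "\<exists>r. ereal (norm (\<Phi> \<xi>)) < r \<and> exact_pole G \<xi> t r" using r by (intro exI[of _ "ereal r"]) (simp add: a_def)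
next
  define a where "a = norm (\<Phi> \<xi>)"
  have a: "1 < a" using norm_Phi[OF \<xi>] by (simp add: a_def)
  assume "\<exists>r. ereal (norm (\<Phi> \<xi>)) < r \<and> exact_pole G \<xi> t r"
  then obtain r h where r: "ereal a < r" and h: "h holomorphic_on D r" "same_germ E h (\<lambda>z. (z - \<xi>) ^ t * G z)" "h \<xi> \<noteq> 0"
    by (auto simp: exact_pole_def a_def)
  have r1: "1 < r" using r a by (auto intro: less_trans[of _ "ereal a"])
  have \<xi>D: "\<xi> \<in> D r" using \<xi> r by (simp add: in_D a_def)
  define g where "g z = h z / (z - \<xi>) ^ t" for z
  show "only_pole E \<Phi> G \<xi> t"
    unfolding only_pole_def
  proof (intro exI conjI)
    show "open (D r)" by (rule open_D[OF r1])
    show "closure (D (ereal (norm (\<Phi> \<xi>)))) \<subseteq> D r"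
      using closure_D[OF a] D_cD[OF r] by (simp add: a_def)
    obtain W where W: "open W" "E \<subseteq> W" "\<forall>z\<in>W. h z = (z - \<xi>) ^ t * G z" using h(2) by (auto simp: same_germ_def)
    show "same_germ E g G" unfolding same_germ_def by (rule exI[of _ "W - {\<xi>}"]) (use W \<xi> in \<open>auto simp: g_def\<close>)
    show "g holomorphic_on D r - {\<xi>}" unfolding g_def
      by (intro holomorphic_intros holomorphic_on_subset[OF h(1)]) auto
    show "is_pole g \<xi>" unfolding g_def using is_pole_basic[OF h(1) open_D[OF r1] \<xi>D h(3)] t by auto
    have "zorder g \<xi> = - int t"
      by (rule zorder_eqI[OF open_D[OF r1] \<xi>D h(1,3)]) (simp add: g_def power_int_minus divide_inverse)
    then show "pole_order g \<xi> = t" by (simp add: pole_order_def)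
  qed
qed

lemma exact_pole_pole_function:
  assumes h: "h holomorphic_on D R" "same_germ E h (\<lambda>z. (z - \<xi>) ^ t * G z)" "h \<xi> \<noteq> 0" and R: "1 < R" and \<xi>: "\<xi> \<notin> E" and t: "1 \<le> t"
  defines "g \<equiv> \<lambda>z. h z / (z - \<xi>) ^ t"
  shows "g meromorphic_on D R" "same_germ E g G" "{z \<in> D R. is_pole g z} = D R \<inter> {\<xi>}" "\<xi> \<in> D R \<Longrightarrow> pole_order g \<xi> = t"
proof -
  show "g meromorphic_on D R" unfolding g_def by (intro meromorphic_intros holo_mero h R)
  obtain W where W: "open W" "E \<subseteq> W" "\<forall>z\<in>W. h z = (z - \<xi>) ^ t * G z" using h(2) by (auto simp: same_germ_def)
  show "same_germ E g G" unfolding same_germ_def by (rule exI[of _ "W - {\<xi>}"]) (use W \<xi> in \<open>auto simp: g_def\<close>)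
  have np: "\<not> is_pole g z" if "z \<in> D R" "z \<noteq> \<xi>" for z
  proof (rule not_is_pole_holomorphic)
    show "g holomorphic_on D R - {\<xi>}" unfolding g_def
      by (intro holomorphic_intros holomorphic_on_subset[OF h(1)]) auto
    show "open (D R - {\<xi>})" using open_D[OF R] by auto
  qed (use that in auto)
  have p: "is_pole g \<xi>" if "\<xi> \<in> D R" unfolding g_def using is_pole_basic[OF h(1) open_D[OF R] that h(3)] t by auto
  show "{z \<in> D R. is_pole g z} = D R \<inter> {\<xi>}" using np p by blast
  show "pole_order g \<xi> = t" if "\<xi> \<in> D R"
  proof -
    have "zorder g \<xi> = - int t"
      by (rule zorder_eqI[OF open_D[OF R] that h(1,3)]) (simp add: g_def power_int_minus divide_inverse)
    then show ?thesis by (simp add: pole_order_def)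
  qed
qed

lemma exact_pole_imp_mero_index_ge:
  assumes x: "exact_pole G \<xi> t R" and R: "1 < R" and \<xi>: "\<xi> \<notin> E" and t: "1 \<le> t"
  shows "R \<le> mero_index E \<Phi> t G"
proof -
  obtain h where h: "h holomorphic_on D R" "same_germ E h (\<lambda>z. (z - \<xi>) ^ t * G z)" "h \<xi> \<noteq> 0" using x by (auto simp: exact_pole_def)
  note g = exact_pole_pole_function[OF h R \<xi> t]
  define g where "g = (\<lambda>z. h z / (z - \<xi>) ^ t)"
  have "poles_at_most g (D R) t" unfolding poles_at_most_def g(3)[folded g_def]
    using g(4)[folded g_def] by (cases "\<xi> \<in> D R") auto
  moreover have "continues E \<Phi> R G g" using g(1,2) by (simp add: continues_def g_def)
  ultimately show ?thesis unfolding mero_index_def using R by (intro Sup_upper) blast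
qed

lemma meromorphic_removes_to_holo_ext:
  assumes R: "1 < R" and u: "u analytic_on E" and g: "g meromorphic_on D R" "same_germ E g u" "\<And>z. z \<in> D R \<Longrightarrow> \<not> is_pole g z"
  shows "holo_ext u R"
proof -
  have e: "{z \<in> D R. is_pole g z} = {}" using g(3) by auto
  have "poles_at_most g (D R) 0" unfolding poles_at_most_def e by simp
  then show ?thesis using holo_ext_iff_mero[OF u R] g by (auto simp: continues_def)
qed

text \<open>The pole of order \<open>t\<close> at \<xi> uses up the whole allowance of
  \<open>t\<close> poles, so a continuation with at most \<open>t\<close> poles has no other one and
  becomes holomorphic after multiplication by (z - \<xi>)^t.\<close>

lemma mero_index_imp_exact_pole:
  assumes x: "exact_pole G \<xi> t r0" "ereal (norm (\<Phi> \<xi>)) < r0" and \<xi>: "\<xi> \<notin> E" and t: "1 \<le> t" and G: "G analytic_on E"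
    and \<rho>: "ereal (norm (\<Phi> \<xi>)) < \<rho>" "\<rho> < mero_index E \<Phi> t G"
  shows "exact_pole G \<xi> t \<rho>"
proof -
  obtain R g where R: "\<rho> < R" "1 < R" and g: "g meromorphic_on D R" "same_germ E g G" "poles_at_most g (D R) t"
    using \<rho>(2) unfolding mero_index_def less_Sup_iff continues_def by blast
  have \<rho>1: "1 < \<rho>"
  proof -
    have "1 < ereal (norm (\<Phi> \<xi>))" using norm_Phi[OF \<xi>] by simp
    then show ?thesis using \<rho>(1) by (rule less_trans)
  qed
  define r1 where "r1 = min r0 R"
  have r1: "ereal (norm (\<Phi> \<xi>)) < r1" "r1 \<le> R" "r1 \<le> r0" using x(2) \<rho>(1) R(1) by (auto simp: r1_def intro: less_trans)
  have r11: "1 < r1"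
  proof -
    have "1 < ereal (norm (\<Phi> \<xi>))" using norm_Phi[OF \<xi>] by simp
    then show ?thesis using r1(1) by (rule less_trans)
  qed
  have \<xi>D: "\<xi> \<in> D r1" using \<xi> r1 by (simp add: in_D)
  then have \<xi>R: "\<xi> \<in> D R" using D_mono[OF r1(2)] by blast
  obtain h where h: "h holomorphic_on D r1" "same_germ E h (\<lambda>z. (z - \<xi>) ^ t * G z)" "h \<xi> \<noteq> 0"
    using exact_pole_mono[OF x(1) r1(3)] by (auto simp: exact_pole_def)
  note g0 = exact_pole_pole_function[OF h r11 \<xi> t]
  define g0 where "g0 = (\<lambda>z. h z / (z - \<xi>) ^ t)"
  have "g meromorphic_on D r1" using g(1) D_mono[OF r1(2)] meromorphic_on_subset by blast
  moreover have "same_germ E g g0" using g(2) g0(2) same_germ_sym same_germ_trans unfolding g0_def by blast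
  ultimately have ev: "\<forall>\<^sub>F w in at \<xi>. g w = g0 w" using mero_germ_eq(1)[OF r11 _ g0(1)[folded g0_def] _ \<xi>D] by blast
  have pg: "is_pole g \<xi>" using is_pole_cong[OF ev refl] g0(3) \<xi>D unfolding g0_def by blast
  have pog: "pole_order g \<xi> = t" using zorder_cong[OF ev refl] g0(4)[OF \<xi>D] by (simp add: pole_order_def g0_def)
  have np: "\<not> is_pole g z" if z: "z \<in> D R" "z \<noteq> \<xi>" for z
  proof
    assume p: "is_pole g z"
    have fin: "finite {z \<in> D R. is_pole g z}" and le: "(\<Sum>z | z \<in> D R \<and> is_pole g z. pole_order g z) \<le> t"
      using g(3) by (auto simp: poles_at_most_def)
    have "(\<Sum>z\<in>{\<xi>, z}. pole_order g z) \<le> (\<Sum>z | z \<in> D R \<and> is_pole g z. pole_order g z)"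
      by (rule sum_mono2[OF fin]) (use z p pg \<xi>R in auto)
    then show False using le z pole_order_pos[OF g(1) z(1) p] pog by simp
  qed
  define k where "k z = (z - \<xi>) ^ t * g z" for z
  have km: "k meromorphic_on D R" unfolding k_def by (intro meromorphic_intros g)
  have kg: "same_germ E k (\<lambda>z. (z - \<xi>) ^ t * G z)" unfolding k_def by (rule same_germ_map[OF g(2)]) simp
  have kev: "\<forall>\<^sub>F w in at \<xi>. k w = h w"
    using ev eventually_at_in_open'[OF open_D[OF r11] \<xi>D] eventually_neq_at_within[of \<xi> \<xi>]
    by eventually_elim (simp add: k_def g0_def)
  have "\<not> is_pole k z" if z: "z \<in> D R" for z
  proof (cases "z = \<xi>")
    case True
    have "\<not> is_pole h \<xi>" using not_is_pole_holomorphic[OF open_D[OF r11] \<xi>D h(1)] .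
    then show ?thesis using is_pole_cong[OF kev refl] True by simp
  next
    case False
    have "(\<lambda>w. (w - \<xi>) ^ t) analytic_on {z}" by (intro analytic_intros)
    then show ?thesis unfolding k_def using is_pole_mult_analytic_nonzero1_iff[of "\<lambda>w. (w - \<xi>) ^ t" z g] False np[OF z] by simp
  qed
  then have "holo_ext (\<lambda>z. (z - \<xi>) ^ t * G z) R"
    by (intro meromorphic_removes_to_holo_ext[OF R(2) _ km kg]) (auto intro!: analytic_intros G)
  then obtain h2 where h2: "h2 holomorphic_on D R" "same_germ E h2 (\<lambda>z. (z - \<xi>) ^ t * G z)" by (auto simp: holo_ext_def)
  have "h2 \<xi> = h \<xi>"
  proof (rule D_identity[OF r11 _ h(1) _ \<xi>D])
    show "h2 holomorphic_on D r1" using h2(1) D_mono[OF r1(2)] holomorphic_on_subset by blast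
    show "same_germ E h2 h" using h2(2) h(2) same_germ_sym same_germ_trans by blast
  qed
  then have "exact_pole G \<xi> t R" unfolding exact_pole_def using h2 h(3) by auto
  then show ?thesis using exact_pole_mono R(1) by auto
qed

end

context pade
begin

definition comb_pole :: "complex \<Rightarrow> nat \<Rightarrow> bool" where
  "comb_pole \<xi> t \<longleftrightarrow> (\<exists>G\<in>V. \<exists>r. ereal (norm (\<Phi> \<xi>)) < r \<and> exact_pole G \<xi> t r)"

lemma only_pole_comb_pole: "\<xi> \<notin> E \<Longrightarrow> 1 \<le> t \<Longrightarrow> (\<exists>G\<in>V. only_pole E \<Phi> G \<xi> t) \<longleftrightarrow> comb_pole \<xi> t"
  using only_pole_iff_exact_pole V_analytic by (auto simp: comb_pole_def)

lemma system_pole_iff: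
  "system_pole E \<Phi> d m F \<xi> \<tau> \<longleftrightarrow> \<xi> \<notin> E \<and> 1 \<le> \<tau> \<and> (\<forall>t\<in>{1..\<tau>}. comb_pole \<xi> t) \<and> (\<forall>\<sigma>. (\<forall>t\<in>{1..\<sigma>}. comb_pole \<xi> t) \<longrightarrow> \<sigma> \<le> \<tau>)"
proof (cases "\<xi> \<in> E")
  case False
  have eq: "(\<forall>t\<in>{1..s}. \<exists>G\<in>V. only_pole E \<Phi> G \<xi> t) \<longleftrightarrow> (\<forall>t\<in>{1..s}. comb_pole \<xi> t)" for s
    by (intro ball_cong refl only_pole_comb_pole[OF False]) auto
  show ?thesis unfolding system_pole_def eq ..
qed (simp add: system_pole_def)

lemma system_pole_D:
  assumes "system_pole E \<Phi> d m F \<xi> \<tau>"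
  shows "\<xi> \<notin> E" "1 \<le> \<tau>" "\<forall>t\<in>{1..\<tau>}. comb_pole \<xi> t" "\<forall>\<sigma>. (\<forall>t\<in>{1..\<sigma>}. comb_pole \<xi> t) \<longrightarrow> \<sigma> \<le> \<tau>"
proof -
  note a = assms[unfolded system_pole_iff]
  show "\<xi> \<notin> E" using a by (elim conjE)
  show "1 \<le> \<tau>" using a by (elim conjE)
  show "\<forall>t\<in>{1..\<tau>}. comb_pole \<xi> t" using a by (elim conjE)
  show "\<forall>\<sigma>. (\<forall>t\<in>{1..\<sigma>}. comb_pole \<xi> t) \<longrightarrow> \<sigma> \<le> \<tau>" using a by (elim conjE)
qed

lemma system_pole_unique:
  assumes "system_pole E \<Phi> d m F \<xi> \<tau>" "system_pole E \<Phi> d m F \<xi> \<tau>'"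
  shows "\<tau> = \<tau>'"
proof (rule antisym)
  note a = system_pole_D[OF assms(1)] and b = system_pole_D[OF assms(2)]
  show "\<tau> \<le> \<tau>'" using b(4)[THEN spec, THEN mp, OF a(3)] .
  show "\<tau>' \<le> \<tau>" using a(4)[THEN spec, THEN mp, OF b(3)] .
qed

lemma sys_order_eq: "system_pole E \<Phi> d m F \<xi> \<tau> \<Longrightarrow> sys_order E \<Phi> d m F \<xi> = \<tau>"
  unfolding sys_order_def by (rule the_equality) (auto intro: system_pole_unique)

abbreviation "Z \<equiv> system_poles E \<Phi> d m F"
abbreviation "ord \<equiv> sys_order E \<Phi> d m F"

lemma system_poles_D:
  assumes "\<xi> \<in> Z"
  shows "\<xi> \<notin> E" "1 \<le> ord \<xi>" "\<And>t. 1 \<le> t \<Longrightarrow> t \<le> ord \<xi> \<Longrightarrow> comb_pole \<xi> t"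
proof -
  obtain \<tau> where \<tau>: "system_pole E \<Phi> d m F \<xi> \<tau>" using assms by (auto simp: system_poles_def)
  note s = system_pole_D(1-3)[OF \<tau>]
  show "\<xi> \<notin> E" "1 \<le> ord \<xi>" "\<And>t. 1 \<le> t \<Longrightarrow> t \<le> ord \<xi> \<Longrightarrow> comb_pole \<xi> t"
    using s by (simp_all add: sys_order_eq[OF \<tau>])
qed

lemma rho_raw_exact_pole:
  assumes \<xi>: "\<xi> \<notin> E" and t: "1 \<le> t" and \<rho>: "ereal (norm (\<Phi> \<xi>)) < \<rho>" "\<rho> < rho_raw E \<Phi> d m F \<xi> t"
  shows "\<exists>G\<in>V. exact_pole G \<xi> t \<rho>"
proof -
  obtain G where G: "G \<in> V" "only_pole E \<Phi> G \<xi> t" "\<rho> < mero_index E \<Phi> t G"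
    using \<rho>(2) unfolding rho_raw_def less_Sup_iff by blast
  have an: "G analytic_on E" using V_analytic G by blast
  obtain r where "ereal (norm (\<Phi> \<xi>)) < r" "exact_pole G \<xi> t r" using only_pole_iff_exact_pole[OF an \<xi> t] G(2) by blast
  then show ?thesis using mero_index_imp_exact_pole[OF _ _ \<xi> t an \<rho>(1) G(3)] G(1) by blast
qed

lemma exact_pole_le_rho_raw:
  assumes \<xi>: "\<xi> \<notin> E" and t: "1 \<le> t" and G: "G \<in> V" "exact_pole G \<xi> t R" "ereal (norm (\<Phi> \<xi>)) < R"
  shows "R \<le> rho_raw E \<Phi> d m F \<xi> t"
proof -
  have an: "G analytic_on E" using V_analytic G by blast
  have "1 < ereal (norm (\<Phi> \<xi>))" using norm_Phi[OF \<xi>] by simp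
  then have R: "1 < R" using G(3) by (rule less_trans)
  have "only_pole E \<Phi> G \<xi> t" using only_pole_iff_exact_pole[OF an \<xi> t] G by blast
  then have "mero_index E \<Phi> t G \<le> rho_raw E \<Phi> d m F \<xi> t" unfolding rho_raw_def using G(1) by (intro Sup_upper) blast
  then show ?thesis using exact_pole_imp_mero_index_ge[OF G(2) R \<xi> t] by (rule order_trans[rotated])
qed

lemma rho_raw_gt:
  assumes "\<xi> \<notin> E" "1 \<le> t" "comb_pole \<xi> t" shows "ereal (norm (\<Phi> \<xi>)) < rho_raw E \<Phi> d m F \<xi> t"
proof -
  obtain G r where "G \<in> V" "ereal (norm (\<Phi> \<xi>)) < r" "exact_pole G \<xi> t r" using assms(3) by (auto simp: comb_pole_def)
  then show ?thesis using exact_pole_le_rho_raw[OF assms(1,2)] less_le_trans by blast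
qed

end

section \<open>The lower bound for the rate\<close>

lemma root_poly_split: "finite Z \<Longrightarrow> A \<subseteq> Z \<Longrightarrow> root_poly Z \<tau> = root_poly A \<tau> * root_poly (Z - A) \<tau>"
  unfolding root_poly_def using prod.subset_diff[of A Z "\<lambda>\<xi>. [:- \<xi>, 1:] ^ \<tau> \<xi>"] by (simp add: mult.commute)

lemma poly_root_poly_eq_0D: "finite Z \<Longrightarrow> poly (root_poly Z \<tau>) z = 0 \<Longrightarrow> z \<in> Z"
  using root_poly_nonzero by blast

context exterior
begin

lemma exact_pole_extend:
  assumes x: "exact_pole G \<xi> t r" "ereal (norm (\<Phi> \<xi>)) < r" "\<xi> \<notin> E" and h: "holo_ext (\<lambda>z. (z - \<xi>) ^ t * G z) r'"
    and r': "ereal (norm (\<Phi> \<xi>)) < r'"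
  shows "exact_pole G \<xi> t r'"
proof -
  obtain h1 where h1: "h1 holomorphic_on D r" "same_germ E h1 (\<lambda>z. (z - \<xi>) ^ t * G z)" "h1 \<xi> \<noteq> 0" using x by (auto simp: exact_pole_def)
  obtain h2 where h2: "h2 holomorphic_on D r'" "same_germ E h2 (\<lambda>z. (z - \<xi>) ^ t * G z)" using h by (auto simp: holo_ext_def)
  have m: "ereal (norm (\<Phi> \<xi>)) < min r r'" using x r' by auto
  have "h2 \<xi> = h1 \<xi>"
  proof (rule D_identity[where R = "min r r'" and f = h2 and g = h1 and z = \<xi>])
    have "1 < ereal (norm (\<Phi> \<xi>))" using norm_Phi[OF x(3)] by simp
    then show "1 < min r r'" using m by (rule less_trans)
    show "h2 holomorphic_on D (min r r')" by (rule holomorphic_on_subset[OF h2(1) D_mono]) simp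
    show "h1 holomorphic_on D (min r r')" by (rule holomorphic_on_subset[OF h1(1) D_mono]) simp
    show "same_germ E h2 h1" using h1(2) h2(2) same_germ_sym same_germ_trans by blast
    show "\<xi> \<in> D (min r r')" using m x(3) by (simp add: in_D)
  qed
  then show ?thesis using h1(3) h2 by (auto simp: exact_pole_def)
qed

end

context pade
begin

text \<open>At a point \<zeta> of the level with remaining order \<open>s\<close>, a multiple of a
  combination \<open>Y\<close> with a pole of exactly that order is subtracted, which lowers the
  remaining order by one. \<open>Y\<close> is holomorphic inside the level, so the pole at \<xi>
  keeps its order. The bound by \<open>ord\<close> guarantees that \<open>Y\<close> exists.\<close>

lemma remove_poles_on_level:
  assumes S: "finite S" "S \<subseteq> Z" "\<And>\<zeta>. \<zeta> \<in> S \<Longrightarrow> ereal (norm (\<Phi> \<zeta>)) = \<rho>"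
    and \<xi>: "\<xi> \<notin> E" "ereal (norm (\<Phi> \<xi>)) < \<rho>" and t: "1 \<le> t"
    and \<sigma>: "\<And>\<zeta>. \<zeta> \<in> S \<Longrightarrow> \<sigma> \<zeta> \<le> ord \<zeta>"
    and G: "G \<in> V" "exact_pole G \<xi> t \<rho>" and h: "\<rho> < r" "holo_ext (\<lambda>z. poly (root_poly S \<sigma>) z * ((z - \<xi>) ^ t * G z)) r"
  shows "\<exists>G'\<in>V. \<exists>r>\<rho>. exact_pole G' \<xi> t r"
  using \<sigma> G h
proof (induction "\<Sum>\<zeta>\<in>S. \<sigma> \<zeta>" arbitrary: \<sigma> G r)
  case 0
  then have "root_poly S \<sigma> = 1" using S(1) by (simp add: root_poly_def)
  then have "holo_ext (\<lambda>z. (z - \<xi>) ^ t * G z) r" using 0 by simp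
  then have "exact_pole G \<xi> t r" using 0 \<xi> by (intro exact_pole_extend[OF 0(4) \<xi>(2,1)]) (auto intro: less_trans)
  then show ?case using 0 by blast
next
  case (Suc l)
  have \<rho>1: "1 < \<rho>"
  proof -
    have "1 < ereal (norm (\<Phi> \<xi>))" using norm_Phi[OF \<xi>(1)] by simp
    then show ?thesis using \<xi>(2) by (rule less_trans)
  qed
  obtain \<zeta> where \<zeta>: "\<zeta> \<in> S" "1 \<le> \<sigma> \<zeta>"
    using Suc.hyps(2) by (metis One_nat_def Suc_leI bot_nat_0.not_eq_extremum nat.simps(3) sum.neutral)
  have \<zeta>Z: "\<zeta> \<in> Z" using \<zeta> S by blast
  note z = system_poles_D[OF \<zeta>Z]
  have z\<rho>: "ereal (norm (\<Phi> \<zeta>)) = \<rho>" by (rule S(3)[OF \<zeta>(1)])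
  have "\<zeta> \<noteq> \<xi>" using z\<rho> \<xi>(2) by auto
  define s where "s = \<sigma> \<zeta>"
  obtain Y r3 where Y: "Y \<in> V" "\<rho> < r3" "exact_pole Y \<zeta> s r3"
    using z(3)[of s] \<zeta> Suc.prems(1)[OF \<zeta>(1)] unfolding comb_pole_def z\<rho> s_def by blast
  define r2 where "r2 = min r r3"
  have r2: "\<rho> < r2" "r2 \<le> r" "r2 \<le> r3" using Y Suc.prems by (auto simp: r2_def)
  have r21: "1 < r2" using \<rho>1 r2(1) by (rule less_trans)
  obtain hg where hg: "hg holomorphic_on D r2" "same_germ E hg (\<lambda>z. poly (root_poly S \<sigma>) z * ((z - \<xi>) ^ t * G z))"
    using holo_ext_mono[OF Suc.prems(5) r2(2)] by (auto simp: holo_ext_def)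
  obtain hy where hy: "hy holomorphic_on D r2" "same_germ E hy (\<lambda>z. (z - \<zeta>) ^ s * Y z)" "hy \<zeta> \<noteq> 0"
    using exact_pole_mono[OF Y(3) r2(3)] by (auto simp: exact_pole_def)
  have anY: "Y analytic_on E" using V_analytic Y by blast
  define P where "P = root_poly (S - {\<zeta>}) \<sigma>"
  have split: "root_poly S \<sigma> = [:- \<zeta>, 1:] ^ s * P"
    using root_poly_insert[of "S - {\<zeta>}" \<zeta> \<sigma>] S(1) \<zeta>(1) by (simp add: P_def s_def insert_absorb)
  have P\<zeta>: "poly P \<zeta> \<noteq> 0" unfolding P_def using S(1) by (intro root_poly_nonzero) auto
  \<comment> \<open>The value at \<zeta> of the counterpart of \<open>hg\<close> for
    \<open>Y\<close>. It is nonzero, so \<open>c\<close> can be chosen to make the new numerator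
    vanish at \<zeta>.\<close>
  define w where "w = (\<zeta> - \<xi>) ^ t * poly P \<zeta> * hy \<zeta>"
  have w: "w \<noteq> 0" using P\<zeta> hy(3) \<open>\<zeta> \<noteq> \<xi>\<close> by (simp add: w_def)
  define c where "c = hg \<zeta> / w"
  define G' where "G' z = 1 * G z + (- c) * Y z" for z
  have G'V: "G' \<in> V" unfolding G'_def by (rule V_lin[OF Suc.prems(2) Y(1)])
  define \<sigma>' where "\<sigma>' = \<sigma>(\<zeta> := s - 1)"
  have P': "root_poly (S - {\<zeta>}) \<sigma>' = P" by (simp add: P_def root_poly_def \<sigma>'_def)
  have split': "root_poly S \<sigma>' = [:- \<zeta>, 1:] ^ (s - 1) * P"
    using root_poly_insert[of "S - {\<zeta>}" \<zeta> \<sigma>'] S(1) \<zeta>(1) unfolding P' by (simp add: \<sigma>'_def insert_absorb)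
  have h': "holo_ext (\<lambda>z. poly (root_poly S \<sigma>') z * ((z - \<xi>) ^ t * G' z)) r2"
  proof (rule holo_ext_divide_linear[where h = "\<lambda>z. hg z - c * ((z - \<xi>) ^ t * poly P z * hy z)"])
    show "(\<lambda>z. hg z - c * ((z - \<xi>) ^ t * poly P z * hy z)) holomorphic_on D r2"
      by (intro holomorphic_intros hg hy poly_holo)
    show "same_germ E (\<lambda>z. hg z - c * ((z - \<xi>) ^ t * poly P z * hy z)) (\<lambda>z. (z - \<zeta>) * (poly (root_poly S \<sigma>') z * ((z - \<xi>) ^ t * G' z)))"
    proof (rule same_germ_combine[OF hg(2) hy(2)])
      fix z assume a: "hg z = poly (root_poly S \<sigma>) z * ((z - \<xi>) ^ t * G z)" "hy z = (z - \<zeta>) ^ s * Y z"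
      define B where "B = (z - \<zeta>) ^ (s - 1)"
      have s: "(z - \<zeta>) ^ s = (z - \<zeta>) * B" using \<zeta>(2) by (simp add: s_def power_eq_if B_def)
      have e: "poly (root_poly S \<sigma>) z = (z - \<zeta>) * B * poly P z" "poly (root_poly S \<sigma>') z = B * poly P z" "hy z = (z - \<zeta>) * B * Y z"
        using s by (simp_all add: split split' a(2) B_def)
      show "hg z - c * ((z - \<xi>) ^ t * poly P z * hy z) = (z - \<zeta>) * (poly (root_poly S \<sigma>') z * ((z - \<xi>) ^ t * G' z))"
        unfolding a(1) e G'_def by (simp add: algebra_simps)
    qed
    show "hg \<zeta> - c * ((\<zeta> - \<xi>) ^ t * poly P \<zeta> * hy \<zeta>) = 0"
      unfolding w_def[symmetric] c_def using w by simp
  qed (use z(1) r21 in auto)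
  have x': "exact_pole G' \<xi> t \<rho>"
  proof -
    obtain g1 where g1: "g1 holomorphic_on D \<rho>" "same_germ E g1 (\<lambda>z. (z - \<xi>) ^ t * G z)" "g1 \<xi> \<noteq> 0"
      using Suc.prems(3) by (auto simp: exact_pole_def)
    have "holo_ext (\<lambda>z. (z - \<zeta>) ^ 0 * Y z) (ereal (norm (\<Phi> \<zeta>)))"
      by (rule exact_pole_holo_ext_low[OF Y(3) z(1) _ anY]) (use Y(2) z\<rho> in auto)
    then obtain y1 where y1: "y1 holomorphic_on D \<rho>" "same_germ E y1 Y" by (auto simp: holo_ext_def z\<rho>)
    have germ: "same_germ E (\<lambda>z. g1 z - c * ((z - \<xi>) ^ t * y1 z)) (\<lambda>z. (z - \<xi>) ^ t * G' z)"
      by (rule same_germ_combine[OF g1(2) y1(2)]) (simp add: G'_def algebra_simps)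
    have hol: "(\<lambda>z. g1 z - c * ((z - \<xi>) ^ t * y1 z)) holomorphic_on D \<rho>" by (intro holomorphic_intros g1 y1)
    show ?thesis unfolding exact_pole_def
      by (rule exI[of _ "\<lambda>z. g1 z - c * ((z - \<xi>) ^ t * y1 z)"]) (use germ hol g1(3) t in \<open>auto simp: power_0_left\<close>)
  qed
  show ?case
  proof (rule Suc.hyps(1)[OF _ _ G'V x' r2(1) h'])
    have "(\<Sum>\<zeta>\<in>S. \<sigma> \<zeta>) = \<sigma> \<zeta> + (\<Sum>\<zeta>\<in>S - {\<zeta>}. \<sigma> \<zeta>)" using S(1) \<zeta>(1) by (rule sum.remove)
    moreover have "(\<Sum>\<zeta>\<in>S. \<sigma>' \<zeta>) = \<sigma>' \<zeta> + (\<Sum>\<zeta>\<in>S - {\<zeta>}. \<sigma>' \<zeta>)" using S(1) \<zeta>(1) by (rule sum.remove)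
    moreover have "(\<Sum>\<zeta>\<in>S - {\<zeta>}. \<sigma>' \<zeta>) = (\<Sum>\<zeta>\<in>S - {\<zeta>}. \<sigma> \<zeta>)" by (intro sum.cong) (auto simp: \<sigma>'_def)
    ultimately show "l = (\<Sum>\<zeta>\<in>S. \<sigma>' \<zeta>)" using Suc.hyps(2) \<zeta>(2) by (simp add: \<sigma>'_def s_def)
    show "\<sigma>' \<zeta>' \<le> ord \<zeta>'" if "\<zeta>' \<in> S" for \<zeta>' using Suc.prems(1)[OF that] by (auto simp: \<sigma>'_def s_def)
  qed
qed


text \<open>Up to \<open>X\<close> only system poles can stop the continuation, and they lie on
  finitely many levels. Clearing a level replaces \<open>G\<close> by a combination that is still
  holomorphic below the level of \<xi>, so the assumed gain up to \<open>X\<close> is available for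
  it again. Each time fewer system poles lie at or beyond the index reached.\<close>

lemma clear_disc:
  assumes Z: "finite Z" and \<xi>: "\<xi> \<notin> E" and t: "1 \<le> t" and X: "norm (\<Phi> \<xi>) < X"
    and gain: "\<And>G. G \<in> V \<Longrightarrow> holo_ext G (ereal (norm (\<Phi> \<xi>))) \<Longrightarrow> holo_ext (\<lambda>z. poly (root_poly Z ord) z * G z) (ereal X)"
    and G: "G \<in> V" "exact_pole G \<xi> t (ereal r)" "norm (\<Phi> \<xi>) < r"
  shows "\<exists>G'\<in>V. exact_pole G' \<xi> t (ereal X)"
  using G
proof (induction "card {\<zeta>\<in>Z. r \<le> norm (\<Phi> \<zeta>)}" arbitrary: G r rule: less_induct)
  case less
  define \<kappa> where "\<kappa> z = norm (\<Phi> z)" for z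
  have \<kappa>1: "1 < \<kappa> \<xi>" using norm_Phi[OF \<xi>] by (simp add: \<kappa>_def)
  have an: "G analytic_on E" using V_analytic less.prems by blast
  define u where "u z = (z - \<xi>) ^ t * G z" for z
  have u: "holo_ext u (ereal r)" unfolding u_def using exact_pole_holo_ext_high[OF less.prems(2) order_refl] .
  have "holo_ext (\<lambda>z. (z - \<xi>) ^ 0 * G z) (ereal (norm (\<Phi> \<xi>)))"
    by (rule exact_pole_holo_ext_low[OF less.prems(2) \<xi> _ an]) (use less.prems in auto)
  then have "holo_ext (\<lambda>z. poly (root_poly Z ord) z * G z) (ereal X)" using gain[OF less.prems(1)] by simp
  from holo_ext_poly_mult[OF this, of "[:- \<xi>, 1:] ^ t"]
  have Ru: "holo_ext (\<lambda>z. poly (root_poly Z ord) z * u z) (ereal X)" by (simp add: u_def mult.left_commute)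
  have ext: "holo_ext u (ereal r')" if r': "1 < r'" "r' \<le> X" "\<And>\<zeta>. \<zeta> \<in> Z \<Longrightarrow> \<kappa> \<zeta> < r' \<Longrightarrow> \<kappa> \<zeta> < r" for r'
  proof (rule holo_ext_divide[OF u _ holo_ext_mono[OF Ru] _ _ root_poly_ne_0])
    fix z assume z: "z \<in> D (ereal r')" "poly (root_poly Z ord) z = 0"
    then have zZ: "z \<in> Z" using poly_root_poly_eq_0D[OF Z] by blast
    then show "z \<in> D (ereal r)" using z r'(3) system_poles_D(1)[OF zZ] by (simp add: in_D \<kappa>_def)
  qed (use r' less.prems \<kappa>1 in \<open>auto simp: \<kappa>_def\<close>)
  define L where "L = {\<zeta>\<in>Z. r \<le> \<kappa> \<zeta> \<and> \<kappa> \<zeta> < X}"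
  show ?case
  proof (cases "X \<le> r \<or> L = {}")
    case True
    have "holo_ext u (ereal X)"
    proof (cases "X \<le> r")
      case True then show ?thesis using u holo_ext_mono by simp
    next
      case False
      show ?thesis by (rule ext) (use True False X \<kappa>1 in \<open>force simp: L_def \<kappa>_def\<close>)+
    qed
    then have "exact_pole G \<xi> t (ereal X)" unfolding u_def using X less.prems by (intro exact_pole_extend[OF less.prems(2) _ \<xi>]) auto
    then show ?thesis using less.prems by blast
  next
    case False
    have fL: "finite L" using Z by (simp add: L_def)
    define \<rho> where "\<rho> = Min (\<kappa> ` L)"
    have "\<rho> \<in> \<kappa> ` L" unfolding \<rho>_def using False fL by (intro Min_in) auto
    then obtain \<zeta>0 where \<zeta>0: "\<zeta>0 \<in> L" "\<kappa> \<zeta>0 = \<rho>" by auto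
    have \<rho>: "r \<le> \<rho>" "\<rho> < X" using \<zeta>0 by (auto simp: L_def)
    have \<rho>min: "\<rho> \<le> \<kappa> \<zeta>" if "\<zeta> \<in> L" for \<zeta> unfolding \<rho>_def using that fL by (intro Min_le) auto
    define S where "S = {\<zeta>\<in>Z. \<kappa> \<zeta> = \<rho>}"
    have \<rho>u: "holo_ext u (ereal \<rho>)"
    proof (rule ext)
      fix \<zeta> assume "\<zeta> \<in> Z" "\<kappa> \<zeta> < \<rho>"
      then show "\<kappa> \<zeta> < r" using \<rho>min[of \<zeta>] \<rho> by (force simp: L_def)
    qed (use \<rho> less.prems \<kappa>1 in \<open>auto simp: \<kappa>_def\<close>)
    have \<xi>\<rho>: "norm (\<Phi> \<xi>) < \<rho>" using less.prems \<rho> by simp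
    have x\<rho>: "exact_pole G \<xi> t (ereal \<rho>)" using \<rho>u less.prems \<xi>\<rho> unfolding u_def by (intro exact_pole_extend[OF less.prems(2) _ \<xi>]) auto
    \<comment> \<open>Within \<open>D r2\<close> the factors of \<open>Z - S\<close> vanish only
      below the level \<rho>, where continuation is already known, so they can be divided
      out.\<close>
    define r2 where "r2 = Min (insert X (\<kappa> ` {\<zeta>\<in>Z. \<rho> < \<kappa> \<zeta>}))"
    have r2: "\<rho> < r2" "r2 \<le> X" "\<And>\<zeta>. \<zeta> \<in> Z \<Longrightarrow> \<rho> < \<kappa> \<zeta> \<Longrightarrow> r2 \<le> \<kappa> \<zeta>"
    proof -
      show "\<rho> < r2" unfolding r2_def using Z \<rho> by (subst Min_gr_iff) auto
      show "r2 \<le> X" unfolding r2_def using Z by (intro Min_le) auto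
      show "r2 \<le> \<kappa> \<zeta>" if "\<zeta> \<in> Z" "\<rho> < \<kappa> \<zeta>" for \<zeta> unfolding r2_def using Z that by (intro Min_le) auto
    qed
    have \<rho>1: "1 < \<rho>" using \<xi>\<rho> \<kappa>1 by (simp add: \<kappa>_def)
    have "holo_ext (\<lambda>z. poly (root_poly S ord) z * u z) (ereal r2)"
    proof (rule holo_ext_divide[where p = "root_poly (Z - S) ord" and R = "ereal \<rho>"])
      show "holo_ext (\<lambda>z. poly (root_poly S ord) z * u z) (ereal \<rho>)" by (rule holo_ext_poly_mult[OF \<rho>u])
      have "root_poly Z ord = root_poly S ord * root_poly (Z - S) ord" using Z by (intro root_poly_split) (auto simp: S_def)
      then have "(\<lambda>z. poly (root_poly (Z - S) ord) z * (poly (root_poly S ord) z * u z)) = (\<lambda>z. poly (root_poly Z ord) z * u z)"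
        by (simp add: mult_ac)
      then show "holo_ext (\<lambda>z. poly (root_poly (Z - S) ord) z * (poly (root_poly S ord) z * u z)) (ereal r2)"
        using holo_ext_mono[OF Ru] r2 by simp
      fix z assume z: "z \<in> D (ereal r2)" "poly (root_poly (Z - S) ord) z = 0"
      then have zZ: "z \<in> Z" "\<kappa> z \<noteq> \<rho>" using poly_root_poly_eq_0D[of "Z - S" ord z] Z by (auto simp: S_def)
      have "\<kappa> z < r2" using z system_poles_D(1)[OF zZ(1)] by (simp add: in_D \<kappa>_def)
      then have "\<kappa> z < \<rho>" using r2(3)[OF zZ(1)] zZ(2) by force
      then show "z \<in> D (ereal \<rho>)" using system_poles_D(1)[OF zZ(1)] by (simp add: in_D \<kappa>_def)
    qed (use \<rho>1 r2 root_poly_ne_0 in auto)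
    then have "\<exists>G'\<in>V. \<exists>r>ereal \<rho>. exact_pole G' \<xi> t r" unfolding u_def
      by (intro remove_poles_on_level[OF _ _ _ \<xi> _ t order_refl less.prems(1) x\<rho>, where S = S and r = "ereal r2"])
        (use Z \<xi>\<rho> r2 in \<open>auto simp: S_def \<kappa>_def\<close>)
    then obtain G' r' where G': "G' \<in> V" "ereal \<rho> < r'" "exact_pole G' \<xi> t r'" by blast
    obtain r'' where r'': "\<rho> < r''" "ereal r'' < r'" using ereal_dense2[OF G'(2)] by auto
    have x'': "exact_pole G' \<xi> t (ereal r'')" using exact_pole_mono[OF G'(3)] r'' by simp
    show ?thesis
    proof (rule less.hyps[OF _ G'(1) x''])
      have "{\<zeta> \<in> Z. r'' \<le> norm (\<Phi> \<zeta>)} \<subset> {\<zeta> \<in> Z. r \<le> norm (\<Phi> \<zeta>)}"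
      proof
        show "{\<zeta> \<in> Z. r'' \<le> norm (\<Phi> \<zeta>)} \<subseteq> {\<zeta> \<in> Z. r \<le> norm (\<Phi> \<zeta>)}" using r'' \<rho> by auto
        have "\<zeta>0 \<in> {\<zeta> \<in> Z. r \<le> norm (\<Phi> \<zeta>)}" "\<zeta>0 \<notin> {\<zeta> \<in> Z. r'' \<le> norm (\<Phi> \<zeta>)}"
          using \<zeta>0 r'' by (auto simp: L_def \<kappa>_def)
        then show "{\<zeta> \<in> Z. r'' \<le> norm (\<Phi> \<zeta>)} \<noteq> {\<zeta> \<in> Z. r \<le> norm (\<Phi> \<zeta>)}" by blast
      qed
      then show "card {\<zeta> \<in> Z. r'' \<le> norm (\<Phi> \<zeta>)} < card {\<zeta> \<in> Z. r \<le> norm (\<Phi> \<zeta>)}" using Z by (intro psubset_card_mono) auto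
      show "norm (\<Phi> \<xi>) < r''" using \<xi>\<rho> r'' by simp
    qed
  qed
qed

end

context pade_limit
begin

theorem rate_lower_bound:
  assumes Z: "finite Z" and R: "R = root_poly Z ord" and \<xi>: "\<xi> \<in> Z" and t: "1 \<le> t" "t \<le> ord \<xi>"
  shows "ereal (norm (\<Phi> \<xi>) / \<theta>) \<le> rho_raw E \<Phi> d m F \<xi> t"
proof -
  note z = system_poles_D[OF \<xi>]
  define a where "a = norm (\<Phi> \<xi>)"
  have a1: "1 < a" using norm_Phi[OF z(1)] by (simp add: a_def)
  have aX: "a < a / \<theta>" using \<theta> a1 by (simp add: less_divide_eq)
  obtain G r where G: "G \<in> V" "ereal a < r" "exact_pole G \<xi> t r" using z(3)[OF t] by (auto simp: comb_pole_def a_def)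
  obtain r' where r': "a < r'" "ereal r' < r" using ereal_dense2[OF G(2)] by auto
  have "\<exists>G'\<in>V. exact_pole G' \<xi> t (ereal (a / \<theta>))"
  proof (rule clear_disc[OF Z z(1) t(1) _ _ G(1)])
    show "exact_pole G \<xi> t (ereal r')" using exact_pole_mono[OF G(3)] r' by simp
    show "holo_ext (\<lambda>z. poly (root_poly Z ord) z * G z) (ereal (a / \<theta>))" if "G \<in> V" "holo_ext G (ereal (norm (\<Phi> \<xi>)))" for G
      using gain[OF that(1), of a] that(2) a1 R by (simp add: a_def)
  qed (use r' aX in \<open>auto simp: a_def\<close>)
  then obtain G' where "G' \<in> V" "exact_pole G' \<xi> t (ereal (a / \<theta>))" by blast
  then show ?thesis using exact_pole_le_rho_raw[OF z(1) t(1)] aX by (simp add: a_def)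
qed

end

section \<open>The error of the approximants\<close>

context exterior
begin

text \<open>There are two regimes. For s1 < x the Faber series converges on \<open>K\<close> and its
  tail is estimated. Otherwise the claimed bound does not decay, so it is enough that the partial
  sums grow no faster, and the bounded function \<open>W\<close> is absorbed. Thus \<open>K\<close>
  may reach beyond the domain of \<open>g\<close>, as happens for polar parts.\<close>

lemma partial_sum_error:
  assumes u: "u analytic_on E" and g: "g holomorphic_on D (ereal y)" "same_germ E g u"
    and x: "1 < x" "x < y" and s: "1 < s" "s < s1"
    and K: "K \<subseteq> cD s" "\<And>z. z \<in> K \<Longrightarrow> z \<in> D (ereal y) \<Longrightarrow> W z = g z" "\<And>z. z \<in> K \<Longrightarrow> norm (W z) \<le> B0"
  obtains C where "C > 0" "\<And>n p z. 1 \<le> n \<Longrightarrow> degree p \<le> n - 1 \<Longrightarrow> (\<And>j. j < n \<Longrightarrow> fc (poly p) j = fc u j) \<Longrightarrow> z \<in> K \<Longrightarrow>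
     norm (W z - poly p z) \<le> C * real n * (s1 / x) ^ n"
proof -
  obtain C0 where C0: "C0 > 0" "\<And>R e z. ereal s1 < R \<Longrightarrow> e holomorphic_on D R \<Longrightarrow> z \<in> cD s \<Longrightarrow>
     norm (e z) \<le> C0 * (\<Sum>n. norm (fc e n) * s1 ^ n)" using faber_bound[OF s] by metis
  have hu: "holo_ext u (ereal y)" using g by (auto simp: holo_ext_def)
  obtain B where B: "B > 0" "\<And>n. norm (fc u n) \<le> B / x ^ n" using fc_bound[OF u hu x(1)] x(2) by auto
  have s1: "1 < s1" using s by simp
  have trm: "norm (fc u j) * s1 ^ j \<le> B * (s1 / x) ^ j" for j
  proof -
    have "norm (fc u j) * s1 ^ j \<le> B / x ^ j * s1 ^ j" using B(2)[of j] s1 by (intro mult_right_mono) auto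
    then show ?thesis by (simp add: power_divide)
  qed
  show ?thesis
  proof (cases "s1 < x")
    case True
    define q where "q = s1 / x"
    have q: "0 < q" "q < 1" using True s1 by (auto simp: q_def)
    show ?thesis
    proof (rule that[of "C0 * (B / (1 - q))"])
      show "C0 * (B / (1 - q)) > 0" using C0 B q by simp
      fix n p z assume n: "1 \<le> n" "degree (p :: complex poly) \<le> n - 1" "\<And>j. j < n \<Longrightarrow> fc (poly p) j = fc u j" and z: "z \<in> K"
      define e where "e v = g v - poly p v" for v
      have y1: "1 < ereal y" using x by simp
      have ang: "g analytic_on E" using g(1) open_D[OF y1] E_sub_D analytic_on_holomorphic by blast
      have eh: "e holomorphic_on D (ereal y)" unfolding e_def by (intro holomorphic_intros g poly_holo)
      have fe: "fc e j = (if j < n then 0 else fc u j)" for j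
      proof -
        have "fc e j = fc g j - fc (poly p) j" unfolding e_def by (rule fc_diff[OF ang poly_analytic])
        also have "fc g j = fc u j" by (rule fc_germ[OF ang u g(2)])
        finally show ?thesis using n(1,2) n(3)[of j] fc_poly_eq_0[of p j] by auto
      qed
      have sm: "(\<lambda>l. B * q ^ n * q ^ l) sums (B * q ^ n * (1 / (1 - q)))"
        using q by (intro sums_mult geometric_sums) auto
      have tail: "norm (fc e (l + n)) * s1 ^ (l + n) \<le> B * q ^ n * q ^ l" for l
        using trm[of "l + n"] by (simp add: fe q_def power_add mult_ac)
      have sm1: "summable (\<lambda>l. norm (fc e (l + n)) * s1 ^ (l + n))"
        by (rule summable_comparison_test'[OF sums_summable[OF sm], of 0]) (use tail s1 in auto)
      then have sm2: "summable (\<lambda>l. norm (fc e l) * s1 ^ l)" by (subst (asm) summable_iff_shift[of "\<lambda>l. norm (fc e l) * s1 ^ l"])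
      have "(\<Sum>l. norm (fc e l) * s1 ^ l) = (\<Sum>l. norm (fc e (l + n)) * s1 ^ (l + n)) + (\<Sum>l<n. norm (fc e l) * s1 ^ l)"
        by (rule suminf_split_initial_segment[OF sm2])
      also have "(\<Sum>l<n. norm (fc e l) * s1 ^ l) = 0" by (intro sum.neutral) (auto simp: fe)
      also have "(\<Sum>l. norm (fc e (l + n)) * s1 ^ (l + n)) \<le> B * q ^ n * (1 / (1 - q))"
        using suminf_le[OF tail sm1 sums_summable[OF sm]] sums_unique[OF sm] by simp
      finally have S: "(\<Sum>l. norm (fc e l) * s1 ^ l) \<le> B / (1 - q) * q ^ n" by simp
      have zs: "z \<in> cD s" using z K by blast
      have "z \<in> D (ereal y)" using zs D_cD[of s "ereal y"] True x s by auto
      then have "W z - poly p z = e z" using K(2)[OF z] by (simp add: e_def)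
      also have "norm (e z) \<le> C0 * (\<Sum>l. norm (fc e l) * s1 ^ l)"
        using True x by (intro C0(2)[OF _ eh zs]) auto
      also have "\<dots> \<le> C0 * (B / (1 - q) * q ^ n)" by (rule mult_left_mono[OF S]) (use C0 in simp)
      also have "\<dots> \<le> C0 * (B / (1 - q)) * real n * q ^ n"
      proof -
        have "C0 * (B / (1 - q)) * 1 * q ^ n \<le> C0 * (B / (1 - q)) * real n * q ^ n"
          using n(1) q C0 B by (intro mult_right_mono mult_left_mono) auto
        then show ?thesis by simp
      qed
      finally show "norm (W z - poly p z) \<le> C0 * (B / (1 - q)) * real n * (s1 / x) ^ n" by (simp add: q_def)
    qed
  next
    case False
    then have q1: "1 \<le> s1 / x" using x by simp
    define B1 where "B1 = max B0 0"
    show ?thesis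
    proof (rule that[of "C0 * B + B1"])
      show "C0 * B + B1 > 0" using C0 B by (auto simp: B1_def intro: add_pos_nonneg)
      fix n p z assume n: "1 \<le> n" "degree (p :: complex poly) \<le> n - 1" "\<And>j. j < n \<Longrightarrow> fc (poly p) j = fc u j" and z: "z \<in> K"
      have zs: "z \<in> cD s" using z K by blast
      have f0: "fc (poly p) j = 0" if "n \<le> j" for j using that n by (intro fc_poly_eq_0) auto
      have "norm (poly p z) \<le> C0 * (\<Sum>l. norm (fc (poly p) l) * s1 ^ l)"
        by (rule C0(2)[OF _ _ zs, of \<infinity>]) (auto intro: poly_holo)
      also have "(\<Sum>l. norm (fc (poly p) l) * s1 ^ l) = (\<Sum>l<n. norm (fc (poly p) l) * s1 ^ l)"
        by (rule suminf_finite) (auto simp: f0)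
      also have "\<dots> \<le> (\<Sum>l<n. B * (s1 / x) ^ n)"
      proof (rule sum_mono)
        fix l assume l: "l \<in> {..<n}"
        have "norm (fc (poly p) l) * s1 ^ l \<le> B * (s1 / x) ^ l" using trm[of l] n(3)[of l] l by simp
        also have "\<dots> \<le> B * (s1 / x) ^ n" using l q1 B by (intro mult_left_mono power_increasing) auto
        finally show "norm (fc (poly p) l) * s1 ^ l \<le> B * (s1 / x) ^ n" .
      qed
      finally have 1: "norm (poly p z) \<le> C0 * (real n * (B * (s1 / x) ^ n))" using C0 by simp
      have "1 \<le> (s1 / x) ^ n" using q1 by (rule one_le_power)
      then have "1 * 1 \<le> real n * (s1 / x) ^ n" using n(1) by (intro mult_mono) auto
      then have "B1 * 1 \<le> B1 * (real n * (s1 / x) ^ n)" by (intro mult_left_mono) (auto simp: B1_def)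
      moreover have "norm (W z) \<le> B1" using K(3)[OF z] by (simp add: B1_def)
      ultimately have 2: "norm (W z) \<le> B1 * (real n * (s1 / x) ^ n)" by simp
      have "norm (W z - poly p z) \<le> norm (W z) + norm (poly p z)" by (rule norm_triangle_ineq4)
      also have "\<dots> \<le> B1 * (real n * (s1 / x) ^ n) + C0 * (real n * (B * (s1 / x) ^ n))" using 1 2 by simp
      also have "\<dots> = (C0 * B + B1) * real n * (s1 / x) ^ n" by (simp add: algebra_simps)
      finally show "norm (W z - poly p z) \<le> (C0 * B + B1) * real n * (s1 / x) ^ n" .
    qed
  qed
qed

end

lemma poly_dvd_prod_linear_taylor_coeff:
  assumes "root_poly Z \<tau> dvd p" "finite Z" "\<xi> \<in> Z" "i < \<tau> \<xi>"
  shows "taylor_coeff p \<xi> i = 0"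
  using dvd_trans[OF linear_power_dvd_root_poly[OF assms(2,3)] assms(1)] assms(4) by (simp add: linear_power_dvd_iff_taylor_coeff)

lemma n_power_absorb:
  fixes a b :: real
  assumes "0 < a" "a < b"
  obtains C where "C > 0" "\<And>n. real n * a ^ n \<le> C * b ^ n"
proof -
  have "(\<lambda>n. real n * (a / b) ^ n) \<longlonglongrightarrow> 0" using assms powser_times_n_limit_0[of "a / b"] by simp
  then have "Bseq (\<lambda>n. real n * (a / b) ^ n)" by (rule convergent_imp_Bseq[OF convergentI])
  then obtain C where C: "C > 0" "\<And>n. norm (real n * (a / b) ^ n) \<le> C" by (auto simp: Bseq_def)
  show ?thesis
  proof (rule that[OF C(1)])
    fix n
    have "real n * (a / b) ^ n \<le> C" using C(2)[of n] assms by simp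
    then have "real n * (a / b) ^ n * b ^ n \<le> C * b ^ n" using assms by (intro mult_right_mono) auto
    then show "real n * a ^ n \<le> C * b ^ n" using assms by (simp add: power_divide)
  qed
qed

context pade
begin

text \<open>Division by \<open>Qh\<close> writes the denominator as \<open>Qh\<close> times a
  polynomial plus a Hermite remainder with its Taylor coefficients at the poles, and partial sums
  depend linearly on the function. The terms with \<open>Qh\<close> are holomorphic up to \<rho>c
  and have rate s1/\<rho>. For the others the error of the partial sum is nearly of size (s1/|\<Phi>
  \<xi>|)^n, and the Taylor coefficient, of size (|\<Phi> \<xi>|/\<rho>)^n, brings it back to nearly
  (s1/\<rho>)^n.\<close>

theorem approximant_error:
  assumes i0: "i0 \<in> index_set" and P: "finite P" "P \<inter> E = {}" "P \<subseteq> D \<rho>c"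
    and H: "H holomorphic_on D \<rho>c" "same_germ E H (\<lambda>z. poly (root_poly P \<tau>) z * bas i0 z)"
    and K: "compact K" "K \<subseteq> D \<rho>c - P" "K \<subseteq> cD s"
    and q: "\<And>n. 1 \<le> n \<Longrightarrow> Sol n (q n)" "\<forall>\<^sub>F n in sequentially. coeff_norm (q n) \<le> B0"
    and p: "\<And>n. 1 \<le> n \<Longrightarrow> degree (p n) \<le> n - 1"
      "\<And>n j. 1 \<le> n \<Longrightarrow> j < n \<Longrightarrow> fc (poly (p n)) j = fc (\<lambda>z. poly (q n) z * bas i0 z) j"
    and s: "1 < s" "s < s2" "s2 < \<rho>" and \<rho>: "ereal \<rho> < \<rho>c"
    and tcb: "\<And>\<xi> i. \<xi> \<in> P \<Longrightarrow> i < \<tau> \<xi> \<Longrightarrow> \<exists>C. \<forall>\<^sub>F n in sequentially. norm (taylor_coeff (q n) \<xi> i) \<le> C * (norm (\<Phi> \<xi>) / \<rho>) ^ n"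
  shows "\<exists>C. \<forall>\<^sub>F n in sequentially. \<forall>z\<in>K. norm (poly (q n) z * (H z / poly (root_poly P \<tau>) z) - poly (p n) z) \<le> C * (s2 / \<rho>) ^ n"
proof -
  define Qh where "Qh = root_poly P \<tau>"
  define b0 where "b0 = bas i0"
  have anb: "b0 analytic_on E" unfolding b0_def by (rule bas_analytic[OF i0])
  have Qh0: "Qh \<noteq> 0" unfolding Qh_def by (rule root_poly_ne_0)
  have QhK: "poly Qh z \<noteq> 0" if "z \<in> K" for z unfolding Qh_def using that K by (intro root_poly_nonzero P) auto
  obtain s1 where s1: "s < s1" "s1 < s2" using s dense by blast
  have \<rho>c: "1 < \<rho>c" using \<rho> s by (auto intro: less_trans[of _ "ereal \<rho>"])
  obtain e where e: "\<And>\<xi> i. \<xi> \<in> P \<Longrightarrow> i < \<tau> \<xi> \<Longrightarrow> degree (e \<xi> i) < (\<Sum>\<xi>\<in>P. \<tau> \<xi>)"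
    "\<And>\<xi> i \<xi>' i'. \<xi> \<in> P \<Longrightarrow> i < \<tau> \<xi> \<Longrightarrow> \<xi>' \<in> P \<Longrightarrow> i' < \<tau> \<xi>' \<Longrightarrow>
       taylor_coeff (e \<xi> i) \<xi>' i' = (if \<xi> = \<xi>' \<and> i = i' then 1 else 0)"
    using hermite_basis[OF P(1), of \<tau>] by blast
  \<comment> \<open>Division is done monomial by monomial, so that only finitely many functions,
    independent of \<open>n\<close>, enter the estimates.\<close>
  define A where "A l = monom 1 l div Qh" for l :: nat
  define Pr where "Pr = (SIGMA \<xi>:P. {..<\<tau> \<xi>})"
  have fPr: "finite Pr" using P by (simp add: Pr_def)
  have decomp: "r = Qh * (\<Sum>l\<le>N. smult (coeff r l) (A l)) + (\<Sum>pr\<in>Pr. smult (taylor_coeff r (fst pr) (snd pr)) (e (fst pr) (snd pr)))"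
    if r: "degree r \<le> N" for r
  proof -
    define b where "b = (\<Sum>l\<le>N. smult (coeff r l) (monom 1 l mod Qh))"
    define a where "a = (\<Sum>l\<le>N. smult (coeff r l) (A l))"
    have "r = (\<Sum>l\<le>N. smult (coeff r l) (monom 1 l))" by (rule poly_sum_monoms[OF r])
    also have "\<dots> = (\<Sum>l\<le>N. Qh * smult (coeff r l) (A l) + smult (coeff r l) (monom 1 l mod Qh))"
    proof (rule sum.cong)
      fix l
      have "monom 1 l = Qh * A l + monom 1 l mod Qh" unfolding A_def by simp
      then have "smult (coeff r l) (monom 1 l) = smult (coeff r l) (Qh * A l + monom 1 l mod Qh)" by simp
      then show "smult (coeff r l) (monom 1 l) = Qh * smult (coeff r l) (A l) + smult (coeff r l) (monom 1 l mod Qh)"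
        by (simp add: smult_add_right)
    qed simp
    also have "\<dots> = Qh * a + b" by (simp add: a_def b_def sum.distrib sum_distrib_left)
    finally have rab: "r = Qh * a + b" .
    have "b = 0 \<or> degree b < degree Qh"
    proof (cases "degree Qh = 0")
      case True
      then have "monom 1 l mod Qh = 0" for l using Qh0 degree_mod_less[of Qh "monom 1 l"] by auto
      then show ?thesis by (simp add: b_def)
    next
      case False
      have "degree (monom 1 l mod Qh) < degree Qh" for l using degree_mod_less[OF Qh0, of "monom 1 l"] False by auto
      then show ?thesis using False unfolding b_def
        by (intro disjI2 degree_sum_less) (auto intro: le_less_trans[OF degree_smult_le])
    qed
    then have "b = (\<Sum>\<xi>\<in>P. \<Sum>i<\<tau> \<xi>. smult (taylor_coeff b \<xi> i) (e \<xi> i))"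
      using degree_root_poly[OF P(1), of \<tau>] by (intro hermite_expand[OF P(1) e]) (auto simp: Qh_def)
    also have "\<dots> = (\<Sum>\<xi>\<in>P. \<Sum>i<\<tau> \<xi>. smult (taylor_coeff r \<xi> i) (e \<xi> i))"
    proof (intro sum.cong refl)
      fix \<xi> i assume z: "\<xi> \<in> P" "i \<in> {..<\<tau> \<xi>}"
      have "taylor_coeff (Qh * a) \<xi> i = 0" using z P by (intro poly_dvd_prod_linear_taylor_coeff[of P \<tau>]) (auto simp: Qh_def)
      then show "smult (taylor_coeff b \<xi> i) (e \<xi> i) = smult (taylor_coeff r \<xi> i) (e \<xi> i)" by (simp add: rab taylor_coeff_add)
    qed
    also have "\<dots> = (\<Sum>pr\<in>Pr. smult (taylor_coeff r (fst pr) (snd pr)) (e (fst pr) (snd pr)))"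
      unfolding Pr_def using P by (subst sum.Sigma) (auto simp: case_prod_beta)
    finally have bb: "b = (\<Sum>pr\<in>Pr. smult (taylor_coeff r (fst pr) (snd pr)) (e (fst pr) (snd pr)))" .
    from rab show ?thesis unfolding a_def bb .
  qed
  define u where "u l z = poly (A l) z * (poly Qh z * b0 z)" for l z
  define v where "v pr z = poly (e (fst pr) (snd pr)) z * b0 z" for pr z
  have anu: "u l analytic_on E" for l unfolding u_def by (intro poly_mult_analytic anb)
  have anv: "v pr analytic_on E" for pr unfolding v_def by (intro poly_mult_analytic anb)
  have expand: "poly r z * b0 z = (\<Sum>l\<le>N. coeff r l * u l z) + (\<Sum>pr\<in>Pr. taylor_coeff r (fst pr) (snd pr) * v pr z)" if r: "degree r \<le> N" for r z
    by (subst decomp[OF r]) (simp add: u_def v_def poly_sum sum_distrib_left sum_distrib_right algebra_simps)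
  have expandH: "poly r z * (H z / poly Qh z) = (\<Sum>l\<le>N. coeff r l * (poly (A l) z * H z)) + (\<Sum>pr\<in>Pr. taylor_coeff r (fst pr) (snd pr) * (poly (e (fst pr) (snd pr)) z * (H z / poly Qh z)))"
    if r: "degree r \<le> N" and z: "z \<in> K" for r z
  proof -
    have "poly r z = poly Qh z * (\<Sum>l\<le>N. coeff r l * poly (A l) z) + (\<Sum>pr\<in>Pr. taylor_coeff r (fst pr) (snd pr) * poly (e (fst pr) (snd pr)) z)"
      by (subst decomp[OF r]) (simp add: poly_sum)
    moreover have "(a * b + c) * (h / a) = b * h + c * (h / a)" if "a \<noteq> 0" for a b c h :: complex
      using that by (simp add: field_simps)
    ultimately have "poly r z * (H z / poly Qh z) = (\<Sum>l\<le>N. coeff r l * poly (A l) z) * H z + (\<Sum>pr\<in>Pr. taylor_coeff r (fst pr) (snd pr) * poly (e (fst pr) (snd pr)) z) * (H z / poly Qh z)"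
      using QhK[OF z] by (simp only:)
    then show ?thesis by (simp only: sum_distrib_right mult.assoc)
  qed
  have HK: "continuous_on K H" by (rule continuous_on_subset[OF holomorphic_on_imp_continuous_on[OF H(1)]]) (use K in auto)
  have bdd: "\<exists>B. \<forall>z\<in>K. norm (f z) \<le> B" if "continuous_on K f" for f :: "complex \<Rightarrow> complex"
    using compact_imp_bounded[OF compact_continuous_image[OF that K(1)]] by (auto simp: bounded_iff)
  have cpoly: "continuous_on K (poly r)" for r :: "complex poly" by (rule holomorphic_on_imp_continuous_on[OF poly_holo])
  obtain y where y: "\<rho> < y" "ereal y < \<rho>c" using ereal_dense2[OF \<rho>] by auto
  have U: "\<exists>C>0. \<forall>n p z. 1 \<le> n \<longrightarrow> degree p \<le> n - 1 \<longrightarrow> (\<forall>j<n. fc (poly p) j = fc (u l) j) \<longrightarrow> z \<in> K \<longrightarrow>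
     norm (poly (A l) z * H z - poly p z) \<le> C * real n * (s1 / \<rho>) ^ n" for l
  proof -
    obtain B where B: "\<And>z. z \<in> K \<Longrightarrow> norm (poly (A l) z * H z) \<le> B"
      using bdd[OF continuous_on_mult[OF cpoly HK]] by blast
    have hol: "(\<lambda>z. poly (A l) z * H z) holomorphic_on D (ereal y)"
      using y by (intro holomorphic_intros poly_holo holomorphic_on_subset[OF H(1) D_mono]) auto
    have germ: "same_germ E (\<lambda>z. poly (A l) z * H z) (u l)"
      by (rule same_germ_map[OF H(2)]) (simp add: u_def Qh_def b0_def)
    obtain C where "C > 0" "\<And>n p z. 1 \<le> n \<Longrightarrow> degree p \<le> n - 1 \<Longrightarrow> (\<And>j. j < n \<Longrightarrow> fc (poly p) j = fc (u l) j) \<Longrightarrow> z \<in> K \<Longrightarrow>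
     norm (poly (A l) z * H z - poly p z) \<le> C * real n * (s1 / \<rho>) ^ n"
      by (rule partial_sum_error[OF anu hol germ _ y(1) s(1) s1(1) K(3) refl B]) (use s in auto)
    then show ?thesis by blast
  qed
  \<comment> \<open>Just below |\<Phi> \<xi>|, but above |\<Phi> \<xi>| s1/s2: the gap between
    \<open>s1\<close> and \<open>s2\<close> pays for the loss, which keeps \<open>t pr\<close> below
    s2/\<rho>.\<close>
  define x where "x \<xi> = (max 1 (norm (\<Phi> \<xi>) * s1 / s2) + norm (\<Phi> \<xi>)) / 2" for \<xi>
  have x: "1 < x \<xi>" "x \<xi> < norm (\<Phi> \<xi>)" "norm (\<Phi> \<xi>) * s1 / s2 < x \<xi>" if "\<xi> \<in> P" for \<xi>
  proof -
    have a: "1 < norm (\<Phi> \<xi>)" using that P norm_Phi by blast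
    have "norm (\<Phi> \<xi>) * s1 < norm (\<Phi> \<xi>) * s2" using a s1 by (intro mult_strict_left_mono) auto
    then have "norm (\<Phi> \<xi>) * s1 / s2 < norm (\<Phi> \<xi>)" using s by (simp add: divide_less_eq)
    then have m: "max 1 (norm (\<Phi> \<xi>) * s1 / s2) < norm (\<Phi> \<xi>)" using a by simp
    have mid: "a < (a + b) / 2" "(a + b) / 2 < b" if "a < b" for a b :: real using that by auto
    have "max 1 (norm (\<Phi> \<xi>) * s1 / s2) < x \<xi>" unfolding x_def by (rule mid(1)[OF m])
    moreover have "x \<xi> < norm (\<Phi> \<xi>)" unfolding x_def by (rule mid(2)[OF m])
    ultimately show "1 < x \<xi>" "x \<xi> < norm (\<Phi> \<xi>)" "norm (\<Phi> \<xi>) * s1 / s2 < x \<xi>" by auto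
  qed
  have Vb: "\<exists>C>0. \<forall>n p z. 1 \<le> n \<longrightarrow> degree p \<le> n - 1 \<longrightarrow> (\<forall>j<n. fc (poly p) j = fc (v pr) j) \<longrightarrow> z \<in> K \<longrightarrow>
     norm (poly (e (fst pr) (snd pr)) z * (H z / poly Qh z) - poly p z) \<le> C * real n * (s1 / x (fst pr)) ^ n" if pr: "pr \<in> Pr" for pr
  proof -
    obtain \<xi> i where pri: "pr = (\<xi>, i)" "\<xi> \<in> P" "i < \<tau> \<xi>" using pr by (auto simp: Pr_def)
    have \<xi>E: "\<xi> \<notin> E" using pri P by auto
    define a where "a = norm (\<Phi> \<xi>)"
    have a1: "1 < a" using norm_Phi[OF \<xi>E] by (simp add: a_def)
    define P1 where "P1 = root_poly (P - {\<xi>}) \<tau>"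
    have QP: "Qh = [:- \<xi>, 1:] ^ \<tau> \<xi> * P1"
      unfolding Qh_def P1_def using root_poly_insert[of "P - {\<xi>}" \<xi> \<tau>] P pri(2) by (simp add: insert_absorb)
    \<comment> \<open>The basis polynomial vanishes to full order at the other poles. So the product
      has a pole at \<xi> only and is holomorphic up to the level of \<xi>, even if other poles lie
      at lower levels.\<close>
    have "P1 dvd e \<xi> i" unfolding P1_def
    proof (rule root_poly_dvd)
      show "[:- \<xi>', 1:] ^ \<tau> \<xi>' dvd e \<xi> i" if "\<xi>' \<in> P - {\<xi>}" for \<xi>'
        unfolding linear_power_dvd_iff_taylor_coeff using e(2)[OF pri(2,3), of \<xi>'] that by auto
    qed (use P in auto)
    then obtain e' where e': "e \<xi> i = P1 * e'" by (auto elim: dvdE)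
    obtain y' where y': "x \<xi> < y'" "y' < a" using x(2)[OF pri(2)] dense unfolding a_def by blast
    have a\<rho>: "ereal a \<le> \<rho>c" using P(3) pri(2) \<xi>E by (auto simp: in_D a_def dest!: subsetD)
    show ?thesis
    proof -
      define g where "g z = poly e' z * H z / (z - \<xi>) ^ \<tau> \<xi>" for z
      have hol: "g holomorphic_on D (ereal a)"
        unfolding g_def
        by (intro holomorphic_intros poly_holo holomorphic_on_subset[OF H(1) D_mono[OF a\<rho>]]) (use \<xi>E in \<open>auto simp: in_D a_def\<close>)
      have germ: "same_germ E g (v pr)"
      proof -
        obtain W where W: "open W" "E \<subseteq> W" "\<forall>z\<in>W. H z = poly (root_poly P \<tau>) z * bas i0 z" using H(2) by (auto simp: same_germ_def)
        show ?thesis unfolding same_germ_def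
        proof (rule exI[of _ "W - {\<xi>}"], intro conjI ballI)
          fix z assume z: "z \<in> W - {\<xi>}"
          then have "H z = (z - \<xi>) ^ \<tau> \<xi> * (poly P1 z * b0 z)" using W(3) QP by (simp add: Qh_def b0_def)
          then show "g z = v pr z" using z by (simp add: g_def v_def pri e')
        qed (use W \<xi>E in auto)
      qed
      have "continuous_on K (\<lambda>z. poly (e \<xi> i) z * (H z / poly Qh z))"
        using QhK by (intro continuous_on_mult continuous_on_divide cpoly HK) auto
      then obtain B where B: "\<And>z. z \<in> K \<Longrightarrow> norm (poly (e \<xi> i) z * (H z / poly Qh z)) \<le> B" using bdd by blast
      have val: "poly (e \<xi> i) z * (H z / poly Qh z) = g z" if "z \<in> K" for z
      proof -
        have "poly Qh z = (z - \<xi>) ^ \<tau> \<xi> * poly P1 z" by (simp add: QP)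
        moreover have "poly P1 z \<noteq> 0" using QhK[OF that] QP by auto
        ultimately show ?thesis by (simp add: g_def e')
      qed
      obtain C where "C > 0" "\<And>n p z. 1 \<le> n \<Longrightarrow> degree p \<le> n - 1 \<Longrightarrow> (\<And>j. j < n \<Longrightarrow> fc (poly p) j = fc (v pr) j) \<Longrightarrow> z \<in> K \<Longrightarrow>
         norm (poly (e \<xi> i) z * (H z / poly Qh z) - poly p z) \<le> C * real n * (s1 / x \<xi>) ^ n"
        by (rule partial_sum_error[OF anv hol germ x(1)[OF pri(2)] _ s(1) s1(1) K(3) val B]) (use x(2)[OF pri(2)] in \<open>auto simp: a_def\<close>)
      then show ?thesis unfolding pri fst_conv snd_conv by blast
    qed
  qed
  have "\<forall>l. \<exists>C. C > 0 \<and> (\<forall>n p z. 1 \<le> n \<longrightarrow> degree p \<le> n - 1 \<longrightarrow> (\<forall>j<n. fc (poly p) j = fc (u l) j) \<longrightarrow> z \<in> K \<longrightarrow>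
     norm (poly (A l) z * H z - poly p z) \<le> C * real n * (s1 / \<rho>) ^ n)" using U by blast
  from choice[OF this] obtain CU where CU: "\<And>l. CU l > 0" "\<And>l n p z. 1 \<le> n \<Longrightarrow> degree p \<le> n - 1 \<Longrightarrow> (\<And>j. j < n \<Longrightarrow> fc (poly p) j = fc (u l) j) \<Longrightarrow> z \<in> K \<Longrightarrow>
     norm (poly (A l) z * H z - poly p z) \<le> CU l * real n * (s1 / \<rho>) ^ n" by blast
  have "\<forall>pr\<in>Pr. \<exists>C. C > 0 \<and> (\<forall>n p z. 1 \<le> n \<longrightarrow> degree p \<le> n - 1 \<longrightarrow> (\<forall>j<n. fc (poly p) j = fc (v pr) j) \<longrightarrow> z \<in> K \<longrightarrow>
     norm (poly (e (fst pr) (snd pr)) z * (H z / poly Qh z) - poly p z) \<le> C * real n * (s1 / x (fst pr)) ^ n)" using Vb by blast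
  from bchoice[OF this] obtain CV where CV: "\<And>pr. pr \<in> Pr \<Longrightarrow> CV pr > 0" "\<And>pr n p z. pr \<in> Pr \<Longrightarrow> 1 \<le> n \<Longrightarrow> degree p \<le> n - 1 \<Longrightarrow> (\<And>j. j < n \<Longrightarrow> fc (poly p) j = fc (v pr) j) \<Longrightarrow> z \<in> K \<Longrightarrow>
     norm (poly (e (fst pr) (snd pr)) z * (H z / poly Qh z) - poly p z) \<le> CV pr * real n * (s1 / x (fst pr)) ^ n" by blast
  have "\<forall>pr\<in>Pr. \<exists>C. \<forall>\<^sub>F n in sequentially. norm (taylor_coeff (q n) (fst pr) (snd pr)) \<le> C * (norm (\<Phi> (fst pr)) / \<rho>) ^ n"
    using tcb by (auto simp: Pr_def)
  from bchoice[OF this] obtain CT where CT: "\<And>pr. pr \<in> Pr \<Longrightarrow> \<forall>\<^sub>F n in sequentially. norm (taylor_coeff (q n) (fst pr) (snd pr)) \<le> CT pr * (norm (\<Phi> (fst pr)) / \<rho>) ^ n" by blast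
  define y1 where "y1 = s2 / \<rho>"
  obtain D1 where D1: "D1 > 0" "\<And>n. real n * (s1 / \<rho>) ^ n \<le> D1 * y1 ^ n"
    using n_power_absorb[of "s1 / \<rho>" y1] s s1 by (auto simp: y1_def divide_strict_right_mono)
  define t where "t pr = norm (\<Phi> (fst pr)) / \<rho> * (s1 / x (fst pr))" for pr :: "complex \<times> nat"
  have "\<forall>pr\<in>Pr. \<exists>C. C > 0 \<and> (\<forall>n. real n * t pr ^ n \<le> C * y1 ^ n)"
  proof
    fix pr assume "pr \<in> Pr"
    then have \<xi>: "fst pr \<in> P" by (auto simp: Pr_def)
    then have a: "1 < norm (\<Phi> (fst pr))" using P norm_Phi by blast
    have t0: "0 < t pr" unfolding t_def using a s s1 x(1)[OF \<xi>] by (intro mult_pos_pos divide_pos_pos) linarith+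
    have "norm (\<Phi> (fst pr)) * s1 < x (fst pr) * s2" using x(3)[OF \<xi>] s by (simp add: divide_less_eq)
    then have "t pr < y1" using s x(1)[OF \<xi>] by (simp add: t_def y1_def divide_less_eq mult.commute)
    from n_power_absorb[OF t0 this] show "\<exists>C. C > 0 \<and> (\<forall>n. real n * t pr ^ n \<le> C * y1 ^ n)" by blast
  qed
  from bchoice[OF this] obtain D2 where D2: "\<And>pr. pr \<in> Pr \<Longrightarrow> D2 pr > 0" "\<And>pr n. pr \<in> Pr \<Longrightarrow> real n * t pr ^ n \<le> D2 pr * y1 ^ n" by blast
  define C where "C = (\<Sum>l\<le>N. B0 * (CU l * D1)) + (\<Sum>pr\<in>Pr. \<bar>CT pr\<bar> * (CV pr * D2 pr))"
  have "\<forall>\<^sub>F n in sequentially. \<forall>pr\<in>Pr. norm (taylor_coeff (q n) (fst pr) (snd pr)) \<le> CT pr * (norm (\<Phi> (fst pr)) / \<rho>) ^ n"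
    by (rule eventually_ball_finite[OF fPr]) (use CT in auto)
  then have "\<forall>\<^sub>F n in sequentially. \<forall>z\<in>K. norm (poly (q n) z * (H z / poly Qh z) - poly (p n) z) \<le> C * y1 ^ n"
    using q(2) eventually_ge_at_top[of 1]
  proof eventually_elim
    case (elim n)
    note n = elim(3)
    have dq: "degree (q n) \<le> N" using Sol_degree[OF q(1)[OF n]] .
    define SU where "SU l = (SOME p. degree p \<le> n - 1 \<and> (\<forall>j<n. fc (poly p) j = fc (u l) j))" for l
    have SU: "degree (SU l) \<le> n - 1" "\<And>j. j < n \<Longrightarrow> fc (poly (SU l)) j = fc (u l) j" for l
      using someI_ex[OF faber_poly_exists[OF n, of "fc (u l)"]] unfolding SU_def by auto
    define SV where "SV pr = (SOME p. degree p \<le> n - 1 \<and> (\<forall>j<n. fc (poly p) j = fc (v pr) j))" for pr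
    have SV: "degree (SV pr) \<le> n - 1" "\<And>j. j < n \<Longrightarrow> fc (poly (SV pr)) j = fc (v pr) j" for pr
      using someI_ex[OF faber_poly_exists[OF n, of "fc (v pr)"]] unfolding SV_def by auto
    define T where "T = (\<Sum>l\<le>N. smult (coeff (q n) l) (SU l)) + (\<Sum>pr\<in>Pr. smult (taylor_coeff (q n) (fst pr) (snd pr)) (SV pr))"
    have poly_T: "poly T = (\<lambda>z. (\<Sum>l\<le>N. coeff (q n) l * poly (SU l) z) + (\<Sum>pr\<in>Pr. taylor_coeff (q n) (fst pr) (snd pr) * poly (SV pr) z))"
      by (simp add: T_def fun_eq_iff poly_sum)
    \<comment> \<open>A polynomial of degree below \<open>n\<close> is determined by its first
      \<open>n\<close> Faber coefficients, so the numerator is the combination of partial sums with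
      the same coefficients as the function.\<close>
    have "p n - T = 0"
    proof (rule faber_poly_unique[of _ n])
      have "degree T \<le> n - 1" unfolding T_def
        by (intro degree_add_le degree_sum_le order_trans[OF degree_smult_le] SU SV) (auto simp: fPr)
      then have "degree (p n - T) \<le> n - 1" using p(1)[OF n] by (intro degree_diff_le)
      then show "degree (p n - T) < n" using n by simp
      fix j assume j: "j < n"
      have 1: "fc (poly T) j = (\<Sum>l\<le>N. coeff (q n) l * fc (poly (SU l)) j) + (\<Sum>pr\<in>Pr. taylor_coeff (q n) (fst pr) (snd pr) * fc (poly (SV pr)) j)"
        unfolding poly_T by (subst fc_add) (auto intro!: analytic_intros poly_analytic simp: fc_sum poly_analytic)
      have 2: "fc (\<lambda>z. poly (q n) z * b0 z) j = (\<Sum>l\<le>N. coeff (q n) l * fc (u l) j) + (\<Sum>pr\<in>Pr. taylor_coeff (q n) (fst pr) (snd pr) * fc (v pr) j)"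
        unfolding expand[OF dq] by (subst fc_add) (auto intro!: analytic_intros anu anv simp: fc_sum anu anv)
      have "fc (poly (p n - T)) j = fc (\<lambda>z. poly (p n) z - poly T z) j" by (simp add: fun_eq_iff poly_diff[abs_def])
      also have "\<dots> = fc (poly (p n)) j - fc (poly T) j" by (rule fc_diff[OF poly_analytic poly_analytic])
      also have "\<dots> = 0" unfolding p(2)[OF n j] b0_def[symmetric] 1 2 using SU(2)[OF j] SV(2)[OF j] by simp
      finally show "fc (poly (p n - T)) j = 0" .
    qed
    then have pT: "p n = T" by simp
    show ?case
    proof
      fix z assume z: "z \<in> K"
      have eq: "poly (q n) z * (H z / poly Qh z) - poly (p n) z =
         (\<Sum>l\<le>N. coeff (q n) l * (poly (A l) z * H z - poly (SU l) z)) +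
         (\<Sum>pr\<in>Pr. taylor_coeff (q n) (fst pr) (snd pr) * (poly (e (fst pr) (snd pr)) z * (H z / poly Qh z) - poly (SV pr) z))"
        unfolding pT poly_T expandH[OF dq z] by (simp only: right_diff_distrib sum_subtractf) simp
      have "norm (poly (q n) z * (H z / poly Qh z) - poly (p n) z) \<le> (\<Sum>l\<le>N. norm (coeff (q n) l * (poly (A l) z * H z - poly (SU l) z))) +
         (\<Sum>pr\<in>Pr. norm (taylor_coeff (q n) (fst pr) (snd pr) * (poly (e (fst pr) (snd pr)) z * (H z / poly Qh z) - poly (SV pr) z)))"
        unfolding eq by (rule order_trans[OF norm_triangle_ineq add_mono[OF norm_sum norm_sum]])
      also have "\<dots> \<le> (\<Sum>l\<le>N. B0 * (CU l * D1) * y1 ^ n) + (\<Sum>pr\<in>Pr. \<bar>CT pr\<bar> * (CV pr * D2 pr) * y1 ^ n)"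
      proof (intro add_mono sum_mono)
        fix l
        have "norm (poly (A l) z * H z - poly (SU l) z) \<le> CU l * (real n * (s1 / \<rho>) ^ n)"
          using CU(2)[OF n SU(1) SU(2) z] by (simp add: mult.assoc)
        also have "\<dots> \<le> CU l * (D1 * y1 ^ n)" using D1(2)[of n] CU(1)[of l] by (intro mult_left_mono) auto
        finally have 1: "norm (poly (A l) z * H z - poly (SU l) z) \<le> CU l * (D1 * y1 ^ n)" .
        have "norm (coeff (q n) l) \<le> B0" using norm_coeff_le elim(2) by (rule order_trans)
        then have "norm (coeff (q n) l) * norm (poly (A l) z * H z - poly (SU l) z) \<le> B0 * (CU l * (D1 * y1 ^ n))"
          using 1 by (intro mult_mono) (auto intro: order_trans[OF norm_ge_zero])
        then show "norm (coeff (q n) l * (poly (A l) z * H z - poly (SU l) z)) \<le> B0 * (CU l * D1) * y1 ^ n"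
          by (simp add: norm_mult mult.assoc)
      next
        fix pr assume pr: "pr \<in> Pr"
        then have \<xi>: "fst pr \<in> P" by (auto simp: Pr_def)
        have 1: "norm (poly (e (fst pr) (snd pr)) z * (H z / poly Qh z) - poly (SV pr) z) \<le> CV pr * real n * (s1 / x (fst pr)) ^ n"
          by (rule CV(2)[OF pr n SV(1) SV(2) z])
        have k0: "0 \<le> norm (\<Phi> (fst pr)) / \<rho>" using s by simp
        have "CT pr * (norm (\<Phi> (fst pr)) / \<rho>) ^ n \<le> \<bar>CT pr\<bar> * (norm (\<Phi> (fst pr)) / \<rho>) ^ n"
          using k0 by (intro mult_right_mono) auto
        then have 2: "norm (taylor_coeff (q n) (fst pr) (snd pr)) \<le> \<bar>CT pr\<bar> * (norm (\<Phi> (fst pr)) / \<rho>) ^ n"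
          using elim(1) pr order_trans by blast
        have "norm (taylor_coeff (q n) (fst pr) (snd pr)) * norm (poly (e (fst pr) (snd pr)) z * (H z / poly Qh z) - poly (SV pr) z)
           \<le> (\<bar>CT pr\<bar> * (norm (\<Phi> (fst pr)) / \<rho>) ^ n) * (CV pr * real n * (s1 / x (fst pr)) ^ n)"
          using 1 2 k0 by (intro mult_mono) auto
        also have "\<dots> = \<bar>CT pr\<bar> * CV pr * (real n * t pr ^ n)"
          unfolding t_def power_mult_distrib by simp
        also have "\<dots> \<le> \<bar>CT pr\<bar> * CV pr * (D2 pr * y1 ^ n)"
          using D2(2)[OF pr, of n] CV(1)[OF pr] by (intro mult_left_mono) auto
        finally show "norm (taylor_coeff (q n) (fst pr) (snd pr) * (poly (e (fst pr) (snd pr)) z * (H z / poly Qh z) - poly (SV pr) z))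
           \<le> \<bar>CT pr\<bar> * (CV pr * D2 pr) * y1 ^ n" by (simp add: norm_mult mult.assoc)
      qed
      also have "\<dots> = C * y1 ^ n" by (simp add: C_def sum_distrib_right distrib_right)
      finally show "norm (poly (q n) z * (H z / poly Qh z) - poly (p n) z) \<le> C * y1 ^ n" .
    qed
  qed
  then show ?thesis unfolding y1_def Qh_def by blast
qed

end

section \<open>The equivalence and the convergence rates\<close>

lemma limsup_root_le:
  assumes x: "\<forall>\<^sub>F n in sequentially. 0 \<le> x n \<and> x n \<le> C * y ^ n" and y: "0 < y"
  shows "limsup (\<lambda>n. ereal (root n (x n))) \<le> ereal y"
proof -
  define C' where "C' = max C 1"
  have "\<forall>\<^sub>F n in sequentially. ereal (root n (x n)) \<le> ereal (root n C' * y)"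
    using x eventually_ge_at_top[of 1]
  proof eventually_elim
    case (elim n)
    have "x n \<le> C' * y ^ n" using elim y by (intro order_trans[OF conjunct2[OF elim(1)]] mult_right_mono) (auto simp: C'_def)
    then have "root n (x n) \<le> root n (C' * y ^ n)" using elim by simp
    also have "\<dots> = root n C' * y" using elim y by (simp add: real_root_mult real_root_power_cancel)
    finally show ?case by simp
  qed
  then have "limsup (\<lambda>n. ereal (root n (x n))) \<le> limsup (\<lambda>n. ereal (root n C' * y))" by (rule Limsup_mono)
  also have "\<dots> = ereal (1 * y)"
    by (intro lim_imp_Limsup tendsto_ereal tendsto_mult tendsto_const LIMSEQ_root_const) (auto simp: C'_def)
  finally show ?thesis by simp
qed

lemma limsup_root_less:
  assumes "limsup (\<lambda>n. ereal (root n (x n))) < ereal y" "\<And>n. 0 \<le> x n" "0 < y"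
  shows "\<forall>\<^sub>F n in sequentially. x n \<le> y ^ n"
proof -
  have "\<forall>\<^sub>F n in sequentially. ereal (root n (x n)) < ereal y" using assms(1) by (rule Limsup_lessD)
  then show ?thesis using eventually_ge_at_top[of 1]
  proof eventually_elim
    case (elim n)
    have "x n = root n (x n) ^ n" using elim assms(2) by (intro real_root_pow_pos2[symmetric]) auto
    also have "\<dots> \<le> y ^ n" using elim assms(2) by (intro power_mono real_root_ge_zero) auto
    finally show ?case .
  qed
qed

lemma limsup_root_nonneg:
  assumes "\<And>n. 0 \<le> x n" shows "0 \<le> limsup (\<lambda>n. ereal (root n (x n)))"
  by (rule le_Limsup) (auto intro!: always_eventually real_root_ge_zero assms)

lemma ereal_ratio_less_iff:
  assumes "0 < k" "0 < y" "0 < (r::ereal)"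
  shows "ereal k / r < ereal y \<longleftrightarrow> ereal (k / y) < r"
  using assms by (cases r) (auto simp: divide_less_eq less_divide_eq mult.commute)

lemma ereal_ratio_le_iff:
  assumes "0 < k" "0 < y" "0 < (r::ereal)"
  shows "ereal k / r \<le> ereal y \<longleftrightarrow> ereal (k / y) \<le> r"
  using assms by (cases r) (auto simp: divide_le_eq le_divide_eq mult.commute)

lemma poly_mult_not_pole:
  fixes p :: "complex poly"
  assumes g: "isolated_singularity_at g z" "not_essential g z" and p: "p \<noteq> 0"
    and o: "is_pole g z \<Longrightarrow> pole_order g z \<le> order z p"
  shows "\<not> is_pole (\<lambda>w. poly p w * g w) z"
proof -
  have "\<exists>c. ((\<lambda>w. poly p w * g w) \<longlongrightarrow> c) (at z)"
  proof (cases "is_pole g z")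
    case False
    then obtain c where "(g \<longlongrightarrow> c) (at z)" using g(2) by (auto simp: not_essential_def)
    then have "((\<lambda>w. poly p w * g w) \<longlongrightarrow> poly p z * c) (at z)" by (intro tendsto_intros)
    then show ?thesis by blast
  next
    case True
    obtain r where r: "r > 0" "g analytic_on ball z r - {z}" using g(1) by (auto simp: isolated_singularity_at_def)
    define t where "t = pole_order g z"
    obtain \<rho> where \<rho>: "\<rho> > 0" "zor_poly g z holomorphic_on cball z \<rho>" "\<forall>w\<in>cball z \<rho> - {z}. g w = zor_poly g z w / (w - z) ^ t"
      using zorder_exist_pole[OF analytic_imp_holomorphic[OF r(2)] open_ball centre_in_ball[THEN iffD2, OF r(1)] True]
      by (auto simp: t_def pole_order_def)
    define l where "l = order z p"
    have "[:- z, 1:] ^ l dvd p" unfolding l_def by (rule order_1)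
    then obtain s where s: "p = [:- z, 1:] ^ l * s" by (auto elim: dvdE)
    have tl: "t \<le> l" using o[OF True] by (simp add: t_def l_def)
    have "continuous_on (ball z \<rho>) (zor_poly g z)"
      using \<rho>(2) holomorphic_on_imp_continuous_on continuous_on_subset ball_subset_cball by blast
    then have "(zor_poly g z \<longlongrightarrow> zor_poly g z z) (at z)"
      using \<rho>(1) by (simp add: continuous_on_eq_continuous_at isCont_def)
    then have "((\<lambda>w. (w - z) ^ (l - t) * poly s w * zor_poly g z w) \<longlongrightarrow> (z - z) ^ (l - t) * poly s z * zor_poly g z z) (at z)"
      by (intro tendsto_intros)
    then have "((\<lambda>w. poly p w * g w) \<longlongrightarrow> (z - z) ^ (l - t) * poly s z * zor_poly g z z) (at z)"
    proof (rule Lim_transform_eventually)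
      show "\<forall>\<^sub>F w in at z. (w - z) ^ (l - t) * poly s w * zor_poly g z w = poly p w * g w"
      proof -
        have "\<forall>\<^sub>F w in at z. w \<in> ball z \<rho> - {z}" by (rule eventually_at_in_open) (use \<rho> in auto)
        then show ?thesis
      proof eventually_elim
        case (elim w)
        then have w: "w - z \<noteq> 0" "g w = zor_poly g z w / (w - z) ^ t" using \<rho>(3) by auto
        have "(w - z) ^ l = (w - z) ^ (l - t) * (w - z) ^ t" using tl by (simp add: power_add[symmetric])
        then show ?case using w by (simp add: s)
      qed
      qed
    qed
    then show ?thesis by blast
  qed
  then show ?thesis unfolding is_pole_def using not_tendsto_and_filterlim_at_infinity[OF trivial_limit_at] by blast
qed

context exterior
begin

lemma Phi_norm_props:
  assumes K: "compact K" "K \<subseteq> D R" and R: "1 < R"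
  shows "1 \<le> Phi_norm E \<Phi> K" "K \<subseteq> cD (Phi_norm E \<Phi> K)" "ereal (Phi_norm E \<Phi> K) < R"
proof -
  have "1 \<le> Phi_norm E \<Phi> K \<and> K \<subseteq> cD (Phi_norm E \<Phi> K) \<and> ereal (Phi_norm E \<Phi> K) < R"
  proof (cases "K \<subseteq> E")
    case True
    then show ?thesis using R by (auto simp: Phi_norm_def cD_def one_ereal_def)
  next
    case False
    obtain b where b: "\<And>z. z \<in> K - E \<Longrightarrow> norm (\<Phi> z) \<le> b" "ereal b < R"
    proof -
      obtain r0 where r0: "1 < ereal r0" "ereal r0 < R" using ereal_dense2[OF R] by auto
      \<comment> \<open>\<open>K - E\<close> need not be compact, but |\<Phi>| is below
        \<open>r0\<close> on \<open>D r0\<close> outside \<open>E\<close>. The rest of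
        \<open>K\<close> is compact, so the supremum stays strictly below \<open>R\<close>.\<close>
      define T where "T = K - D (ereal r0)"
      have T: "compact T" "T \<subseteq> - E" using compact_diff[OF K(1) open_D[OF r0(1)]] E_sub_D by (auto simp: T_def)
      show ?thesis
      proof (cases "T = {}")
        case True
        then have "norm (\<Phi> z) \<le> r0" if "z \<in> K - E" for z using that by (force simp: T_def in_D)
        then show ?thesis using that[of r0] r0 by blast
      next
        case False
        have "continuous_on T (\<lambda>z. norm (\<Phi> z))" by (intro continuous_intros continuous_on_subset[OF cont_Phi] T)
        then obtain x where x: "x \<in> T" "\<And>y. y \<in> T \<Longrightarrow> norm (\<Phi> y) \<le> norm (\<Phi> x)"
          using continuous_attains_sup[OF T(1) False] by blast
        have xR: "ereal (norm (\<Phi> x)) < R" using x(1) T K in_D by (auto simp: T_def)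
        show ?thesis
        proof (rule that[of "norm (\<Phi> x)"])
          fix z assume z: "z \<in> K - E"
          show "norm (\<Phi> z) \<le> norm (\<Phi> x)"
          proof (cases "z \<in> T")
            case False
            then have "norm (\<Phi> z) < r0" using z by (auto simp: T_def in_D)
            moreover have "r0 \<le> norm (\<Phi> x)" using x(1) T by (auto simp: T_def in_D)
            ultimately show ?thesis by simp
          qed (rule x(2))
        qed (rule xR)
      qed
    qed
    have P: "Phi_norm E \<Phi> K = Sup (insert 0 ((\<lambda>z. norm (\<Phi> z)) ` (K - E)))"
      using False by (simp add: Phi_norm_def sup_norm_def)
    have bd: "bdd_above (insert 0 ((\<lambda>z. norm (\<Phi> z)) ` (K - E)))" using b(1) by (auto intro!: bdd_aboveI[of _ b])
    have up: "norm (\<Phi> z) \<le> Phi_norm E \<Phi> K" if "z \<in> K - E" for z unfolding P using that bd by (intro cSup_upper) auto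
    obtain z0 where z0: "z0 \<in> K - E" using False by blast
    have "0 \<le> b" using b(1)[OF z0] norm_ge_zero order_trans by blast
    then have "Phi_norm E \<Phi> K \<le> b" unfolding P using b(1) by (intro cSup_least) auto
    then have "ereal (Phi_norm E \<Phi> K) < R" using b(2) by (meson ereal_less_eq(3) le_less_trans)
    moreover have "1 \<le> Phi_norm E \<Phi> K" using norm_Phi[of z0] up[OF z0] z0 by auto
    ultimately show ?thesis using up by (auto simp: cD_def)
  qed
  then show "1 \<le> Phi_norm E \<Phi> K" "K \<subseteq> cD (Phi_norm E \<Phi> K)" "ereal (Phi_norm E \<Phi> K) < R" by auto
qed

end

lemma sum_order_root_poly:
  fixes R :: "complex poly" assumes "lead_coeff R = 1"
  shows "(\<Sum>\<xi>\<in>{\<xi>. poly R \<xi> = 0}. order \<xi> R) = degree R"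
proof -
  obtain xs where xs: "R = list_poly xs" using monic_eq_list_poly[OF assms] by blast
  have "{\<xi>. poly R \<xi> = 0} = set xs" by (auto simp: xs poly_list_poly_eq_0_iff)
  then show ?thesis using sum_count_set[of xs "set xs"] by (simp add: xs order_list_poly degree_list_poly)
qed

section \<open>The equivalence of (a) and (b) and the exact rate of the denominators\<close>

locale pade_sequence = pade +
  fixes Q :: "nat \<Rightarrow> complex poly" and P :: "nat \<Rightarrow> nat \<Rightarrow> nat \<Rightarrow> complex poly"
  assumes QP: "\<And>n. 1 \<le> n \<Longrightarrow> lead_coeff (Q n) = 1 \<and> pade_faber E \<Phi> d m F n (Q n) (P n)"
begin

definition rate :: "complex poly \<Rightarrow> ereal" where
  "rate R = limsup (\<lambda>n. ereal (root n (coeff_norm (Q n - R))))"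

abbreviation "Qs \<equiv> root_poly Z ord"

lemma Q_Sol: "1 \<le> n \<Longrightarrow> Sol n (Q n)" and Q_monic: "1 \<le> n \<Longrightarrow> lead_coeff (Q n) = 1"
  using QP pade_faber_imp_Sol(1) by blast+

lemma rate_nonneg: "0 \<le> rate R"
  unfolding rate_def by (rule limsup_root_nonneg[OF coeff_norm_nonneg])

lemma rate_less_pade_limit:
  assumes "degree R = N" "rate R < ereal \<theta>" "0 < \<theta>" "\<theta> < 1"
  shows "pade_limit E \<Phi> d m F Q R \<theta>"
proof unfold_locales
  show "\<forall>\<^sub>F n in sequentially. coeff_norm (Q n - R) \<le> \<theta> ^ n"
    using assms unfolding rate_def by (intro limsup_root_less coeff_norm_nonneg)
qed (use assms Q_Sol Q_monic in auto)

lemma rate_less_obtain: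
  assumes "rate R < x"
  obtains \<theta> where "rate R < ereal \<theta>" "ereal \<theta> < x" "0 < \<theta>"
proof -
  obtain \<theta> where \<theta>: "rate R < ereal \<theta>" "ereal \<theta> < x" using ereal_dense2[OF assms] by blast
  have "0 < ereal \<theta>" using rate_nonneg \<theta>(1) by (rule le_less_trans)
  then show ?thesis using that \<theta> by simp
qed

lemma monic_unique_iff:
  "(\<forall>\<^sub>F n in sequentially. \<exists>!q. lead_coeff q = 1 \<and> (\<exists>p. pade_faber E \<Phi> d m F n q p)) \<longleftrightarrow>
   (\<forall>\<^sub>F n in sequentially. \<forall>q q'. Sol n q \<and> lead_coeff q = 1 \<and> Sol n q' \<and> lead_coeff q' = 1 \<longrightarrow> q = q')"
proof -
  have *: "(\<exists>!q. lead_coeff q = 1 \<and> (\<exists>p. pade_faber E \<Phi> d m F n q p)) \<longleftrightarrow>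
     (\<forall>q q'. Sol n q \<and> lead_coeff q = 1 \<and> Sol n q' \<and> lead_coeff q' = 1 \<longrightarrow> q = q')" if n: "1 \<le> n" for n
  proof -
    have a: "lead_coeff q = 1 \<and> (\<exists>p. pade_faber E \<Phi> d m F n q p) \<longleftrightarrow> Sol n q \<and> lead_coeff q = 1" for q
      unfolding pade_faber_iff[OF n] by auto
    show ?thesis unfolding a using Q_Sol[OF n] Q_monic[OF n] by blast
  qed
  have ev: "\<forall>\<^sub>F n in sequentially. (\<exists>!q. lead_coeff q = 1 \<and> (\<exists>p. pade_faber E \<Phi> d m F n q p)) \<longleftrightarrow>
     (\<forall>q q'. Sol n q \<and> lead_coeff q = 1 \<and> Sol n q' \<and> lead_coeff q' = 1 \<longrightarrow> q = q')"
    using eventually_ge_at_top[of 1] by eventually_elim (rule *)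
  show ?thesis by (rule eventually_subst[OF ev])
qed

text \<open>A zero of \<open>R\<close> is a system pole of at least its multiplicity by
  \<open>limit_zeros_are_system_poles\<close> and of at most that by \<open>order_le\<close>, which
  also shows that there are no other system poles. The orders then add up to the degree.\<close>

theorem inverse_direction:
  assumes uniq: "\<forall>\<^sub>F n in sequentially. \<exists>!q. lead_coeff q = 1 \<and> (\<exists>p. pade_faber E \<Phi> d m F n q p)"
    and R: "degree R = N" "rate R < 1"
  shows "finite Z" "(\<Sum>\<xi>\<in>Z. ord \<xi>) = N"
proof -
  obtain \<theta> where \<theta>: "rate R < ereal \<theta>" "ereal \<theta> < 1" "0 < \<theta>" using rate_less_obtain[OF R(2)] .
  interpret L: pade_limit E \<Phi> d m F Q R \<theta> using \<theta> R by (intro rate_less_pade_limit) auto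
  note zeros = L.limit_zeros_are_system_poles[OF uniq[unfolded monic_unique_iff]]
  have comb_pole: "system_pole E \<Phi> d m F \<xi> (order \<xi> R)" if "poly R \<xi> = 0" for \<xi>
  proof -
    have "\<xi> \<notin> E" using zeros(1)[OF that] .
    moreover have "1 \<le> order \<xi> R" using that L.R_ne_0 by (simp add: order_root Suc_leI)
    moreover have "\<forall>t\<in>{1..order \<xi> R}. comb_pole \<xi> t" using zeros(2)[OF that] unfolding comb_pole_def by auto
    moreover have "\<sigma> \<le> order \<xi> R" if "\<forall>t\<in>{1..\<sigma>}. comb_pole \<xi> t" for \<sigma>
      by (rule L.order_le[OF \<open>\<xi> \<notin> E\<close>]) (use that in \<open>auto simp: comb_pole_def\<close>)
    ultimately show ?thesis unfolding system_pole_iff by blast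
  qed
  have Z: "Z = {\<xi>. poly R \<xi> = 0}"
  proof (intro equalityI subsetI)
    fix \<xi> assume "\<xi> \<in> {\<xi>. poly R \<xi> = 0}"
    then show "\<xi> \<in> Z" using comb_pole by (auto simp: system_poles_def)
  next
    fix \<xi> assume z: "\<xi> \<in> Z"
    note s = system_poles_D[OF z]
    have "ord \<xi> \<le> order \<xi> R" by (rule L.order_le[OF s(1)]) (use s(3) in \<open>auto simp: comb_pole_def\<close>)
    then have "order \<xi> R \<noteq> 0" using s(2) by simp
    then show "\<xi> \<in> {\<xi>. poly R \<xi> = 0}" by (simp add: order_root)
  qed
  show "finite Z" unfolding Z by (rule poly_roots_finite[OF L.R_ne_0])
  have "(\<Sum>\<xi>\<in>Z. ord \<xi>) = (\<Sum>\<xi>\<in>{\<xi>. poly R \<xi> = 0}. order \<xi> R)"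
    by (rule sum.cong[OF Z]) (use comb_pole sys_order_eq in auto)
  then show "(\<Sum>\<xi>\<in>Z. ord \<xi>) = N" using sum_order_root_poly[OF L.R_monic] R by simp
qed

end

locale pade_direct = pade_sequence +
  assumes finite_Z: "finite Z" and sum_ord: "(\<Sum>\<xi>\<in>Z. ord \<xi>) = N"
begin

definition max_ratio :: ereal where
  "max_ratio = Max ((\<lambda>\<xi>. ereal (norm (\<Phi> \<xi>)) / rho_pole E \<Phi> d m F \<xi>) ` Z)"

lemma Z_ne: "Z \<noteq> {}"
  using sum_ord N_pos by auto

lemma degree_Qs: "degree Qs = N"
  using degree_root_poly[OF finite_Z] sum_ord by simp

lemma rho_bold_le_raw: "1 \<le> s \<Longrightarrow> s \<le> t \<Longrightarrow> rho_bold E \<Phi> d m F \<xi> t \<le> rho_raw E \<Phi> d m F \<xi> s"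
  unfolding rho_bold_def by (intro Min_le) auto

lemma rho_bold_gt:
  assumes "\<xi> \<in> Z" "1 \<le> t" "t \<le> ord \<xi>"
  shows "ereal (norm (\<Phi> \<xi>)) < rho_bold E \<Phi> d m F \<xi> t"
  unfolding rho_bold_def using assms system_poles_D[OF assms(1)] by (subst Min_gr_iff) (auto intro!: rho_raw_gt)

lemma rho_pole_gt: "\<xi> \<in> Z \<Longrightarrow> ereal (norm (\<Phi> \<xi>)) < rho_pole E \<Phi> d m F \<xi>"
  unfolding rho_pole_def using system_poles_D(2) by (intro rho_bold_gt) auto

lemma Phi_pos: "\<xi> \<in> Z \<Longrightarrow> 1 < norm (\<Phi> \<xi>)"
  using system_poles_D(1) norm_Phi by blast

lemma rho_pole_pos: "\<xi> \<in> Z \<Longrightarrow> 0 < rho_pole E \<Phi> d m F \<xi>"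
  using rho_pole_gt[of \<xi>] by (rule le_less_trans[rotated]) (simp_all add: zero_ereal_def)

lemma max_ratio_less_1: "max_ratio < 1"
  unfolding max_ratio_def
proof (subst Max_less_iff)
  show "\<forall>a\<in>(\<lambda>\<xi>. ereal (norm (\<Phi> \<xi>)) / rho_pole E \<Phi> d m F \<xi>) ` Z. a < 1"
  proof
    fix a assume "a \<in> (\<lambda>\<xi>. ereal (norm (\<Phi> \<xi>)) / rho_pole E \<Phi> d m F \<xi>) ` Z"
    then obtain \<xi> where \<xi>: "\<xi> \<in> Z" "a = ereal (norm (\<Phi> \<xi>)) / rho_pole E \<Phi> d m F \<xi>" by auto
    show "a < 1"
      unfolding \<xi>(2) one_ereal_def using rho_pole_gt[OF \<xi>(1)] rho_pole_pos[OF \<xi>(1)] Phi_pos[OF \<xi>(1)]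
      by (subst ereal_ratio_less_iff) auto
  qed
qed (use finite_Z Z_ne in auto)

lemma system_data:
  assumes y: "max_ratio < ereal y" "0 < y" "y < 1" and \<xi>: "\<xi> \<in> Z" and s: "s \<in> {1..ord \<xi>}"
  shows "\<exists>G\<in>V. \<exists>\<rho>. ereal (norm (\<Phi> \<xi>) / y) < \<rho> \<and> exact_pole G \<xi> s \<rho>"
proof -
  have "ereal (norm (\<Phi> \<xi>)) / rho_pole E \<Phi> d m F \<xi> \<le> max_ratio"
    unfolding max_ratio_def using finite_Z \<xi> by (intro Max_ge) auto
  then have "ereal (norm (\<Phi> \<xi>)) / rho_pole E \<Phi> d m F \<xi> < ereal y" using y(1) by (rule le_less_trans)
  then have "ereal (norm (\<Phi> \<xi>) / y) < rho_pole E \<Phi> d m F \<xi>"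
    using Phi_pos[OF \<xi>] y rho_pole_pos[OF \<xi>] by (subst (asm) ereal_ratio_less_iff) auto
  also have "\<dots> \<le> rho_raw E \<Phi> d m F \<xi> s" unfolding rho_pole_def using s by (intro rho_bold_le_raw) auto
  finally obtain \<rho> where \<rho>: "ereal (norm (\<Phi> \<xi>) / y) < ereal \<rho>" "ereal \<rho> < rho_raw E \<Phi> d m F \<xi> s" using ereal_dense2 by blast
  have "norm (\<Phi> \<xi>) * y < norm (\<Phi> \<xi>) * 1" using Phi_pos[OF \<xi>] y by (intro mult_strict_left_mono) auto
  then have "norm (\<Phi> \<xi>) < norm (\<Phi> \<xi>) / y" using y by (simp add: less_divide_eq)
  then have "ereal (norm (\<Phi> \<xi>)) < ereal \<rho>" using \<rho>(1) by simp
  then obtain G where "G \<in> V" "exact_pole G \<xi> s (ereal \<rho>)"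
    using rho_raw_exact_pole[OF system_poles_D(1)[OF \<xi>] _ _ \<rho>(2)] s by auto
  then show ?thesis using \<rho>(1) by blast
qed

lemma Z_E: "Z \<inter> E = {}"
  using system_poles_D(1) by blast

lemma max_ratio_obtain: assumes "max_ratio < x" obtains y where "max_ratio < ereal y" "ereal y < x" "0 < y"
proof -
  obtain y where y: "max_ratio < ereal y" "ereal y < x" using ereal_dense2[OF assms] by blast
  obtain \<xi> where \<xi>: "\<xi> \<in> Z" using Z_ne by blast
  have "0 \<le> ereal (norm (\<Phi> \<xi>)) / rho_pole E \<Phi> d m F \<xi>" using rho_pole_pos[OF \<xi>] by (cases "rho_pole E \<Phi> d m F \<xi>") auto
  also have "\<dots> \<le> max_ratio" unfolding max_ratio_def using finite_Z \<xi> by (intro Max_ge) auto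
  also note y(1)
  finally show ?thesis using that y by simp
qed

lemma Sol_rate:
  assumes y: "max_ratio < ereal y" "0 < y" "y < 1"
  shows "\<forall>\<^sub>F n in sequentially. \<forall>q. Sol n q \<and> coeff q N = 0 \<longrightarrow> q = 0"
    "\<exists>C. \<forall>\<^sub>F n in sequentially. \<forall>q. Sol n q \<and> lead_coeff q = 1 \<longrightarrow> degree q = N \<and> coeff_norm (q - Qs) \<le> C * y ^ n"
  by (rule Sol_unique_rate[OF finite_Z Z_E sum_ord y(2,3) system_data[OF y]]; assumption)+

theorem monic_unique: "\<forall>\<^sub>F n in sequentially. \<exists>!q. lead_coeff q = 1 \<and> (\<exists>p. pade_faber E \<Phi> d m F n q p)"
proof -
  obtain y where y: "max_ratio < ereal y" "ereal y < 1" "0 < y" using max_ratio_obtain[OF max_ratio_less_1] .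
  then have y': "y < 1" by simp
  obtain C where C: "\<forall>\<^sub>F n in sequentially. \<forall>q. Sol n q \<and> lead_coeff q = 1 \<longrightarrow> degree q = N \<and> coeff_norm (q - Qs) \<le> C * y ^ n"
    using Sol_rate(2)[OF y(1,3) y'] by blast
  show ?thesis unfolding monic_unique_iff
    using C Sol_rate(1)[OF y(1,3) y']
  proof eventually_elim
    case (elim n)
    show ?case
    proof (intro allI impI)
      fix q q' assume q: "Sol n q \<and> lead_coeff q = 1 \<and> Sol n q' \<and> lead_coeff q' = 1"
      have "degree q = N" "degree q' = N" using elim(1) q by blast+
      then have "coeff (smult 1 q + smult (- 1) q') N = 0" using q by simp
      moreover have "Sol n (smult 1 q + smult (- 1) q')" using q by (intro Sol_lin) auto
      ultimately have "smult 1 q + smult (- 1) q' = 0" using elim(2) by blast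
      then show "q = q'" by simp
    qed
  qed
qed

lemma rate_Qs_le: "rate Qs \<le> max_ratio"
proof (rule dense_ge)
  fix x assume x: "max_ratio < x"
  then have "max_ratio < min x 1" using max_ratio_less_1 by simp
  then obtain y where y: "max_ratio < ereal y" "ereal y < min x 1" "0 < y" using max_ratio_obtain by blast
  then have y': "y < 1" by simp
  obtain C where C: "\<forall>\<^sub>F n in sequentially. \<forall>q. Sol n q \<and> lead_coeff q = 1 \<longrightarrow> degree q = N \<and> coeff_norm (q - Qs) \<le> C * y ^ n"
    using Sol_rate(2)[OF y(1,3) y'] by blast
  have "\<forall>\<^sub>F n in sequentially. 0 \<le> coeff_norm (Q n - Qs) \<and> coeff_norm (Q n - Qs) \<le> C * y ^ n"
    using C eventually_ge_at_top[of 1] by eventually_elim (use Q_Sol Q_monic coeff_norm_nonneg in auto)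
  then have "rate Qs \<le> ereal y" unfolding rate_def using y(3) by (rule limsup_root_le)
  then show "rate Qs \<le> x" using y(2) by (auto intro: order_trans less_imp_le)
qed

lemma rate_Qs_less_1: "rate Qs < 1"
  using rate_Qs_le max_ratio_less_1 by (rule le_less_trans)

text \<open>A rate below the ratio at some \<xi> leaves room for a \<theta> in between, and
  \<open>rate_lower_bound\<close> for this \<theta> would force the ratio at \<xi> down to
  \<theta>.\<close>

theorem rate_Qs: "rate Qs = max_ratio"
proof (rule antisym[OF rate_Qs_le])
  show "max_ratio \<le> rate Qs"
    unfolding max_ratio_def
  proof (subst Max_le_iff)
    show "\<forall>a\<in>(\<lambda>\<xi>. ereal (norm (\<Phi> \<xi>)) / rho_pole E \<Phi> d m F \<xi>) ` Z. a \<le> rate Qs"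
    proof (intro ballI, elim imageE)
      fix a \<xi> assume \<xi>: "\<xi> \<in> Z" and a: "a = ereal (norm (\<Phi> \<xi>)) / rho_pole E \<Phi> d m F \<xi>"
      show "a \<le> rate Qs"
      proof (rule ccontr)
        assume "\<not> a \<le> rate Qs"
        then have "rate Qs < min a 1" using rate_Qs_less_1 by simp
        then obtain \<theta> where \<theta>: "rate Qs < ereal \<theta>" "ereal \<theta> < min a 1" "0 < \<theta>" using rate_less_obtain by blast
        interpret L: pade_limit E \<Phi> d m F Q Qs \<theta>
          using \<theta> degree_Qs by (intro rate_less_pade_limit) auto
        have "ereal (norm (\<Phi> \<xi>) / \<theta>) \<le> rho_raw E \<Phi> d m F \<xi> t" if "1 \<le> t" "t \<le> ord \<xi>" for t
          by (rule L.rate_lower_bound[OF finite_Z refl \<xi> that])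
        then have "ereal (norm (\<Phi> \<xi>) / \<theta>) \<le> rho_pole E \<Phi> d m F \<xi>"
          unfolding rho_pole_def rho_bold_def using system_poles_D(2)[OF \<xi>] by (subst Min_ge_iff) auto
        then have "a \<le> ereal \<theta>" unfolding a
          using Phi_pos[OF \<xi>] \<theta>(3) rho_pole_pos[OF \<xi>] by (subst ereal_ratio_le_iff) auto
        moreover have "ereal \<theta> < a" using \<theta>(2) by simp
        ultimately show False by (rule leD[THEN notE])
      qed
    qed
  qed (use finite_Z Z_ne in auto)
qed

theorem limit_unique:
  assumes "degree R = N" "rate R < 1" shows "R = Qs"
proof -
  obtain \<theta> where \<theta>: "rate R < ereal \<theta>" "ereal \<theta> < 1" "0 < \<theta>" using rate_less_obtain[OF assms(2)] .
  obtain \<theta>' where \<theta>': "rate Qs < ereal \<theta>'" "ereal \<theta>' < 1" "0 < \<theta>'" using rate_less_obtain[OF rate_Qs_less_1] .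
  interpret L: pade_limit E \<Phi> d m F Q R \<theta> using \<theta> assms by (intro rate_less_pade_limit) auto
  interpret L': pade_limit E \<Phi> d m F Q Qs \<theta>' using \<theta>' degree_Qs by (intro rate_less_pade_limit) auto
  have "coeff R i = coeff Qs i" for i by (rule LIMSEQ_unique[OF L.Q_coeff_limit L'.Q_coeff_limit])
  then show ?thesis by (simp add: poly_eq_iff)
qed

end

section \<open>The poles of a single component and the approximants\<close>

lemma meromorphic_pole_data:
  assumes "g meromorphic_on A" "z \<in> A"
  shows "isolated_singularity_at g z" "not_essential g z"
  using assms meromorphic_on_isolated_singularity meromorphic_on_not_essential meromorphic_on_subset[of g A "{z}"] by auto

context exterior
begin

lemma quotient_germ:
  assumes R: "1 < R" and H: "H holomorphic_on D R" "same_germ E H (\<lambda>z. poly p z * u z)"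
    and p: "p \<noteq> 0" "\<And>z. z \<in> E \<Longrightarrow> poly p z \<noteq> 0"
  shows "(\<lambda>z. H z / poly p z) meromorphic_on D R" "same_germ E (\<lambda>z. H z / poly p z) u"
    "z \<in> D R \<Longrightarrow> poly p z \<noteq> 0 \<Longrightarrow> (\<lambda>z. H z / poly p z) analytic_on {z}"
    "z \<in> D R \<Longrightarrow> poly p z \<noteq> 0 \<Longrightarrow> mero_ext E \<Phi> R u z = H z / poly p z"
proof -
  have Ha: "H analytic_on D R" using H(1) open_D[OF R] by (simp add: analytic_on_open)
  have pa: "poly p analytic_on S" for S using poly_holo[of p UNIV] analytic_on_open[of UNIV "poly p"] analytic_on_subset by blast
  show m: "(\<lambda>z. H z / poly p z) meromorphic_on D R"
    by (intro meromorphic_on_divide analytic_on_imp_meromorphic_on Ha pa)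
  show g: "same_germ E (\<lambda>z. H z / poly p z) u"
  proof -
    obtain V where V: "open V" "E \<subseteq> V" "\<forall>z\<in>V. H z = poly p z * u z" using H(2) by (auto simp: same_germ_def)
    have "open (V - {z. poly p z = 0})" by (intro open_Diff V finite_imp_closed poly_roots_finite p)
    then show ?thesis unfolding same_germ_def
      by (intro exI[of _ "V - {z. poly p z = 0}"]) (use V p(2) in auto)
  qed
  assume z: "z \<in> D R" "poly p z \<noteq> 0"
  show a: "(\<lambda>z. H z / poly p z) analytic_on {z}"
    by (intro analytic_on_divide pa analytic_on_subset[OF Ha]) (use z in auto)
  show "mero_ext E \<Phi> R u z = H z / poly p z"
    using mero_ext_props(3)[OF R m g z(1)] remove_sings_at_analytic[OF a] by simp
qed

end

context pade_direct
begin

lemma order_root_poly_ge: "finite S \<Longrightarrow> z \<in> S \<Longrightarrow> \<tau> z \<le> order z (root_poly S \<tau>)"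
  using linear_power_dvd_root_poly[of S z \<tau>] root_poly_ne_0[of S \<tau>] by (simp add: order_divides)

abbreviation comp_index :: "nat \<Rightarrow> ereal" where "comp_index \<equiv> rho_comp E \<Phi> d m F"
abbreviation comp_ext :: "nat \<Rightarrow> complex \<Rightarrow> complex" where "comp_ext \<alpha> \<equiv> mero_ext E \<Phi> (comp_index \<alpha>) (F \<alpha>)"
abbreviation comp_poles :: "nat \<Rightarrow> complex set" where
  "comp_poles \<alpha> \<equiv> {\<xi> \<in> D (comp_index \<alpha>). is_pole (comp_ext \<alpha>) \<xi>}"
abbreviation comp_poly :: "nat \<Rightarrow> complex poly" where
  "comp_poly \<alpha> \<equiv> root_poly (comp_poles \<alpha>) (pole_order (comp_ext \<alpha>))"

text \<open>The continuations admissible for different indices are separate functions. Multiplied by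
  \<open>Qs\<close> they become holomorphic, so \<open>Qs\<close> times the component continues to
  the supremum itself by \<open>holo_ext_sup\<close>; dividing back gives one meromorphic function
  there, with which the chosen continuation is compared.\<close>

lemma component_structure:
  assumes \<alpha>: "\<alpha> \<in> {1..d}"
  shows "1 < comp_index \<alpha>"
    "\<And>\<xi>. \<xi> \<in> comp_poles \<alpha> \<Longrightarrow> \<xi> \<in> Z \<and> 1 \<le> pole_order (comp_ext \<alpha>) \<xi> \<and> pole_order (comp_ext \<alpha>) \<xi> \<le> ord \<xi>"
    "holo_ext (\<lambda>z. poly (comp_poly \<alpha>) z * F \<alpha> z) (comp_index \<alpha>)"
proof -
  define \<rho>c where "\<rho>c = comp_index \<alpha>"
  define u where "u = F \<alpha>"
  define S where "S \<rho> g \<longleftrightarrow> 1 < \<rho> \<and> g meromorphic_on D \<rho> \<and> same_germ E g u \<and>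
    (\<forall>z\<in>D \<rho>. is_pole g z \<longrightarrow> z \<in> Z \<and> pole_order g z \<le> ord z)" for \<rho> g
  have \<rho>c: "\<rho>c = Sup {\<rho>. \<exists>g. S \<rho> g}" unfolding \<rho>c_def rho_comp_def continues_def S_def u_def
    by (intro arg_cong[where f = Sup]) auto
  have S_le: "\<rho> \<le> \<rho>c" if "S \<rho> g" for \<rho> g unfolding \<rho>c using that by (intro Sup_upper) auto
  have S_gt: "\<exists>\<rho>' g. \<rho> < \<rho>' \<and> S \<rho>' g" if "\<rho> < \<rho>c" for \<rho> using that unfolding \<rho>c less_Sup_iff by auto
  have ua: "u analytic_on E" unfolding u_def by (rule F_analytic[OF \<alpha>])
  have Qu: "(\<lambda>z. poly Qs z * u z) analytic_on E" by (rule poly_mult_analytic[OF ua])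
  have pole_Qs: "\<not> is_pole (\<lambda>w. poly Qs w * g w) z" if "S \<rho> g" "z \<in> D \<rho>" for \<rho> g z
    using that finite_Z order_root_poly_ge[OF finite_Z, of z ord] unfolding S_def
    by (intro poly_mult_not_pole root_poly_ne_0 meromorphic_pole_data[of g "D \<rho>"]) (auto intro: order_trans)
  have pm: "poly p meromorphic_on S" for S and p :: "complex poly"
    using poly_holo[of p UNIV] analytic_on_open[of UNIV "poly p"] analytic_on_subset analytic_on_imp_meromorphic_on by blast
  have S_holo_ext: "holo_ext (\<lambda>z. poly Qs z * u z) \<rho>" if s: "S \<rho> g" for \<rho> g
    using s pole_Qs[OF s] unfolding S_def
    by (intro meromorphic_removes_to_holo_ext[where g = "\<lambda>z. poly Qs z * g z"] Qu meromorphic_on_mult pm)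
       (auto intro: same_germ_map)
  obtain r where r: "1 < r" "u holomorphic_on D (ereal r)" using analytic_holo_ext[OF ua] .
  have r1: "1 < ereal r" using r(1) by simp
  have "\<not> is_pole u z" if "z \<in> D (ereal r)" for z
    using not_is_pole_holomorphic[OF open_D[OF r1] that r(2)] .
  then have "S (ereal r) u" unfolding S_def using r1 r(2) holo_mero same_germ_refl by auto
  then have \<rho>c1: "1 < \<rho>c" using S_le r1 less_le_trans by blast
  have "holo_ext (\<lambda>z. poly Qs z * u z) \<rho>c"
  proof (rule holo_ext_sup[OF Qu \<rho>c1])
    fix \<rho> assume "\<rho> < \<rho>c"
    then obtain \<rho>' g where "\<rho> < \<rho>'" "S \<rho>' g" using S_gt by blast
    then show "holo_ext (\<lambda>z. poly Qs z * u z) \<rho>" using S_holo_ext holo_ext_mono less_imp_le by blast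
  qed
  then obtain h where h: "h holomorphic_on D \<rho>c" "same_germ E h (\<lambda>z. poly Qs z * u z)" unfolding holo_ext_def by blast
  define g0 where "g0 z = h z / poly Qs z" for z
  have QsE: "poly Qs z \<noteq> 0" if "z \<notin> Z" for z using root_poly_nonzero[OF finite_Z that] .
  have g0: "g0 meromorphic_on D \<rho>c" "same_germ E g0 u" "\<And>z. z \<in> D \<rho>c \<Longrightarrow> z \<notin> Z \<Longrightarrow> g0 analytic_on {z}"
    using quotient_germ[OF \<rho>c1 h root_poly_ne_0] QsE Z_E unfolding g0_def by blast+
  define f where "f = comp_ext \<alpha>"
  have f: "\<forall>\<^sub>F w in at z. f w = g0 w" if "z \<in> D \<rho>c" for z
    using mero_ext_props(2)[OF \<rho>c1 g0(1,2) that] by (simp add: f_def \<rho>c_def u_def)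
  have pole_eq: "is_pole f z \<longleftrightarrow> is_pole g0 z" "pole_order f z = pole_order g0 z" if "z \<in> D \<rho>c" for z
    using is_pole_cong[OF f[OF that] refl] zorder_cong[OF f[OF that] refl] by (auto simp: pole_order_def)
  have main: "z \<in> Z \<and> 1 \<le> pole_order f z \<and> pole_order f z \<le> ord z" if z: "z \<in> D \<rho>c" "is_pole f z" for z
  proof -
    have pg: "is_pole g0 z" using z pole_eq by simp
    have zZ: "z \<in> Z" using g0(3)[OF z(1)] pg analytic_at_imp_no_pole by blast
    then have zE: "z \<notin> E" using Z_E by blast
    \<comment> \<open>The bound on the order is known for the admissible continuations only; one of
      them reaches past \<open>z\<close>.\<close>
    obtain \<rho> g where g: "ereal (norm (\<Phi> z)) < \<rho>" "S \<rho> g" using S_gt z(1) in_D[OF zE] by blast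
    have zD: "z \<in> D \<rho>" using g(1) in_D[OF zE] by simp
    have "g0 meromorphic_on D \<rho>" using g0(1) D_mono[OF S_le[OF g(2)]] meromorphic_on_subset by blast
    then have "\<forall>\<^sub>F w in at z. g w = g0 w"
      using g(2) g0(2) zD unfolding S_def by (intro mero_germ_eq(1)[of \<rho>]) (auto intro: same_germ_trans same_germ_sym)
    then have "is_pole g z \<longleftrightarrow> is_pole g0 z" "pole_order g z = pole_order g0 z"
      using is_pole_cong zorder_cong by (auto simp: pole_order_def)
    then have "pole_order f z \<le> ord z" using g(2) zD pg pole_eq(2)[OF z(1)] unfolding S_def by auto
    moreover have "1 \<le> pole_order f z" using pole_order_pos[OF g0(1) z(1) pg] pole_eq(2)[OF z(1)] by simp
    ultimately show ?thesis using zZ by blast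
  qed
  define Ph where "Ph = {\<xi> \<in> D \<rho>c. is_pole f \<xi>}"
  have fPh: "finite Ph" using main finite_Z by (auto simp: Ph_def intro: finite_subset)
  have "holo_ext (\<lambda>z. poly (root_poly Ph (pole_order f)) z * u z) \<rho>c"
  proof (rule meromorphic_removes_to_holo_ext[OF \<rho>c1 poly_mult_analytic[OF ua]])
    show "(\<lambda>z. poly (root_poly Ph (pole_order f)) z * g0 z) meromorphic_on D \<rho>c"
      by (intro meromorphic_on_mult pm g0)
    show "same_germ E (\<lambda>z. poly (root_poly Ph (pole_order f)) z * g0 z) (\<lambda>z. poly (root_poly Ph (pole_order f)) z * u z)"
      by (rule same_germ_map[OF g0(2)]) simp
    fix z assume z: "z \<in> D \<rho>c"
    show "\<not> is_pole (\<lambda>z. poly (root_poly Ph (pole_order f)) z * g0 z) z"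
      using z pole_eq[OF z] order_root_poly_ge[OF fPh, of z "pole_order f"]
      by (intro poly_mult_not_pole root_poly_ne_0 meromorphic_pole_data[OF g0(1)]) (auto simp: Ph_def)
  qed
  then show "holo_ext (\<lambda>z. poly (comp_poly \<alpha>) z * F \<alpha> z) (comp_index \<alpha>)"
    by (simp add: Ph_def f_def \<rho>c_def u_def)
  show "1 < comp_index \<alpha>" using \<rho>c1 by (simp add: \<rho>c_def)
  show "\<xi> \<in> Z \<and> 1 \<le> pole_order (comp_ext \<alpha>) \<xi> \<and> pole_order (comp_ext \<alpha>) \<xi> \<le> ord \<xi>" if "\<xi> \<in> comp_poles \<alpha>" for \<xi>
    using main that by (simp add: f_def \<rho>c_def)
qed

lemma finite_comp_poles: "\<alpha> \<in> {1..d} \<Longrightarrow> finite (comp_poles \<alpha>)"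
  using component_structure(2) finite_Z by (meson finite_subset subsetI)

lemma rho_star_props:
  assumes \<alpha>: "\<alpha> \<in> {1..d}"
  shows "1 < rho_star E \<Phi> d m F \<alpha>" "rho_star E \<Phi> d m F \<alpha> \<le> comp_index \<alpha>"
    "\<And>\<xi>. \<xi> \<in> comp_poles \<alpha> \<Longrightarrow> rho_star E \<Phi> d m F \<alpha> \<le> rho_bold E \<Phi> d m F \<xi> (pole_order (comp_ext \<alpha>) \<xi>)"
proof -
  let ?B = "(\<lambda>\<xi>. rho_bold E \<Phi> d m F \<xi> (pole_order (comp_ext \<alpha>) \<xi>)) ` comp_poles \<alpha>"
  have fin: "finite (insert (comp_index \<alpha>) ?B)" using finite_comp_poles[OF \<alpha>] by simp
  have eq: "rho_star E \<Phi> d m F \<alpha> = Min (insert (comp_index \<alpha>) ?B)" by (simp add: rho_star_def Let_def)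
  show "rho_star E \<Phi> d m F \<alpha> \<le> comp_index \<alpha>" unfolding eq by (rule Min_le[OF fin]) simp
  show "rho_star E \<Phi> d m F \<alpha> \<le> rho_bold E \<Phi> d m F \<xi> (pole_order (comp_ext \<alpha>) \<xi>)" if "\<xi> \<in> comp_poles \<alpha>" for \<xi>
    unfolding eq by (rule Min_le[OF fin]) (use that in blast)
  have "1 < rho_bold E \<Phi> d m F \<xi> (pole_order (comp_ext \<alpha>) \<xi>)" if "\<xi> \<in> comp_poles \<alpha>" for \<xi>
  proof -
    have c: "\<xi> \<in> Z" "1 \<le> pole_order (comp_ext \<alpha>) \<xi>" "pole_order (comp_ext \<alpha>) \<xi> \<le> ord \<xi>"
      using component_structure(2)[OF \<alpha> that] by auto
    have "(1::ereal) < ereal (norm (\<Phi> \<xi>))" using Phi_pos[OF c(1)] by simp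
    then show ?thesis using rho_bold_gt[OF c] by (rule less_trans)
  qed
  then show "1 < rho_star E \<Phi> d m F \<alpha>"
    unfolding eq using fin component_structure(1)[OF \<alpha>] by (subst Min_gr_iff) auto
qed

lemma Q_convergent:
  obtains B \<theta> where "0 < \<theta>" "\<theta> < 1" "\<forall>\<^sub>F n in sequentially. coeff_norm (Q n) \<le> B"
    "\<forall>\<^sub>F n in sequentially. coeff_norm (Q n - Qs) \<le> \<theta> ^ n"
proof -
  obtain \<theta> where \<theta>: "rate Qs < ereal \<theta>" "ereal \<theta> < 1" "0 < \<theta>" using rate_less_obtain[OF rate_Qs_less_1] .
  interpret L: pade_limit E \<Phi> d m F Q Qs \<theta> using \<theta> degree_Qs by (intro rate_less_pade_limit) auto
  show ?thesis using that[OF L.\<theta> L.Q_bounded L.Q_limit] .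
qed

text \<open>For \<rho> at most |\<Phi> \<xi>| no decay is claimed and boundedness of the
  denominators suffices; beyond that the estimate is \<open>Sol_taylor_coeff_bound\<close> with y =
  |\<Phi> \<xi>|/\<rho>.\<close>

lemma Q_taylor_coeff_bound:
  assumes \<xi>: "\<xi> \<in> Z" and i: "i < t" and \<rho>: "0 < \<rho>" "ereal \<rho> < rho_bold E \<Phi> d m F \<xi> t"
  shows "\<exists>C. \<forall>\<^sub>F n in sequentially. norm (taylor_coeff (Q n) \<xi> i) \<le> C * (norm (\<Phi> \<xi>) / \<rho>) ^ n"
proof -
  obtain B \<theta> where B: "\<forall>\<^sub>F n in sequentially. coeff_norm (Q n) \<le> B" using Q_convergent by blast
  define y where "y = norm (\<Phi> \<xi>) / \<rho>"
  have "0 < norm (\<Phi> \<xi>)" using Phi_pos[OF \<xi>] by linarith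
  then have y0: "0 < y" using \<rho>(1) by (simp add: y_def)
  show ?thesis
  proof (cases "y < 1")
    case False
    obtain C where C: "C > 0" "\<And>p. degree p \<le> N \<Longrightarrow> norm (taylor_coeff p \<xi> i) \<le> C * coeff_norm p" using taylor_coeff_bound by blast
    have "\<forall>\<^sub>F n in sequentially. norm (taylor_coeff (Q n) \<xi> i) \<le> (C * \<bar>B\<bar>) * y ^ n"
      using B eventually_ge_at_top[of 1]
    proof eventually_elim
      case (elim n)
      have "norm (taylor_coeff (Q n) \<xi> i) \<le> C * coeff_norm (Q n)" using C(2) Sol_degree[OF Q_Sol] elim by blast
      also have "\<dots> \<le> (C * \<bar>B\<bar>) * 1" using C elim by (auto intro!: mult_left_mono)
      also have "\<dots> \<le> (C * \<bar>B\<bar>) * y ^ n" using C False by (intro mult_left_mono one_le_power) auto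
      finally show ?case .
    qed
    then show ?thesis unfolding y_def by blast
  next
    case True
    have "\<exists>G\<in>V. \<exists>\<rho>'. ereal \<rho> < \<rho>' \<and> exact_pole G \<xi> s \<rho>'" if s: "s \<in> {1..t}" for s
    proof -
      have "ereal \<rho> < rho_raw E \<Phi> d m F \<xi> s" using \<rho>(2) rho_bold_le_raw[of s t \<xi>] s by (auto intro: less_le_trans)
      then obtain \<rho>' where \<rho>': "ereal \<rho> < ereal \<rho>'" "ereal \<rho>' < rho_raw E \<Phi> d m F \<xi> s" using ereal_dense2 by blast
      have "norm (\<Phi> \<xi>) < \<rho>" using True \<rho>(1) by (simp add: y_def divide_less_eq)
      then have "ereal (norm (\<Phi> \<xi>)) < ereal \<rho>'" using \<rho>'(1) by simp
      then obtain G where "G \<in> V" "exact_pole G \<xi> s (ereal \<rho>')"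
        using rho_raw_exact_pole[OF system_poles_D(1)[OF \<xi>] _ _ \<rho>'(2)] s by auto
      then show ?thesis using \<rho>'(1) by blast
    qed
    then have "\<exists>G. \<forall>s\<in>{1..t}. G s \<in> V \<and> (\<exists>\<rho>'. ereal \<rho> < \<rho>' \<and> exact_pole (G s) \<xi> s \<rho>')" by (intro bchoice) blast
    then obtain G where G: "\<And>s. s \<in> {1..t} \<Longrightarrow> G s \<in> V" "\<forall>s\<in>{1..t}. \<exists>\<rho>'. ereal \<rho> < \<rho>' \<and> exact_pole (G s) \<xi> s \<rho>'" by blast
    obtain r where r: "\<forall>s\<in>{1..t}. ereal \<rho> < r s \<and> exact_pole (G s) \<xi> s (r s)" using bchoice[OF G(2)] by blast
    have y\<rho>: "norm (\<Phi> \<xi>) / y = \<rho>" using y0 unfolding y_def by auto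
    have "\<exists>C. \<forall>\<^sub>F n in sequentially. \<forall>q. Sol n q \<longrightarrow> norm (taylor_coeff q \<xi> i) \<le> C * y ^ n * coeff_norm q"
      by (rule Sol_taylor_coeff_bound[where t = t and \<rho> = r and G = G]) (use system_poles_D(1)[OF \<xi>] G(1) r y0 True i y\<rho> in auto)
    then obtain C where C: "\<forall>\<^sub>F n in sequentially. \<forall>q. Sol n q \<longrightarrow> norm (taylor_coeff q \<xi> i) \<le> C * y ^ n * coeff_norm q" by blast
    have "\<forall>\<^sub>F n in sequentially. norm (taylor_coeff (Q n) \<xi> i) \<le> (\<bar>C\<bar> * \<bar>B\<bar>) * y ^ n"
      using C B eventually_ge_at_top[of 1]
    proof eventually_elim
      case (elim n)
      have "norm (taylor_coeff (Q n) \<xi> i) \<le> C * y ^ n * coeff_norm (Q n)" using elim Q_Sol by blast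
      also have "\<dots> \<le> \<bar>C\<bar> * y ^ n * \<bar>B\<bar>"
        using elim y0 coeff_norm_nonneg by (intro mult_mono) (auto intro: mult_right_mono)
      finally show ?case by (simp add: mult_ac)
    qed
    then show ?thesis unfolding y_def by blast
  qed
qed

theorem approximant_convergence:
  assumes \<alpha>: "\<alpha> \<in> {1..d}" and k: "k < m \<alpha>"
    and K: "compact K" "K \<subseteq> D (rho_star E \<Phi> d m F \<alpha>) - Z"
  shows "limsup (\<lambda>n. ereal (root n (sup_norm K (\<lambda>z. poly (P n k \<alpha>) z / poly (Q n) z -
           z ^ k * mero_ext E \<Phi> (rho_star E \<Phi> d m F \<alpha>) (F \<alpha>) z))))
         \<le> ereal (Phi_norm E \<Phi> K) / rho_star E \<Phi> d m F \<alpha>"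
proof -
  define \<rho>s where "\<rho>s = rho_star E \<Phi> d m F \<alpha>"
  define \<rho>c where "\<rho>c = comp_index \<alpha>"
  define S where "S = comp_poles \<alpha>"
  define \<tau> where "\<tau> = pole_order (comp_ext \<alpha>)"
  note star = rho_star_props[OF \<alpha>, folded \<rho>s_def \<rho>c_def]
  have K': "K \<subseteq> D \<rho>s" "K \<inter> Z = {}" using K(2) by (auto simp: \<rho>s_def)
  have S: "finite S" "S \<subseteq> Z" "S \<subseteq> D \<rho>c"
    using finite_comp_poles[OF \<alpha>] component_structure(2)[OF \<alpha>] by (auto simp: S_def \<rho>c_def)
  obtain H where H: "H holomorphic_on D \<rho>c" "same_germ E H (\<lambda>z. poly (root_poly S \<tau>) z * F \<alpha> z)"
    using component_structure(3)[OF \<alpha>] by (auto simp: holo_ext_def S_def \<tau>_def \<rho>c_def)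
  define f where "f = mero_ext E \<Phi> \<rho>s (F \<alpha>)"
  have f: "f z = H z / poly (root_poly S \<tau>) z" if "z \<in> K" for z
    unfolding f_def
  proof (rule quotient_germ(4)[OF star(1) _ H(2) root_poly_ne_0])
    show "H holomorphic_on D \<rho>s" using H(1) D_mono[OF star(2)] holomorphic_on_subset by blast
    show "poly (root_poly S \<tau>) z \<noteq> 0" if "z \<in> E" for z
      by (rule root_poly_nonzero[OF S(1)]) (use that S Z_E in blast)
    show "poly (root_poly S \<tau>) z \<noteq> 0"
      by (rule root_poly_nonzero[OF S(1)]) (use \<open>z \<in> K\<close> S K' in blast)
  qed (use that K' in auto)
  define s0 where "s0 = Phi_norm E \<Phi> K"
  note s0 = Phi_norm_props[OF K(1) K'(1) star(1), folded s0_def]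
  define e where "e n z = poly (P n k \<alpha>) z / poly (Q n) z - z ^ k * f z" for n z
  obtain B \<theta> where B: "0 < \<theta>" "\<theta> < 1" "\<forall>\<^sub>F n in sequentially. coeff_norm (Q n) \<le> B"
    "\<forall>\<^sub>F n in sequentially. coeff_norm (Q n - Qs) \<le> \<theta> ^ n" by (rule Q_convergent)
  \<comment> \<open>\<open>K\<close> contains no zero of the limit \<open>Qs\<close>, so from some
    index on the denominators stay away from 0 on it.\<close>
  obtain \<delta> where \<delta>: "0 < \<delta>" "\<forall>\<^sub>F n in sequentially. \<forall>z\<in>K. \<delta> \<le> norm (poly (Q n) z)"
  proof -
    have "\<exists>\<delta>>0. \<forall>z\<in>K. \<delta> \<le> norm (poly Qs z)"
    proof (cases "K = {}")
      case False
      have "continuous_on K (\<lambda>z. norm (poly Qs z))" by (intro continuous_intros)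
      then obtain z0 where z0: "z0 \<in> K" "\<And>z. z \<in> K \<Longrightarrow> norm (poly Qs z0) \<le> norm (poly Qs z)"
        using continuous_attains_inf[OF K(1) False] by blast
      have "poly Qs z0 \<noteq> 0" by (rule root_poly_nonzero[OF finite_Z]) (use z0 K' in auto)
      then show ?thesis using z0(2) by (intro exI[of _ "norm (poly Qs z0)"]) auto
    qed (auto intro: exI[of _ 1])
    then obtain \<delta> where \<delta>: "0 < \<delta>" "\<And>z. z \<in> K \<Longrightarrow> \<delta> \<le> norm (poly Qs z)" by blast
    obtain b where b: "\<And>z. z \<in> K \<Longrightarrow> norm z \<le> b" using compact_imp_bounded[OF K(1)] by (auto simp: bounded_iff)
    have "(\<lambda>n. \<theta> ^ n * max b 1 ^ N) \<longlonglongrightarrow> 0 * max b 1 ^ N" using B by (intro tendsto_intros LIMSEQ_power_zero) auto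
    then have "\<forall>\<^sub>F n in sequentially. \<theta> ^ n * max b 1 ^ N < \<delta> / 2"
      by (rule order_tendstoD(2)) (use \<delta>(1) in simp)
    then have "\<forall>\<^sub>F n in sequentially. \<forall>z\<in>K. \<delta> / 2 \<le> norm (poly (Q n) z)"
      using B(4) eventually_ge_at_top[of 1]
    proof eventually_elim
      case (elim n)
      show ?case
      proof
        fix z assume z: "z \<in> K"
        have "degree (Q n - Qs) \<le> N" using degree_Qs Sol_degree[OF Q_Sol[OF elim(3)]] by (intro degree_diff_le) auto
        then have "norm (poly (Q n - Qs) z) \<le> coeff_norm (Q n - Qs) * max b 1 ^ N"
          using b[OF z] by (intro norm_poly_le) auto
        also have "\<dots> \<le> \<theta> ^ n * max b 1 ^ N" using elim by (intro mult_right_mono) auto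
        finally have "norm (poly (Q n) z - poly Qs z) \<le> \<delta> / 2" using elim by simp
        moreover have "norm (poly Qs z) \<le> norm (poly (Q n) z) + norm (poly (Q n) z - poly Qs z)"
          using norm_triangle_ineq4[of "poly (Q n) z" "poly (Q n) z - poly Qs z"] by simp
        ultimately show "\<delta> / 2 \<le> norm (poly (Q n) z)" using \<delta>(2)[OF z] by linarith
      qed
    qed
    then show ?thesis using that[of "\<delta> / 2"] \<delta>(1) by simp
  qed
  have pf: "pade_faber E \<Phi> d m F n (Q n) (P n)" if "1 \<le> n" for n using QP[OF that] by blast
  show ?thesis
    unfolding \<rho>s_def[symmetric] f_def[symmetric] s0_def[symmetric] e_def[symmetric]
  proof (rule dense_ge)
    fix x assume x: "ereal s0 / \<rho>s < x"
    obtain c where c: "ereal s0 / \<rho>s < ereal c" "ereal c < x" using ereal_dense2[OF x] by blast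
    have \<rho>s0: "0 < \<rho>s" using star(1) by (rule less_trans[rotated]) simp
    have "0 \<le> ereal s0 / \<rho>s" using s0(1) \<rho>s0 by (cases \<rho>s) auto
    then have c0: "0 < c" using c(1) by (metis ereal_less(2) le_less_trans)
    have "ereal (s0 / c) < \<rho>s" using c(1) ereal_ratio_less_iff[of s0 c \<rho>s] s0(1) c0 \<rho>s0 by auto
    then have max_less: "ereal (max s0 (s0 / c)) < \<rho>s" using s0(3) by (simp add: max_def)
    \<comment> \<open>The radii are to satisfy s0 < s < s2 < \<rho> and s2 \<le> c \<rho>, with
      \<rho> below the index \<rho>s. There is room for \<open>s2\<close> because \<mu> exceeds both
      s0 and s0/c; the rate s2/\<rho> is then at most \<open>c\<close>.\<close>
    obtain \<mu> where \<mu>: "max s0 (s0 / c) < \<mu>" "ereal \<mu> < \<rho>s" using ereal_dense2[OF max_less] by auto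
    obtain \<rho> where \<rho>: "\<mu> < \<rho>" "ereal \<rho> < \<rho>s" using ereal_dense2[OF \<mu>(2)] by auto
    define s2 where "s2 = min \<mu> (c * \<mu>)"
    have "s0 < c * \<mu>" using \<mu>(1) c0 by (simp add: divide_less_eq mult.commute)
    then have s2: "s0 < s2" "s2 < \<rho>" "s2 \<le> c * \<rho>" using \<mu>(1) \<rho>(1) c0
      by (auto simp: s2_def intro: min.coboundedI2)
    obtain s where s: "s0 < s" "s < s2" using dense[OF s2(1)] by blast
    have \<rho>0: "0 < \<rho>" using s2 s0(1) by simp
    have Ks: "K \<subseteq> cD s" using s0(2) s(1) by (auto simp: cD_def)
    have "\<exists>C. \<forall>\<^sub>F n in sequentially. \<forall>z\<in>K.
       norm (poly (Q n) z * (z ^ k * H z / poly (root_poly S \<tau>) z) - poly (P n k \<alpha>) z) \<le> C * (s2 / \<rho>) ^ n"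
    proof (rule approximant_error[of "(\<alpha>, k)" S \<rho>c "\<lambda>z. z ^ k * H z" \<tau> K s Q B "\<lambda>n. P n k \<alpha>" s2 \<rho>])
      show "(\<alpha>, k) \<in> index_set" using \<alpha> k by (simp add: index_set_def)
      show "(\<lambda>z. z ^ k * H z) holomorphic_on D \<rho>c" by (intro holomorphic_intros H)
      show "same_germ E (\<lambda>z. z ^ k * H z) (\<lambda>z. poly (root_poly S \<tau>) z * bas (\<alpha>, k) z)"
        by (rule same_germ_map[OF H(2)]) (simp add: bas_pair)
      show "K \<subseteq> D \<rho>c - S" using K' S D_mono[OF star(2)] by blast
      show "degree (P n k \<alpha>) \<le> n - 1" if "1 \<le> n" for n
        using pf[OF that] \<alpha> k unfolding pade_faber_def by blast
      show "fc (poly (P n k \<alpha>)) j = fc (\<lambda>z. poly (Q n) z * bas (\<alpha>, k) z) j" if "1 \<le> n" "j < n" for n j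
        using pade_faber_imp_Sol(3)[OF pf[OF that(1)] that(1) \<alpha> k] that by simp
      show "ereal \<rho> < \<rho>c" using \<rho>(2) star(2) by (rule less_le_trans)
      show "\<exists>C. \<forall>\<^sub>F n in sequentially. norm (taylor_coeff (Q n) \<xi> i) \<le> C * (norm (\<Phi> \<xi>) / \<rho>) ^ n"
        if "\<xi> \<in> S" "i < \<tau> \<xi>" for \<xi> i
      proof (rule Q_taylor_coeff_bound[OF _ that(2) \<rho>0])
        show "\<xi> \<in> Z" using that S by blast
        show "ereal \<rho> < rho_bold E \<Phi> d m F \<xi> (\<tau> \<xi>)"
          using \<rho>(2) star(3) that(1) less_le_trans unfolding S_def \<tau>_def \<rho>c_def by blast
      qed
    qed (use S Z_E K Ks Q_Sol B(3) s s0(1) s2(2) in auto)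
    then obtain C where C: "\<forall>\<^sub>F n in sequentially. \<forall>z\<in>K.
       norm (poly (Q n) z * (z ^ k * H z / poly (root_poly S \<tau>) z) - poly (P n k \<alpha>) z) \<le> C * (s2 / \<rho>) ^ n" by blast
    define C' where "C' = \<bar>C\<bar> / \<delta>"
    have "\<forall>\<^sub>F n in sequentially. 0 \<le> sup_norm K (e n) \<and> sup_norm K (e n) \<le> C' * (s2 / \<rho>) ^ n"
      using C \<delta>(2)
    proof eventually_elim
      case (elim n)
      have r0: "0 \<le> (s2 / \<rho>) ^ n" using s2 s0(1) \<rho>0 by simp
      have b: "norm (e n z) \<le> C' * (s2 / \<rho>) ^ n" if z: "z \<in> K" for z
      proof -
        have qz: "\<delta> \<le> norm (poly (Q n) z)" using elim z by blast
        then have nz: "poly (Q n) z \<noteq> 0" using \<delta>(1) by auto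
        have "e n z = - (poly (Q n) z * (z ^ k * H z / poly (root_poly S \<tau>) z) - poly (P n k \<alpha>) z) / poly (Q n) z"
          using nz by (simp add: e_def f[OF z] field_simps)
        then have "norm (e n z) = norm (poly (Q n) z * (z ^ k * H z / poly (root_poly S \<tau>) z) - poly (P n k \<alpha>) z) / norm (poly (Q n) z)"
          by (simp add: norm_divide norm_minus_commute)
        also have "\<dots> \<le> (\<bar>C\<bar> * (s2 / \<rho>) ^ n) / \<delta>"
          using elim z qz \<delta>(1) r0 by (intro frac_le) (auto intro: order_trans[OF _ mult_right_mono])
        finally show ?thesis by (simp add: C'_def)
      qed
      have bd: "bdd_above (insert 0 ((\<lambda>z. norm (e n z)) ` K))" using b by (auto intro!: bdd_aboveI[of _ "max 0 (C' * (s2 / \<rho>) ^ n)"] simp: le_max_iff_disj)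
      have "0 \<le> C' * (s2 / \<rho>) ^ n" using r0 \<delta>(1) by (simp add: C'_def)
      then have "sup_norm K (e n) \<le> C' * (s2 / \<rho>) ^ n" unfolding sup_norm_def using b by (intro cSup_least) auto
      moreover have "0 \<le> sup_norm K (e n)" unfolding sup_norm_def using bd by (intro cSup_upper) auto
      ultimately show ?case by blast
    qed
    then have "limsup (\<lambda>n. ereal (root n (sup_norm K (e n)))) \<le> ereal (s2 / \<rho>)"
      by (rule limsup_root_le) (use s2 s0(1) \<rho>0 in simp)
    also have "\<dots> \<le> ereal c" using s2(3) \<rho>0 by (simp add: divide_le_eq)
    also have "\<dots> \<le> x" using c(2) by simp
    finally show "limsup (\<lambda>n. ereal (root n (sup_norm K (e n)))) \<le> x" .
  qed
qed

end

theorem corollary1p1: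
  fixes E :: "complex set" and \<Phi> :: "complex \<Rightarrow> complex"
    and d :: nat and m :: "nat \<Rightarrow> nat" and F :: "nat \<Rightarrow> complex \<Rightarrow> complex"
    and Q :: "nat \<Rightarrow> complex poly" and P :: "nat \<Rightarrow> nat \<Rightarrow> nat \<Rightarrow> complex poly"
  assumes "compact E" and "\<exists>x\<in>E. \<exists>y\<in>E. x \<noteq> y" and "0 \<in> E"
    and "simply_connected (sphere_compl E)"
    and "exterior_map E \<Phi>"
    and "1 \<le> d" and "\<forall>\<alpha>\<in>{1..d}. 1 \<le> m \<alpha>" and "\<forall>\<alpha>\<in>{1..d}. F \<alpha> analytic_on E"
    and "\<forall>n\<ge>1. lead_coeff (Q n) = 1 \<and> pade_faber E \<Phi> d m F n (Q n) (P n)"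
  shows
    "let poles = system_poles E \<Phi> d m F;
         rate = (\<lambda>R. limsup (\<lambda>n. ereal (root n (coeff_norm (Q n - R)))));
         a = (finite poles \<and> (\<Sum>\<xi>\<in>poles. sys_order E \<Phi> d m F \<xi>) = msize d m);
         b = ((\<forall>\<^sub>F n in sequentially. \<exists>!q. lead_coeff q = 1 \<and> (\<exists>p. pade_faber E \<Phi> d m F n q p)) \<and>
              (\<exists>R. degree R = msize d m \<and> rate R < 1))
     in (a \<longleftrightarrow> b) \<and>
        (a \<or> b \<longrightarrow>
           (\<forall>R. degree R = msize d m \<and> rate R < 1 \<longrightarrow> R = system_poly E \<Phi> d m F) \<and>
           rate (system_poly E \<Phi> d m F) =
             Max ((\<lambda>\<xi>. ereal (norm (\<Phi> \<xi>)) / rho_pole E \<Phi> d m F \<xi>) ` poles) \<and>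
           (\<forall>\<alpha>\<in>{1..d}. \<forall>k<m \<alpha>. \<forall>K. compact K \<and>
              K \<subseteq> canon_dom E \<Phi> (rho_star E \<Phi> d m F \<alpha>) - poles \<longrightarrow>
              limsup (\<lambda>n. ereal (root n (sup_norm K (\<lambda>z.
                  poly (P n k \<alpha>) z / poly (Q n) z -
                  z ^ k * mero_ext E \<Phi> (rho_star E \<Phi> d m F \<alpha>) (F \<alpha>) z))))
                \<le> ereal (Phi_norm E \<Phi> K) / rho_star E \<Phi> d m F \<alpha>))"
proof -
  interpret pade_sequence E \<Phi> d m F Q P
    using assms by unfold_locales auto
  have sys: "system_poly E \<Phi> d m F = Qs" by (simp add: system_poly_def root_poly_def)
  let ?a = "finite Z \<and> (\<Sum>\<xi>\<in>Z. ord \<xi>) = N"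
  let ?b = "(\<forall>\<^sub>F n in sequentially. \<exists>!q. lead_coeff q = 1 \<and> (\<exists>p. pade_faber E \<Phi> d m F n q p)) \<and>
    (\<exists>R. degree R = N \<and> rate R < 1)"
  have ba: ?a if ?b using that inverse_direction by blast
  have ab: ?b if ?a
  proof -
    interpret pade_direct E \<Phi> d m F Q P using that by unfold_locales auto
    show ?b using monic_unique degree_Qs rate_Qs_less_1 by blast
  qed
  have "(\<forall>R. degree R = N \<and> rate R < 1 \<longrightarrow> R = system_poly E \<Phi> d m F) \<and>
      rate (system_poly E \<Phi> d m F) = Max ((\<lambda>\<xi>. ereal (norm (\<Phi> \<xi>)) / rho_pole E \<Phi> d m F \<xi>) ` Z) \<and>
      (\<forall>\<alpha>\<in>{1..d}. \<forall>k<m \<alpha>. \<forall>K. compact K \<and> K \<subseteq> D (rho_star E \<Phi> d m F \<alpha>) - Z \<longrightarrow>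
        limsup (\<lambda>n. ereal (root n (sup_norm K (\<lambda>z. poly (P n k \<alpha>) z / poly (Q n) z -
            z ^ k * mero_ext E \<Phi> (rho_star E \<Phi> d m F \<alpha>) (F \<alpha>) z))))
          \<le> ereal (Phi_norm E \<Phi> K) / rho_star E \<Phi> d m F \<alpha>)" if ?a
  proof -
    interpret pade_direct E \<Phi> d m F Q P using that by unfold_locales auto
    show ?thesis unfolding sys using limit_unique rate_Qs[unfolded max_ratio_def] approximant_convergence by blast
  qed
  then show ?thesis
    unfolding Let_def rate_def[symmetric] using ab ba by blast
qed

end
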